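(* Let $0\le k\le n$, $l\ge0$, $\mathcal U=\mathbb U_{k,l}$, and $O=|\phi\rangle\langle\phi|-\mathbb 1/d$ with $|\phi\rangle\in\mathcal H$ a pure state. Then, with $\gamma=3/4$, $$V_*(O)\le 2^{1-M_2(\phi)/2}\gamma^{kl}+\frac6d,\qquad -\frac6d<V_*(O,\phi)-2^{1-M_2(\phi)}\gamma^{kl}<\frac4d.$$
   Context: Let $n\ge1$, $d=2^n$, $\mathcal H=(\mathbb C^2)^{\otimes n}$ with computational basis $\{|\mathbf b\rangle\}$. For a unitary ensemble $\mathcal U$ with measurement channel $\mathcal M(X)=\mathbb E_{U}\sum_{\mathbf b}\langle\mathbf b|UXU^\dagger|\mathbf b\rangle U^\dagger|\mathbf b\rangle\langle\mathbf b|U$ (for a 2-design, $\mathcal M^{-1}(O)=(d+1)O-\operatorname{tr}(O)\mathbb 1$), define for a density operator $\rho$ and traceless Hermitian $O$: $V_*(O,\rho)=\mathbb E_{U}\bigl(\sum_{\mathbf b}\langle\mathbf b|U\rho U^\dagger|\mathbf b\rangle\langle\mathbf b|U\mathcal M^{-1}(O)U^\dagger|\mathbf b\rangle\bigr)^2-[\operatorname{tr}(O\rho)]^2$, $V_*(O)=\max_\rho V_*(O,\rho)$, $V_*(O,\phi)=V_*(O,|\phi\rangle\langle\phi|)$. Let $T=\mathrm{diag}(1,e^{i\pi/4})$, $\hat T_k=I^{\otimes(n-k)}\otimes T^{\otimes k}$; $\mathbb U_{k,l}$ is the distribution of $C_l\hat T_kC_{l-1}\cdots\hat T_kC_0$ with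 $C_0,\dots,C_l$ independent uniform elements of the $n$-qubit Clifford group $\mathrm{Cl}_n$. With $\overline{\mathcal P}_n=\{I,X,Y,Z\}^{\otimes n}$, the stabilizer 2-Rényi entropy of $|\phi\rangle$ is $M_2(\phi)=-\log_2\bigl(\frac1d\sum_{P\in\overline{\mathcal P}_n}\langle\phi|P|\phi\rangle^4\bigr)$. *)

theory Defs
  imports Complex_Main "Jordan_Normal_Form.Matrix"
begin

definition adj :: "complex mat \<Rightarrow> complex mat" where
  "adj A = mat (dim_col A) (dim_row A) (\<lambda>(i,j). cnj (A $$ (j,i)))"

definition mtrace :: "complex mat \<Rightarrow> complex" where
  "mtrace A = (\<Sum>i<dim_row A. A $$ (i,i))"

definition kron :: "complex mat \<Rightarrow> complex mat \<Rightarrow> complex mat" where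
  "kron A B = mat (dim_row A * dim_row B) (dim_col A * dim_col B)
     (\<lambda>(i,j). A $$ (i div dim_row B, j div dim_col B) * B $$ (i mod dim_row B, j mod dim_col B))"

text \<open>Tensor product of a list of matrices: A1 \<otimes> A2 \<otimes> ... \<otimes> An (first factor = most significant qubit).\<close>
definition tensor_list :: "complex mat list \<Rightarrow> complex mat" where
  "tensor_list As = foldr kron As (1\<^sub>m 1)"

definition outer :: "complex vec \<Rightarrow> complex vec \<Rightarrow> complex mat" where
  "outer u v = mat (dim_vec u) (dim_vec v) (\<lambda>(i,j). u $ i * cnj (v $ j))"

definition I2 :: "complex mat" where "I2 = 1\<^sub>m 2"
definition PX :: "complex mat" where "PX = mat 2 2 (\<lambda>(i,j). if i \<noteq> j then 1 else 0)"
definition PY :: "complex mat" where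
  "PY = mat 2 2 (\<lambda>(i,j). if i = 0 \<and> j = 1 then - \<i> else if i = 1 \<and> j = 0 then \<i> else 0)"
definition PZ :: "complex mat" where
  "PZ = mat 2 2 (\<lambda>(i,j). if i = j then (if i = 0 then 1 else -1) else 0)"
definition Hgate :: "complex mat" where
  "Hgate = mat 2 2 (\<lambda>(i,j). (if i = 1 \<and> j = 1 then -1 else 1) / complex_of_real (sqrt 2))"
definition Sgate :: "complex mat" where
  "Sgate = mat 2 2 (\<lambda>(i,j). if i = j then (if i = 0 then 1 else \<i>) else 0)"
definition Tgate :: "complex mat" where
  "Tgate = mat 2 2 (\<lambda>(i,j). if i = j then (if i = 0 then 1 else cis (pi / 4)) else 0)"

definition on_qubit :: "nat \<Rightarrow> nat \<Rightarrow> complex mat \<Rightarrow> complex mat" where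
  "on_qubit n q G = tensor_list (map (\<lambda>j. if j = q then G else I2) [0..<n])"

text \<open>Bit value of qubit q in basis index x (consistent with the tensor ordering).\<close>
definition qbit :: "nat \<Rightarrow> nat \<Rightarrow> nat \<Rightarrow> nat" where
  "qbit n q x = (x div 2 ^ (n - 1 - q)) mod 2"

definition cnot_map :: "nat \<Rightarrow> nat \<Rightarrow> nat \<Rightarrow> nat \<Rightarrow> nat" where
  "cnot_map n c t x = (if qbit n c x = 1 then
       (if qbit n t x = 1 then x - 2 ^ (n - 1 - t) else x + 2 ^ (n - 1 - t)) else x)"

definition CNOT :: "nat \<Rightarrow> nat \<Rightarrow> nat \<Rightarrow> complex mat" where
  "CNOT n c t = mat (2 ^ n) (2 ^ n) (\<lambda>(i,j). if i = cnot_map n c t j then 1 else 0)"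

definition clifford_gens :: "nat \<Rightarrow> complex mat set" where
  "clifford_gens n = {on_qubit n q Hgate | q. q < n} \<union> {on_qubit n q Sgate | q. q < n}
      \<union> {CNOT n c t | c t. c < n \<and> t < n \<and> c \<noteq> t}"

text \<open>The n-qubit Clifford group, as the (finite) group generated by H, S and CNOT gates.
  Since it is finite, the generated monoid already is the generated group.\<close>
inductive_set clifford_group :: "nat \<Rightarrow> complex mat set" for n where
  one: "1\<^sub>m (2 ^ n) \<in> clifford_group n"
| gen: "G \<in> clifford_gens n \<Longrightarrow> U \<in> clifford_group n \<Longrightarrow> G * U \<in> clifford_group n"

definition That :: "nat \<Rightarrow> nat \<Rightarrow> complex mat" where
  "That n k = tensor_list (replicate (n - k) I2 @ replicate k Tgate)"

fun ckword :: "nat \<Rightarrow> nat \<Rightarrow> (nat \<Rightarrow> complex mat) \<Rightarrow> nat \<Rightarrow> complex mat" where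
  "ckword n k c 0 = c 0"
| "ckword n k c (Suc m) = c (Suc m) * That n k * ckword n k c m"

text \<open>Expectation over the ensemble \<bbbU>_{k,l}: C_0,...,C_l i.i.d. uniform on the Clifford group.\<close>
definition ens_expect :: "nat \<Rightarrow> nat \<Rightarrow> nat \<Rightarrow> (complex mat \<Rightarrow> 'a::real_vector) \<Rightarrow> 'a" where
  "ens_expect n k l f =
     (let C = Pi\<^sub>E {0..l} (\<lambda>_. clifford_group n)
      in (1 / real (card C)) *\<^sub>R (\<Sum>c\<in>C. f (ckword n k c l)))"

definition basis_proj :: "nat \<Rightarrow> nat \<Rightarrow> complex mat" where
  "basis_proj d b = mat d d (\<lambda>(i,j). if i = b \<and> j = b then 1 else 0)"

definition meas_channel :: "nat \<Rightarrow> nat \<Rightarrow> nat \<Rightarrow> complex mat \<Rightarrow> complex mat" where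
  "meas_channel n k l X = mat (2^n) (2^n) (\<lambda>ij. ens_expect n k l (\<lambda>U.
      \<Sum>b<2^n. (U * X * adj U) $$ (b,b) * (adj U * basis_proj (2^n) b * U) $$ ij))"

definition meas_channel_inv :: "nat \<Rightarrow> nat \<Rightarrow> nat \<Rightarrow> complex mat \<Rightarrow> complex mat" where
  "meas_channel_inv n k l Ob = (THE X. X \<in> carrier_mat (2^n) (2^n) \<and> meas_channel n k l X = Ob)"

definition Vstar :: "nat \<Rightarrow> nat \<Rightarrow> nat \<Rightarrow> complex mat \<Rightarrow> complex mat \<Rightarrow> real" where
  "Vstar n k l Ob \<rho> =
     ens_expect n k l (\<lambda>U. (Re (\<Sum>b<2^n. (U * \<rho> * adj U) $$ (b,b)
                                   * (U * meas_channel_inv n k l Ob * adj U) $$ (b,b))) ^ 2)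
     - (Re (mtrace (Ob * \<rho>))) ^ 2"

definition density_op :: "nat \<Rightarrow> complex mat \<Rightarrow> bool" where
  "density_op d \<rho> \<longleftrightarrow> \<rho> \<in> carrier_mat d d \<and> adj \<rho> = \<rho> \<and> mtrace \<rho> = 1 \<and>
     (\<forall>v \<in> carrier_vec d. Re (conjugate v \<bullet> (\<rho> *\<^sub>v v)) \<ge> 0)"

definition Vstar_max :: "nat \<Rightarrow> nat \<Rightarrow> nat \<Rightarrow> complex mat \<Rightarrow> real" where
  "Vstar_max n k l Ob = Sup {Vstar n k l Ob \<rho> | \<rho>. density_op (2^n) \<rho>}"

definition pauli_strings :: "nat \<Rightarrow> complex mat set" where
  "pauli_strings n = {tensor_list Ps | Ps. length Ps = n \<and> set Ps \<subseteq> {I2, PX, PY, PZ}}"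

definition stab_renyi2 :: "nat \<Rightarrow> complex vec \<Rightarrow> real" where
  "stab_renyi2 n \<phi> = - log 2 ((1 / 2 ^ n) *
      (\<Sum>P\<in>pauli_strings n. (Re (conjugate \<phi> \<bullet> (P *\<^sub>v \<phi>))) ^ 4))"

end

(*
A Clifford unitary permutes the Pauli operators up to signs, and the Clifford group induces all
symplectic transvections on Pauli words. By Witt's extension theorem the orbit of a triple of words
is determined by the coincidences and commutation signs in it, so fourth moments over the Clifford
group reduce to character sums over these finitely many orbits.

For a pure state psi the variance V_*(O, psi) is an affine function of the averages A and B of
  sum_P <psi|P|psi>^2 <phi|P|phi>^2  and  sum_P <psi|P|psi> <phi|P|phi> |<psi|P|phi>|^2
evaluated at U psi, U phi. If n >= 3, a layer of T gates after a random Clifford unitary moves A + 2 B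
and A - B towards fixed points, with contraction factors in [0, (3/4)^k]; initially |B| <= A and
A <= d 2^(-M_2(phi)/2) by Cauchy-Schwarz. This gives the upper bounds; n <= 2 is covered by crude
estimates. For the lower bound at psi = phi, twirling with Pauli operators shows that one layer
decreases the average of sum_P <phi|P|phi>^4 at most by the factor (3/4)^k. Finally V_*(O, rho) is
the variance of a random variable linear in rho, hence convex, so pure states suffice.
*)
theory Submission
  imports Defs "HOL-Library.Function_Algebras" "Jordan_Normal_Form.Determinant"
begin

subsection \<open>Tensor products\<close>

text \<open>A T layer mixes all orbits of triples of words, so the Clifford average must be known
  exactly on each of them. The values combine traces of permutations of the four tensor factors,
  taken alone or against the sum of all P tensored four times. The latter are unchanged by double
  transpositions, which leaves one for each element of the six-element quotient S_4/V_4; for two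
  copies each of psi and phi they take only the two values A and B. Three independent commuting
  words exist only if 4^n/4 - 4 > 0, hence the restriction n >= 3 in the recursion. The constant 3/4
  is the mean over I, X, Y, Z of the sum of fourth powers in a column of the Pauli transfer matrix
  of T: the columns I and Z give 1, the columns X and Y give 1/4 + 1/4. The factors of the recursion
  are at most (3/4)^k, the wrong direction for a bound from below; there an inequality is used that
  needs only the orbit of a single word.\<close>

lemma sum_lessThan_mult:
  fixes h :: "nat \<Rightarrow> 'a::comm_monoid_add"
  shows "sum h {..<A * B} = (\<Sum>i<A. \<Sum>j<B. h (i * B + j))"
proof -
  have "(\<Sum>i<A. sum h {i * B..<i * B + B}) = sum h {..<A * B}"
    by (rule sum.nat_group)
  moreover have "sum h {i * B..<i * B + B} = (\<Sum>j<B. h (i * B + j))" for i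
    using sum.shift_bounds_nat_ivl[of h 0 "i * B" B] by (simp add: lessThan_atLeast0 add.commute)
  ultimately show ?thesis by simp
qed

lemma kron_carrier [simp]:
  "A \<in> carrier_mat a b \<Longrightarrow> B \<in> carrier_mat c e \<Longrightarrow> kron A B \<in> carrier_mat (a * c) (b * e)"
  by (auto simp: kron_def)

lemma kron_index:
  assumes "A \<in> carrier_mat a b" "B \<in> carrier_mat c e" "i < a * c" "j < b * e"
  shows "kron A B $$ (i,j) = A $$ (i div c, j div e) * B $$ (i mod c, j mod e)"
  using assms by (auto simp: kron_def)

lemma kron_mult:
  assumes "A \<in> carrier_mat a b" "B \<in> carrier_mat c e" "A' \<in> carrier_mat b g" "B' \<in> carrier_mat e h"
  shows "kron A B * kron A' B' = kron (A * A') (B * B')"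
proof (rule eq_matI)
  have c1: "kron A B \<in> carrier_mat (a * c) (b * e)" "kron A' B' \<in> carrier_mat (b * e) (g * h)"
    "kron (A * A') (B * B') \<in> carrier_mat (a * c) (g * h)"
    using assms by auto
  show "dim_row (kron A B * kron A' B') = dim_row (kron (A * A') (B * B'))"
    "dim_col (kron A B * kron A' B') = dim_col (kron (A * A') (B * B'))" using c1 by auto
  fix i j assume "i < dim_row (kron (A * A') (B * B'))" "j < dim_col (kron (A * A') (B * B'))"
  then have ij: "i < a * c" "j < g * h" using c1 by auto
  have pos: "0 < c" "0 < h" using ij by (auto intro: Nat.gr0I)
  have lt: "i div c < a" "j div h < g" "i mod c < c" "j mod h < h"
    using ij pos by (auto simp: less_mult_imp_div_less)
  have "(kron A B * kron A' B') $$ (i,j) = (\<Sum>k<b * e. kron A B $$ (i,k) * kron A' B' $$ (k,j))"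
    using c1 ij by (simp add: scalar_prod_def lessThan_atLeast0)
  also have "\<dots> = (\<Sum>k<b. \<Sum>l<e. kron A B $$ (i,k*e+l) * kron A' B' $$ (k*e+l,j))"
    by (rule sum_lessThan_mult)
  also have "\<dots> = (\<Sum>k<b. \<Sum>l<e. (A $$ (i div c, k) * A' $$ (k, j div h)) * (B $$ (i mod c, l) * B' $$ (l, j mod h)))"
  proof (intro sum.cong refl)
    fix k l assume kl: "k \<in> {..<b}" "l \<in> {..<e}"
    have "k * e + l < b * e"
      using kl mult_le_mono1[of "Suc k" b e] by auto
    then show "kron A B $$ (i,k*e+l) * kron A' B' $$ (k*e+l,j) = (A $$ (i div c, k) * A' $$ (k, j div h)) * (B $$ (i mod c, l) * B' $$ (l, j mod h))"
      using kl kron_index[OF assms(1,2) ij(1), of "k*e+l"] kron_index[OF assms(3,4) _ ij(2), of "k*e+l"]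
      by (simp add: mult_ac)
  qed
  also have "\<dots> = (\<Sum>k<b. A $$ (i div c, k) * A' $$ (k, j div h)) * (\<Sum>l<e. B $$ (i mod c, l) * B' $$ (l, j mod h))"
    by (simp add: sum_product)
  also have "\<dots> = (A * A') $$ (i div c, j div h) * (B * B') $$ (i mod c, j mod h)"
    using assms lt by (simp add: scalar_prod_def lessThan_atLeast0)
  also have "\<dots> = kron (A * A') (B * B') $$ (i,j)"
    using assms ij by (subst kron_index[where a=a and b=g and c=c and e=h]) auto
  finally show "(kron A B * kron A' B') $$ (i,j) = kron (A * A') (B * B') $$ (i,j)" .
qed

text \<open>The factors are given by a function of the position, so that products, adjoints and
  scalars of tensor products reduce to pointwise statements. Position 0 is the most significant
  qubit.\<close>

definition ten :: "nat \<Rightarrow> (nat \<Rightarrow> complex mat) \<Rightarrow> complex mat" where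
  "ten n f = tensor_list (map f [0..<n])"

lemma ten_0 [simp]: "ten 0 f = 1\<^sub>m 1"
  by (simp add: ten_def tensor_list_def)

lemma ten_Suc: "ten (Suc n) f = kron (f 0) (ten n (\<lambda>q. f (Suc q)))"
proof -
  have "map f [0..<Suc n] = f 0 # map (\<lambda>q. f (Suc q)) [0..<n]"
    by (simp add: upt_conv_Cons map_Suc_upt[symmetric] del: upt_Suc)
  then show ?thesis by (simp add: ten_def tensor_list_def del: upt_Suc)
qed

lemma ten_cong: "(\<And>q. q < n \<Longrightarrow> f q = g q) \<Longrightarrow> ten n f = ten n g"
  unfolding ten_def by (rule arg_cong[where f=tensor_list]) simp

lemma ten_carrier [simp]:
  "(\<And>q. q < n \<Longrightarrow> f q \<in> carrier_mat 2 2) \<Longrightarrow> ten n f \<in> carrier_mat (2 ^ n) (2 ^ n)"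
proof (induction n arbitrary: f)
  case (Suc n)
  have "f 0 \<in> carrier_mat 2 2" "ten n (\<lambda>q. f (Suc q)) \<in> carrier_mat (2 ^ n) (2 ^ n)"
    using Suc by auto
  then show ?case unfolding ten_Suc using kron_carrier by fastforce
qed auto

lemma ten_mult:
  "(\<And>q. q < n \<Longrightarrow> f q \<in> carrier_mat 2 2) \<Longrightarrow> (\<And>q. q < n \<Longrightarrow> g q \<in> carrier_mat 2 2) \<Longrightarrow>
    ten n f * ten n g = ten n (\<lambda>q. f q * g q)"
proof (induction n arbitrary: f g)
  case (Suc n)
  have c: "f 0 \<in> carrier_mat 2 2" "ten n (\<lambda>q. f (Suc q)) \<in> carrier_mat (2 ^ n) (2 ^ n)"
    "g 0 \<in> carrier_mat 2 2" "ten n (\<lambda>q. g (Suc q)) \<in> carrier_mat (2 ^ n) (2 ^ n)"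
    using Suc.prems by auto
  show ?case unfolding ten_Suc kron_mult[OF c] using Suc by simp
qed auto

lemma qbit_0: "i < 2 ^ Suc n \<Longrightarrow> qbit (Suc n) 0 i = i div 2 ^ n"
  by (simp add: qbit_def less_mult_imp_div_less)

lemma qbit_Suc: "q < n \<Longrightarrow> qbit (Suc n) (Suc q) i = qbit n q (i mod 2 ^ n)"
proof -
  assume q: "q < n"
  let ?m = "n - Suc q"
  have "n = ?m + Suc (n - Suc ?m)" using q by simp
  then have "(i mod 2 ^ n) div 2 ^ ?m mod 2 = i div 2 ^ ?m mod 2"
    using bit_take_bit_iff[of n i ?m] q unfolding bit_iff_odd take_bit_eq_mod
    by (auto simp: mod_2_eq_odd)
  then show ?thesis using q by (simp add: qbit_def)
qed

lemma qbit_less_2 [simp]: "qbit n q i < 2"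
  by (simp add: qbit_def)

lemma ten_index:
  "(\<And>q. q < n \<Longrightarrow> f q \<in> carrier_mat 2 2) \<Longrightarrow> i < 2 ^ n \<Longrightarrow> j < 2 ^ n \<Longrightarrow>
    ten n f $$ (i,j) = (\<Prod>q<n. f q $$ (qbit n q i, qbit n q j))"
proof (induction n arbitrary: f i j)
  case (Suc n)
  have c: "f 0 \<in> carrier_mat 2 2" "ten n (\<lambda>q. f (Suc q)) \<in> carrier_mat (2 ^ n) (2 ^ n)"
    using Suc.prems by auto
  have "ten (Suc n) f $$ (i,j) = f 0 $$ (i div 2 ^ n, j div 2 ^ n) * ten n (\<lambda>q. f (Suc q)) $$ (i mod 2 ^ n, j mod 2 ^ n)"
    unfolding ten_Suc by (rule kron_index[OF c]) (use Suc.prems in auto)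
  also have "ten n (\<lambda>q. f (Suc q)) $$ (i mod 2 ^ n, j mod 2 ^ n) = (\<Prod>q<n. f (Suc q) $$ (qbit n q (i mod 2 ^ n), qbit n q (j mod 2 ^ n)))"
    by (rule Suc.IH) (use Suc.prems in auto)
  also have "\<dots> = (\<Prod>q<n. f (Suc q) $$ (qbit (Suc n) (Suc q) i, qbit (Suc n) (Suc q) j))"
    by (intro prod.cong) (auto simp: qbit_Suc)
  finally show ?case using Suc.prems by (simp add: prod.lessThan_Suc_shift qbit_0 del: prod.lessThan_Suc)
qed auto

lemma qbit_eqI: "i < 2 ^ n \<Longrightarrow> j < 2 ^ n \<Longrightarrow> (\<And>q. q < n \<Longrightarrow> qbit n q i = qbit n q j) \<Longrightarrow> i = j"
proof (induction n arbitrary: i j)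
  case (Suc n)
  have "i mod 2 ^ n = j mod 2 ^ n"
  proof (rule Suc.IH)
    fix q assume "q < n"
    then show "qbit n q (i mod 2 ^ n) = qbit n q (j mod 2 ^ n)"
      using Suc.prems(3)[of "Suc q"] by (simp add: qbit_Suc)
  qed auto
  moreover have "i div 2 ^ n = j div 2 ^ n"
    using Suc.prems(3)[of 0] Suc.prems(1,2) by (simp add: qbit_0)
  ultimately show ?case by (metis div_mult_mod_eq)
qed auto

lemma ten_smult:
  assumes "\<And>q. q < n \<Longrightarrow> f q \<in> carrier_mat 2 2"
  shows "ten n (\<lambda>q. c q \<cdot>\<^sub>m f q) = (\<Prod>q<n. c q) \<cdot>\<^sub>m ten n f"
proof -
  have c: "ten n (\<lambda>q. c q \<cdot>\<^sub>m f q) \<in> carrier_mat (2 ^ n) (2 ^ n)" "ten n f \<in> carrier_mat (2 ^ n) (2 ^ n)"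
    using assms by auto
  show ?thesis
  proof (rule eq_matI)
    fix i j assume "i < dim_row ((\<Prod>q<n. c q) \<cdot>\<^sub>m ten n f)" "j < dim_col ((\<Prod>q<n. c q) \<cdot>\<^sub>m ten n f)"
    then have ij: "i < 2 ^ n" "j < 2 ^ n" using c by auto
    have "ten n (\<lambda>q. c q \<cdot>\<^sub>m f q) $$ (i,j) = (\<Prod>q<n. (c q \<cdot>\<^sub>m f q) $$ (qbit n q i, qbit n q j))"
      by (rule ten_index) (use assms ij in auto)
    also have "\<dots> = (\<Prod>q<n. c q * f q $$ (qbit n q i, qbit n q j))"
    proof (intro prod.cong refl)
      fix q assume "q \<in> {..<n}"
      then have "f q \<in> carrier_mat 2 2" using assms by auto
      then show "(c q \<cdot>\<^sub>m f q) $$ (qbit n q i, qbit n q j) = c q * f q $$ (qbit n q i, qbit n q j)"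
        by (subst index_smult_mat) auto
    qed
    also have "\<dots> = (\<Prod>q<n. c q) * ten n f $$ (i,j)"
      by (subst ten_index) (use assms ij in \<open>auto simp: prod.distrib\<close>)
    finally show "ten n (\<lambda>q. c q \<cdot>\<^sub>m f q) $$ (i,j) = ((\<Prod>q<n. c q) \<cdot>\<^sub>m ten n f) $$ (i,j)"
      using c ij by simp
  qed (use c in auto)
qed

lemma adj_carrier [simp]: "A \<in> carrier_mat a b \<Longrightarrow> adj A \<in> carrier_mat b a"
  by (auto simp: adj_def)

lemma adj_dim [simp]: "dim_row (adj A) = dim_col A" "dim_col (adj A) = dim_row A"
  by (auto simp: adj_def)

lemma adj_index: "A \<in> carrier_mat a b \<Longrightarrow> i < b \<Longrightarrow> j < a \<Longrightarrow> adj A $$ (i,j) = cnj (A $$ (j,i))"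
  by (auto simp: adj_def)

lemma adj_ten:
  assumes "\<And>q. q < n \<Longrightarrow> f q \<in> carrier_mat 2 2"
  shows "adj (ten n f) = ten n (\<lambda>q. adj (f q))"
proof -
  have c: "ten n (\<lambda>q. adj (f q)) \<in> carrier_mat (2 ^ n) (2 ^ n)" "ten n f \<in> carrier_mat (2 ^ n) (2 ^ n)"
    using assms by auto
  show ?thesis
  proof (rule eq_matI)
    fix i j assume "i < dim_row (ten n (\<lambda>q. adj (f q)))" "j < dim_col (ten n (\<lambda>q. adj (f q)))"
    then have ij: "i < 2 ^ n" "j < 2 ^ n" using c by auto
    have "ten n (\<lambda>q. adj (f q)) $$ (i,j) = (\<Prod>q<n. adj (f q) $$ (qbit n q i, qbit n q j))"
      by (rule ten_index) (use assms ij in auto)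
    also have "\<dots> = (\<Prod>q<n. cnj (f q $$ (qbit n q j, qbit n q i)))"
      by (intro prod.cong refl adj_index[where a=2 and b=2]) (use assms in auto)
    also have "\<dots> = cnj (ten n f $$ (j,i))"
      by (subst ten_index) (use assms ij in auto)
    finally show "adj (ten n f) $$ (i,j) = ten n (\<lambda>q. adj (f q)) $$ (i,j)"
      using c ij by (simp add: adj_index[OF c(2)])
  qed (use carrier_matD[OF c(1)] carrier_matD[OF c(2)] in simp_all)
qed

lemma mtrace_kron:
  assumes "A \<in> carrier_mat a a" "B \<in> carrier_mat c c"
  shows "mtrace (kron A B) = mtrace A * mtrace B"
proof -
  have k: "kron A B \<in> carrier_mat (a * c) (a * c)" using assms by simp
  have "mtrace (kron A B) = (\<Sum>i<a * c. kron A B $$ (i,i))" using k by (simp add: mtrace_def)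
  also have "\<dots> = (\<Sum>i<a. \<Sum>j<c. kron A B $$ (i * c + j, i * c + j))" by (rule sum_lessThan_mult)
  also have "\<dots> = (\<Sum>i<a. \<Sum>j<c. A $$ (i,i) * B $$ (j,j))"
  proof (intro sum.cong refl)
    fix k l assume kl: "k \<in> {..<a}" "l \<in> {..<c}"
    have "k * c + l < a * c"
      using kl mult_le_mono1[of "Suc k" a c] by auto
    then show "kron A B $$ (k * c + l, k * c + l) = A $$ (k,k) * B $$ (l,l)"
      using kl by (subst kron_index[OF assms]) auto
  qed
  also have "\<dots> = mtrace A * mtrace B" using assms by (simp add: mtrace_def sum_product)
  finally show ?thesis .
qed

lemma mtrace_ten:
  "(\<And>q. q < n \<Longrightarrow> f q \<in> carrier_mat 2 2) \<Longrightarrow> mtrace (ten n f) = (\<Prod>q<n. mtrace (f q))"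
proof (induction n arbitrary: f)
  case (Suc n)
  have c: "f 0 \<in> carrier_mat 2 2" "ten n (\<lambda>q. f (Suc q)) \<in> carrier_mat (2 ^ n) (2 ^ n)"
    using Suc.prems by auto
  show ?case unfolding ten_Suc mtrace_kron[OF c] using Suc
    by (simp add: prod.lessThan_Suc_shift del: prod.lessThan_Suc)
qed (auto simp: mtrace_def)

subsection \<open>Traces and adjoints\<close>

lemma mtrace_mult:
  assumes "A \<in> carrier_mat a b" "B \<in> carrier_mat b a"
  shows "mtrace (A * B) = (\<Sum>i<a. \<Sum>j<b. A $$ (i,j) * B $$ (j,i))"
  using assms by (simp add: mtrace_def scalar_prod_def lessThan_atLeast0)

lemma mtrace_comm:
  assumes "A \<in> carrier_mat a b" "B \<in> carrier_mat b a"
  shows "mtrace (A * B) = mtrace (B * A)"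
  unfolding mtrace_mult[OF assms] mtrace_mult[OF assms(2,1)]
  by (subst sum.swap) (simp add: mult.commute)

lemma mtrace_smult: "A \<in> carrier_mat a a \<Longrightarrow> mtrace (c \<cdot>\<^sub>m A) = c * mtrace A"
  by (simp add: mtrace_def sum_distrib_left)

lemma mtrace_add: "A \<in> carrier_mat a a \<Longrightarrow> B \<in> carrier_mat a a \<Longrightarrow> mtrace (A + B) = mtrace A + mtrace B"
  by (simp add: mtrace_def sum.distrib)

lemma mtrace_minus: "A \<in> carrier_mat a a \<Longrightarrow> B \<in> carrier_mat a a \<Longrightarrow> mtrace (A - B) = mtrace A - mtrace B"
  by (simp add: mtrace_def sum_subtractf)

lemma mtrace_one [simp]: "mtrace (1\<^sub>m d) = of_nat d"
  by (simp add: mtrace_def)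

lemma adj_adj [simp]: "adj (adj A) = A"
  by (rule eq_matI) (auto simp: adj_def)

lemma adj_mult:
  assumes "A \<in> carrier_mat a b" "B \<in> carrier_mat b c"
  shows "adj (A * B) = adj B * adj A"
  by (rule eq_matI) (use assms in \<open>auto simp: adj_def scalar_prod_def mult.commute\<close>)

lemma adj_one [simp]: "adj (1\<^sub>m d) = 1\<^sub>m d"
  by (rule eq_matI) (auto simp: adj_def)

lemma adj_smult: "adj (c \<cdot>\<^sub>m A) = cnj c \<cdot>\<^sub>m adj A"
  by (rule eq_matI) (auto simp: adj_def)

lemma adj_add: "A \<in> carrier_mat a b \<Longrightarrow> B \<in> carrier_mat a b \<Longrightarrow> adj (A + B) = adj A + adj B"
  by (rule eq_matI) (auto simp: adj_def)

subsection \<open>Pauli operators\<close>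

datatype letter = LI | LX | LY | LZ

lemma UNIV_letter: "UNIV = {LI, LX, LY, LZ}"
  using letter.exhaust by auto

instance letter :: finite
  by standard (simp add: UNIV_letter)

lemma sum_letter: "(\<Sum>l\<in>UNIV. f l) = f LI + f LX + f LY + f LZ"
  by (simp add: UNIV_letter add.assoc)

text \<open>The Klein four-group of Pauli matrices modulo phases: \<open>a + b\<close> is the letter
  of the product, and each letter is its own inverse.\<close>

instantiation letter :: ab_group_add
begin
definition "0 = LI"
definition "a + b = (case a of LI \<Rightarrow> b
   | LX \<Rightarrow> (case b of LI \<Rightarrow> LX | LX \<Rightarrow> LI | LY \<Rightarrow> LZ | LZ \<Rightarrow> LY)
   | LY \<Rightarrow> (case b of LI \<Rightarrow> LY | LX \<Rightarrow> LZ | LY \<Rightarrow> LI | LZ \<Rightarrow> LX)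
   | LZ \<Rightarrow> (case b of LI \<Rightarrow> LZ | LX \<Rightarrow> LY | LY \<Rightarrow> LX | LZ \<Rightarrow> LI))"
definition "- a = (a :: letter)"
definition "a - b = (a :: letter) + b"
instance
  by standard (auto simp: zero_letter_def plus_letter_def uminus_letter_def minus_letter_def split: letter.splits)
end

definition sigma :: "letter \<Rightarrow> complex mat" where
  "sigma l = (case l of LI \<Rightarrow> I2 | LX \<Rightarrow> PX | LY \<Rightarrow> PY | LZ \<Rightarrow> PZ)"

text \<open>The commutation sign of two Pauli matrices, that is, the symplectic form written
  multiplicatively. It is complex-valued because it multiplies complex amplitudes
  throughout.\<close>

definition sl :: "letter \<Rightarrow> letter \<Rightarrow> complex" where
  "sl a b = (if a = LI \<or> b = LI \<or> a = b then 1 else -1)"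

text \<open>The phase by which a product of two Pauli matrices differs from the matrix of the summed
  letter, a cocycle for the addition of letters.\<close>

definition pl :: "letter \<Rightarrow> letter \<Rightarrow> complex" where
  "pl a b = (if a = LI \<or> b = LI \<or> a = b then 1
     else if (a,b) \<in> {(LX,LY),(LY,LZ),(LZ,LX)} then \<i> else -\<i>)"

lemmas gate_defs = I2_def PX_def PY_def PZ_def

lemma sigma_carrier [simp]: "sigma l \<in> carrier_mat 2 2"
  by (cases l) (auto simp: sigma_def gate_defs)

lemma less_2: "(i::nat) < 2 \<longleftrightarrow> i = 0 \<or> i = 1" by auto

lemma mat2_eqI:
  assumes "A \<in> carrier_mat 2 2" "B \<in> carrier_mat 2 2"
    "A $$ (0,0) = B $$ (0,0)" "A $$ (0,1) = B $$ (0,1)" "A $$ (1,0) = B $$ (1,0)" "A $$ (1,1) = B $$ (1,1)"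
  shows "A = B"
  by (rule eq_matI) (use assms in \<open>auto simp: less_2\<close>)

lemma mat2_mult_index:
  assumes "A \<in> carrier_mat 2 2" "B \<in> carrier_mat 2 2" "i < 2" "j < 2"
  shows "(A * B) $$ (i,j) = A $$ (i,0) * B $$ (0,j) + A $$ (i,1) * B $$ (1,j)"
  using assms by (auto simp: scalar_prod_def numeral_2_eq_2)

lemma sigma_entries:
  "sigma l $$ (0,0) = (case l of LI \<Rightarrow> 1 | LX \<Rightarrow> 0 | LY \<Rightarrow> 0 | LZ \<Rightarrow> 1)"
  "sigma l $$ (0,Suc 0) = (case l of LI \<Rightarrow> 0 | LX \<Rightarrow> 1 | LY \<Rightarrow> -\<i> | LZ \<Rightarrow> 0)"
  "sigma l $$ (Suc 0,0) = (case l of LI \<Rightarrow> 0 | LX \<Rightarrow> 1 | LY \<Rightarrow> \<i> | LZ \<Rightarrow> 0)"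
  "sigma l $$ (Suc 0,Suc 0) = (case l of LI \<Rightarrow> 1 | LX \<Rightarrow> 0 | LY \<Rightarrow> 0 | LZ \<Rightarrow> -1)"
  by (cases l; simp add: sigma_def gate_defs)+

lemma sigma_mult: "sigma a * sigma b = pl a b \<cdot>\<^sub>m sigma (a + b)"
proof (rule mat2_eqI)
  show "sigma a * sigma b \<in> carrier_mat 2 2" using mult_carrier_mat[of "sigma a" 2 2 "sigma b" 2] by simp
  show "pl a b \<cdot>\<^sub>m sigma (a + b) \<in> carrier_mat 2 2" by simp
  have d: "dim_row (sigma l) = 2" "dim_col (sigma l) = 2" for l using carrier_matD[OF sigma_carrier[of l]] by auto
  show "(sigma a * sigma b) $$ (0,0) = (pl a b \<cdot>\<^sub>m sigma (a + b)) $$ (0,0)"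
    "(sigma a * sigma b) $$ (0,1) = (pl a b \<cdot>\<^sub>m sigma (a + b)) $$ (0,1)"
    "(sigma a * sigma b) $$ (1,0) = (pl a b \<cdot>\<^sub>m sigma (a + b)) $$ (1,0)"
    "(sigma a * sigma b) $$ (1,1) = (pl a b \<cdot>\<^sub>m sigma (a + b)) $$ (1,1)"
    by (cases a; cases b; simp add: mat2_mult_index d sigma_entries pl_def plus_letter_def del: index_mult_mat)+
qed

lemma pl_swap: "pl a b = sl a b * pl b a"
  by (cases a; cases b; simp add: pl_def sl_def)

lemma sl_sym: "sl a b = sl b a" by (auto simp: sl_def)

lemma sl_add: "sl (a + b) c = sl a c * sl b c"
  by (cases a; cases b; cases c; simp add: sl_def plus_letter_def)

lemma adj_sigma: "adj (sigma l) = sigma l"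
  by (rule mat2_eqI) (cases l; simp add: adj_index[OF sigma_carrier] sigma_entries)+

type_synonym word = "nat \<Rightarrow> letter"

text \<open>Letters from position n on are forced to be trivial, so that equality of functions is
  equality of words and the n-qubit words form a finite group in which every element is its own
  inverse.\<close>

definition words :: "nat \<Rightarrow> word set" where
  "words n = {u. \<forall>q\<ge>n. u q = 0}"

definition pauli :: "nat \<Rightarrow> word \<Rightarrow> complex mat" where
  "pauli n u = ten n (\<lambda>q. sigma (u q))"

definition sg :: "nat \<Rightarrow> word \<Rightarrow> word \<Rightarrow> complex" where
  "sg n u v = (\<Prod>q<n. sl (u q) (v q))"

definition phase :: "nat \<Rightarrow> word \<Rightarrow> word \<Rightarrow> complex" where
  "phase n u v = (\<Prod>q<n. pl (u q) (v q))"

lemma letter_double [simp]: "(a::letter) + a = 0"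
  by (cases a) (auto simp: plus_letter_def zero_letter_def)

lemma word_double [simp]: "(u::word) + u = 0"
  by (rule ext) (simp add: plus_fun_def zero_fun_def)

lemma word_double_left [simp]: "(u::word) + (u + v) = v"
  by (simp add: add.assoc[symmetric])

lemma word_add_eq_0_iff [simp]: "(u::word) + v = 0 \<longleftrightarrow> u = v"
  by (metis add.right_neutral word_double_left word_double)

lemma words_0 [simp]: "0 \<in> words n"
  by (simp add: words_def)

lemma words_add [simp]: "u \<in> words n \<Longrightarrow> v \<in> words n \<Longrightarrow> u + v \<in> words n"
  by (simp add: words_def)

lemma words_zero: "words 0 = {0}"
  by (auto simp: words_def zero_fun_def)

lemma words_Suc: "words (Suc n) = (\<lambda>(u,l). u(n := l)) ` (words n \<times> UNIV)"
proof -
  have "u \<in> (\<lambda>(u,l). u(n := l)) ` (words n \<times> UNIV)" if "u \<in> words (Suc n)" for u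
  proof (rule image_eqI)
    show "u = (\<lambda>(u,l). u(n := l)) (u(n := 0), u n)" by simp
    show "(u(n := 0), u n) \<in> words n \<times> UNIV"
      using that by (auto simp: words_def Suc_le_eq)
  qed
  then show ?thesis by (auto simp: words_def)
qed

lemma inj_words_Suc: "inj_on (\<lambda>(u,l). u(n := l)) (words n \<times> (UNIV :: letter set))"
proof (rule inj_onI, clarify)
  fix u v :: word and a b assume u: "u \<in> words n" "v \<in> words n" and e: "u(n := a) = v(n := b)"
  have "a = b" using fun_cong[OF e, of n] by simp
  moreover have "u q = v q" for q
    using fun_cong[OF e, of q] u by (cases "q = n") (auto simp: words_def)
  ultimately show "u = v \<and> a = b" by auto
qed

lemma finite_words [simp]: "finite (words n)"
  by (induction n) (auto simp: words_zero words_Suc)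

text \<open>Distributivity over positions. The basic character sums, the counts of words and the
  weight sums of a T layer all reduce to one-qubit sums in this way.\<close>

lemma sum_words_prod:
  fixes g :: "nat \<Rightarrow> letter \<Rightarrow> 'a::comm_semiring_1"
  shows "(\<Sum>u\<in>words n. \<Prod>q<n. g q (u q)) = (\<Prod>q<n. \<Sum>l\<in>UNIV. g q l)"
proof (induction n)
  case (Suc n)
  have "(\<Sum>u\<in>words (Suc n). \<Prod>q<Suc n. g q (u q)) = (\<Sum>(u,l)\<in>words n \<times> UNIV. \<Prod>q<Suc n. g q ((u(n := l)) q))"
    unfolding words_Suc by (subst sum.reindex[OF inj_words_Suc]) (simp add: case_prod_unfold)
  also have "\<dots> = (\<Sum>u\<in>words n. \<Sum>l\<in>UNIV. (\<Prod>q<n. g q (u q)) * g n l)"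
    by (simp add: sum.cartesian_product)
  also have "\<dots> = (\<Sum>u\<in>words n. \<Prod>q<n. g q (u q)) * (\<Sum>l\<in>UNIV. g n l)"
    by (simp add: sum_product)
  finally show ?case using Suc by simp
qed (simp add: words_zero)

lemma card_words: "card (words n) = 4 ^ n"
  using sum_words_prod[where n=n and g="\<lambda>_ _. 1::nat"] by (simp add: UNIV_letter numeral_eq_Suc)

lemma pauli_carrier [simp]: "pauli n u \<in> carrier_mat (2 ^ n) (2 ^ n)"
  by (simp add: pauli_def)

lemma pauli_dim [simp]: "dim_row (pauli n u) = 2 ^ n" "dim_col (pauli n u) = 2 ^ n"
  using carrier_matD[OF pauli_carrier[of n u]] by auto

lemma smult_smult_mat: "c \<cdot>\<^sub>m (e \<cdot>\<^sub>m A) = (c * e :: 'a :: semigroup_mult) \<cdot>\<^sub>m A"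
  by (rule eq_matI) (auto simp: mult.assoc)

lemma pauli_mult: "pauli n u * pauli n v = phase n u v \<cdot>\<^sub>m pauli n (u + v)"
  unfolding pauli_def phase_def by (subst ten_mult) (auto simp: sigma_mult ten_smult)

lemma phase_swap: "phase n u v = sg n u v * phase n v u"
  by (simp add: phase_def sg_def prod.distrib[symmetric] pl_swap[symmetric])

lemma pauli_commute: "pauli n u * pauli n v = sg n u v \<cdot>\<^sub>m (pauli n v * pauli n u)"
  unfolding pauli_mult by (simp add: phase_swap[of n u v] add.commute smult_smult_mat)

lemma sg_sym: "sg n u v = sg n v u"
  by (simp add: sg_def sl_sym)

lemma sg_add_left: "sg n (u + v) w = sg n u w * sg n v w"
  by (simp add: sg_def sl_add prod.distrib)

lemma sg_add_right: "sg n w (u + v) = sg n w u * sg n w v"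
  by (metis sg_add_left sg_sym)

lemma sg_self [simp]: "sg n u u = 1"
  by (simp add: sg_def sl_def)

lemma sg_0 [simp]: "sg n 0 u = 1" "sg n u 0 = 1"
  by (simp_all add: sg_def sl_def zero_letter_def)

lemma sg_cases: "sg n u v = 1 \<or> sg n u v = -1"
proof (induction n)
  case (Suc n)
  have "sl (u n) (v n) = 1 \<or> sl (u n) (v n) = -1" by (simp add: sl_def)
  then show ?case using Suc by (auto simp: sg_def)
qed (simp add: sg_def)

lemma sg_square [simp]: "sg n u v * sg n u v = 1"
  using sg_cases[of n u v] by auto

text \<open>Orthogonality of characters: a nonidentity letter commutes with two letters and
  anticommutes with the other two, so a single nonzero position makes the product over positions
  vanish.\<close>

lemma sum_sg:
  assumes "u \<in> words n"
  shows "(\<Sum>v\<in>words n. sg n u v) = (if u = 0 then 4 ^ n else 0)"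
proof -
  have "(\<Sum>v\<in>words n. sg n u v) = (\<Prod>q<n. \<Sum>l\<in>UNIV. sl (u q) l)"
    unfolding sg_def by (rule sum_words_prod)
  also have "\<dots> = (\<Prod>q<n. if u q = 0 then 4 else 0)"
    by (intro prod.cong refl, rename_tac q, case_tac "u q") (simp_all add: sum_letter sl_def zero_letter_def del: sum_constant)
  also have "\<dots> = (if u = 0 then 4 ^ n else 0)"
  proof (cases "u = 0")
    case False
    then obtain q where "u q \<noteq> 0" by (auto simp: fun_eq_iff)
    moreover from this have "q < n" using assms by (auto simp: words_def not_le[symmetric])
    ultimately show ?thesis using False by (auto intro: prod_zero)
  qed simp
  finally show ?thesis .
qed

lemma pauli_0: "pauli n 0 = 1\<^sub>m (2 ^ n)"
proof (rule eq_matI)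
  fix i j assume "i < dim_row (1\<^sub>m (2 ^ n) :: complex mat)" "j < dim_col (1\<^sub>m (2 ^ n) :: complex mat)"
  then have ij: "i < 2 ^ n" "j < 2 ^ n" by auto
  have "pauli n 0 $$ (i,j) = (\<Prod>q<n. sigma LI $$ (qbit n q i, qbit n q j))"
    unfolding pauli_def by (subst ten_index) (use ij in \<open>auto simp: zero_letter_def\<close>)
  also have "\<dots> = (\<Prod>q<n. if qbit n q i = qbit n q j then 1 else 0)"
    by (intro prod.cong refl) (simp add: sigma_def I2_def)
  also have "\<dots> = (if i = j then 1 else 0)"
    using qbit_eqI[OF ij] by (auto intro!: prod.neutral prod_zero)
  finally show "pauli n 0 $$ (i,j) = 1\<^sub>m (2 ^ n) $$ (i,j)" using ij by simp
qed auto

lemma phase_self [simp]: "phase n u u = 1"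
  by (simp add: phase_def pl_def)

lemma pauli_square: "pauli n u * pauli n u = 1\<^sub>m (2 ^ n)"
proof -
  have "1 \<cdot>\<^sub>m A = A" for A :: "complex mat" by (rule eq_matI) auto
  then show ?thesis by (simp add: pauli_mult pauli_0)
qed

lemma adj_pauli [simp]: "adj (pauli n u) = pauli n u"
  by (simp add: pauli_def adj_ten adj_sigma)

lemma mtrace_sigma: "mtrace (sigma l) = (if l = 0 then 2 else 0)"
  by (cases l) (simp_all add: mtrace_def sigma_entries zero_letter_def numeral_2_eq_2 carrier_matD[OF sigma_carrier, unfolded numeral_2_eq_2])

lemma mtrace_pauli:
  assumes "u \<in> words n"
  shows "mtrace (pauli n u) = (if u = 0 then 2 ^ n else 0)"
proof -
  have "mtrace (pauli n u) = (\<Prod>q<n. if u q = 0 then 2 else 0)"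
    unfolding pauli_def by (subst mtrace_ten) (auto simp: mtrace_sigma)
  also have "\<dots> = (if u = 0 then 2 ^ n else 0)"
  proof (cases "u = 0")
    case False
    then obtain q where "u q \<noteq> 0" by (auto simp: fun_eq_iff)
    moreover from this have "q < n" using assms by (auto simp: words_def not_le[symmetric])
    ultimately show ?thesis using False by (auto intro: prod_zero)
  qed simp
  finally show ?thesis .
qed

text \<open>Entrywise form of the identity that P tensor P, summed over all Pauli strings, is 2^n
  times the swap operator. Both sides factor over positions, so one qubit decides.\<close>

lemma pauli_entry_sum:
  assumes "i < 2 ^ n" "j < 2 ^ n" "k < 2 ^ n" "l < 2 ^ n"
  shows "(\<Sum>u\<in>words n. pauli n u $$ (i,j) * pauli n u $$ (k,l)) = (if i = l \<and> j = k then 2 ^ n else 0)"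
proof -
  have "(\<Sum>u\<in>words n. pauli n u $$ (i,j) * pauli n u $$ (k,l)) =
     (\<Sum>u\<in>words n. \<Prod>q<n. sigma (u q) $$ (qbit n q i, qbit n q j) * sigma (u q) $$ (qbit n q k, qbit n q l))"
    by (intro sum.cong refl) (simp add: pauli_def ten_index assms prod.distrib)
  also have "\<dots> = (\<Prod>q<n. \<Sum>a\<in>UNIV. sigma a $$ (qbit n q i, qbit n q j) * sigma a $$ (qbit n q k, qbit n q l))"
    by (rule sum_words_prod)
  also have "\<dots> = (\<Prod>q<n. if qbit n q i = qbit n q l \<and> qbit n q j = qbit n q k then 2 else 0)"
  proof (intro prod.cong refl)
    fix q
    have c: "(\<Sum>a\<in>UNIV. sigma a $$ (b1,b2) * sigma a $$ (b3,b4)) = (if b1 = b4 \<and> b2 = b3 then 2 else 0)"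
      if "b1 < 2" "b2 < 2" "b3 < 2" "b4 < 2" for b1 b2 b3 b4
      using that by (auto simp: less_2 sum_letter sigma_entries)
    show "(\<Sum>a\<in>UNIV. sigma a $$ (qbit n q i, qbit n q j) * sigma a $$ (qbit n q k, qbit n q l)) = (if qbit n q i = qbit n q l \<and> qbit n q j = qbit n q k then 2 else 0)"
      by (rule c) auto
  qed
  also have "\<dots> = (if i = l \<and> j = k then 2 ^ n else 0)"
  proof (cases "i = l \<and> j = k")
    case False
    then obtain q where "q < n" "\<not> (qbit n q i = qbit n q l \<and> qbit n q j = qbit n q k)"
      using qbit_eqI assms by blast
    then show ?thesis using False by (auto intro!: prod_zero)
  qed simp
  finally show ?thesis .
qed

text \<open>Completeness of the Pauli strings as an orthogonal basis, in bilinear form. It holds for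
  arbitrary matrices and therefore for the nonhermitian |b><a| used below.\<close>

lemma sum_pauli_trace:
  assumes "X \<in> carrier_mat (2 ^ n) (2 ^ n)" "Y \<in> carrier_mat (2 ^ n) (2 ^ n)"
  shows "(\<Sum>u\<in>words n. mtrace (X * pauli n u) * mtrace (Y * pauli n u)) = 2 ^ n * mtrace (X * Y)"
proof -
  let ?N = "{..<(2::nat) ^ n}"
  have "(\<Sum>u\<in>words n. mtrace (X * pauli n u) * mtrace (Y * pauli n u)) =
    (\<Sum>u\<in>words n. \<Sum>i\<in>?N. \<Sum>j\<in>?N. \<Sum>k\<in>?N. \<Sum>l\<in>?N. X $$ (i,j) * Y $$ (k,l) * (pauli n u $$ (j,i) * pauli n u $$ (l,k)))"
  proof (intro sum.cong refl)
    fix u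
    show "mtrace (X * pauli n u) * mtrace (Y * pauli n u) = (\<Sum>i\<in>?N. \<Sum>j\<in>?N. \<Sum>k\<in>?N. \<Sum>l\<in>?N. X $$ (i,j) * Y $$ (k,l) * (pauli n u $$ (j,i) * pauli n u $$ (l,k)))"
      unfolding mtrace_mult[OF assms(1) pauli_carrier] mtrace_mult[OF assms(2) pauli_carrier] sum_distrib_right
      unfolding sum_distrib_left by (simp only: mult_ac)
  qed
  also have "\<dots> = (\<Sum>i\<in>?N. \<Sum>j\<in>?N. \<Sum>k\<in>?N. \<Sum>l\<in>?N. X $$ (i,j) * Y $$ (k,l) * (\<Sum>u\<in>words n. pauli n u $$ (j,i) * pauli n u $$ (l,k)))"
    by (simp only: sum.swap[of _ "words n"] sum_distrib_left)
  also have "\<dots> = (\<Sum>i\<in>?N. \<Sum>j\<in>?N. \<Sum>k\<in>?N. \<Sum>l\<in>?N. X $$ (i,j) * Y $$ (k,l) * (if j = k \<and> i = l then 2 ^ n else 0))"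
    by (intro sum.cong refl) (simp add: pauli_entry_sum)
  also have "\<dots> = (\<Sum>i\<in>?N. \<Sum>j\<in>?N. \<Sum>k\<in>?N. if j = k then X $$ (i,j) * Y $$ (k,i) * 2 ^ n else 0)"
  proof (intro sum.cong refl)
    fix i j k assume "i \<in> ?N"
    then show "(\<Sum>l\<in>?N. X $$ (i,j) * Y $$ (k,l) * (if j = k \<and> i = l then 2 ^ n else 0)) =
      (if j = k then X $$ (i,j) * Y $$ (k,i) * 2 ^ n else 0)"
      by (cases "j = k") (simp_all add: if_distrib[of "\<lambda>x. _ * x"] cong: if_cong)
  qed
  also have "\<dots> = (\<Sum>i\<in>?N. \<Sum>j\<in>?N. X $$ (i,j) * Y $$ (j,i) * 2 ^ n)"
    by (intro sum.cong refl) simp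
  also have "\<dots> = 2 ^ n * mtrace (X * Y)"
    by (simp add: mtrace_mult[OF assms] sum_distrib_left sum_distrib_right mult_ac)
  finally show ?thesis .
qed

subsection \<open>The Clifford group acts on Pauli words by transvections\<close>

text \<open>The commutative algebra generated by one Pauli operator of square 1; rotations about
  \<open>pauli n w\<close> multiply inside it like pairs (a, b).\<close>

definition lin :: "nat \<Rightarrow> word \<Rightarrow> complex \<Rightarrow> complex \<Rightarrow> complex mat" where
  "lin n w a b = a \<cdot>\<^sub>m 1\<^sub>m (2 ^ n) + b \<cdot>\<^sub>m pauli n w"

lemma lin_carrier [simp]: "lin n w a b \<in> carrier_mat (2 ^ n) (2 ^ n)"
  by (simp add: lin_def)

lemma lin_dim [simp]: "dim_row (lin n w a b) = 2 ^ n" "dim_col (lin n w a b) = 2 ^ n"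
  using carrier_matD[OF lin_carrier] by auto

lemma one_smult_mat [simp]: "(1::complex) \<cdot>\<^sub>m A = A"
  by (rule eq_matI) auto

lemma smult_mult_smult:
  fixes a b :: complex
  assumes "A \<in> carrier_mat m k" "B \<in> carrier_mat k l"
  shows "(a \<cdot>\<^sub>m A) * (b \<cdot>\<^sub>m B) = (a * b) \<cdot>\<^sub>m (A * B)"
proof -
  have "(a \<cdot>\<^sub>m A) * (b \<cdot>\<^sub>m B) = a \<cdot>\<^sub>m (A * (b \<cdot>\<^sub>m B))"
    by (rule mult_smult_assoc_mat) (use assms in auto)
  also have "A * (b \<cdot>\<^sub>m B) = b \<cdot>\<^sub>m (A * B)"
    by (rule mult_smult_distrib) (use assms in auto)
  finally show ?thesis by (simp add: smult_smult_mat)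
qed

lemma lin_mult_right:
  assumes "A \<in> carrier_mat (2 ^ n) (2 ^ n)"
  shows "lin n w a b * A = a \<cdot>\<^sub>m A + b \<cdot>\<^sub>m (pauli n w * A)"
proof -
  have "lin n w a b * A = (a \<cdot>\<^sub>m 1\<^sub>m (2 ^ n)) * A + (b \<cdot>\<^sub>m pauli n w) * A"
    unfolding lin_def by (rule add_mult_distrib_mat) (use assms in auto)
  also have "(a \<cdot>\<^sub>m 1\<^sub>m (2 ^ n)) * A = a \<cdot>\<^sub>m A"
    using assms by (simp add: mult_smult_assoc_mat[OF one_carrier_mat assms])
  also have "(b \<cdot>\<^sub>m pauli n w) * A = b \<cdot>\<^sub>m (pauli n w * A)"
    by (rule mult_smult_assoc_mat[OF pauli_carrier assms])
  finally show ?thesis .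
qed

lemma lin_mult_left:
  assumes "A \<in> carrier_mat (2 ^ n) (2 ^ n)"
  shows "A * lin n w a b = a \<cdot>\<^sub>m A + b \<cdot>\<^sub>m (A * pauli n w)"
proof -
  have "A * lin n w a b = A * (a \<cdot>\<^sub>m 1\<^sub>m (2 ^ n)) + A * (b \<cdot>\<^sub>m pauli n w)"
    unfolding lin_def by (rule mult_add_distrib_mat) (use assms in auto)
  also have "A * (a \<cdot>\<^sub>m 1\<^sub>m (2 ^ n)) = a \<cdot>\<^sub>m A"
    using assms by (simp add: mult_smult_distrib[OF assms one_carrier_mat])
  also have "A * (b \<cdot>\<^sub>m pauli n w) = b \<cdot>\<^sub>m (A * pauli n w)"
    by (rule mult_smult_distrib[OF assms pauli_carrier])
  finally show ?thesis .
qed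

lemma lin_mult: "lin n w a b * lin n w a' b' = lin n w (a * a' + b * b') (a * b' + b * a')"
  unfolding lin_mult_right[OF lin_carrier] lin_mult_left[OF pauli_carrier] pauli_square
  by (rule eq_matI) (auto simp: lin_def algebra_simps)

lemma adj_lin: "adj (lin n w a b) = lin n w (cnj a) (cnj b)"
  unfolding lin_def by (subst adj_add[where a="2 ^ n" and b="2 ^ n"]) (auto simp: adj_smult)

lemma pauli_lin: "pauli n u * lin n w a b = lin n w a (sg n u w * b) * pauli n u"
  unfolding lin_mult_left[OF pauli_carrier] lin_mult_right[OF pauli_carrier]
  by (subst pauli_commute[of n u w]) (simp add: smult_smult_mat mult.commute)

lemma lin_one: "lin n w 1 0 = 1\<^sub>m (2 ^ n)"
  by (rule eq_matI) (auto simp: lin_def)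

lemma lin_pauli: "lin n w 0 b = b \<cdot>\<^sub>m pauli n w"
  by (rule eq_matI) (auto simp: lin_def)

definition rt :: complex where "rt = complex_of_real (1 / sqrt 2)"

lemma rt_sq [simp]: "rt * rt = 1 / 2"
proof -
  have "rt * rt = complex_of_real ((1 / sqrt 2) * (1 / sqrt 2))" by (simp only: rt_def of_real_mult)
  also have "(1 / sqrt 2) * (1 / sqrt 2) = (1/2 :: real)" by (simp add: real_divide_square_eq)
  finally show ?thesis by simp
qed

lemma rt_mult [simp]: "rt * (rt * x) = x / 2"
  unfolding mult.assoc[symmetric] rt_sq by simp

lemma cnj_rt [simp]: "cnj rt = rt" by (simp add: rt_def)

text \<open>The quarter rotation exp(-i pi/4 P_w). It is a Clifford unitary, not to be confused with
  the non-Clifford \<open>Tgate\<close>.\<close>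

definition tgate :: "nat \<Rightarrow> word \<Rightarrow> complex mat" where
  "tgate n w = lin n w rt (- \<i> * rt)"

definition tv :: "nat \<Rightarrow> word \<Rightarrow> word \<Rightarrow> word" where
  "tv n w u = (if sg n u w = 1 then u else u + w)"

definition pm :: "complex \<Rightarrow> bool" where
  "pm e \<longleftrightarrow> e = 1 \<or> e = -1"

lemma pm_mult: "pm a \<Longrightarrow> pm b \<Longrightarrow> pm (a * b)"
  by (auto simp: pm_def)

text \<open>Heisenberg picture, with the adjoint on the left, so that \<open>acts_mult\<close>
  composes in reverse order. The sign e stays unspecified because only the map on words is
  tracked.\<close>

definition acts :: "nat \<Rightarrow> complex mat \<Rightarrow> (word \<Rightarrow> word) \<Rightarrow> bool" where
  "acts n U \<pi> \<longleftrightarrow> U \<in> carrier_mat (2 ^ n) (2 ^ n) \<and> adj U * U = 1\<^sub>m (2 ^ n) \<and>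
     (\<forall>u\<in>words n. \<pi> u \<in> words n \<and> (\<exists>e. pm e \<and> adj U * pauli n u * U = e \<cdot>\<^sub>m pauli n (\<pi> u)))"

lemma acts_words: "acts n U \<pi> \<Longrightarrow> u \<in> words n \<Longrightarrow> \<pi> u \<in> words n"
  by (simp add: acts_def)

lemma acts_conj:
  assumes "acts n U \<pi>" "u \<in> words n"
  obtains e where "pm e" "adj U * pauli n u * U = e \<cdot>\<^sub>m pauli n (\<pi> u)"
  using assms by (auto simp: acts_def)

lemma tv_words [simp]: "w \<in> words n \<Longrightarrow> u \<in> words n \<Longrightarrow> tv n w u \<in> words n"
  by (simp add: tv_def)

text \<open>A Pauli operator commuting with \<open>pauli n w\<close> is fixed. An anticommuting one
  turns the rotation into its adjoint when moved past it, and the square of that adjoint is a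
  multiple of \<open>pauli n w\<close>, so w is added to the word.\<close>

lemma acts_lin:
  assumes w: "w \<in> words n" and c: "c = \<i> \<or> c = -\<i>"
  shows "acts n (lin n w rt (c * rt)) (tv n w)"
proof -
  let ?L = "lin n w rt (c * rt)"
  have cc: "c * c = -1" "cnj c = - c" using c by auto
  have adjL: "adj ?L = lin n w rt (- c * rt)" by (simp add: adj_lin cc)
  have un: "adj ?L * ?L = 1\<^sub>m (2 ^ n)"
    unfolding adjL lin_mult lin_one[of n w, symmetric]
    by (rule arg_cong2[where f="lin n w"]) (use cc in \<open>auto simp: algebra_simps\<close>)
  have "\<exists>e. pm e \<and> adj ?L * pauli n u * ?L = e \<cdot>\<^sub>m pauli n (tv n w u)" if u: "u \<in> words n" for u
  proof (cases "sg n u w = 1")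
    case True
    have "adj ?L * pauli n u * ?L = adj ?L * (pauli n u * ?L)"
      by (rule assoc_mult_mat) auto
    also have "\<dots> = adj ?L * (?L * pauli n u)" using True by (simp add: pauli_lin)
    also have "\<dots> = (adj ?L * ?L) * pauli n u" by (rule assoc_mult_mat[symmetric]) auto
    also have "\<dots> = pauli n u" by (simp add: un)
    finally show ?thesis using True by (intro exI[of _ 1]) (simp add: tv_def pm_def)
  next
    case False
    then have s: "sg n u w = -1" using sg_cases[of n u w] by simp
    have "adj ?L * pauli n u * ?L = adj ?L * (pauli n u * ?L)"
      by (rule assoc_mult_mat) auto
    also have "\<dots> = adj ?L * (adj ?L * pauli n u)" using s by (simp add: pauli_lin adjL)
    also have "\<dots> = (adj ?L * adj ?L) * pauli n u" by (rule assoc_mult_mat[symmetric]) auto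
    also have "adj ?L * adj ?L = (- c) \<cdot>\<^sub>m pauli n w"
      unfolding adjL lin_mult lin_pauli[symmetric]
      by (rule arg_cong2[where f="lin n w"]) (use cc in \<open>auto simp: algebra_simps\<close>)
    also have "(- c) \<cdot>\<^sub>m pauli n w * pauli n u = (- c) \<cdot>\<^sub>m (pauli n w * pauli n u)"
      by (rule mult_smult_assoc_mat) auto
    finally have 1: "adj ?L * pauli n u * ?L = (- c * phase n w u) \<cdot>\<^sub>m pauli n (u + w)"
      by (simp add: pauli_mult smult_smult_mat add.commute)
    define e where "e = - c * phase n w u"
    \<comment> \<open>The product of two anticommuting Pauli operators has square -1, so the phase
      is i or -i; multiplied by -c it becomes a sign.\<close>
    have ph: "phase n w u * phase n w u = -1"
    proof -
      have "pauli n w * pauli n u * (pauli n w * pauli n u) = (phase n w u * phase n w u) \<cdot>\<^sub>m 1\<^sub>m (2 ^ n)"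
        unfolding pauli_mult[of n w u]
        by (simp only: smult_mult_smult[OF pauli_carrier pauli_carrier] pauli_square)
      moreover have "pauli n w * pauli n u * (pauli n w * pauli n u) = (-1) \<cdot>\<^sub>m 1\<^sub>m (2 ^ n)"
      proof -
        have "pauli n w * pauli n u * (pauli n w * pauli n u) = pauli n w * (pauli n u * (pauli n w * pauli n u))"
          by (rule assoc_mult_mat) (auto intro!: mult_carrier_mat)
        also have "pauli n u * (pauli n w * pauli n u) = (pauli n u * pauli n w) * pauli n u"
          by (rule assoc_mult_mat[symmetric]) auto
        also have "\<dots> = (-1) \<cdot>\<^sub>m (pauli n w * pauli n u * pauli n u)"
          unfolding pauli_commute[of n u w] s by (rule mult_smult_assoc_mat) (auto intro!: mult_carrier_mat)
        also have "pauli n w * pauli n u * pauli n u = pauli n w * (pauli n u * pauli n u)"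
          by (rule assoc_mult_mat) auto
        also have "\<dots> = pauli n w" by (simp add: pauli_square)
        also have "pauli n w * ((-1) \<cdot>\<^sub>m pauli n w) = (-1) \<cdot>\<^sub>m 1\<^sub>m (2 ^ n)"
          by (subst mult_smult_distrib[OF pauli_carrier pauli_carrier]) (simp add: pauli_square)
        finally show ?thesis .
      qed
      ultimately have "((phase n w u * phase n w u) \<cdot>\<^sub>m 1\<^sub>m (2 ^ n)) $$ (0,0) = ((-1 :: complex) \<cdot>\<^sub>m 1\<^sub>m (2 ^ n)) $$ (0,0)"
        by simp
      then show ?thesis by simp
    qed
    have "e * e = (c * c) * (phase n w u * phase n w u)" by (simp add: e_def mult_ac)
    then have "e * e = 1" using ph cc by simp
    then have "pm e" by (simp add: square_eq_1_iff pm_def)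
    moreover have "adj ?L * pauli n u * ?L = e \<cdot>\<^sub>m pauli n (tv n w u)"
      unfolding 1 e_def using False by (simp add: tv_def)
    ultimately show ?thesis by blast
  qed
  then show ?thesis using un w by (simp add: acts_def)
qed

lemma acts_tgate: "w \<in> words n \<Longrightarrow> acts n (tgate n w) (tv n w)"
  unfolding tgate_def by (rule acts_lin) auto

lemma acts_adj_tgate: "w \<in> words n \<Longrightarrow> acts n (adj (tgate n w)) (tv n w)"
  unfolding tgate_def adj_lin using acts_lin[of w n \<i>] by simp

lemma acts_carrier: "acts n U \<pi> \<Longrightarrow> U \<in> carrier_mat (2 ^ n) (2 ^ n)"
  by (simp add: acts_def)

lemma acts_unitary: "acts n U \<pi> \<Longrightarrow> adj U * U = 1\<^sub>m (2 ^ n)"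
  by (simp add: acts_def)

lemma conj_mult:
  assumes "U \<in> carrier_mat d d" "V \<in> carrier_mat d d" "A \<in> carrier_mat d d"
  shows "adj (U * V) * A * (U * V) = adj V * (adj U * A * U) * V"
proof -
  have c: "adj U \<in> carrier_mat d d" "adj V \<in> carrier_mat d d" using assms by auto
  have "adj (U * V) * A * (U * V) = (adj V * adj U) * A * (U * V)"
    using assms by (simp add: adj_mult)
  also have "\<dots> = ((adj V * adj U) * A * U) * V"
    by (rule assoc_mult_mat[symmetric, where ?n\<^sub>1.0=d and ?n\<^sub>2.0=d and ?n\<^sub>3.0=d and ?n\<^sub>4.0=d])
      (use assms c in \<open>auto intro!: mult_carrier_mat\<close>)
  also have "(adj V * adj U) * A = adj V * (adj U * A)"
    by (rule assoc_mult_mat) (use assms c in auto)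
  also have "adj V * (adj U * A) * U = adj V * (adj U * A * U)"
    by (rule assoc_mult_mat[where ?n\<^sub>1.0=d and ?n\<^sub>2.0=d and ?n\<^sub>3.0=d and ?n\<^sub>4.0=d])
      (use assms c in \<open>auto intro!: mult_carrier_mat\<close>)
  finally show ?thesis .
qed

lemma conj_smult:
  assumes "U \<in> carrier_mat d d" "A \<in> carrier_mat d d"
  shows "adj U * (e \<cdot>\<^sub>m A) * U = e \<cdot>\<^sub>m (adj U * A * U)"
proof -
  have c: "adj U \<in> carrier_mat d d" using assms by auto
  have "adj U * (e \<cdot>\<^sub>m A) = e \<cdot>\<^sub>m (adj U * A)" by (rule mult_smult_distrib[OF c assms(2)])
  moreover have "adj U * A \<in> carrier_mat d d" using c assms by auto
  ultimately show ?thesis using mult_smult_assoc_mat[of "adj U * A" d d U d e] assms by (simp only:)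
qed

lemma acts_mult:
  assumes "acts n U \<pi>" "acts n V \<rho>"
  shows "acts n (U * V) (\<rho> \<circ> \<pi>)"
proof -
  have c: "U \<in> carrier_mat (2^n) (2^n)" "V \<in> carrier_mat (2^n) (2^n)"
    using assms by (auto simp: acts_carrier)
  have "adj (U * V) * (U * V) = adj V * (adj U * U) * V"
  proof -
    have "adj (U * V) \<in> carrier_mat (2^n) (2^n)" "adj U \<in> carrier_mat (2^n) (2^n)"
      using c mult_carrier_mat[OF c] by auto
    then have "adj (U * V) * 1\<^sub>m (2^n) = adj (U * V)" "adj U * 1\<^sub>m (2^n) = adj U"
      by (auto intro: right_mult_one_mat)
    then show ?thesis using conj_mult[OF c one_carrier_mat] by (simp only:)
  qed
  also have "\<dots> = 1\<^sub>m (2^n)" using assms c by (simp add: acts_unitary)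
  finally have un: "adj (U * V) * (U * V) = 1\<^sub>m (2^n)" .
  have "\<rho> (\<pi> u) \<in> words n \<and> (\<exists>e. pm e \<and> adj (U * V) * pauli n u * (U * V) = e \<cdot>\<^sub>m pauli n (\<rho> (\<pi> u)))"
    if u: "u \<in> words n" for u
  proof -
    have p: "\<pi> u \<in> words n" and p': "\<rho> (\<pi> u) \<in> words n"
      using assms u by (auto intro: acts_words)
    obtain e where e: "pm e" "adj U * pauli n u * U = e \<cdot>\<^sub>m pauli n (\<pi> u)"
      using acts_conj[OF assms(1) u] .
    obtain e' where e': "pm e'" "adj V * pauli n (\<pi> u) * V = e' \<cdot>\<^sub>m pauli n (\<rho> (\<pi> u))"
      using acts_conj[OF assms(2) p] .
    have "adj (U * V) * pauli n u * (U * V) = (e * e') \<cdot>\<^sub>m pauli n (\<rho> (\<pi> u))"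
      unfolding conj_mult[OF c pauli_carrier] e(2) conj_smult[OF c(2) pauli_carrier] e'(2) smult_smult_mat ..
    moreover have "pm (e * e')" using e(1) e'(1) by (rule pm_mult)
    ultimately show ?thesis using p' by blast
  qed
  then show ?thesis using mult_carrier_mat[OF c] un unfolding acts_def comp_apply by blast
qed

lemma acts_smult:
  assumes "acts n U \<pi>" "cnj c * c = 1"
  shows "acts n (c \<cdot>\<^sub>m U) \<pi>"
proof -
  have c: "U \<in> carrier_mat (2^n) (2^n)" "adj U \<in> carrier_mat (2^n) (2^n)" using assms by (auto simp: acts_carrier)
  have key: "adj (c \<cdot>\<^sub>m U) * A * (c \<cdot>\<^sub>m U) = adj U * A * U" if A: "A \<in> carrier_mat (2^n) (2^n)" for A
  proof -
    have AU: "adj U * A \<in> carrier_mat (2^n) (2^n)" using c A by auto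
    have "adj (c \<cdot>\<^sub>m U) * A * (c \<cdot>\<^sub>m U) = (cnj c \<cdot>\<^sub>m (adj U * A)) * (c \<cdot>\<^sub>m U)"
      by (simp add: adj_smult mult_smult_assoc_mat[OF c(2) A])
    also have "\<dots> = cnj c \<cdot>\<^sub>m (c \<cdot>\<^sub>m (adj U * A * U))"
      using c by (simp add: mult_smult_assoc_mat[OF AU, of "c \<cdot>\<^sub>m U" "2^n"] mult_smult_distrib[OF AU, of U])
    also have "\<dots> = adj U * A * U" by (simp add: smult_smult_mat assms)
    finally show ?thesis .
  qed
  have "adj (c \<cdot>\<^sub>m U) * (c \<cdot>\<^sub>m U) = adj U * U"
    using key[OF one_carrier_mat] c by simp
  then show ?thesis using assms key[OF pauli_carrier] by (auto simp: acts_def)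
qed

section \<open>Hadamard and phase gates as products of quarter rotations\<close>

definition single :: "nat \<Rightarrow> letter \<Rightarrow> word" where
  "single q l = (\<lambda>j. if j = q then l else 0)"

lemma single_words [simp]: "q < n \<Longrightarrow> single q l \<in> words n"
  by (auto simp: single_def words_def)

lemma sg_single: "q < n \<Longrightarrow> sg n u (single q l) = sl (u q) l"
  unfolding sg_def single_def
  by (subst prod.remove[of _ q]) (auto simp: sl_def zero_letter_def intro!: prod.neutral)

lemma on_qubit_ten: "on_qubit n q G = ten n (\<lambda>j. if j = q then G else I2)"
  by (simp add: on_qubit_def ten_def)

lemma I2_carrier [simp]: "I2 \<in> carrier_mat 2 2"
  by (simp add: I2_def)

lemma on_qubit_carrier [simp]: "G \<in> carrier_mat 2 2 \<Longrightarrow> on_qubit n q G \<in> carrier_mat (2^n) (2^n)"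
  by (simp add: on_qubit_ten)

lemma on_qubit_mult:
  "A \<in> carrier_mat 2 2 \<Longrightarrow> B \<in> carrier_mat 2 2 \<Longrightarrow> on_qubit n q A * on_qubit n q B = on_qubit n q (A * B)"
  unfolding on_qubit_ten by (subst ten_mult) (auto intro!: ten_cong simp: I2_def)

lemma pauli_single: "pauli n (single q l) = on_qubit n q (sigma l)"
  unfolding pauli_def on_qubit_ten
  by (rule ten_cong) (simp add: single_def sigma_def zero_letter_def)

lemma on_qubit_index:
  assumes "q < n" "A \<in> carrier_mat 2 2" "i < 2^n" "j < 2^n"
  shows "on_qubit n q A $$ (i,j) = A $$ (qbit n q i, qbit n q j) * (\<Prod>r\<in>{..<n} - {q}. I2 $$ (qbit n r i, qbit n r j))"
proof -
  have "on_qubit n q A $$ (i,j) = (\<Prod>r<n. (if r = q then A else I2) $$ (qbit n r i, qbit n r j))"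
    unfolding on_qubit_ten by (rule ten_index) (use assms in auto)
  also have "\<dots> = A $$ (qbit n q i, qbit n q j) * (\<Prod>r\<in>{..<n} - {q}. (if r = q then A else I2) $$ (qbit n r i, qbit n r j))"
    by (subst prod.remove[of _ q]) (use assms in auto)
  also have "(\<Prod>r\<in>{..<n} - {q}. (if r = q then A else I2) $$ (qbit n r i, qbit n r j)) = (\<Prod>r\<in>{..<n} - {q}. I2 $$ (qbit n r i, qbit n r j))"
    by (rule prod.cong) auto
  finally show ?thesis .
qed

lemma on_qubit_lin:
  assumes "q < n"
  shows "on_qubit n q (a \<cdot>\<^sub>m I2 + b \<cdot>\<^sub>m sigma l) = lin n (single q l) a b"
proof -
  have G: "a \<cdot>\<^sub>m I2 + b \<cdot>\<^sub>m sigma l \<in> carrier_mat 2 2" by auto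
  have one: "on_qubit n q I2 = 1\<^sub>m (2^n)"
    using pauli_single[of n q LI] pauli_0[of n] by (simp add: single_def zero_letter_def zero_fun_def sigma_def cong: if_cong)
  show ?thesis
  proof (rule eq_matI)
    fix i j assume "i < dim_row (lin n (single q l) a b)" "j < dim_col (lin n (single q l) a b)"
    then have ij: "i < 2^n" "j < 2^n" by auto
    let ?R = "\<Prod>r\<in>{..<n} - {q}. I2 $$ (qbit n r i, qbit n r j)"
    have d: "dim_row (sigma l) = 2" "dim_col (sigma l) = 2" "dim_row I2 = 2" "dim_col I2 = 2" using carrier_matD[OF sigma_carrier[of l]] by (auto simp: I2_def)
    have "on_qubit n q (a \<cdot>\<^sub>m I2 + b \<cdot>\<^sub>m sigma l) $$ (i,j) = (a * I2 $$ (qbit n q i, qbit n q j) + b * sigma l $$ (qbit n q i, qbit n q j)) * ?R"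
      unfolding on_qubit_index[OF assms G ij] using d by simp
    also have "\<dots> = a * on_qubit n q I2 $$ (i,j) + b * on_qubit n q (sigma l) $$ (i,j)"
      unfolding on_qubit_index[OF assms I2_carrier ij] on_qubit_index[OF assms sigma_carrier ij] by (simp add: algebra_simps)
    also have "\<dots> = lin n (single q l) a b $$ (i,j)"
      using ij by (simp add: lin_def one pauli_single[symmetric])
    finally show "on_qubit n q (a \<cdot>\<^sub>m I2 + b \<cdot>\<^sub>m sigma l) $$ (i,j) = lin n (single q l) a b $$ (i,j)" .
  qed (use carrier_matD[OF on_qubit_carrier[OF G, of n q]] in simp_all)
qed

lemma on_qubit_one: "on_qubit n q I2 = 1\<^sub>m (2^n)"
  using pauli_single[of n q LI] pauli_0[of n] by (simp add: single_def zero_letter_def zero_fun_def sigma_def cong: if_cong)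

lemma on_qubit_smult:
  assumes "q < n" "A \<in> carrier_mat 2 2"
  shows "on_qubit n q (c \<cdot>\<^sub>m A) = c \<cdot>\<^sub>m on_qubit n q A"
proof -
  have c: "c \<cdot>\<^sub>m A \<in> carrier_mat 2 2" using assms by auto
  show ?thesis
  proof (rule eq_matI)
    have d: "dim_row A = 2" "dim_col A = 2" using assms by auto
    note dd = carrier_matD[OF on_qubit_carrier[OF assms(2), of n q]] carrier_matD[OF on_qubit_carrier[OF c, of n q]]
    show "dim_row (on_qubit n q (c \<cdot>\<^sub>m A)) = dim_row (c \<cdot>\<^sub>m on_qubit n q A)"
      "dim_col (on_qubit n q (c \<cdot>\<^sub>m A)) = dim_col (c \<cdot>\<^sub>m on_qubit n q A)" using dd by auto
    fix i j assume "i < dim_row (c \<cdot>\<^sub>m on_qubit n q A)" "j < dim_col (c \<cdot>\<^sub>m on_qubit n q A)"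
    then show "on_qubit n q (c \<cdot>\<^sub>m A) $$ (i,j) = (c \<cdot>\<^sub>m on_qubit n q A) $$ (i,j)"
      using d dd by (simp add: on_qubit_index[OF assms(1) c] on_qubit_index[OF assms])
  qed
qed

definition tg1 :: "letter \<Rightarrow> complex mat" where
  "tg1 l = rt \<cdot>\<^sub>m I2 + (- \<i> * rt) \<cdot>\<^sub>m sigma l"

lemma tg1_carrier [simp]: "tg1 l \<in> carrier_mat 2 2"
  by (simp add: tg1_def)

lemma on_qubit_tg1: "q < n \<Longrightarrow> on_qubit n q (tg1 l) = tgate n (single q l)"
  unfolding tg1_def tgate_def by (rule on_qubit_lin)

text \<open>The eighth root of unity exp(i pi/4), the global phase between the phase and CNOT gates
  and products of quarter rotations; the Hadamard gate needs its square.\<close>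

definition ph8 :: complex where "ph8 = rt * (1 + \<i>)"

lemma ph8_unit: "cnj ph8 * ph8 = 1" "ph8 * ph8 = \<i>"
proof -
  have "cnj ph8 * ph8 = (rt * rt) * ((1 - \<i>) * (1 + \<i>))" by (simp add: ph8_def mult_ac)
  then show "cnj ph8 * ph8 = 1" by (simp add: algebra_simps)
  have "ph8 * ph8 = (rt * rt) * ((1 + \<i>) * (1 + \<i>))" by (simp add: ph8_def mult_ac)
  then show "ph8 * ph8 = \<i>" by (simp add: algebra_simps)
qed

lemma tg1_entries: "tg1 l $$ (i,j) = rt * (I2 $$ (i,j)) - \<i> * rt * sigma l $$ (i,j)" if "i < 2" "j < 2"
  using that carrier_matD[OF sigma_carrier[of l]] by (simp add: tg1_def I2_def)

lemma Sgate_eq: "Sgate = ph8 \<cdot>\<^sub>m tg1 LZ"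
proof (rule mat2_eqI)
  have d: "dim_row (tg1 LZ) = 2" "dim_col (tg1 LZ) = 2" using carrier_matD[OF tg1_carrier[of LZ]] by auto
  show "Sgate $$ (0,0) = (ph8 \<cdot>\<^sub>m tg1 LZ) $$ (0,0)" "Sgate $$ (0,1) = (ph8 \<cdot>\<^sub>m tg1 LZ) $$ (0,1)"
    "Sgate $$ (1,0) = (ph8 \<cdot>\<^sub>m tg1 LZ) $$ (1,0)" "Sgate $$ (1,1) = (ph8 \<cdot>\<^sub>m tg1 LZ) $$ (1,1)"
    by (auto simp: d tg1_entries sigma_entries I2_def Sgate_def ph8_def algebra_simps)
qed (auto simp: Sgate_def)

lemma Hgate_eq: "Hgate = (ph8 * ph8) \<cdot>\<^sub>m (tg1 LZ * (tg1 LX * tg1 LZ))"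
proof (rule mat2_eqI)
  have c: "tg1 LX * tg1 LZ \<in> carrier_mat 2 2" by (rule mult_carrier_mat[OF tg1_carrier tg1_carrier])
  have c2: "tg1 LZ * (tg1 LX * tg1 LZ) \<in> carrier_mat 2 2" by (rule mult_carrier_mat[OF tg1_carrier c])
  show "(ph8 * ph8) \<cdot>\<^sub>m (tg1 LZ * (tg1 LX * tg1 LZ)) \<in> carrier_mat 2 2" using c2 by auto
  have d: "dim_row (tg1 l) = 2" "dim_col (tg1 l) = 2" for l using carrier_matD[OF tg1_carrier[of l]] by auto
  have h: "1 / complex_of_real (sqrt 2) = rt" by (simp add: rt_def)
  have h': "x / complex_of_real (sqrt 2) = rt * x" for x by (simp add: rt_def)
  show "Hgate $$ (0,0) = ((ph8 * ph8) \<cdot>\<^sub>m (tg1 LZ * (tg1 LX * tg1 LZ))) $$ (0,0)"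
    "Hgate $$ (0,1) = ((ph8 * ph8) \<cdot>\<^sub>m (tg1 LZ * (tg1 LX * tg1 LZ))) $$ (0,1)"
    "Hgate $$ (1,0) = ((ph8 * ph8) \<cdot>\<^sub>m (tg1 LZ * (tg1 LX * tg1 LZ))) $$ (1,0)"
    "Hgate $$ (1,1) = ((ph8 * ph8) \<cdot>\<^sub>m (tg1 LZ * (tg1 LX * tg1 LZ))) $$ (1,1)"
    by (auto simp: d mat2_mult_index[OF tg1_carrier c] mat2_mult_index[OF tg1_carrier tg1_carrier] tg1_entries
       mat2_mult_index[OF tg1_carrier c, unfolded One_nat_def] mat2_mult_index[OF tg1_carrier tg1_carrier, unfolded One_nat_def]
       sigma_entries I2_def Hgate_def ph8_unit(2) h' algebra_simps simp del: index_mult_mat(1))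
      (simp_all add: field_simps)
qed (auto simp: Hgate_def)

subsection \<open>The CNOT gate\<close>

text \<open>General element of the algebra spanned by 1, P_a, P_x and P_(a+x). It is used for a the
  Z on the control and x the X on the target, which commute and whose product carries no
  phase.\<close>

definition quad :: "nat \<Rightarrow> word \<Rightarrow> word \<Rightarrow> complex \<Rightarrow> complex \<Rightarrow> complex \<Rightarrow> complex \<Rightarrow> complex mat" where
  "quad n a x p q r s = p \<cdot>\<^sub>m 1\<^sub>m (2^n) + (q \<cdot>\<^sub>m pauli n a + (r \<cdot>\<^sub>m pauli n x + s \<cdot>\<^sub>m pauli n (a + x)))"

lemma quad_carrier [simp]: "quad n a x p q r s \<in> carrier_mat (2^n) (2^n)"
  by (auto simp: quad_def intro!: add_carrier_mat)

lemma quad_dim [simp]: "dim_row (quad n a x p q r s) = 2^n" "dim_col (quad n a x p q r s) = 2^n"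
  using carrier_matD[OF quad_carrier] by auto

lemma pauli_mult_quad:
  "pauli n w * quad n a x p q r s = p \<cdot>\<^sub>m pauli n w + (q \<cdot>\<^sub>m (pauli n w * pauli n a) +
     (r \<cdot>\<^sub>m (pauli n w * pauli n x) + s \<cdot>\<^sub>m (pauli n w * pauli n (a + x))))"
proof -
  let ?d = "(2::nat)^n"
  have "pauli n w * quad n a x p q r s = pauli n w * (p \<cdot>\<^sub>m 1\<^sub>m ?d) + (pauli n w * (q \<cdot>\<^sub>m pauli n a) +
     (pauli n w * (r \<cdot>\<^sub>m pauli n x) + pauli n w * (s \<cdot>\<^sub>m pauli n (a + x))))"
    unfolding quad_def
    by (subst mult_add_distrib_mat[of _ ?d ?d _ ?d], simp, simp, (intro add_carrier_mat smult_carrier_mat; simp),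
        subst mult_add_distrib_mat[of _ ?d ?d _ ?d], simp, simp, (intro add_carrier_mat smult_carrier_mat; simp),
        subst mult_add_distrib_mat[of _ ?d ?d _ ?d], simp, simp, simp, rule refl)
  then show ?thesis
    by (simp add: mult_smult_distrib[OF pauli_carrier pauli_carrier] mult_smult_distrib[OF pauli_carrier one_carrier_mat])
qed

lemma quad_lin:
  "k \<cdot>\<^sub>m quad n a x p q r s + k' \<cdot>\<^sub>m quad n a x p' q' r' s' =
    quad n a x (k * p + k' * p') (k * q + k' * q') (k * r + k' * r') (k * s + k' * s')"
  by (rule eq_matI) (auto simp: quad_def algebra_simps)

context
  fixes n c t :: nat
  assumes ct: "c < n" "t < n" "c \<noteq> t"
begin

private abbreviation "a \<equiv> single c LZ"
private abbreviation "x \<equiv> single t LX"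

private lemma phases:
  "phase n a x = 1" "phase n x a = 1" "phase n a (a + x) = 1" "phase n x (a + x) = 1"
  unfolding phase_def using ct
  by (auto intro!: prod.neutral simp: single_def pl_def zero_letter_def plus_letter_def)

private lemma a_quad: "pauli n a * quad n a x p q r s = quad n a x q p s r"
  unfolding pauli_mult_quad pauli_mult phases
  by (rule eq_matI) (auto simp: quad_def pauli_0 phases algebra_simps)

private lemma x_quad: "pauli n x * quad n a x p q r s = quad n a x r s p q"
proof -
  have e: "x + (a + x) = a" by (simp add: add.left_commute)
  show ?thesis
  unfolding pauli_mult_quad pauli_mult phases e
  by (rule eq_matI) (auto simp: quad_def pauli_0 phases algebra_simps)
qed

lemma quad_CNOT:
  "quad n a x (1/2) (1/2) (1/2) (-1/2) = ph8 \<cdot>\<^sub>m (tgate n a * (tgate n x * adj (tgate n (a + x))))"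
proof -
  have 1: "adj (tgate n (a + x)) = quad n a x rt 0 0 (\<i> * rt)"
    unfolding tgate_def adj_lin by (rule eq_matI) (auto simp: quad_def lin_def)
  have 2: "tgate n x * adj (tgate n (a + x)) = quad n a x (1/2) (1/2) (-\<i>/2) (\<i>/2)"
    unfolding 1 unfolding tgate_def lin_mult_right[OF quad_carrier] x_quad quad_lin
    by (simp add: algebra_simps)
  have 3: "tgate n a * quad n a x (1/2) (1/2) (-\<i>/2) (\<i>/2) = cnj ph8 \<cdot>\<^sub>m quad n a x (1/2) (1/2) (1/2) (-1/2)"
    unfolding tgate_def lin_mult_right[OF quad_carrier] a_quad quad_lin
    by (rule eq_matI) (auto simp: quad_def ph8_def algebra_simps add_divide_distrib diff_divide_distrib)
  show ?thesis unfolding 2 3 smult_smult_mat using ph8_unit(1) by (simp add: mult.commute)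
qed

lemma cnot_map_less: "i < 2^n \<Longrightarrow> cnot_map n c t i < 2^n"
proof -
  assume i: "i < 2^n"
  let ?m = "n - 1 - t"
  have m: "?m < n" using ct by simp
  have t: "take_bit n i = i" using i by (simp add: take_bit_nat_eq_self_iff)
  have "i + 2 ^ ?m < 2^n" if "\<not> bit i ?m"
  proof -
    have "i + 2 ^ ?m = set_bit ?m i" using that by (simp add: set_bit_eq)
    moreover have "take_bit n (set_bit ?m i) = set_bit ?m i" using m t by (simp add: take_bit_set_bit_eq)
    ultimately show ?thesis by (metis take_bit_nat_eq_self_iff)
  qed
  then show ?thesis using i by (auto simp: cnot_map_def qbit_def bit_iff_odd mod_2_eq_odd)
qed

lemma qbit_bit: "qbit n q i = of_bool (bit i (n - 1 - q))"
  by (simp add: qbit_def bit_iff_odd mod_2_eq_odd)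

lemma qbit_cnot_map:
  assumes q: "q < n"
  shows "qbit n q (cnot_map n c t i) = (if q = t \<and> qbit n c i = 1 then 1 - qbit n t i else qbit n q i)"
proof -
  have s: "cnot_map n c t i = (if bit i (n - 1 - c) then
     (if bit i (n - 1 - t) then unset_bit (n - 1 - t) i else set_bit (n - 1 - t) i) else i)"
  proof -
    have "i - 2 ^ m = unset_bit m i" if "bit i m" for m
    proof -
      have "unset_bit m i + 2 ^ m = set_bit m (unset_bit m i)" by (simp add: set_bit_eq bit_unset_bit_iff)
      also have "\<dots> = i" using that by (intro bit_eqI) (auto simp: bit_set_bit_iff bit_unset_bit_iff)
      finally show ?thesis by simp
    qed
    then show ?thesis by (simp add: cnot_map_def qbit_bit set_bit_eq)
  qed
  have "n - 1 - q = n - 1 - t \<longleftrightarrow> q = t" using q ct by auto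
  then show ?thesis unfolding s qbit_bit by (auto simp: bit_set_bit_iff bit_unset_bit_iff)
qed

lemma pauli_two_index:
  assumes "i < 2^n" "j < 2^n"
  shows "pauli n (single c l + single t m) $$ (i,j) = sigma l $$ (qbit n c i, qbit n c j) * sigma m $$ (qbit n t i, qbit n t j)
     * (\<Prod>r\<in>{..<n} - {c} - {t}. if qbit n r i = qbit n r j then 1 else 0)"
proof -
  let ?w = "single c l + single t m"
  have "pauli n ?w $$ (i,j) = (\<Prod>r<n. sigma (?w r) $$ (qbit n r i, qbit n r j))"
    unfolding pauli_def by (rule ten_index) (use assms in auto)
  also have "\<dots> = sigma (?w c) $$ (qbit n c i, qbit n c j) * (\<Prod>r\<in>{..<n} - {c}. sigma (?w r) $$ (qbit n r i, qbit n r j))"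
    by (subst prod.remove[of _ c]) (use ct in auto)
  also have "(\<Prod>r\<in>{..<n} - {c}. sigma (?w r) $$ (qbit n r i, qbit n r j)) =
    sigma (?w t) $$ (qbit n t i, qbit n t j) * (\<Prod>r\<in>{..<n} - {c} - {t}. sigma (?w r) $$ (qbit n r i, qbit n r j))"
    by (subst prod.remove[of _ t]) (use ct in auto)
  also have "(\<Prod>r\<in>{..<n} - {c} - {t}. sigma (?w r) $$ (qbit n r i, qbit n r j)) =
     (\<Prod>r\<in>{..<n} - {c} - {t}. if qbit n r i = qbit n r j then 1 else 0)"
    by (intro prod.cong refl) (auto simp: single_def sigma_def I2_def zero_letter_def plus_letter_def)
  also have "?w c = l" using ct by (simp add: single_def)
  also have "?w t = m" using ct by (simp add: single_def)
  finally show ?thesis by (simp add: mult.assoc plus_fun_def)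
qed

text \<open>With Z on the control and X on the target, CNOT is (1 + Z)/2 + (1 - Z)/2 X. The entries
  are compared bit by bit, all other qubits contributing an equality test.\<close>

lemma CNOT_quad: "CNOT n c t = quad n a x (1/2) (1/2) (1/2) (-1/2)"
proof (rule eq_matI)
  fix i j assume "i < dim_row (quad n a x (1/2) (1/2) (1/2) (-1/2))" "j < dim_col (quad n a x (1/2) (1/2) (1/2) (-1/2))"
  then have ij: "i < 2^n" "j < 2^n" by auto
  let ?E = "\<Prod>r\<in>{..<n} - {c} - {t}. if qbit n r i = qbit n r j then 1 else (0::complex)"
  have s0: "single q LI = 0" for q by (rule ext) (simp add: single_def zero_letter_def)
  have e: "pauli n a $$ (i,j) = sigma LZ $$ (qbit n c i, qbit n c j) * sigma LI $$ (qbit n t i, qbit n t j) * ?E"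
    "pauli n x $$ (i,j) = sigma LI $$ (qbit n c i, qbit n c j) * sigma LX $$ (qbit n t i, qbit n t j) * ?E"
    "1\<^sub>m (2^n) $$ (i,j) = sigma LI $$ (qbit n c i, qbit n c j) * sigma LI $$ (qbit n t i, qbit n t j) * ?E"
    using pauli_two_index[OF ij, of LZ LI] pauli_two_index[OF ij, of LI LX] pauli_two_index[OF ij, of LI LI]
    by (simp_all add: s0 pauli_0)
  have q: "quad n a x (1/2) (1/2) (1/2) (-1/2) $$ (i,j) = 1/2 * (1\<^sub>m (2^n) $$ (i,j) + pauli n a $$ (i,j) + pauli n x $$ (i,j) - pauli n (a + x) $$ (i,j))"
    using ij by (simp add: quad_def algebra_simps del: index_one_mat(1))
  have E: "?E = (if \<forall>r<n. r \<noteq> c \<longrightarrow> r \<noteq> t \<longrightarrow> qbit n r i = qbit n r j then 1 else 0)"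
    by (auto intro!: prod.neutral prod_zero)
  have l: "CNOT n c t $$ (i,j) = (if i = cnot_map n c t j then 1 else 0)"
    using ij by (simp add: CNOT_def)
  have "i = cnot_map n c t j \<longleftrightarrow> (\<forall>r<n. qbit n r i = qbit n r (cnot_map n c t j))"
    using qbit_eqI[OF ij(1) cnot_map_less[OF ij(2)]] by blast
  also have "\<dots> \<longleftrightarrow> (\<forall>r<n. r \<noteq> c \<longrightarrow> r \<noteq> t \<longrightarrow> qbit n r i = qbit n r j) \<and> qbit n c i = qbit n c j
     \<and> qbit n t i = (if qbit n c j = 1 then 1 - qbit n t j else qbit n t j)"
    using ct by (auto simp: qbit_cnot_map)
  finally have iff: "i = cnot_map n c t j \<longleftrightarrow> (\<forall>r<n. r \<noteq> c \<longrightarrow> r \<noteq> t \<longrightarrow> qbit n r i = qbit n r j) \<and> qbit n c i = qbit n c j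
     \<and> qbit n t i = (if qbit n c j = 1 then 1 - qbit n t j else qbit n t j)" .
  have b: "qbit n c i = 0 \<or> qbit n c i = 1" "qbit n c j = 0 \<or> qbit n c j = 1"
    "qbit n t i = 0 \<or> qbit n t i = 1" "qbit n t j = 0 \<or> qbit n t j = 1"
    using qbit_less_2 unfolding less_2 by blast+
  show "CNOT n c t $$ (i,j) = quad n a x (1/2) (1/2) (1/2) (-1/2) $$ (i,j)"
    unfolding l q pauli_two_index[OF ij, of LZ LX] e E iff
    using b by (elim disjE) (simp_all add: sigma_entries)
qed (auto simp: CNOT_def)

lemma CNOT_eq: "CNOT n c t = ph8 \<cdot>\<^sub>m (tgate n a * (tgate n x * adj (tgate n (a + x))))"
  unfolding CNOT_quad quad_CNOT ..

lemma acts_CNOT: "acts n (CNOT n c t) ((tv n (a + x) \<circ> tv n x) \<circ> tv n a)"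
  unfolding CNOT_eq
  by (intro acts_smult acts_mult acts_tgate acts_adj_tgate ph8_unit(1)) (use ct in auto)

lemma adj_CNOT: "adj (CNOT n c t) = CNOT n c t"
proof -
  have c: "\<And>k w. k \<cdot>\<^sub>m pauli n w \<in> carrier_mat (2^n) (2^n)" "k \<cdot>\<^sub>m 1\<^sub>m (2^n) \<in> carrier_mat (2^n) (2^n)" for k :: complex
    by auto
  show ?thesis
    unfolding CNOT_quad quad_def adj_add[OF c(2) add_carrier_mat[OF add_carrier_mat[OF c(1)]]]
      adj_add[OF c(1) add_carrier_mat[OF c(1)]] adj_add[OF c(1) c(1)] adj_smult adj_pauli adj_one
    by simp
qed

end

subsection \<open>The Clifford group\<close>

lemma acts_one: "acts n (1\<^sub>m (2^n)) (\<lambda>u. u)"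
  unfolding acts_def by (auto intro!: exI[of _ 1] simp: pm_def)

lemma Hgate_carrier [simp]: "Hgate \<in> carrier_mat 2 2" and Sgate_carrier [simp]: "Sgate \<in> carrier_mat 2 2"
  by (auto simp: Hgate_def Sgate_def)

lemma on_Hgate:
  assumes q: "q < n"
  shows "on_qubit n q Hgate = (ph8 * ph8) \<cdot>\<^sub>m
    (tgate n (single q LZ) * (tgate n (single q LX) * tgate n (single q LZ)))"
proof -
  have c: "tg1 LX * tg1 LZ \<in> carrier_mat 2 2" by (rule mult_carrier_mat[OF tg1_carrier tg1_carrier])
  show ?thesis
    unfolding Hgate_eq on_qubit_smult[OF q mult_carrier_mat[OF tg1_carrier c]]
      on_qubit_mult[OF tg1_carrier c, symmetric] on_qubit_mult[OF tg1_carrier tg1_carrier, symmetric] on_qubit_tg1[OF q] ..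
qed

lemma on_Sgate: "q < n \<Longrightarrow> on_qubit n q Sgate = ph8 \<cdot>\<^sub>m tgate n (single q LZ)"
  unfolding Sgate_eq by (subst on_qubit_smult) (auto simp: on_qubit_tg1)

lemma acts_Hgate: "q < n \<Longrightarrow> acts n (on_qubit n q Hgate)
    ((tv n (single q LZ) \<circ> tv n (single q LX)) \<circ> tv n (single q LZ))"
  unfolding on_Hgate
  by (intro acts_smult acts_mult acts_tgate) (auto simp: ph8_unit)

lemma acts_Sgate: "q < n \<Longrightarrow> acts n (on_qubit n q Sgate) (tv n (single q LZ))"
  unfolding on_Sgate by (intro acts_smult acts_tgate) (auto simp: ph8_unit)

lemma clifford_gens_acts: "G \<in> clifford_gens n \<Longrightarrow> \<exists>\<pi>. acts n G \<pi>"
  unfolding clifford_gens_def using acts_Hgate acts_Sgate acts_CNOT by blast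

lemma clifford_acts: "U \<in> clifford_group n \<Longrightarrow> \<exists>\<pi>. acts n U \<pi>"
proof (induction rule: clifford_group.induct)
  case (gen G U)
  then show ?case using clifford_gens_acts acts_mult by blast
qed (use acts_one in blast)

lemma clifford_carrier: "U \<in> clifford_group n \<Longrightarrow> U \<in> carrier_mat (2^n) (2^n)"
  using clifford_acts acts_carrier by blast

lemma clifford_unitary: "U \<in> clifford_group n \<Longrightarrow> adj U * U = 1\<^sub>m (2^n)"
  using clifford_acts acts_unitary by blast

lemma clifford_unitary': "U \<in> clifford_group n \<Longrightarrow> U * adj U = 1\<^sub>m (2^n)"
  using clifford_unitary mat_mult_left_right_inverse[of "adj U" "2^n" U] clifford_carrier by simp

lemma gen_in_clifford: "G \<in> clifford_gens n \<Longrightarrow> G \<in> clifford_group n"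
proof -
  assume G: "G \<in> clifford_gens n"
  then have "G * 1\<^sub>m (2^n) \<in> clifford_group n" by (intro clifford_group.intros)
  moreover have "G \<in> carrier_mat (2^n) (2^n)" using clifford_gens_acts[OF G] acts_carrier by blast
  ultimately show ?thesis by simp
qed

lemma clifford_mult: "U \<in> clifford_group n \<Longrightarrow> V \<in> clifford_group n \<Longrightarrow> U * V \<in> clifford_group n"
proof (induction rule: clifford_group.induct)
  case one
  then show ?case using left_mult_one_mat[OF clifford_carrier[OF one]] by simp
next
  case (gen G U)
  have "G * U * V = G * (U * V)"
    using clifford_carrier[OF gen_in_clifford[OF gen.hyps(1)]] clifford_carrier[OF gen.hyps(2)] clifford_carrier[OF gen.prems]
    by (rule assoc_mult_mat)
  then show ?case using gen by (simp add: clifford_group.gen)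
qed

text \<open>Limits the scalars that the group can contain, as finiteness requires: the H and CNOT
  generators are involutions, and the square of S is the involution Z.\<close>

lemma det_fourth:
  assumes "U \<in> clifford_group n"
  shows "det U ^ 4 = 1"
  using assms
proof (induction rule: clifford_group.induct)
  case (gen G U)
  have Gc: "G \<in> carrier_mat (2^n) (2^n)" using gen(1) gen_in_clifford clifford_carrier by blast
  have sq: "det A ^ 2 = 1" if "A \<in> carrier_mat (2^n) (2^n)" "A * A = 1\<^sub>m (2^n)" for A :: "complex mat"
    using det_mult[OF that(1,1)] that(2) by (simp add: power2_eq_square)
  have "det G ^ 4 = 1"
  proof -
    from gen(1) consider (H) q where "q < n" "G = on_qubit n q Hgate" | (S) q where "q < n" "G = on_qubit n q Sgate"
      | (C) c t where "c < n" "t < n" "c \<noteq> t" "G = CNOT n c t"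
      unfolding clifford_gens_def by blast
    then show ?thesis
    proof cases
      case H
      have "Hgate * Hgate = I2"
      proof (rule mat2_eqI)
        have h: "x / complex_of_real (sqrt 2) = rt * x" for x by (simp add: rt_def)
        show "(Hgate * Hgate) $$ (0,0) = I2 $$ (0,0)" "(Hgate * Hgate) $$ (0,1) = I2 $$ (0,1)"
          "(Hgate * Hgate) $$ (1,0) = I2 $$ (1,0)" "(Hgate * Hgate) $$ (1,1) = I2 $$ (1,1)"
          by (simp_all add: mat2_mult_index Hgate_def[abs_def] I2_def h del: index_mult_mat(1))
      qed (use mult_carrier_mat[OF Hgate_carrier Hgate_carrier] in auto)
      then have "G * G = 1\<^sub>m (2^n)" unfolding H(2) by (simp add: on_qubit_mult on_qubit_one)
      then have "det G ^ 2 = 1" using sq Gc by blast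
      then show ?thesis using power_mult[of "det G" 2 2] by simp
    next
      case S
      have SS: "Sgate * Sgate = PZ"
      proof (rule mat2_eqI)
        show "(Sgate * Sgate) $$ (0,0) = PZ $$ (0,0)" "(Sgate * Sgate) $$ (0,1) = PZ $$ (0,1)"
          "(Sgate * Sgate) $$ (1,0) = PZ $$ (1,0)" "(Sgate * Sgate) $$ (1,1) = PZ $$ (1,1)"
          by (simp_all add: mat2_mult_index Sgate_def[abs_def] PZ_def del: index_mult_mat(1))
      qed (use mult_carrier_mat[OF Sgate_carrier Sgate_carrier] in \<open>auto simp: PZ_def\<close>)
      have "G * G = pauli n (single q LZ)"
        unfolding S(2) pauli_single by (simp add: on_qubit_mult SS sigma_def)
      then have "det G ^ 2 = det (pauli n (single q LZ))" using det_mult[OF Gc Gc] by (simp add: power2_eq_square)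
      moreover have "det (pauli n (single q LZ)) ^ 2 = 1" by (rule sq) (auto simp: pauli_square)
      ultimately show ?thesis using power_mult[of "det G" 2 2] by simp
    next
      case C
      have "G * G = 1\<^sub>m (2^n)"
        using acts_unitary[OF acts_CNOT[OF C(1-3)]] adj_CNOT[OF C(1-3)] C(4) by simp
      then have "det G ^ 2 = 1" using sq Gc by blast
      then show ?thesis using power_mult[of "det G" 2 2] by simp
    qed
  qed
  then show ?case using gen(3) det_mult[OF Gc clifford_carrier[OF gen(2)]] by (simp add: power_mult_distrib)
qed simp

lemma mat_eqI_trace:
  assumes "A \<in> carrier_mat d d" "B \<in> carrier_mat d d"
    "\<And>Y. Y \<in> carrier_mat d d \<Longrightarrow> mtrace (A * Y) = mtrace (B * Y)"
  shows "A = B"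
proof (rule eq_matI)
  fix i j assume "i < dim_row B" "j < dim_col B"
  then have ij: "i < d" "j < d" using assms by auto
  define Y :: "complex mat" where "Y = mat d d (\<lambda>(k,l). if k = j \<and> l = i then 1 else 0)"
  have Y: "Y \<in> carrier_mat d d" by (simp add: Y_def)
  have "mtrace (C * Y) = C $$ (i,j)" if "C \<in> carrier_mat d d" for C
  proof -
    have "mtrace (C * Y) = (\<Sum>k<d. \<Sum>l<d. if l = j then (if k = i then C $$ (k,l) else 0) else 0)"
      unfolding mtrace_mult[OF that Y] by (intro sum.cong refl) (auto simp: Y_def)
    also have "\<dots> = C $$ (i,j)" using ij by simp
    finally show ?thesis .
  qed
  then show "A $$ (i,j) = B $$ (i,j)" using assms(3)[OF Y] assms(1,2) by metis
qed (use assms in auto)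

lemma exists_anticommuting:
  assumes "u \<in> words n" "u \<noteq> 0"
  obtains v where "v \<in> words n" "sg n u v = -1"
proof -
  have "\<exists>v\<in>words n. sg n u v \<noteq> 1"
  proof (rule ccontr)
    assume "\<not> ?thesis"
    then have "(\<Sum>v\<in>words n. sg n u v) = of_nat (card (words n))" by simp
    then show False using sum_sg[OF assms(1)] assms(2) by (simp add: card_words)
  qed
  then show ?thesis using that sg_cases[of n u] by blast
qed

text \<open>Schur's lemma by hand: for u nonzero, moving an anticommuting \<open>pauli n v\<close>
  around the trace of \<open>M * pauli n u\<close> reverses its sign, so only the identity
  coefficient of M survives.\<close>

lemma commutes_paulis_scalar:
  assumes M: "M \<in> carrier_mat (2^n) (2^n)" and comm: "\<And>u. u \<in> words n \<Longrightarrow> pauli n u * M = M * pauli n u"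
  shows "M = (mtrace M / 2^n) \<cdot>\<^sub>m 1\<^sub>m (2^n)"
proof (rule mat_eqI_trace[OF M])
  fix Y :: "complex mat" assume Y: "Y \<in> carrier_mat (2^n) (2^n)"
  have z: "mtrace (M * pauli n u) = 0" if u: "u \<in> words n" "u \<noteq> 0" for u
  proof -
    obtain v where v: "v \<in> words n" "sg n u v = -1" using exists_anticommuting[OF u] .
    have MP: "M * pauli n u \<in> carrier_mat (2^n) (2^n)" for u using M by simp
    have "mtrace (M * pauli n u) = mtrace ((M * pauli n u * pauli n v) * pauli n v)"
      unfolding assoc_mult_mat[OF MP pauli_carrier pauli_carrier] pauli_square right_mult_one_mat[OF MP] ..
    also have "\<dots> = mtrace (pauli n v * (M * pauli n u * pauli n v))"
      by (rule mtrace_comm) (use M in \<open>auto intro!: mult_carrier_mat\<close>)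
    also have "pauli n v * (M * pauli n u * pauli n v) = (pauli n v * M) * (pauli n u * pauli n v)"
      unfolding assoc_mult_mat[OF M pauli_carrier pauli_carrier]
      by (rule assoc_mult_mat[OF pauli_carrier M mult_carrier_mat[OF pauli_carrier pauli_carrier], symmetric])
    also have "\<dots> = (M * pauli n v) * (- 1 \<cdot>\<^sub>m (pauli n v * pauli n u))"
      using comm[OF v(1)] pauli_commute[of n u v] v by simp
    also have "\<dots> = (-1) \<cdot>\<^sub>m ((M * pauli n v) * (pauli n v * pauli n u))"
      by (rule mult_smult_distrib) (use M in \<open>auto intro!: mult_carrier_mat\<close>)
    also have "(M * pauli n v) * (pauli n v * pauli n u) = M * ((pauli n v * pauli n v) * pauli n u)"
      unfolding assoc_mult_mat[OF pauli_carrier pauli_carrier pauli_carrier]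
      by (rule assoc_mult_mat[OF M pauli_carrier mult_carrier_mat[OF pauli_carrier pauli_carrier]])
    also have "\<dots> = M * pauli n u" by (simp add: pauli_square)
    finally have "mtrace (M * pauli n u) = - mtrace (M * pauli n u)"
      using mtrace_smult[OF MP, of "-1"] by simp
    then show ?thesis by simp
  qed
  have "2^n * mtrace (M * Y) = (\<Sum>u\<in>words n. mtrace (M * pauli n u) * mtrace (Y * pauli n u))"
    by (rule sum_pauli_trace[OF M Y, symmetric])
  also have "\<dots> = mtrace (M * pauli n 0) * mtrace (Y * pauli n 0)"
    by (subst sum.remove[of _ 0]) (auto simp: z intro!: sum.neutral)
  also have "\<dots> = mtrace M * mtrace Y" using M Y by (simp add: pauli_0)
  finally show "mtrace (M * Y) = mtrace ((mtrace M / 2^n) \<cdot>\<^sub>m 1\<^sub>m (2^n) * Y)"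
    using Y by (simp add: mult_smult_assoc_mat[OF one_carrier_mat Y] mtrace_smult[OF Y] field_simps)
qed simp

text \<open>Equal actions mean that \<open>V * adj U\<close> commutes with every Pauli operator,
  hence is a scalar.\<close>

lemma same_action_scalar:
  assumes U: "U \<in> clifford_group n" and V: "V \<in> clifford_group n"
    and eq: "\<And>u. u \<in> words n \<Longrightarrow> adj U * pauli n u * U = adj V * pauli n u * V"
  shows "\<exists>c. V = c \<cdot>\<^sub>m U"
proof -
  note c = clifford_carrier[OF U] clifford_carrier[OF V]
  have c': "adj U \<in> carrier_mat (2^n) (2^n)" "adj V \<in> carrier_mat (2^n) (2^n)" using c by auto
  note A = assoc_mult_mat[of _ "2^n" "2^n" _ "2^n" _ "2^n"]
  let ?M = "V * adj U"
  have M: "?M \<in> carrier_mat (2^n) (2^n)" using c c' by simp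
  have comm: "pauli n u * ?M = ?M * pauli n u" if u: "u \<in> words n" for u
  proof -
    have "V * (adj U * pauli n u * U) * adj U = V * (adj V * pauli n u * V) * adj U"
      using eq[OF u] by simp
    moreover have "V * (adj U * pauli n u * U) * adj U = ?M * pauli n u * (U * adj U)"
    proof -
      have X: "adj U * pauli n u \<in> carrier_mat (2^n) (2^n)" using c' by simp
      have MP: "?M * pauli n u \<in> carrier_mat (2^n) (2^n)" using M by simp
      show ?thesis
        unfolding assoc_mult_mat[OF c(2) X c(1), symmetric] assoc_mult_mat[OF c(2) c'(1) pauli_carrier, symmetric]
          assoc_mult_mat[OF MP c(1) c'(1)] ..
    qed
    moreover have "V * (adj V * pauli n u * V) * adj U = (V * adj V) * (pauli n u * ?M)"
    proof -
      have X: "pauli n u * V \<in> carrier_mat (2^n) (2^n)" "V * adj V \<in> carrier_mat (2^n) (2^n)"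
        by (rule mult_carrier_mat[OF pauli_carrier c(2)], rule mult_carrier_mat[OF c(2) c'(2)])
      show ?thesis
        unfolding assoc_mult_mat[OF c'(2) pauli_carrier c(2)] assoc_mult_mat[OF c(2) c'(2) X(1), symmetric]
          assoc_mult_mat[OF X(2) X(1) c'(1)] assoc_mult_mat[OF pauli_carrier c(2) c'(1)] ..
    qed
    ultimately have "?M * pauli n u * (U * adj U) = (V * adj V) * (pauli n u * ?M)" by simp
    then show ?thesis
      using M mult_carrier_mat[OF M pauli_carrier, of u] mult_carrier_mat[OF pauli_carrier M, of u]
      by (simp only: clifford_unitary'[OF U] clifford_unitary'[OF V] left_mult_one_mat right_mult_one_mat)
  qed
  define k where "k = mtrace ?M / 2^n"
  have "?M = k \<cdot>\<^sub>m 1\<^sub>m (2^n)" unfolding k_def by (rule commutes_paulis_scalar[OF M comm])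
  then have "?M * U = (k \<cdot>\<^sub>m 1\<^sub>m (2^n)) * U" by simp
  moreover have "?M * U = V * (adj U * U)" using c c' by (simp add: A)
  moreover have "(k \<cdot>\<^sub>m 1\<^sub>m (2^n)) * U = k \<cdot>\<^sub>m U" using c mult_smult_assoc_mat[OF one_carrier_mat c(1)] by simp
  ultimately show ?thesis using clifford_unitary[OF U] c by auto
qed

text \<open>The signed action on Pauli operators takes finitely many values. Two elements with the
  same action differ by a scalar, and comparing fourth powers of determinants makes this scalar a
  root of unity of bounded order.\<close>

lemma finite_clifford: "finite (clifford_group n)"
proof -
  define f where "f U = restrict (\<lambda>u. adj U * pauli n u * U) (words n)" for U
  let ?B = "(\<lambda>(e,v). e \<cdot>\<^sub>m pauli n v) ` ({1,-1} \<times> words n)"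
  have "f U \<in> (\<Pi>\<^sub>E u\<in>words n. ?B)" if U: "U \<in> clifford_group n" for U
  proof -
    obtain \<pi> where \<pi>: "acts n U \<pi>" using clifford_acts[OF U] by blast
    have "adj U * pauli n u * U \<in> ?B" if u: "u \<in> words n" for u
    proof -
      obtain e where "pm e" "adj U * pauli n u * U = e \<cdot>\<^sub>m pauli n (\<pi> u)" using acts_conj[OF \<pi> u] .
      then show ?thesis using acts_words[OF \<pi> u] by (intro image_eqI[of _ _ "(e, \<pi> u)"]) (auto simp: pm_def)
    qed
    then show ?thesis by (auto simp: f_def)
  qed
  then have "finite (f ` clifford_group n)"
    by (intro finite_subset[of "f ` clifford_group n" "\<Pi>\<^sub>E u\<in>words n. ?B"] finite_PiE) auto
  moreover have "finite {V \<in> clifford_group n. f V = y}" if "y \<in> f ` clifford_group n" for y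
  proof -
    obtain U where U: "U \<in> clifford_group n" "y = f U" using \<open>y \<in> f ` clifford_group n\<close> by blast
    have "{V \<in> clifford_group n. f V = y} \<subseteq> (\<lambda>c. c \<cdot>\<^sub>m U) ` {c. c ^ (2^n * 4) = 1}"
    proof
      fix V assume "V \<in> {V \<in> clifford_group n. f V = y}"
      then have V: "V \<in> clifford_group n" "f V = f U" using U by auto
      have eq: "adj U * pauli n u * U = adj V * pauli n u * V" if "u \<in> words n" for u
        using fun_cong[OF V(2), of u] that by (simp add: f_def)
      obtain c where c: "V = c \<cdot>\<^sub>m U" using same_action_scalar[OF U(1) V(1) eq] by blast
      have "det V = c ^ (2^n) * det U"
        unfolding c using clifford_carrier[OF U(1)] by (simp add: det_smult)
      then have "det V ^ 4 = c ^ (2^n * 4) * det U ^ 4" by (simp add: power_mult_distrib power_mult)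
      then have "c ^ (2^n * 4) = 1" using det_fourth[OF U(1)] det_fourth[OF V(1)] by simp
      then show "V \<in> (\<lambda>c. c \<cdot>\<^sub>m U) ` {c. c ^ (2^n * 4) = 1}" using c by blast
    qed
    moreover have "finite {c::complex. c ^ (2^n * 4) = 1}" by (rule finite_nth_roots) simp
    ultimately show ?thesis using finite_surj by blast
  qed
  moreover have "clifford_group n = (\<Union>y\<in>f ` clifford_group n. {V \<in> clifford_group n. f V = y})" by blast
  ultimately show ?thesis by (metis (no_types, lifting) finite_UN_I)
qed

lemma clifford_left_inj: "U \<in> clifford_group n \<Longrightarrow> inj_on (\<lambda>C. U * C) (clifford_group n)"
proof (rule inj_onI)
  fix C D assume U: "U \<in> clifford_group n" and CD: "C \<in> clifford_group n" "D \<in> clifford_group n" "U * C = U * D"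
  have "adj U * (U * E) = E" if "E \<in> clifford_group n" for E
    using clifford_carrier[OF U] clifford_carrier[OF that] clifford_unitary[OF U]
    by (subst assoc_mult_mat[of _ "2^n" "2^n" _ "2^n" _ "2^n", symmetric]) auto
  then show "C = D" using CD by metis
qed

lemma clifford_left_image: "U \<in> clifford_group n \<Longrightarrow> (\<lambda>C. U * C) ` clifford_group n = clifford_group n"
  by (rule endo_inj_surj[OF finite_clifford _ clifford_left_inj]) (auto intro: clifford_mult)

text \<open>The inductive definition only yields a monoid. Left multiplication is injective on this
  finite set, hence surjective, and this produces the inverse.\<close>

lemma clifford_adj: "U \<in> clifford_group n \<Longrightarrow> adj U \<in> clifford_group n"
proof -
  assume U: "U \<in> clifford_group n"
  obtain C where C: "C \<in> clifford_group n" "1\<^sub>m (2^n) = U * C"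
    using clifford_left_image[OF U] clifford_group.one[of n] by blast
  have "adj U = adj U * (U * C)" using C(2) clifford_carrier[OF U] by (metis adj_carrier right_mult_one_mat)
  also have "\<dots> = C"
    using clifford_carrier[OF U] clifford_carrier[OF C(1)] clifford_unitary[OF U]
    by (subst assoc_mult_mat[of _ "2^n" "2^n" _ "2^n" _ "2^n", symmetric]) auto
  finally show ?thesis using C by simp
qed

text \<open>The phase c is free because the gates realise quarter rotations only up to a global
  phase, which cancels under conjugation.\<close>

definition tset :: "nat \<Rightarrow> word set" where
  "tset n = {w \<in> words n. \<exists>c. cnj c * c = 1 \<and> c \<cdot>\<^sub>m tgate n w \<in> clifford_group n}"

lemma conj_lin:
  assumes "acts n U \<pi>" "adj U * pauli n w * U = e \<cdot>\<^sub>m pauli n (\<pi> w)"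
  shows "adj U * lin n w a b * U = lin n (\<pi> w) a (e * b)"
proof -
  note c = acts_carrier[OF assms(1)]
  have c': "adj U \<in> carrier_mat (2^n) (2^n)" using c by simp
  have "adj U * lin n w a b * U = (a \<cdot>\<^sub>m adj U + b \<cdot>\<^sub>m (adj U * pauli n w)) * U"
    by (simp add: lin_mult_left[OF c'])
  also have "\<dots> = (a \<cdot>\<^sub>m adj U) * U + (b \<cdot>\<^sub>m (adj U * pauli n w)) * U"
    by (rule add_mult_distrib_mat[of _ "2^n" "2^n"]) (use c c' in auto)
  also have "(a \<cdot>\<^sub>m adj U) * U = a \<cdot>\<^sub>m 1\<^sub>m (2^n)"
    using mult_smult_assoc_mat[OF c' c] acts_unitary[OF assms(1)] by simp
  also have "(b \<cdot>\<^sub>m (adj U * pauli n w)) * U = b \<cdot>\<^sub>m (e \<cdot>\<^sub>m pauli n (\<pi> w))"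
    using mult_smult_assoc_mat[OF mult_carrier_mat[OF c' pauli_carrier] c] assms(2) by metis
  finally show ?thesis by (simp add: lin_def smult_smult_mat mult.commute)
qed

text \<open>Conjugation carries the rotation about w to one about plus or minus the Pauli operator
  of the image word. With the minus sign it is the adjoint of the desired rotation, and the group is
  closed under adjoints.\<close>

lemma tset_conj:
  assumes U: "U \<in> clifford_group n" "acts n U \<pi>" and w: "w \<in> tset n"
  shows "\<pi> w \<in> tset n"
proof -
  from w obtain c where w: "w \<in> words n" and c: "cnj c * c = 1" "c \<cdot>\<^sub>m tgate n w \<in> clifford_group n"
    by (auto simp: tset_def)
  note Uc = clifford_carrier[OF U(1)]
  have tc: "tgate n v \<in> carrier_mat (2^n) (2^n)" for v by (simp add: tgate_def)
  obtain e where e: "pm e" "adj U * pauli n w * U = e \<cdot>\<^sub>m pauli n (\<pi> w)" using acts_conj[OF U(2) w] .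
  have "adj U * (c \<cdot>\<^sub>m tgate n w) * U \<in> clifford_group n"
    using U c by (intro clifford_mult clifford_adj)
  also have "adj U * (c \<cdot>\<^sub>m tgate n w) * U = c \<cdot>\<^sub>m lin n (\<pi> w) rt (e * (- \<i> * rt))"
    unfolding conj_smult[OF Uc tc] unfolding tgate_def conj_lin[OF U(2) e(2)] ..
  finally have in_cl: "c \<cdot>\<^sub>m lin n (\<pi> w) rt (e * (- \<i> * rt)) \<in> clifford_group n" .
  from e(1) show ?thesis unfolding pm_def
  proof
    assume "e = 1"
    then show ?thesis using in_cl acts_words[OF U(2) w] c by (auto simp: tset_def tgate_def)
  next
    assume "e = -1"
    then have "adj (c \<cdot>\<^sub>m lin n (\<pi> w) rt (e * (- \<i> * rt))) = cnj c \<cdot>\<^sub>m tgate n (\<pi> w)"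
      by (simp add: adj_smult adj_lin tgate_def)
    then have "cnj c \<cdot>\<^sub>m tgate n (\<pi> w) \<in> clifford_group n" using clifford_adj[OF in_cl] by simp
    moreover have "cnj (cnj c) * cnj c = 1" using c by (simp add: mult.commute)
    ultimately show ?thesis using acts_words[OF U(2) w] unfolding tset_def by blast
  qed
qed

lemma tset_acts:
  assumes "w \<in> tset n"
  obtains g where "g \<in> clifford_group n" "acts n g (tv n w)"
  using assms acts_smult[OF acts_tgate] by (auto simp: tset_def)

text \<open>\<open>tset_conj\<close> is applied to the rotation about v itself, which moves the
  anticommuting word w to w + v.\<close>

lemma tset_add: "w \<in> tset n \<Longrightarrow> v \<in> tset n \<Longrightarrow> sg n w v = -1 \<Longrightarrow> w + v \<in> tset n"
proof -
  assume w: "w \<in> tset n" and v: "v \<in> tset n" and s: "sg n w v = -1"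
  obtain g where "g \<in> clifford_group n" "acts n g (tv n v)" using tset_acts[OF v] .
  from tset_conj[OF this w] show ?thesis using s by (simp add: tv_def)
qed

lemma tset_single: "q < n \<Longrightarrow> l \<noteq> LI \<Longrightarrow> single q l \<in> tset n"
proof -
  assume q: "q < n" and l: "l \<noteq> LI"
  have "on_qubit n q Sgate \<in> clifford_group n" "on_qubit n q Hgate \<in> clifford_group n"
    using q by (auto intro!: gen_in_clifford simp: clifford_gens_def)
  then have Z: "single q LZ \<in> tset n"
    using q on_Sgate[OF q] ph8_unit(1) by (auto simp: tset_def)
  have "((tv n (single q LZ) \<circ> tv n (single q LX)) \<circ> tv n (single q LZ)) (single q LZ) \<in> tset n"
    by (rule tset_conj[OF \<open>on_qubit n q Hgate \<in> clifford_group n\<close> acts_Hgate[OF q] Z])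
  moreover have "((tv n (single q LZ) \<circ> tv n (single q LX)) \<circ> tv n (single q LZ)) (single q LZ) = single q LX"
    using q by (simp add: tv_def sg_single) (auto simp: sl_def single_def plus_letter_def fun_eq_iff zero_letter_def)
  ultimately have X: "single q LX \<in> tset n" by simp
  have "single q LZ + single q LX \<in> tset n"
    by (rule tset_add[OF Z X]) (use q in \<open>simp add: sg_single, simp add: single_def sl_def\<close>)
  moreover have "single q LZ + single q LX = single q LY"
    by (auto simp: single_def plus_letter_def fun_eq_iff zero_letter_def)
  ultimately show ?thesis using X Z l by (cases l) auto
qed

text \<open>CNOT turns Z on the target into Z on both qubits. The remaining letters are reached by
  adding anticommuting one-qubit words, one position at a time.\<close>

lemma tset_two:
  assumes q: "q < n" "r < n" "q \<noteq> r" and l: "l \<noteq> LI" "m \<noteq> LI"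
  shows "single q l + single r m \<in> tset n"
proof -
  have C: "CNOT n q r \<in> clifford_group n"
    using q by (auto intro!: gen_in_clifford simp: clifford_gens_def)
  let ?\<pi> = "(tv n (single q LZ + single r LX) \<circ> tv n (single r LX)) \<circ> tv n (single q LZ)"
  have "?\<pi> (single r LZ) \<in> tset n"
    by (rule tset_conj[OF C acts_CNOT[OF q] tset_single]) (use q in auto)
  moreover have "?\<pi> (single r LZ) = single q LZ + single r LZ"
    using q by (simp add: tv_def sg_single sg_add_left sg_add_right)
      (auto simp: sl_def single_def plus_letter_def fun_eq_iff zero_letter_def)
  ultimately have ZZ: "single q LZ + single r LZ \<in> tset n" by simp
  have step: "single q (a + b) + single r c \<in> tset n"
    if "single q a + single r c \<in> tset n" "b \<noteq> LI" "sl a b = -1" "q < n" "r < n" "q \<noteq> r" for q r a b c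
  proof -
    have "single q a + single r c + single q b \<in> tset n"
      by (rule tset_add[OF that(1) tset_single]) (use that in \<open>simp_all add: sg_single sg_add_left\<close>, simp add: single_def sl_def zero_letter_def)
    moreover have "single q a + single r c + single q b = single q (a + b) + single r c"
      using that by (auto simp: single_def fun_eq_iff)
    ultimately show ?thesis by simp
  qed
  have l': "single q l + single r LZ \<in> tset n"
  proof (cases "l = LZ")
    case False
    then show ?thesis using step[OF ZZ, of "LZ + l"] l q
      by (cases l) (auto simp: sl_def plus_letter_def)
  qed (use ZZ in simp)
  then have "single r LZ + single q l \<in> tset n" by (simp add: add.commute)
  then have "single r m + single q l \<in> tset n"
  proof (cases "m = LZ")
    case False
    then show ?thesis using step[OF \<open>single r LZ + single q l \<in> tset n\<close>, of "LZ + m"] l q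
      by (cases m) (auto simp: sl_def plus_letter_def)
  qed simp
  then show ?thesis by (simp add: add.commute)
qed

text \<open>Induction on the weight: a word of weight at least 2 is the sum of two anticommuting
  words, one of weight 2 and one of smaller weight than the given word.\<close>

lemma tset_all: "w \<in> words n \<Longrightarrow> w \<noteq> 0 \<Longrightarrow> w \<in> tset n"
proof (induction "card {q. q < n \<and> w q \<noteq> 0}" arbitrary: w rule: less_induct)
  case less
  let ?S = "\<lambda>w. {q. q < n \<and> (w::word) q \<noteq> 0}"
  obtain q where q: "w q \<noteq> 0" using less.prems(2) by (auto simp: fun_eq_iff)
  then have "q < n" using less.prems(1) by (auto simp: words_def not_le[symmetric])
  note q = q this
  show ?case
  proof (cases "?S w = {q}")
    case True
    have "w r = single q (w q) r" for r
      using True less.prems(1) by (cases "r < n") (auto simp: single_def words_def)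
    then have "w = single q (w q)" by (rule ext)
    then show ?thesis using tset_single[OF q(2), of "w q"] q by (simp add: zero_letter_def)
  next
    case False
    then obtain r where r: "r < n" "w r \<noteq> 0" "r \<noteq> q" using q by blast
    \<comment> \<open>Since b differs from the letter at q, the word w + e keeps a nontrivial letter
      at q that anticommutes with b, while position r is cleared.\<close>
    obtain b where b: "b \<noteq> LI" "b \<noteq> w q"
      using letter.distinct(1,3) letter.distinct(7) by (cases "w q = LX") metis+
    define e where "e = single q b + single r (w r)"
    have e: "e \<in> tset n" unfolding e_def
      by (rule tset_two) (use q r b in \<open>auto simp: zero_letter_def\<close>)
    have sub: "?S (w + e) \<subset> ?S w"
    proof (rule psubsetI)
      have "w x \<noteq> 0" if "(w + e) x \<noteq> 0" for x
        using that q r by (cases "x = q"; cases "x = r") (simp_all add: e_def single_def)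
      then show "?S (w + e) \<subseteq> ?S w" by blast
      have "r \<in> ?S w" "r \<notin> ?S (w + e)" using r by (simp_all add: e_def single_def)
      then show "?S (w + e) \<noteq> ?S w" by blast
    qed
    have "(w + e) q \<noteq> 0" using b q r
      by (simp add: e_def single_def) (cases "w q"; cases b; simp add: plus_letter_def zero_letter_def)
    then have nz: "w + e \<noteq> 0" by auto
    have "e \<in> words n" using e by (simp add: tset_def)
    then have "w + e \<in> tset n"
      by (intro less.hyps psubset_card_mono sub nz) (use less.prems in auto)
    moreover have "sg n (w + e) e = -1"
    proof -
      have "sg n (w + e) e = sl ((w + e) q) b * sl ((w + e) r) (w r)"
        unfolding e_def sg_add_right using q r by (simp add: sg_single)
      also have "(w + e) r = 0" using r by (simp add: e_def single_def)
      also have "sl ((w + e) q) b = -1" using b q r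
        by (simp add: e_def single_def) (cases "w q"; cases b; simp add: plus_letter_def zero_letter_def sl_def)
      finally show ?thesis by (simp add: sl_def zero_letter_def plus_fun_def)
    qed
    ultimately have "(w + e) + e \<in> tset n" using e tset_add by blast
    moreover have "(w + e) + e = w" by (simp add: add.assoc)
    ultimately show ?thesis by simp
  qed
qed

lemma clifford_transvection:
  assumes "w \<in> words n" "w \<noteq> 0"
  obtains g where "g \<in> clifford_group n" "acts n g (tv n w)"
  using tset_acts[OF tset_all[OF assms]] .

subsection \<open>Witt's extension theorem for Pauli words\<close>

declare plus_fun_apply [simp del] zero_fun_apply [simp del]

lemma sg_sum:
  assumes "finite S"
  shows "sg n w (\<Sum>S) = (\<Prod>v\<in>S. sg n w v)"
  using assms by (induction S rule: finite_induct) (auto simp: sg_add_right)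

lemma sum_words: "finite S \<Longrightarrow> S \<subseteq> words n \<Longrightarrow> \<Sum>S \<in> words n"
  by (induction S rule: finite_induct) auto

text \<open>Solvability of a linear system over the field with two elements: the number of solutions
  is a character sum, all of whose terms are nonnegative when the system is consistent.\<close>
lemma exists_prescribed_signs:
  fixes b :: "word \<Rightarrow> complex"
  assumes I: "finite I" "I \<subseteq> words n" and b: "\<And>v. v \<in> I \<Longrightarrow> pm (b v)"
    and cons: "\<And>S. S \<subseteq> I \<Longrightarrow> \<Sum>S = 0 \<Longrightarrow> (\<Prod>v\<in>S. b v) = 1"
  shows "\<exists>w\<in>words n. \<forall>v\<in>I. sg n w v = b v"
proof -
  let ?Z = "{S \<in> Pow I. \<Sum>S = 0}"
  have "(\<Sum>w\<in>words n. \<Prod>v\<in>I. b v * sg n w v + 1) = (\<Sum>w\<in>words n. \<Sum>S\<in>Pow I. \<Prod>v\<in>S. b v * sg n w v)"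
    using I(1) by (simp add: prod_add)
  also have "\<dots> = (\<Sum>S\<in>Pow I. \<Sum>w\<in>words n. (\<Prod>v\<in>S. b v) * sg n w (\<Sum>S))"
    by (subst sum.swap, intro sum.cong refl) (use I in \<open>auto simp: prod.distrib sg_sum finite_subset\<close>)
  also have "\<dots> = (\<Sum>S\<in>Pow I. if \<Sum>S = 0 then 4 ^ n else 0)"
  proof (intro sum.cong refl)
    fix S assume S: "S \<in> Pow I"
    then have "\<Sum>S \<in> words n" using I by (intro sum_words) (auto intro: finite_subset)
    then have "(\<Sum>w\<in>words n. sg n w (\<Sum>S)) = (if \<Sum>S = 0 then 4 ^ n else 0)"
      using sum_sg[of "\<Sum>S" n] by (simp add: sg_sym)
    then show "(\<Sum>w\<in>words n. (\<Prod>v\<in>S. b v) * sg n w (\<Sum>S)) = (if \<Sum>S = 0 then 4 ^ n else 0)"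
      using cons[of S] S by (auto simp: sum_distrib_left[symmetric])
  qed
  also have "\<dots> = of_nat (card ?Z) * 4 ^ n"
    using I(1) by (simp add: sum.If_cases Int_def)
  finally have eq: "(\<Sum>w\<in>words n. \<Prod>v\<in>I. b v * sg n w v + 1) = of_nat (card ?Z) * 4 ^ n" .
  have "{} \<in> ?Z" by simp
  then have "card ?Z \<noteq> 0" using I(1) by (metis (no_types, lifting) card_eq_0_iff empty_iff finite_Pow_iff finite_subset mem_Collect_eq subsetI)
  then have "(\<Sum>w\<in>words n. \<Prod>v\<in>I. b v * sg n w v + 1) \<noteq> 0" unfolding eq by simp
  then obtain w where w: "w \<in> words n" "(\<Prod>v\<in>I. b v * sg n w v + 1) \<noteq> 0"
    by (meson sum.neutral)
  have "sg n w v = b v" if v: "v \<in> I" for v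
  proof -
    have "b v * sg n w v + 1 \<noteq> 0" using w(2) v I(1) by (metis prod_zero)
    then show ?thesis using b[OF v] sg_cases[of n w v] by (auto simp: pm_def)
  qed
  then show ?thesis using w by blast
qed

text \<open>Products of transvections. They preserve sums and commutation signs, and each factor is
  induced by a Clifford unitary, which is what the invariance of Clifford averages requires.\<close>

inductive_set isoms :: "nat \<Rightarrow> (word \<Rightarrow> word) set" for n where
  isoms_id: "(\<lambda>u. u) \<in> isoms n"
| isoms_step: "h \<in> isoms n \<Longrightarrow> w \<in> words n \<Longrightarrow> w \<noteq> 0 \<Longrightarrow> (\<lambda>u. tv n w (h u)) \<in> isoms n"

lemma isoms_comp: "g \<in> isoms n \<Longrightarrow> h \<in> isoms n \<Longrightarrow> (\<lambda>u. g (h u)) \<in> isoms n"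
  by (induction g rule: isoms.induct) (auto intro: isoms_step)

lemma isoms_tv: "w \<in> words n \<Longrightarrow> w \<noteq> 0 \<Longrightarrow> tv n w \<in> isoms n"
  using isoms_step[OF isoms_id] by simp

lemma tv_add: "tv n w (u + v) = tv n w u + tv n w v"
proof -
  have "u + w + (v + w) = u + v + (w + w)" by (simp only: add_ac)
  then show ?thesis
    using sg_cases[of n u w] sg_cases[of n v w] by (auto simp: tv_def sg_add_left add_ac)
qed

lemma sg_tv: "sg n (tv n w u) (tv n w v) = sg n u v"
  using sg_cases[of n u w] sg_cases[of n v w] sg_sym[of n w u] sg_sym[of n w v]
  by (auto simp: tv_def sg_add_left sg_add_right)

lemma tv_eq_0: "tv n w u = 0 \<longleftrightarrow> u = 0"
  by (auto simp: tv_def)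

lemma isoms_add: "h \<in> isoms n \<Longrightarrow> h (u + v) = h u + h v"
  by (induction rule: isoms.induct) (auto simp: tv_add)

lemma isoms_sg: "h \<in> isoms n \<Longrightarrow> sg n (h u) (h v) = sg n u v"
  by (induction rule: isoms.induct) (auto simp: sg_tv)

lemma isoms_eq_0: "h \<in> isoms n \<Longrightarrow> h u = 0 \<longleftrightarrow> u = 0"
  by (induction rule: isoms.induct) (auto simp: tv_eq_0)

lemma isoms_words: "h \<in> isoms n \<Longrightarrow> u \<in> words n \<Longrightarrow> h u \<in> words n"
  by (induction rule: isoms.induct) auto

lemma isoms_eq: "h \<in> isoms n \<Longrightarrow> h u = h v \<longleftrightarrow> u = v"
  using isoms_eq_0[of h n "u + v"] isoms_add[of h n u v] by (metis word_add_eq_0_iff)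

text \<open>If x and y anticommute, the transvection along x + y sends x to y and fixes every word
  on which x and y have the same sign. If they commute, two such steps pass through a word w that
  anticommutes with both.\<close>

lemma witt_step:
  assumes Fs: "finite Fs" "Fs \<subseteq> words n" and xy: "x \<in> words n" "y \<in> words n"
    and ind: "\<And>S. S \<subseteq> Fs \<Longrightarrow> \<Sum>S \<noteq> x \<and> \<Sum>S \<noteq> y"
    and eq: "\<And>f. f \<in> Fs \<Longrightarrow> sg n x f = sg n y f"
  shows "\<exists>h\<in>isoms n. (\<forall>f\<in>Fs. h f = f) \<and> h x = y"
proof (cases "x = y")
  case True
  then show ?thesis by (intro bexI[OF _ isoms_id]) simp
next
  case ne: False
  have dir: "\<exists>h\<in>isoms n. (\<forall>f\<in>Fs. h f = f) \<and> h x = y"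
    if "x \<in> words n" "y \<in> words n" "\<And>f. f \<in> Fs \<Longrightarrow> sg n x f = sg n y f" "sg n x y = -1" for x y
  proof (intro bexI conjI ballI)
    have "x \<noteq> y" using that(4) by auto
    then show "tv n (x + y) \<in> isoms n" using that by (intro isoms_tv) auto
    show "tv n (x + y) x = y" using that by (simp add: tv_def sg_add_right)
    fix f assume "f \<in> Fs"
    then have "sg n f (x + y) = 1" using that(3) by (simp add: sg_add_right sg_sym[of n f])
    then show "tv n (x + y) f = f" by (simp add: tv_def)
  qed
  show ?thesis
  proof (cases "sg n x y = -1")
    case True
    then show ?thesis using dir xy eq by blast
  next
    case False
    then have sxy: "sg n x y = 1" using sg_cases by blast
    have nin: "x \<notin> Fs" "y \<notin> Fs" using ind[of "{x}"] ind[of "{y}"] by auto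
    \<comment> \<open>The intermediate word must anticommute with x and y and agree with x, hence
      with y, on the words to be fixed.\<close>
    let ?b = "\<lambda>v. if v = x \<or> v = y then -1 else sg n x v"
    have "\<exists>w\<in>words n. \<forall>v\<in>insert x (insert y Fs). sg n w v = ?b v"
    proof (rule exists_prescribed_signs)
      fix S assume S: "S \<subseteq> insert x (insert y Fs)" "\<Sum>S = 0"
      define S' where "S' = S - {x,y}"
      have S': "S' \<subseteq> Fs" "finite S'" using S Fs by (auto simp: S'_def intro: finite_subset)
      have fS: "finite S" using S Fs by (auto intro: finite_subset)
      have pS': "(\<Prod>v\<in>S'. ?b v) = sg n x (\<Sum>S')"
        unfolding sg_sum[OF S'(2)] by (intro prod.cong refl) (auto simp: S'_def)
      consider "x \<notin> S" "y \<notin> S" | "x \<in> S" "y \<notin> S" | "x \<notin> S" "y \<in> S" | "x \<in> S" "y \<in> S" by blast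
      then show "(\<Prod>v\<in>S. ?b v) = 1"
      proof cases
        case 1
        then have "S' = S" by (auto simp: S'_def)
        then show ?thesis using pS' S by simp
      next
        case 2
        then have "S = insert x S'" "x \<notin> S'" by (auto simp: S'_def)
        then have "x + \<Sum>S' = 0" using S(2) S' by simp
        then show ?thesis using ind[OF S'(1)] by simp
      next
        case 3
        then have "S = insert y S'" "y \<notin> S'" by (auto simp: S'_def)
        then have "y + \<Sum>S' = 0" using S(2) S' by simp
        then show ?thesis using ind[OF S'(1)] by simp
      next
        case 4
        then have e: "S = insert x (insert y S')" "x \<notin> insert y S'" "y \<notin> S'" using ne by (auto simp: S'_def)
        then have "x + (y + \<Sum>S') = 0" using S(2) S' by simp
        \<comment> \<open>The prescribed signs are consistent because x and y commute: those on S'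
          multiply to sg n x (x + y) = sg n x y = 1, and the two factors -1 cancel.\<close>
        then have "\<Sum>S' = x + y" by (metis add.assoc word_add_eq_0_iff)
        moreover have "(\<Prod>v\<in>S. ?b v) = (-1) * ((-1) * (\<Prod>v\<in>S'. ?b v))"
          unfolding e(1) using e S' by (subst prod.insert; simp)+
        ultimately show ?thesis using pS' sxy by (simp add: sg_add_right)
      qed
    qed (use Fs xy sg_cases in \<open>auto simp: pm_def\<close>)
    then obtain w where w: "w \<in> words n" "sg n w x = -1" "sg n w y = -1" "\<And>f. f \<in> Fs \<Longrightarrow> sg n w f = sg n x f"
    proof -
      assume a: "\<And>w. \<lbrakk>w \<in> words n; sg n w x = -1; sg n w y = -1; \<And>f. f \<in> Fs \<Longrightarrow> sg n w f = sg n x f\<rbrakk> \<Longrightarrow> thesis"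
      assume "\<exists>w\<in>words n. \<forall>v\<in>insert x (insert y Fs). sg n w v = ?b v"
      then obtain w where "w \<in> words n" "\<forall>v\<in>insert x (insert y Fs). sg n w v = ?b v" by blast
      then show thesis by (intro a[of w]) (use nin in auto)
    qed
    obtain h where h: "h \<in> isoms n" "\<forall>f\<in>Fs. h f = f" "h x = w"
      using dir[of x w] w xy sg_sym by metis
    obtain h' where h': "h' \<in> isoms n" "\<forall>f\<in>Fs. h' f = f" "h' w = y"
      using dir[of w y] w xy eq by metis
    show ?thesis by (rule bexI[OF _ isoms_comp[OF h'(1) h(1)]]) (use h h' in auto)
  qed
qed

lemma witt_1:
  assumes "u \<in> words n" "v \<in> words n" "u \<noteq> 0" "v \<noteq> 0"
  shows "\<exists>h\<in>isoms n. h u = v"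
  using witt_step[of "{}" n u v] assms by auto

text \<open>Words are moved into place one at a time, those already placed being held fixed by
  \<open>witt_step\<close>.\<close>

lemma witt_2:
  assumes u: "u1 \<in> words n" "u2 \<in> words n" and v: "v1 \<in> words n" "v2 \<in> words n"
    and ne: "u1 \<noteq> 0" "u2 \<noteq> 0" "u1 \<noteq> u2" "v1 \<noteq> 0" "v2 \<noteq> 0" "v1 \<noteq> v2" and s: "sg n u1 u2 = sg n v1 v2"
  shows "\<exists>h\<in>isoms n. h u1 = v1 \<and> h u2 = v2"
proof -
  obtain h where h: "h \<in> isoms n" "h u1 = v1" using witt_1 u v ne by blast
  have "\<exists>g\<in>isoms n. (\<forall>f\<in>{v1}. g f = f) \<and> g (h u2) = v2"
  proof (rule witt_step)
    show "\<Sum>S \<noteq> h u2 \<and> \<Sum>S \<noteq> v2" if "S \<subseteq> {v1}" for S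
    proof -
      have "S = {} \<or> S = {v1}" using that by blast
      then show ?thesis using ne h isoms_eq_0[OF h(1), of u2] isoms_eq[OF h(1), of u1 u2] by auto
    qed
    show "sg n (h u2) f = sg n v2 f" if "f \<in> {v1}" for f
      using that h s isoms_sg[OF h(1), of u2 u1] by (simp add: sg_sym)
  qed (use u v h isoms_words in auto)
  then obtain g where "g \<in> isoms n" "g v1 = v1" "g (h u2) = v2" by auto
  then show ?thesis using h isoms_comp[of g n h] by (intro bexI[of _ "\<lambda>u. g (h u)"]) auto
qed

lemma witt_3:
  assumes u: "u1 \<in> words n" "u2 \<in> words n" "u3 \<in> words n" and v: "v1 \<in> words n" "v2 \<in> words n" "v3 \<in> words n"
    and ne: "u1 \<noteq> 0" "u2 \<noteq> 0" "u1 \<noteq> u2" "u3 \<notin> {0, u1, u2, u1 + u2}"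
     "v1 \<noteq> 0" "v2 \<noteq> 0" "v1 \<noteq> v2" "v3 \<notin> {0, v1, v2, v1 + v2}"
    and s: "sg n u1 u2 = sg n v1 v2" "sg n u1 u3 = sg n v1 v3" "sg n u2 u3 = sg n v2 v3"
  shows "\<exists>h\<in>isoms n. h u1 = v1 \<and> h u2 = v2 \<and> h u3 = v3"
proof -
  obtain h where h: "h \<in> isoms n" "h u1 = v1" "h u2 = v2" using witt_2[OF u(1,2) v(1,2)] ne s by blast
  have "\<exists>g\<in>isoms n. (\<forall>f\<in>{v1, v2}. g f = f) \<and> g (h u3) = v3"
  proof (rule witt_step)
    show "\<Sum>S \<noteq> h u3 \<and> \<Sum>S \<noteq> v3" if "S \<subseteq> {v1, v2}" for S
    proof -
      have "S = {} \<or> S = {v1} \<or> S = {v2} \<or> S = {v1,v2}" using that by blast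
      then show ?thesis
        using ne h isoms_eq_0[OF h(1), of u3] isoms_eq[OF h(1), of u1 u3] isoms_eq[OF h(1), of u2 u3]
          isoms_eq[OF h(1), of "u1 + u2" u3] isoms_add[OF h(1), of u1 u2] by auto
    qed
    show "sg n (h u3) f = sg n v3 f" if "f \<in> {v1, v2}" for f
      using that h s isoms_sg[OF h(1), of u3 u1] isoms_sg[OF h(1), of u3 u2] by (auto simp: sg_sym)
  qed (use u v h isoms_words in auto)
  then obtain g where "g \<in> isoms n" "g v1 = v1" "g v2 = v2" "g (h u3) = v3" by auto
  then show ?thesis using h isoms_comp[of g n h] by (intro bexI[of _ "\<lambda>u. g (h u)"]) auto
qed

subsection \<open>Sums of class functions\<close>

text \<open>The indicator of a sign s = b is (1 + b s)/2, so the count is half of 4^n plus a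
  vanishing character sum.\<close>

lemma card_sg:
  assumes "u \<in> words n" "u \<noteq> 0" "pm b"
  shows "of_nat (card {v \<in> words n. sg n u v = b}) = (4 ^ n / 2 :: complex)"
proof -
  have "of_nat (card {v \<in> words n. sg n u v = b}) = (\<Sum>v\<in>words n. if sg n u v = b then 1 else (0::complex))"
    by (simp add: sum.If_cases Int_def)
  also have "\<dots> = (\<Sum>v\<in>words n. (1 + b * sg n u v) / 2)"
    using assms(3) by (intro sum.cong refl, rename_tac v, cut_tac u=u and v=v in sg_cases[of n]) (auto simp: pm_def)
  also have "\<dots> = 4 ^ n / 2"
    using sum_sg[OF assms(1)] assms(2) by (simp add: sum_divide_distrib[symmetric] sum.distrib sum_distrib_left[symmetric] card_words)
  finally show ?thesis .
qed

lemma card_sg2: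
  assumes "u1 \<in> words n" "u2 \<in> words n" "u1 \<noteq> 0" "u2 \<noteq> 0" "u1 \<noteq> u2" "pm b1" "pm b2"
  shows "of_nat (card {v \<in> words n. sg n u1 v = b1 \<and> sg n u2 v = b2}) = (4 ^ n / 4 :: complex)"
proof -
  have "of_nat (card {v \<in> words n. sg n u1 v = b1 \<and> sg n u2 v = b2}) = (\<Sum>v\<in>words n. if sg n u1 v = b1 \<and> sg n u2 v = b2 then 1 else (0::complex))"
    by (simp add: sum.If_cases Int_def)
  also have "\<dots> = (\<Sum>v\<in>words n. (1 + b1 * sg n u1 v + b2 * sg n u2 v + b1 * b2 * sg n (u1 + u2) v) / 4)"
  proof (intro sum.cong refl)
    fix v
    show "(if sg n u1 v = b1 \<and> sg n u2 v = b2 then 1 else 0) = (1 + b1 * sg n u1 v + b2 * sg n u2 v + b1 * b2 * sg n (u1 + u2) v) / 4"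
      using assms(6,7) sg_cases[of n u1 v] sg_cases[of n u2 v] by (auto simp: pm_def sg_add_left)
  qed
  also have "\<dots> = 4 ^ n / 4"
    using sum_sg[OF assms(1)] sum_sg[OF assms(2)] sum_sg[of "u1 + u2" n] assms
    by (simp add: sum_divide_distrib[symmetric] sum.distrib sum_distrib_left[symmetric] card_words)
  finally show ?thesis .
qed

lemma pm_1 [simp]: "pm 1" "pm (-1)" by (auto simp: pm_def)

text \<open>The words commuting with u number 4^n/2 and include 0 and u, which are treated
  separately.\<close>

lemma sum_given_1:
  fixes g :: "word \<Rightarrow> complex"
  assumes u: "u \<in> words n" "u \<noteq> 0"
    and c: "\<And>v. v \<in> words n \<Longrightarrow> v \<noteq> 0 \<Longrightarrow> v \<noteq> u \<Longrightarrow> sg n u v = 1 \<Longrightarrow> g v = gc"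
    and a: "\<And>v. v \<in> words n \<Longrightarrow> sg n u v = -1 \<Longrightarrow> g v = ga"
  shows "(\<Sum>v\<in>words n. g v) = g 0 + g u + (4^n / 2 - 2) * gc + (4^n / 2) * ga"
proof -
  let ?P = "{v \<in> words n. sg n u v = 1}" and ?M = "{v \<in> words n. sg n u v = -1}"
  have split: "words n = ?P \<union> ?M" "?P \<inter> ?M = {}" using sg_cases[of n u] by auto
  have "(\<Sum>v\<in>words n. g v) = sum g ?P + sum g ?M"
    by (subst split(1), rule sum.union_disjoint) (use split(2) in auto)
  also have "sum g ?M = of_nat (card ?M) * ga" using a by simp
  also have "of_nat (card ?M) = (4^n / 2 :: complex)" using card_sg[OF u, of "-1"] by simp
  also have "sum g ?P = g 0 + (g u + sum g (?P - {0} - {u}))"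
    using u by (subst sum.remove[of _ 0], simp, simp, subst sum.remove[of _ u]) auto
  also have "sum g (?P - {0} - {u}) = of_nat (card (?P - {0} - {u})) * gc" using c by simp
  also have "of_nat (card (?P - {0} - {u})) = (4^n / 2 - 2 :: complex)"
  proof -
    have "card ?P = Suc (Suc (card (?P - {0} - {u})))"
      using u by (subst card.remove[of _ 0], simp, simp, subst card.remove[of "?P - {0}" u]) auto
    then have "(of_nat (card ?P) :: complex) = of_nat (card (?P - {0} - {u})) + 2" by simp
    then show ?thesis using card_sg[OF u, of 1] by (simp add: algebra_simps)
  qed
  finally show ?thesis by (simp add: add_ac)
qed

text \<open>The common commutant of two independent commuting words has 4^n/4 elements and contains
  their span of four. For n = 2 nothing else remains, which is why the later division requires n >=
  3.\<close>

lemma sum_given_2: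
  fixes g :: "word \<Rightarrow> complex"
  assumes u: "u1 \<in> words n" "u2 \<in> words n" "u1 \<noteq> 0" "u2 \<noteq> 0" "u1 \<noteq> u2" and s: "sg n u1 u2 = 1"
    and c: "\<And>v. v \<in> words n \<Longrightarrow> v \<notin> {0, u1, u2, u1 + u2} \<Longrightarrow> sg n u1 v = 1 \<Longrightarrow> sg n u2 v = 1 \<Longrightarrow> g v = gc"
  shows "(\<Sum>v\<in>{v \<in> words n. sg n u1 v = 1 \<and> sg n u2 v = 1}. g v) =
    g 0 + g u1 + g u2 + g (u1 + u2) + (4^n / 4 - 4) * gc"
proof -
  let ?P = "{v \<in> words n. sg n u1 v = 1 \<and> sg n u2 v = 1}" and ?E = "{0, u1, u2, u1 + u2}"
  have E: "?E \<subseteq> ?P" using u s by (auto simp: sg_add_right sg_sym)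
  have ne: "u1 + u2 \<noteq> 0" "u1 + u2 \<noteq> u1" "u1 + u2 \<noteq> u2" using u by auto
  have d: "0 \<notin> {u1, u2, u1 + u2}" "u1 \<notin> {u2, u1 + u2}" "u2 \<notin> {u1 + u2}" using u ne by auto
  have cE: "card ?E = 4" using d by (simp add: card_insert_if)
  have "sum g ?P = sum g ?E + sum g (?P - ?E)" using sum.subset_diff[OF E, of g] by (simp add: add.commute)
  also have "sum g (?P - ?E) = (\<Sum>v\<in>?P - ?E. gc)" by (rule sum.cong[OF refl], rule c) auto
  also have "\<dots> = of_nat (card (?P - ?E)) * gc" by simp
  also have "of_nat (card (?P - ?E)) = (4^n / 4 - 4 :: complex)"
  proof -
    have "card (?P - ?E) + 4 = card ?P" using E cE card_mono[OF _ E] card_Diff_subset[of ?E ?P] by simp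
    then have "of_nat (card (?P - ?E) + 4) = (of_nat (card ?P) :: complex)" by (simp only:)
    then have "of_nat (card (?P - ?E)) + 4 = (4^n / 4 :: complex)"
      unfolding of_nat_add of_nat_numeral card_sg2[OF u pm_1(1) pm_1(1)] .
    then show ?thesis by (simp only: eq_diff_eq)
  qed
  also have "sum g ?E = g 0 + g u1 + g u2 + g (u1 + u2)"
    using d by (simp add: add_ac)
  finally show ?thesis .
qed

subsection \<open>Averages over the Clifford group\<close>

definition avg :: "nat \<Rightarrow> (complex mat \<Rightarrow> 'a::real_vector) \<Rightarrow> 'a" where
  "avg n f = (1 / real (card (clifford_group n))) *\<^sub>R (\<Sum>C\<in>clifford_group n. f C)"

lemma card_clifford_pos: "card (clifford_group n) > 0"
  using finite_clifford clifford_group.one[of n] card_gt_0_iff by blast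

lemma avg_const [simp]: "avg n (\<lambda>_. c) = c"
  using card_clifford_pos[of n] by (simp add: avg_def sum_constant_scaleR)

lemma avg_cong: "(\<And>C. C \<in> clifford_group n \<Longrightarrow> f C = g C) \<Longrightarrow> avg n f = avg n g"
  by (simp add: avg_def)

lemma avg_eq_const: "(\<And>C. C \<in> clifford_group n \<Longrightarrow> f C = c) \<Longrightarrow> avg n f = c"
  using avg_cong[of n f "\<lambda>_. c"] by simp

lemma avg_add: "avg n (\<lambda>C. f C + g C) = avg n f + avg n g"
  by (simp add: avg_def sum.distrib scaleR_add_right)

lemma avg_diff: "avg n (\<lambda>C. f C - g C) = avg n f - avg n g"
  by (simp add: avg_def sum_subtractf scaleR_diff_right)

lemma avg_sum: "avg n (\<lambda>C. \<Sum>i\<in>I. f i C) = (\<Sum>i\<in>I. avg n (f i))"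
  unfolding avg_def by (subst sum.swap) (simp add: scaleR_sum_right)

lemma avg_cmult: "avg n (\<lambda>C. (k::'a::real_algebra) * f C) = k * avg n f"
  by (simp add: avg_def sum_distrib_left)

lemma avg_shift:
  assumes "U \<in> clifford_group n"
  shows "avg n (\<lambda>C. f (U * C)) = avg n f"
proof -
  have "sum f (clifford_group n) = sum f ((\<lambda>C. U * C) ` clifford_group n)"
    using clifford_left_image[OF assms] by simp
  also have "\<dots> = (\<Sum>C\<in>clifford_group n. f (U * C))"
    by (subst sum.reindex[OF clifford_left_inj[OF assms]]) simp
  finally show ?thesis by (simp add: avg_def)
qed

definition cj :: "complex mat \<Rightarrow> complex mat \<Rightarrow> complex mat" where
  "cj C X = C * X * adj C"

lemma cj_carrier [simp]: "C \<in> carrier_mat d d \<Longrightarrow> X \<in> carrier_mat d d \<Longrightarrow> cj C X \<in> carrier_mat d d"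
  unfolding cj_def by (rule mult_carrier_mat[OF mult_carrier_mat adj_carrier])

lemma cj_mult:
  assumes "U \<in> carrier_mat d d" "C \<in> carrier_mat d d" "X \<in> carrier_mat d d"
  shows "cj (U * C) X = cj U (cj C X)"
  using conj_mult[OF adj_carrier[OF assms(2)] adj_carrier[OF assms(1)] assms(3)]
  unfolding cj_def adj_mult[OF assms(1,2), symmetric] adj_adj .

lemma mtrace_cj_mult:
  assumes "C \<in> carrier_mat d d" "X \<in> carrier_mat d d" "A \<in> carrier_mat d d"
  shows "mtrace (cj C X * A) = mtrace (X * (adj C * A * C))"
proof -
  have c: "adj C \<in> carrier_mat d d" "C * X \<in> carrier_mat d d" "adj C * A \<in> carrier_mat d d" using assms by auto
  have "cj C X * A = C * X * (adj C * A)" unfolding cj_def by (rule assoc_mult_mat[OF c(2,1) assms(3)])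
  also have "\<dots> = C * (X * (adj C * A))" by (rule assoc_mult_mat[OF assms(1,2) c(3)])
  finally have "mtrace (cj C X * A) = mtrace (C * (X * (adj C * A)))" by simp
  also have "\<dots> = mtrace ((X * (adj C * A)) * C)"
    by (rule mtrace_comm[OF assms(1) mult_carrier_mat[OF assms(2) c(3)]])
  also have "(X * (adj C * A)) * C = X * (adj C * A * C)" by (rule assoc_mult_mat[OF assms(2) c(3) assms(1)])
  finally show ?thesis .
qed

lemma mtrace_cj:
  assumes "C \<in> carrier_mat d d" "X \<in> carrier_mat d d" "adj C * C = 1\<^sub>m d"
  shows "mtrace (cj C X) = mtrace X"
  using mtrace_cj_mult[OF assms(1,2) one_carrier_mat] assms cj_carrier[OF assms(1,2)] by simp

lemma mtrace_acts:
  assumes "acts n C \<pi>" "u \<in> words n" "X \<in> carrier_mat (2^n) (2^n)"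
  shows "\<exists>e. pm e \<and> adj C * pauli n u * C = e \<cdot>\<^sub>m pauli n (\<pi> u) \<and>
    (\<forall>X\<in>carrier_mat (2^n) (2^n). mtrace (cj C X * pauli n u) = e * mtrace (X * pauli n (\<pi> u)))"
proof -
  obtain e where e: "pm e" "adj C * pauli n u * C = e \<cdot>\<^sub>m pauli n (\<pi> u)" using acts_conj[OF assms(1,2)] .
  have "mtrace (cj C X * pauli n u) = e * mtrace (X * pauli n (\<pi> u))" if "X \<in> carrier_mat (2^n) (2^n)" for X
    using mtrace_cj_mult[OF acts_carrier[OF assms(1)] that pauli_carrier] e(2)
      mult_smult_distrib[OF that pauli_carrier] mtrace_smult[OF mult_carrier_mat[OF that pauli_carrier]] by simp
  then show ?thesis using e by blast
qed

text \<open>Words with equal images would have proportional Pauli operators, contradicting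
  orthogonality of distinct Pauli operators under the trace.\<close>

lemma acts_inj:
  assumes "acts n C \<pi>"
  shows "inj_on \<pi> (words n)"
proof (rule inj_onI)
  fix u v assume uv: "u \<in> words n" "v \<in> words n" "\<pi> u = \<pi> v"
  note c = acts_carrier[OF assms]
  have CC: "C * adj C = 1\<^sub>m (2^n)"
    using mat_mult_left_right_inverse[of "adj C" "2^n" C] acts_unitary[OF assms] c by simp
  obtain e where e: "pm e" "adj C * pauli n u * C = e \<cdot>\<^sub>m pauli n (\<pi> u)" using acts_conj[OF assms uv(1)] .
  obtain e' where e': "pm e'" "adj C * pauli n v * C = e' \<cdot>\<^sub>m pauli n (\<pi> v)" using acts_conj[OF assms uv(2)] .
  have "adj C * pauli n u * C = (e * e') \<cdot>\<^sub>m (adj C * pauli n v * C)"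
    unfolding e(2) e'(2) smult_smult_mat uv(3) using e(1) e'(1) by (auto simp: pm_def)
  then have eq: "mtrace (cj C X * pauli n u) = (e * e') * mtrace (cj C X * pauli n v)" if "X \<in> carrier_mat (2^n) (2^n)" for X
  proof -
    assume e: "adj C * pauli n u * C = (e * e') \<cdot>\<^sub>m (adj C * pauli n v * C)"
    have M: "adj C * pauli n v * C \<in> carrier_mat (2^n) (2^n)"
      using c by (intro mult_carrier_mat[OF mult_carrier_mat[OF _ pauli_carrier]]) simp_all
    show ?thesis
      unfolding mtrace_cj_mult[OF c that pauli_carrier] e mult_smult_distrib[OF that M]
      by (rule mtrace_smult[OF mult_carrier_mat[OF that M]])
  qed
  have "mtrace (pauli n u * pauli n u) = (e * e') * mtrace (pauli n u * pauli n v)"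
  proof -
    have ac: "adj C \<in> carrier_mat (2^n) (2^n)" using c by simp
    have "cj C (cj (adj C) (pauli n u)) = cj (C * adj C) (pauli n u)"
      by (rule cj_mult[OF c ac pauli_carrier, symmetric])
    also have "\<dots> = pauli n u" unfolding CC cj_def by simp
    finally have k: "cj C (cj (adj C) (pauli n u)) = pauli n u" .
    show ?thesis using eq[OF cj_carrier[OF ac pauli_carrier[of n u]]] unfolding k .
  qed
  then have "phase n u v * mtrace (pauli n (u + v)) \<noteq> 0"
    by (auto simp: pauli_square pauli_mult mtrace_smult[OF pauli_carrier])
  then show "u = v" using mtrace_pauli[of "u + v" n] uv by (auto split: if_splits)
qed

lemma acts_sum:
  assumes "acts n C \<pi>"
  shows "(\<Sum>u\<in>words n. f (\<pi> u)) = (\<Sum>u\<in>words n. f u)"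
proof -
  have "\<pi> ` words n = words n"
    by (rule endo_inj_surj[OF finite_words _ acts_inj[OF assms]]) (use acts_words[OF assms] in auto)
  then show ?thesis using sum.reindex[OF acts_inj[OF assms], of f] by simp
qed

subsection \<open>Rank one families\<close>

text \<open>An abstraction of the family of the matrices \<open>|b\<^sub>j\<rangle>\<langle>a\<^sub>i|\<close> for vectors \<open>a\<^sub>i\<close>, \<open>b\<^sub>j\<close>: only
  the rule for collapsing a product is needed, and it is preserved by unitary conjugation.\<close>

type_synonym fam = "nat \<Rightarrow> nat \<Rightarrow> complex mat"

definition rank1 :: "nat \<Rightarrow> fam \<Rightarrow> bool" where
  "rank1 n X \<longleftrightarrow> (\<forall>i j. X i j \<in> carrier_mat (2^n) (2^n)) \<and>
    (\<forall>i j k l. \<forall>A\<in>carrier_mat (2^n) (2^n). X i j * A * X k l = mtrace (X i l * A) \<cdot>\<^sub>m X k j)"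

definition cjf :: "complex mat \<Rightarrow> fam \<Rightarrow> fam" where
  "cjf C X = (\<lambda>i j. cj C (X i j))"

definition reidx :: "(nat \<Rightarrow> nat) \<Rightarrow> fam \<Rightarrow> fam" where
  "reidx \<sigma> X = (\<lambda>i j. X (\<sigma> i) (\<sigma> j))"

lemma rank1_carrier: "rank1 n X \<Longrightarrow> X i j \<in> carrier_mat (2^n) (2^n)"
  by (simp add: rank1_def)

lemma rank1_collapse:
  "rank1 n X \<Longrightarrow> A \<in> carrier_mat (2^n) (2^n) \<Longrightarrow> X i j * A * X k l = mtrace (X i l * A) \<cdot>\<^sub>m X k j"
  by (simp add: rank1_def)

lemma rank1_reidx: "rank1 n X \<Longrightarrow> rank1 n (reidx \<sigma> X)"
  by (simp add: rank1_def reidx_def)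

lemma rank1_cjf:
  assumes X: "rank1 n X" and C: "C \<in> carrier_mat (2^n) (2^n)" "adj C * C = 1\<^sub>m (2^n)"
  shows "rank1 n (cjf C X)"
proof -
  have c: "cj C (X i j) \<in> carrier_mat (2^n) (2^n)" for i j using C rank1_carrier[OF X] by simp
  moreover have "cj C (X i j) * A * cj C (X k l) = mtrace (cj C (X i l) * A) \<cdot>\<^sub>m cj C (X k j)"
    if A: "A \<in> carrier_mat (2^n) (2^n)" for i j k l A
  proof -
    have aC: "adj C \<in> carrier_mat (2^n) (2^n)" using C by simp
    note x = rank1_carrier[OF X]
    have CX: "C * X a b \<in> carrier_mat (2^n) (2^n)" for a b using C(1) x by (rule mult_carrier_mat)
    have Xa: "X a b * adj C \<in> carrier_mat (2^n) (2^n)" for a b using x aC by (rule mult_carrier_mat)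
    have CXa: "C * X a b * adj C \<in> carrier_mat (2^n) (2^n)" for a b using CX aC by (rule mult_carrier_mat)
    have AC: "adj C * A \<in> carrier_mat (2^n) (2^n)" "adj C * A * C \<in> carrier_mat (2^n) (2^n)"
      using aC A C by (auto intro: mult_carrier_mat)
    have XA: "X i j * (adj C * A * C) \<in> carrier_mat (2^n) (2^n)" using x AC(2) by (rule mult_carrier_mat)
    have "cj C (X i j) * A * cj C (X k l) = (C * X i j * (adj C * A)) * (C * X k l * adj C)"
      unfolding cj_def assoc_mult_mat[OF CX aC A] ..
    also have "\<dots> = (C * X i j * (adj C * A)) * (C * (X k l * adj C))"
      unfolding assoc_mult_mat[OF C(1) x aC] ..
    also have "\<dots> = (C * X i j * (adj C * A)) * C * (X k l * adj C)"
      by (rule assoc_mult_mat[OF mult_carrier_mat[OF CX AC(1)] C(1) Xa, symmetric])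
    also have "(C * X i j * (adj C * A)) * C = C * X i j * (adj C * A * C)"
      by (rule assoc_mult_mat[OF CX AC(1) C(1)])
    also have "\<dots> = C * (X i j * (adj C * A * C))"
      by (rule assoc_mult_mat[OF C(1) x AC(2)])
    also have "C * (X i j * (adj C * A * C)) * (X k l * adj C) = C * (X i j * (adj C * A * C) * (X k l * adj C))"
      by (rule assoc_mult_mat[OF C(1) XA Xa])
    also have "X i j * (adj C * A * C) * (X k l * adj C) = X i j * (adj C * A * C) * X k l * adj C"
      by (rule assoc_mult_mat[OF XA x aC, symmetric])
    also have "X i j * (adj C * A * C) * X k l = mtrace (X i l * (adj C * A * C)) \<cdot>\<^sub>m X k j"
      by (rule rank1_collapse[OF X AC(2)])
    also have "mtrace (X i l * (adj C * A * C)) = mtrace (cj C (X i l) * A)"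
      by (rule mtrace_cj_mult[OF C(1) x A, symmetric])
    also have "C * (mtrace (cj C (X i l) * A) \<cdot>\<^sub>m X k j * adj C) = mtrace (cj C (X i l) * A) \<cdot>\<^sub>m (C * (X k j * adj C))"
      unfolding mult_smult_assoc_mat[OF x aC] by (rule mult_smult_distrib[OF C(1) Xa])
    also have "C * (X k j * adj C) = cj C (X k j)"
      unfolding cj_def by (rule assoc_mult_mat[OF C(1) x aC, symmetric])
    finally show ?thesis .
  qed
  ultimately show ?thesis by (simp add: rank1_def cjf_def)
qed

abbreviation (input) "gg X i j \<equiv> mtrace (X i j)"

definition ee :: "nat \<Rightarrow> fam \<Rightarrow> nat \<Rightarrow> nat \<Rightarrow> word \<Rightarrow> complex" where
  "ee n X i j u = mtrace (X i j * pauli n u)"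

text \<open>For X i j = |b_j><a_i|, \<open>ee n X i j u\<close> is <a_i|P_u|b_j>, and
  \<open>pp\<close> pairs the bras 0, 1, 2, 3 with the kets a, b, c, e. Varying the kets permutes
  the tensor factors against the sum of P tensored four times.\<close>

definition pp :: "nat \<Rightarrow> fam \<Rightarrow> nat \<Rightarrow> nat \<Rightarrow> nat \<Rightarrow> nat \<Rightarrow> complex" where
  "pp n X a b c e = (\<Sum>u\<in>words n. ee n X 0 a u * ee n X 1 b u * ee n X 2 c u * ee n X 3 e u)"

lemma trace_sandwich:
  assumes "rank1 n X" "A \<in> carrier_mat (2^n) (2^n)" "B \<in> carrier_mat (2^n) (2^n)"
  shows "mtrace (X i j * A * (X k l * B)) = mtrace (X i l * A) * mtrace (X k j * B)"
proof -
  note x = rank1_carrier[OF assms(1)]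
  have "X i j * A * (X k l * B) = X i j * A * X k l * B"
    by (rule assoc_mult_mat[OF mult_carrier_mat[OF x assms(2)] x assms(3), symmetric])
  also have "\<dots> = mtrace (X i l * A) \<cdot>\<^sub>m (X k j * B)"
    unfolding rank1_collapse[OF assms(1,2)] by (rule mult_smult_assoc_mat[OF x assms(3)])
  finally show ?thesis using mtrace_smult[OF mult_carrier_mat[OF x assms(3)]] by simp
qed

lemma trace_product:
  assumes "rank1 n X"
  shows "mtrace (X i j * X k l) = gg X i l * gg X k j"
  using trace_sandwich[OF assms one_carrier_mat one_carrier_mat, of i j k l]
    right_mult_one_mat[OF rank1_carrier[OF assms]] by simp

lemma sum_right:
  assumes X: "rank1 n X" and M: "M \<in> carrier_mat (2^n) (2^n)"
  shows "(\<Sum>u\<in>words n. ee n X i j u * mtrace (X k l * (M * pauli n u))) = 2^n * (gg X i l * mtrace (X k j * M))"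
proof -
  note x = rank1_carrier[OF X]
  have XM: "X k l * M \<in> carrier_mat (2^n) (2^n)" using x M by (rule mult_carrier_mat)
  have "(\<Sum>u\<in>words n. ee n X i j u * mtrace (X k l * (M * pauli n u))) =
      (\<Sum>u\<in>words n. mtrace (X i j * pauli n u) * mtrace (X k l * M * pauli n u))"
    unfolding assoc_mult_mat[OF x M pauli_carrier] ee_def ..
  also have "\<dots> = 2^n * mtrace (X i j * (X k l * M))"
    by (rule sum_pauli_trace[OF x XM])
  also have "mtrace (X i j * (X k l * M)) = gg X i l * mtrace (X k j * M)"
    using trace_sandwich[OF X one_carrier_mat M, of i j k l] right_mult_one_mat[OF x] by simp
  finally show ?thesis .
qed

text \<open>Cycling the trace brings the enclosed Pauli operator to the end; the swap identity then
  separates what stood to its left from what stood to its right.\<close>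

lemma sum_middle:
  assumes X: "rank1 n X" and M: "M \<in> carrier_mat (2^n) (2^n)" "M' \<in> carrier_mat (2^n) (2^n)"
  shows "(\<Sum>u\<in>words n. ee n X i j u * mtrace (X k l * (M * (pauli n u * M')))) =
    2^n * (mtrace (X i l * M') * mtrace (X k j * M))"
proof -
  note x = rank1_carrier[OF X]
  have c: "M' * (X k l * M) \<in> carrier_mat (2^n) (2^n)" using x M by (intro mult_carrier_mat)
  have e: "mtrace (X k l * (M * (pauli n u * M'))) = mtrace (M' * (X k l * M) * pauli n u)" for u
  proof -
    have PM: "pauli n u * M' \<in> carrier_mat (2^n) (2^n)" using M(2) by (rule mult_carrier_mat[OF pauli_carrier])
    have XM: "X k l * M \<in> carrier_mat (2^n) (2^n)" using x M(1) by (rule mult_carrier_mat)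
    have XMP: "X k l * M * pauli n u \<in> carrier_mat (2^n) (2^n)" using XM pauli_carrier by (rule mult_carrier_mat)
    have "X k l * (M * (pauli n u * M')) = X k l * M * (pauli n u * M')"
      by (rule assoc_mult_mat[OF x M(1) PM, symmetric])
    also have "\<dots> = X k l * M * pauli n u * M'" by (rule assoc_mult_mat[OF XM pauli_carrier M(2), symmetric])
    finally have "mtrace (X k l * (M * (pauli n u * M'))) = mtrace (M' * (X k l * M * pauli n u))"
      using mtrace_comm[OF XMP M(2)] by simp
    also have "M' * (X k l * M * pauli n u) = M' * (X k l * M) * pauli n u"
      by (rule assoc_mult_mat[OF M(2) XM pauli_carrier, symmetric])
    finally show ?thesis .
  qed
  have "(\<Sum>u\<in>words n. ee n X i j u * mtrace (X k l * (M * (pauli n u * M')))) =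
     2^n * mtrace (X i j * (M' * (X k l * M)))"
    unfolding e ee_def by (rule sum_pauli_trace[OF x c])
  also have "X i j * (M' * (X k l * M)) = X i j * M' * (X k l * M)"
    by (rule assoc_mult_mat[OF x M(2) mult_carrier_mat[OF x M(1)], symmetric])
  finally show ?thesis using trace_sandwich[OF X M(2,1)] by simp
qed

lemma sum_ee_ee: "rank1 n X \<Longrightarrow> (\<Sum>u\<in>words n. ee n X i j u * ee n X k l u) = 2^n * (gg X i l * gg X k j)"
  using sum_pauli_trace[OF rank1_carrier rank1_carrier, of n X X i j k l] trace_product[of n X i j k l]
  by (simp add: ee_def)

text \<open>The sign turns P_v into P_u P_v P_u. The swap from summing over v then exchanges the two
  kets and leaves one P_u in each factor.\<close>

lemma sum_sg_ee:
  assumes X: "rank1 n X"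
  shows "(\<Sum>v\<in>words n. sg n u v * (ee n X i j v * ee n X k l v)) = 2^n * (ee n X i l u * ee n X k j u)"
proof -
  note x = rank1_carrier[OF X]
  have "sg n u v * (ee n X i j v * ee n X k l v) = ee n X i j v * mtrace (X k l * (pauli n u * (pauli n v * pauli n u)))" for v
  proof -
    have "pauli n u * (pauli n v * pauli n u) = pauli n u * (sg n u v \<cdot>\<^sub>m (pauli n u * pauli n v))"
      using pauli_commute[of n v u] by (simp add: sg_sym)
    also have "\<dots> = sg n u v \<cdot>\<^sub>m (pauli n u * (pauli n u * pauli n v))"
      by (rule mult_smult_distrib[OF pauli_carrier mult_carrier_mat[OF pauli_carrier pauli_carrier]])
    also have "pauli n u * (pauli n u * pauli n v) = pauli n v"
      unfolding assoc_mult_mat[OF pauli_carrier pauli_carrier pauli_carrier, symmetric] pauli_square by simp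
    finally have "mtrace (X k l * (pauli n u * (pauli n v * pauli n u))) = sg n u v * ee n X k l v"
      by (simp add: mult_smult_distrib[OF x pauli_carrier] mtrace_smult[OF mult_carrier_mat[OF x pauli_carrier]] ee_def)
    then show ?thesis by simp
  qed
  then show ?thesis using sum_middle[OF X pauli_carrier pauli_carrier, of i j k l u u] by (simp only: ee_def)
qed

subsection \<open>Fourfold Clifford averages of Pauli operators\<close>

text \<open>The fourth Pauli operator is taken to be the product of the other three. This makes \<open>phi\<close>
  insensitive to the signs of the three others, so that only words, not signed operators, matter.\<close>

definition phi :: "nat \<Rightarrow> fam \<Rightarrow> word \<Rightarrow> word \<Rightarrow> word \<Rightarrow> complex" where
  "phi n X u v w = ee n X 0 0 u * ee n X 1 1 v * ee n X 2 2 w *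
     mtrace (X 3 3 * (pauli n w * (pauli n v * pauli n u)))"

definition FF :: "nat \<Rightarrow> fam \<Rightarrow> word \<Rightarrow> word \<Rightarrow> word \<Rightarrow> complex" where
  "FF n X u v w = avg n (\<lambda>C. phi n (cjf C X) u v w)"

lemma pauli_cancel [simp]: "pauli n u * (pauli n u * pauli n v) = pauli n v"
  unfolding assoc_mult_mat[OF pauli_carrier pauli_carrier pauli_carrier, symmetric] pauli_square by simp

lemma pauli_mult_0 [simp]: "pauli n 0 * pauli n u = pauli n u" "pauli n u * pauli n 0 = pauli n u"
  unfolding pauli_0 by simp_all

text \<open>Each of the three words contributes its sign twice, once in its own factor and once in
  the product, so all signs cancel.\<close>

lemma phi_acts:
  assumes C: "acts n C \<pi>" and X: "\<And>i j. X i j \<in> carrier_mat (2^n) (2^n)"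
    and u: "u \<in> words n" "v \<in> words n" "w \<in> words n"
  shows "phi n (cjf C X) u v w = phi n X (\<pi> u) (\<pi> v) (\<pi> w)"
proof -
  note c = acts_carrier[OF C]
  obtain e1 where e1: "pm e1" "adj C * pauli n u * C = e1 \<cdot>\<^sub>m pauli n (\<pi> u)"
    "\<And>Y. Y \<in> carrier_mat (2^n) (2^n) \<Longrightarrow> mtrace (cj C Y * pauli n u) = e1 * mtrace (Y * pauli n (\<pi> u))"
    using mtrace_acts[OF C u(1) X] by blast
  obtain e2 where e2: "pm e2" "adj C * pauli n v * C = e2 \<cdot>\<^sub>m pauli n (\<pi> v)"
    "\<And>Y. Y \<in> carrier_mat (2^n) (2^n) \<Longrightarrow> mtrace (cj C Y * pauli n v) = e2 * mtrace (Y * pauli n (\<pi> v))"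
    using mtrace_acts[OF C u(2) X] by blast
  obtain e3 where e3: "pm e3" "adj C * pauli n w * C = e3 \<cdot>\<^sub>m pauli n (\<pi> w)"
    "\<And>Y. Y \<in> carrier_mat (2^n) (2^n) \<Longrightarrow> mtrace (cj C Y * pauli n w) = e3 * mtrace (Y * pauli n (\<pi> w))"
    using mtrace_acts[OF C u(3) X] by blast
  have CC: "C * adj C = 1\<^sub>m (2^n)"
    using mat_mult_left_right_inverse[OF adj_carrier[OF c] c] acts_unitary[OF C] by simp
  have prod: "adj C * (A * B) * C = (adj C * A * C) * (adj C * B * C)"
    if A: "A \<in> carrier_mat (2^n) (2^n)" and B: "B \<in> carrier_mat (2^n) (2^n)" for A B
  proof -
    note ac = adj_carrier[OF c]
    have 1: "adj C * A \<in> carrier_mat (2^n) (2^n)" "adj C * B \<in> carrier_mat (2^n) (2^n)" "B * C \<in> carrier_mat (2^n) (2^n)"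
      "adj C * (B * C) \<in> carrier_mat (2^n) (2^n)" "A * C \<in> carrier_mat (2^n) (2^n)"
      using ac A B c by (auto intro!: mult_carrier_mat)
    have "(adj C * A * C) * (adj C * B * C) = (adj C * A) * (C * (adj C * B * C))"
      by (rule assoc_mult_mat[OF 1(1) c mult_carrier_mat[OF 1(2) c]])
    also have "C * (adj C * B * C) = C * (adj C * (B * C))"
      by (simp only: assoc_mult_mat[OF ac B c])
    also have "\<dots> = (C * adj C) * (B * C)" by (rule assoc_mult_mat[OF c ac 1(3), symmetric])
    also have "\<dots> = B * C" unfolding CC by (rule left_mult_one_mat[OF 1(3)])
    also have "(adj C * A) * (B * C) = (adj C * A) * B * C" by (rule assoc_mult_mat[OF 1(1) B c, symmetric])
    also have "(adj C * A) * B = adj C * (A * B)" by (rule assoc_mult_mat[OF ac A B])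
    finally show ?thesis by simp
  qed
  have P: "pauli n v * pauli n u \<in> carrier_mat (2^n) (2^n)" "pauli n (\<pi> v) * pauli n (\<pi> u) \<in> carrier_mat (2^n) (2^n)"
     "pauli n (\<pi> w) * (pauli n (\<pi> v) * pauli n (\<pi> u)) \<in> carrier_mat (2^n) (2^n)"
    by (auto intro!: mult_carrier_mat[OF pauli_carrier])
  have "adj C * (pauli n w * (pauli n v * pauli n u)) * C =
     (e3 \<cdot>\<^sub>m pauli n (\<pi> w)) * ((e2 \<cdot>\<^sub>m pauli n (\<pi> v)) * (e1 \<cdot>\<^sub>m pauli n (\<pi> u)))"
    unfolding prod[OF pauli_carrier P(1)] prod[OF pauli_carrier pauli_carrier] e1(2) e2(2) e3(2) ..
  also have "\<dots> = (e3 * (e2 * e1)) \<cdot>\<^sub>m (pauli n (\<pi> w) * (pauli n (\<pi> v) * pauli n (\<pi> u)))"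
    unfolding smult_mult_smult[OF pauli_carrier pauli_carrier] by (rule smult_mult_smult[OF pauli_carrier P(2)])
  finally have "mtrace (cj C (X 3 3) * (pauli n w * (pauli n v * pauli n u))) =
     (e3 * (e2 * e1)) * mtrace (X 3 3 * (pauli n (\<pi> w) * (pauli n (\<pi> v) * pauli n (\<pi> u))))"
    unfolding mtrace_cj_mult[OF c X mult_carrier_mat[OF pauli_carrier P(1)]]
    using mult_smult_distrib[OF X P(3)] mtrace_smult[OF mult_carrier_mat[OF X P(3)]] by simp
  then have "phi n (cjf C X) u v w = (e1 * e1) * (e2 * e2) * (e3 * e3) * phi n X (\<pi> u) (\<pi> v) (\<pi> w)"
    by (simp add: phi_def cjf_def ee_def e1(3)[OF X] e2(3)[OF X] e3(3)[OF X] mult_ac)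
  also have "(e1 * e1) * (e2 * e2) * (e3 * e3) = 1" using e1(1) e2(1) e3(1) by (auto simp: pm_def)
  finally show ?thesis by simp
qed

text \<open>Left invariance of the average lets C be replaced by g * C for a Clifford unitary g
  inducing the transvection, and g then acts on the words alone.\<close>

lemma FF_tv:
  assumes X: "\<And>i j. X i j \<in> carrier_mat (2^n) (2^n)" and w: "w \<in> words n" "w \<noteq> 0"
    and u: "u1 \<in> words n" "u2 \<in> words n" "u3 \<in> words n"
  shows "FF n X (tv n w u1) (tv n w u2) (tv n w u3) = FF n X u1 u2 u3"
proof -
  obtain g where g: "g \<in> clifford_group n" "acts n g (tv n w)" using clifford_transvection[OF w] .
  have "FF n X u1 u2 u3 = avg n (\<lambda>C. phi n (cjf (g * C) X) u1 u2 u3)"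
    unfolding FF_def by (rule avg_shift[OF g(1), symmetric])
  also have "\<dots> = avg n (\<lambda>C. phi n (cjf C X) (tv n w u1) (tv n w u2) (tv n w u3))"
  proof (rule avg_cong)
    fix C assume C: "C \<in> clifford_group n"
    have "cjf (g * C) X = cjf g (cjf C X)"
      using cj_mult[OF clifford_carrier[OF g(1)] clifford_carrier[OF C] X] by (simp add: cjf_def)
    moreover have "cjf C X i j \<in> carrier_mat (2^n) (2^n)" for i j
      using clifford_carrier[OF C] X by (simp add: cjf_def)
    ultimately show "phi n (cjf (g * C) X) u1 u2 u3 = phi n (cjf C X) (tv n w u1) (tv n w u2) (tv n w u3)"
      using phi_acts[OF g(2) _ u, of "cjf C X"] by simp
  qed
  finally show ?thesis by (simp add: FF_def)
qed

lemma FF_isoms: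
  assumes h: "h \<in> isoms n" and X: "rank1 n X"
    and u: "u1 \<in> words n" "u2 \<in> words n" "u3 \<in> words n"
  shows "FF n X (h u1) (h u2) (h u3) = FF n X u1 u2 u3"
  using h
proof (induction rule: isoms.induct)
  case (isoms_step h w)
  then show ?case
    using FF_tv[OF rank1_carrier[OF X] isoms_step(2,3)] u isoms_words[OF isoms_step(1)] by simp
qed simp

section \<open>Values of invariant functions on orbits, obtained from their sums\<close>

lemma sum_isoms:
  assumes "h \<in> isoms n"
  shows "(\<Sum>u\<in>words n. f (h u)) = (\<Sum>u\<in>words n. f u)"
proof -
  have inj: "inj_on h (words n)" using isoms_eq[OF assms] by (auto intro: inj_onI)
  have "h ` words n = words n"
    by (rule endo_inj_surj[OF finite_words _ inj]) (use isoms_words[OF assms] in auto)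
  then show ?thesis using sum.reindex[OF inj, of f] by simp
qed

lemma four_pow: "(4::complex) ^ n = 2 ^ n * 2 ^ n"
  by (simp add: power_mult_distrib[symmetric])

text \<open>By \<open>witt_1\<close> the nonzero words form a single orbit, of 4^n - 1
  elements.\<close>

lemma single_value:
  assumes "\<And>h u. h \<in> isoms n \<Longrightarrow> u \<in> words n \<Longrightarrow> G (h u) = G u" and u: "u0 \<in> words n" "u0 \<noteq> 0"
  shows "(4^n - 1) * G u0 = (\<Sum>u\<in>words n. G u) - (G 0 :: complex)"
proof -
  have "(\<Sum>u\<in>words n. G u) = G 0 + (\<Sum>u\<in>words n - {0}. G u)"
    by (subst sum.remove[of _ 0]) auto
  also have "(\<Sum>u\<in>words n - {0}. G u) = (\<Sum>u\<in>words n - {0}. G u0)"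
  proof (intro sum.cong refl)
    fix u assume "u \<in> words n - {0}"
    then obtain h where "h \<in> isoms n" "h u0 = u" using witt_1 u by blast
    then show "G u = G u0" using assms(1) u by metis
  qed
  also have "\<dots> = (4^n - 1) * G u0" by (simp add: card_Diff_subset card_words of_nat_diff)
  finally show ?thesis by simp
qed

text \<open>Degenerate commuting pairs satisfy u = 0, v = 0 or u = v. These three sets meet only in
  (0, 0), which is subtracted three times instead of once, hence the correction 2 * G 0 0.\<close>

lemma pair_value_comm:
  fixes G :: "word \<Rightarrow> word \<Rightarrow> complex"
  assumes inv: "\<And>h u v. h \<in> isoms n \<Longrightarrow> u \<in> words n \<Longrightarrow> v \<in> words n \<Longrightarrow> G (h u) (h v) = G u v"
    and u: "u0 \<in> words n" "v0 \<in> words n" "u0 \<noteq> 0" "v0 \<noteq> 0" "u0 \<noteq> v0" "sg n u0 v0 = 1"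
  shows "(4^n - 1) * (4^n / 2 - 2) * G u0 v0 =
    (\<Sum>u\<in>words n. \<Sum>v\<in>words n. (1 + sg n u v) / 2 * G u v) - (\<Sum>u\<in>words n. G u 0) - (\<Sum>v\<in>words n. G 0 v)
    - (\<Sum>u\<in>words n. G u u) + 2 * G 0 0"
proof -
  have in1: "(\<Sum>v\<in>words n. (1 + sg n u v) / 2 * G u v) = G u 0 + G u u + (4^n / 2 - 2) * G u0 v0"
    if "u \<in> words n - {0}" for u
  proof -
    have uu: "u \<in> words n" "u \<noteq> 0" using that by auto
    have "(\<Sum>v\<in>words n. (1 + sg n u v) / 2 * G u v) = (1 + sg n u 0) / 2 * G u 0 + (1 + sg n u u) / 2 * G u u
      + (4^n / 2 - 2) * G u0 v0 + (4^n / 2) * 0"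
    proof (rule sum_given_1[OF uu])
      fix v assume v: "v \<in> words n" "v \<noteq> 0" "v \<noteq> u" "sg n u v = 1"
      then obtain h where "h \<in> isoms n" "h u0 = u" "h v0 = v"
        using witt_2[OF u(1,2) uu(1) v(1)] u uu by auto
      then show "(1 + sg n u v) / 2 * G u v = G u0 v0" using inv[of h u0 v0] u v by simp
    qed simp
    then show ?thesis by simp
  qed
  have c: "of_nat (card (words n - {0})) = (4^n - 1 :: complex)" by (simp add: card_Diff_subset card_words of_nat_diff)
  have r: "(\<Sum>u\<in>words n. f u) = f 0 + (\<Sum>u\<in>words n - {0}. f u)" for f :: "word \<Rightarrow> complex"
    by (rule sum.remove) auto
  have "(\<Sum>u\<in>words n. \<Sum>v\<in>words n. (1 + sg n u v) / 2 * G u v) =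
    (\<Sum>v\<in>words n. G 0 v) + (\<Sum>u\<in>words n - {0}. G u 0 + G u u + (4^n / 2 - 2) * G u0 v0)"
    unfolding r[of "\<lambda>u. \<Sum>v\<in>words n. (1 + sg n u v) / 2 * G u v"]
    by (rule arg_cong2[where f="(+)"], simp, rule sum.cong[OF refl in1])
  also have "\<dots> = (\<Sum>v\<in>words n. G 0 v) + ((\<Sum>u\<in>words n - {0}. G u 0) + (\<Sum>u\<in>words n - {0}. G u u) + (4^n - 1) * ((4^n / 2 - 2) * G u0 v0))"
    unfolding sum.distrib sum_constant c by simp
  finally show ?thesis unfolding r[of "\<lambda>u. G u 0"] r[of "\<lambda>u. G u u"] by (simp add: algebra_simps)
qed

text \<open>Anticommuting words are automatically nonzero and distinct, so no degenerate pairs have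
  to be subtracted.\<close>

lemma pair_value_anti:
  fixes G :: "word \<Rightarrow> word \<Rightarrow> complex"
  assumes inv: "\<And>h u v. h \<in> isoms n \<Longrightarrow> u \<in> words n \<Longrightarrow> v \<in> words n \<Longrightarrow> G (h u) (h v) = G u v"
    and u: "u0 \<in> words n" "v0 \<in> words n" "sg n u0 v0 = -1"
  shows "(4^n - 1) * (4^n / 2) * G u0 v0 = (\<Sum>u\<in>words n. \<Sum>v\<in>words n. (1 - sg n u v) / 2 * G u v)"
proof -
  have ne: "u0 \<noteq> 0" "v0 \<noteq> 0" "u0 \<noteq> v0" using u(3) by auto
  have in1: "(\<Sum>v\<in>words n. (1 - sg n u v) / 2 * G u v) = (4^n / 2) * G u0 v0"
    if "u \<in> words n - {0}" for u
  proof -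
    have uu: "u \<in> words n" "u \<noteq> 0" using that by auto
    have "(\<Sum>v\<in>words n. (1 - sg n u v) / 2 * G u v) = (1 - sg n u 0) / 2 * G u 0 + (1 - sg n u u) / 2 * G u u
      + (4^n / 2 - 2) * 0 + (4^n / 2) * G u0 v0"
    proof (rule sum_given_1[OF uu])
      fix v assume v: "v \<in> words n" "sg n u v = -1"
      then have "v \<noteq> 0" "v \<noteq> u" by auto
      then obtain h where "h \<in> isoms n" "h u0 = u" "h v0 = v"
        using witt_2[OF u(1,2) uu(1) v(1)] u ne uu v by auto
      then show "(1 - sg n u v) / 2 * G u v = G u0 v0" using inv[of h u0 v0] u v by simp
    qed simp
    then show ?thesis by simp
  qed
  have c: "of_nat (card (words n - {0})) = (4^n - 1 :: complex)" by (simp add: card_Diff_subset card_words of_nat_diff)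
  have "(\<Sum>u\<in>words n. \<Sum>v\<in>words n. (1 - sg n u v) / 2 * G u v) =
    (\<Sum>v\<in>words n. (1 - sg n 0 v) / 2 * G 0 v) + (\<Sum>u\<in>words n - {0}. \<Sum>v\<in>words n. (1 - sg n u v) / 2 * G u v)"
    by (rule sum.remove) auto
  also have "(\<Sum>u\<in>words n - {0}. \<Sum>v\<in>words n. (1 - sg n u v) / 2 * G u v) = (\<Sum>u\<in>words n - {0}. (4^n / 2) * G u0 v0)"
    by (rule sum.cong[OF refl in1])
  also have "\<dots> = (4^n - 1) * ((4^n / 2) * G u0 v0)" by (simp only: sum_constant c)
  finally show ?thesis by simp
qed

subsection \<open>Character sums\<close>

lemma ee_0 [simp]: "rank1 n X \<Longrightarrow> ee n X i j 0 = gg X i j"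
  unfolding ee_def pauli_0 by (simp add: right_mult_one_mat[OF rank1_carrier])

lemma phi_uuv: "phi n X u u v = ee n X 0 0 u * ee n X 1 1 u * (ee n X 2 2 v * ee n X 3 3 v)"
  by (simp add: phi_def pauli_square ee_def)

lemma phi_uvv: "phi n X u v v = ee n X 0 0 u * ee n X 3 3 u * (ee n X 1 1 v * ee n X 2 2 v)"
  by (simp add: phi_def ee_def)

lemma mtrace_pauli_swap:
  assumes "Y \<in> carrier_mat (2^n) (2^n)"
  shows "mtrace (Y * (pauli n u * pauli n v)) = sg n u v * mtrace (Y * (pauli n v * pauli n u))"
  unfolding pauli_commute[of n u v]
  using mult_smult_distrib[OF assms mult_carrier_mat[OF pauli_carrier pauli_carrier]]
    mtrace_smult[OF mult_carrier_mat[OF assms mult_carrier_mat[OF pauli_carrier pauli_carrier]]] by simp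

lemma phi_uvu:
  assumes "rank1 n X"
  shows "phi n X u v u = sg n u v * (ee n X 0 0 u * ee n X 2 2 u * (ee n X 1 1 v * ee n X 3 3 v))"
proof -
  have "mtrace (X 3 3 * (pauli n u * (pauli n v * pauli n u))) = sg n u v * ee n X 3 3 v"
  proof -
    have "pauli n u * (pauli n v * pauli n u) = pauli n u * (sg n u v \<cdot>\<^sub>m (pauli n u * pauli n v))"
      using pauli_commute[of n v u] by (simp add: sg_sym)
    also have "\<dots> = sg n u v \<cdot>\<^sub>m pauli n v"
      using mult_smult_distrib[OF pauli_carrier mult_carrier_mat[OF pauli_carrier pauli_carrier]] by simp
    finally show ?thesis
      using mult_smult_distrib[OF rank1_carrier[OF assms] pauli_carrier]
        mtrace_smult[OF mult_carrier_mat[OF rank1_carrier[OF assms] pauli_carrier]] by (simp add: ee_def)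
  qed
  then show ?thesis by (simp add: phi_def mult_ac)
qed

lemma phi_sum_pauli:
  assumes "rank1 n X"
  shows "phi n X u v (u + v) = ee n X 0 0 u * ee n X 1 1 v * mtrace (X 2 2 * (pauli n v * pauli n u)) * gg X 3 3"
proof -
  note x = rank1_carrier[OF assms]
  have vu: "pauli n v * pauli n u = phase n v u \<cdot>\<^sub>m pauli n (u + v)" by (simp add: pauli_mult add.commute)
  have a: "mtrace (X 2 2 * (pauli n v * pauli n u)) = phase n v u * ee n X 2 2 (u + v)"
    unfolding vu ee_def using mult_smult_distrib[OF x pauli_carrier] mtrace_smult[OF mult_carrier_mat[OF x pauli_carrier]] by simp
  have "pauli n (u + v) * (pauli n v * pauli n u) = phase n v u \<cdot>\<^sub>m 1\<^sub>m (2^n)"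
    unfolding vu using mult_smult_distrib[OF pauli_carrier pauli_carrier] by (simp add: pauli_square)
  then have "mtrace (X 3 3 * (pauli n (u + v) * (pauli n v * pauli n u))) = phase n v u * gg X 3 3"
    using mult_smult_distrib[OF x one_carrier_mat] right_mult_one_mat[OF x] mtrace_smult[OF x] by simp
  then show ?thesis using a by (simp add: phi_def mult_ac)
qed

lemma sum2_uv:
  assumes "rank1 n X"
  shows "(\<Sum>u\<in>words n. \<Sum>v\<in>words n. phi n X u u v) = 4^n * (gg X 0 1 * gg X 1 0 * (gg X 2 3 * gg X 3 2))"
proof -
  have "(\<Sum>u\<in>words n. \<Sum>v\<in>words n. phi n X u u v) =
    (\<Sum>u\<in>words n. ee n X 0 0 u * ee n X 1 1 u) * (\<Sum>v\<in>words n. ee n X 2 2 v * ee n X 3 3 v)"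
    by (simp add: phi_uuv sum_product)
  then show ?thesis by (simp add: sum_ee_ee[OF assms] four_pow mult_ac)
qed

lemma sum2_sg:
  assumes "rank1 n X"
  shows "(\<Sum>u\<in>words n. \<Sum>v\<in>words n. sg n u v * phi n X u u v) = 2^n * pp n X 0 1 3 2"
proof -
  have "(\<Sum>u\<in>words n. \<Sum>v\<in>words n. sg n u v * phi n X u u v) =
    (\<Sum>u\<in>words n. ee n X 0 0 u * ee n X 1 1 u * (\<Sum>v\<in>words n. sg n u v * (ee n X 2 2 v * ee n X 3 3 v)))"
    by (simp add: phi_uuv sum_distrib_left mult_ac)
  then show ?thesis by (simp add: sum_sg_ee[OF assms] pp_def sum_distrib_left mult_ac)
qed

lemma sum2_three:
  assumes "rank1 n X"
  shows "(\<Sum>u\<in>words n. \<Sum>v\<in>words n. ee n X i i u * ee n X j j v * mtrace (X k k * (pauli n v * pauli n u)))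
    = 4^n * (gg X i k * gg X j i * gg X k j)"
proof -
  have "(\<Sum>u\<in>words n. \<Sum>v\<in>words n. ee n X i i u * ee n X j j v * mtrace (X k k * (pauli n v * pauli n u))) =
    (\<Sum>v\<in>words n. ee n X j j v * (\<Sum>u\<in>words n. ee n X i i u * mtrace (X k k * (pauli n v * pauli n u))))"
    by (subst sum.swap) (simp add: sum_distrib_left mult_ac)
  also have "\<dots> = (\<Sum>v\<in>words n. ee n X j j v * (2^n * (gg X i k * ee n X k i v)))"
    by (simp only: sum_right[OF assms pauli_carrier] ee_def[of n X k i])
  also have "\<dots> = 2^n * gg X i k * (\<Sum>v\<in>words n. ee n X j j v * ee n X k i v)"
    by (simp add: sum_distrib_left mult_ac)
  finally show ?thesis by (simp add: sum_ee_ee[OF assms] four_pow mult_ac)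
qed

text \<open>The two 3-cycles on the factors i, j, k, one for each order of the two Pauli operators
  in the factor k; the projection onto commuting pairs averages them.\<close>

definition t3c :: "nat \<Rightarrow> fam \<Rightarrow> nat \<Rightarrow> nat \<Rightarrow> nat \<Rightarrow> complex" where
  "t3c n X i j k = 4^n / 2 * (gg X i k * gg X j i * gg X k j + gg X j k * gg X i j * gg X k i)"

lemma sum2_three_comm:
  assumes "rank1 n X"
  shows "(\<Sum>u\<in>words n. \<Sum>v\<in>words n. (1 + sg n u v) / 2 * (ee n X i i u * ee n X j j v * mtrace (X k k * (pauli n v * pauli n u))))
    = t3c n X i j k"
proof -
  have "(\<Sum>u\<in>words n. \<Sum>v\<in>words n. (1 + sg n u v) / 2 * (ee n X i i u * ee n X j j v * mtrace (X k k * (pauli n v * pauli n u)))) =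
   ((\<Sum>u\<in>words n. \<Sum>v\<in>words n. ee n X i i u * ee n X j j v * mtrace (X k k * (pauli n v * pauli n u))) +
    (\<Sum>u\<in>words n. \<Sum>v\<in>words n. ee n X i i u * ee n X j j v * mtrace (X k k * (pauli n u * pauli n v)))) / 2"
  proof -
    have "(1 + sg n u v) / 2 * (ee n X i i u * ee n X j j v * mtrace (X k k * (pauli n v * pauli n u))) =
       (ee n X i i u * ee n X j j v * mtrace (X k k * (pauli n v * pauli n u)) +
        ee n X i i u * ee n X j j v * mtrace (X k k * (pauli n u * pauli n v))) / 2" for u v
    proof -
      have "(1 + s) / 2 * (a * b * m) = (a * b * m + a * b * (s * m)) / 2" for s a b m :: complex by (simp add: field_simps)
      then show ?thesis using mtrace_pauli_swap[OF rank1_carrier[OF assms], of k k u v] by simp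
    qed
    then show ?thesis by (simp only: sum.distrib sum_divide_distrib[symmetric])
  qed
  also have "(\<Sum>u\<in>words n. \<Sum>v\<in>words n. ee n X i i u * ee n X j j v * mtrace (X k k * (pauli n u * pauli n v))) =
    (\<Sum>v\<in>words n. \<Sum>u\<in>words n. ee n X j j v * ee n X i i u * mtrace (X k k * (pauli n u * pauli n v)))"
    by (subst sum.swap) (simp add: mult_ac)
  finally show ?thesis unfolding sum2_three[OF assms] t3c_def by (rule trans) (simp add: field_simps)
qed

text \<open>Each word occurs in its own factor and in the last one, so summing over it swaps kets
  between these two. Three swaps with the last factor compose to a 4-cycle.\<close>

lemma sum3_cycle:
  assumes "rank1 n X"
  shows "(\<Sum>w\<in>words n. \<Sum>v\<in>words n. \<Sum>u\<in>words n. ee n X i i u * ee n X j j v * ee n X k k w *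
      mtrace (X 3 3 * (pauli n w * (pauli n v * pauli n u)))) =
    8^n * (gg X i 3 * gg X j i * gg X k j * gg X 3 k)"
proof -
  have PP: "pauli n w * pauli n v \<in> carrier_mat (2^n) (2^n)" for w v by (rule mult_carrier_mat[OF pauli_carrier pauli_carrier])
  have inner: "(\<Sum>u\<in>words n. ee n X i i u * ee n X j j v * ee n X k k w * mtrace (X 3 3 * (pauli n w * (pauli n v * pauli n u)))) =
    ee n X k k w * (ee n X j j v * mtrace (X 3 i * (pauli n w * pauli n v))) * (2^n * gg X i 3)" for v w
  proof -
    have "(\<Sum>u\<in>words n. ee n X i i u * ee n X j j v * ee n X k k w * mtrace (X 3 3 * (pauli n w * (pauli n v * pauli n u)))) =
      ee n X j j v * ee n X k k w * (\<Sum>u\<in>words n. ee n X i i u * mtrace (X 3 3 * (pauli n w * pauli n v * pauli n u)))"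
      unfolding assoc_mult_mat[OF pauli_carrier pauli_carrier pauli_carrier] by (simp add: sum_distrib_left mult_ac)
    then show ?thesis unfolding sum_right[OF assms PP] by (simp add: mult_ac)
  qed
  have "(\<Sum>w\<in>words n. \<Sum>v\<in>words n. \<Sum>u\<in>words n. ee n X i i u * ee n X j j v * ee n X k k w *
      mtrace (X 3 3 * (pauli n w * (pauli n v * pauli n u)))) =
    (\<Sum>w\<in>words n. ee n X k k w * (\<Sum>v\<in>words n. ee n X j j v * mtrace (X 3 i * (pauli n w * pauli n v)))) * (2^n * gg X i 3)"
    unfolding inner sum_distrib_right[symmetric] by (simp only: mult.assoc sum_distrib_left[symmetric] sum_distrib_right[symmetric])
  also have "\<dots> = (\<Sum>w\<in>words n. ee n X k k w * ee n X 3 j w) * (2^n * gg X j i) * (2^n * gg X i 3)"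
    unfolding sum_right[OF assms pauli_carrier] ee_def[of n X 3 j] by (simp add: sum_distrib_right sum_distrib_left mult_ac)
  also have "(8::complex)^n = 2^n * 2^n * 2^n" by (simp add: power_mult_distrib[symmetric])
  ultimately show ?thesis by (simp add: sum_ee_ee[OF assms] mult_ac)
qed

definition cyc :: "nat \<Rightarrow> fam \<Rightarrow> nat \<Rightarrow> nat \<Rightarrow> nat \<Rightarrow> complex" where
  "cyc n X i j k = 8^n * (gg X i 3 * gg X j i * gg X k j * gg X 3 k)"

lemma mtrace_swap_inner:
  assumes "Y \<in> carrier_mat (2^n) (2^n)"
  shows "sg n u v * mtrace (Y * (pauli n w * (pauli n v * pauli n u))) = mtrace (Y * (pauli n w * (pauli n u * pauli n v)))"
proof -
  have PP: "pauli n v * pauli n u \<in> carrier_mat (2^n) (2^n)" for u v by (rule mult_carrier_mat[OF pauli_carrier pauli_carrier])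
  have PPP: "pauli n w * (pauli n v * pauli n u) \<in> carrier_mat (2^n) (2^n)" by (rule mult_carrier_mat[OF pauli_carrier PP])
  have "pauli n w * (pauli n u * pauli n v) = sg n u v \<cdot>\<^sub>m (pauli n w * (pauli n v * pauli n u))"
    unfolding pauli_commute[of n u v] by (rule mult_smult_distrib[OF pauli_carrier PP])
  then show ?thesis using mult_smult_distrib[OF assms PPP] mtrace_smult[OF mult_carrier_mat[OF assms PPP]] by simp
qed

lemma mtrace_swap_outer:
  assumes "Y \<in> carrier_mat (2^n) (2^n)"
  shows "sg n v w * mtrace (Y * (pauli n w * (pauli n v * pauli n u))) = mtrace (Y * (pauli n v * (pauli n w * pauli n u)))"
proof -
  have PP: "pauli n v * pauli n u \<in> carrier_mat (2^n) (2^n)" for u v by (rule mult_carrier_mat[OF pauli_carrier pauli_carrier])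
  have PPP: "pauli n w * (pauli n v * pauli n u) \<in> carrier_mat (2^n) (2^n)" by (rule mult_carrier_mat[OF pauli_carrier PP])
  have "pauli n v * (pauli n w * pauli n u) = pauli n v * pauli n w * pauli n u"
    by (rule assoc_mult_mat[OF pauli_carrier pauli_carrier pauli_carrier, symmetric])
  also have "\<dots> = sg n v w \<cdot>\<^sub>m (pauli n w * pauli n v * pauli n u)"
    unfolding pauli_commute[of n v w] by (rule mult_smult_assoc_mat[OF PP pauli_carrier])
  also have "pauli n w * pauli n v * pauli n u = pauli n w * (pauli n v * pauli n u)"
    by (rule assoc_mult_mat[OF pauli_carrier pauli_carrier pauli_carrier])
  finally have "pauli n v * (pauli n w * pauli n u) = sg n v w \<cdot>\<^sub>m (pauli n w * (pauli n v * pauli n u))" .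
  then show ?thesis using mult_smult_distrib[OF assms PPP] mtrace_smult[OF mult_carrier_mat[OF assms PPP]] by simp
qed

lemma sum3_swap12: "(\<Sum>u\<in>A. \<Sum>v\<in>B. \<Sum>w\<in>C. f u v w) = (\<Sum>v\<in>B. \<Sum>u\<in>A. \<Sum>w\<in>C. f u v w)"
  by (rule sum.swap)

lemma sum3_swap23: "(\<Sum>u\<in>A. \<Sum>v\<in>B. \<Sum>w\<in>C. f u v w) = (\<Sum>u\<in>A. \<Sum>w\<in>C. \<Sum>v\<in>B. f u v w)"
  by (rule sum.cong[OF refl], rule sum.swap)

context
  fixes n :: nat and X :: fam
  assumes X: "rank1 n X"
begin

private abbreviation "W \<equiv> words n"
private abbreviation "eps u v w \<equiv> ee n X 0 0 u * ee n X 1 1 v * ee n X 2 2 w"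
private abbreviation "tr3 u v w \<equiv> mtrace (X 3 3 * (pauli n u * (pauli n v * pauli n w)))"

private lemma x33: "X 3 3 \<in> carrier_mat (2^n) (2^n)"
  by (rule rank1_carrier[OF X])

private lemma six_orders:
  "(\<Sum>u\<in>W. \<Sum>v\<in>W. \<Sum>w\<in>W. eps u v w * tr3 w v u) = cyc n X 0 1 2"
  "(\<Sum>u\<in>W. \<Sum>v\<in>W. \<Sum>w\<in>W. eps u v w * tr3 w u v) = cyc n X 1 0 2"
  "(\<Sum>u\<in>W. \<Sum>v\<in>W. \<Sum>w\<in>W. eps u v w * tr3 v w u) = cyc n X 0 2 1"
  "(\<Sum>u\<in>W. \<Sum>v\<in>W. \<Sum>w\<in>W. eps u v w * tr3 u w v) = cyc n X 1 2 0"
  "(\<Sum>u\<in>W. \<Sum>v\<in>W. \<Sum>w\<in>W. eps u v w * tr3 v u w) = cyc n X 2 0 1"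
  "(\<Sum>u\<in>W. \<Sum>v\<in>W. \<Sum>w\<in>W. eps u v w * tr3 u v w) = cyc n X 2 1 0"
proof -
  note c = sum3_cycle[OF X, folded cyc_def]
  note a = mult.commute mult.left_commute mult.assoc
  show "(\<Sum>u\<in>W. \<Sum>v\<in>W. \<Sum>w\<in>W. eps u v w * tr3 w v u) = cyc n X 0 1 2"
    unfolding c[symmetric] by (subst sum3_swap12, subst sum3_swap23, subst sum3_swap12) (simp only: a)
  show "(\<Sum>u\<in>W. \<Sum>v\<in>W. \<Sum>w\<in>W. eps u v w * tr3 w u v) = cyc n X 1 0 2"
    unfolding c[symmetric] by (subst sum3_swap23, subst sum3_swap12) (simp only: a)
  show "(\<Sum>u\<in>W. \<Sum>v\<in>W. \<Sum>w\<in>W. eps u v w * tr3 v w u) = cyc n X 0 2 1"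
    unfolding c[symmetric] by (subst sum3_swap12, subst sum3_swap23) (simp only: a)
  show "(\<Sum>u\<in>W. \<Sum>v\<in>W. \<Sum>w\<in>W. eps u v w * tr3 u w v) = cyc n X 1 2 0"
    unfolding c[symmetric] by (subst sum3_swap23) (simp only: a)
  show "(\<Sum>u\<in>W. \<Sum>v\<in>W. \<Sum>w\<in>W. eps u v w * tr3 v u w) = cyc n X 2 0 1"
    unfolding c[symmetric] by (subst sum3_swap12) (simp only: a)
  show "(\<Sum>u\<in>W. \<Sum>v\<in>W. \<Sum>w\<in>W. eps u v w * tr3 u v w) = cyc n X 2 1 0"
    unfolding c[symmetric] by (simp only: a)
qed

text \<open>The sign sg n u w alone is not produced by reordering P_w P_v P_u. Summing over v, which
  stands between P_w and P_u, and then over w with the sign leaves a single sum over one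
  word.\<close>

private lemma sum3_s13:
  "(\<Sum>u\<in>W. \<Sum>v\<in>W. \<Sum>w\<in>W. sg n u w * (eps u v w * tr3 w v u)) = 4^n * pp n X 0 3 1 2"
proof -
  have "(\<Sum>u\<in>W. \<Sum>v\<in>W. \<Sum>w\<in>W. sg n u w * (eps u v w * tr3 w v u)) =
    (\<Sum>u\<in>W. \<Sum>w\<in>W. sg n u w * (ee n X 0 0 u * ee n X 2 2 w) * (\<Sum>v\<in>W. ee n X 1 1 v * tr3 w v u))"
    by (subst sum3_swap23) (simp only: sum_distrib_left mult.commute mult.left_commute mult.assoc)
  also have "\<dots> = (\<Sum>u\<in>W. 2^n * (ee n X 0 0 u * ee n X 1 3 u) * (\<Sum>w\<in>W. sg n u w * (ee n X 2 2 w * ee n X 3 1 w)))"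
    unfolding sum_middle[OF X pauli_carrier pauli_carrier]
    by (simp only: ee_def sum_distrib_left mult.commute mult.left_commute mult.assoc)
  also have "\<dots> = 4^n * pp n X 0 3 1 2"
    unfolding sum_sg_ee[OF X] pp_def four_pow sum_distrib_left
    by (simp only: mult.commute mult.left_commute mult.assoc)
  finally show ?thesis .
qed

private lemma sum3_s12_s23:
  "(\<Sum>u\<in>W. \<Sum>v\<in>W. \<Sum>w\<in>W. sg n v w * (eps u v w * tr3 w u v)) = 4^n * pp n X 3 1 0 2"
proof -
  have "(\<Sum>u\<in>W. \<Sum>v\<in>W. \<Sum>w\<in>W. sg n v w * (eps u v w * tr3 w u v)) =
    (\<Sum>v\<in>W. \<Sum>w\<in>W. sg n v w * (ee n X 1 1 v * ee n X 2 2 w) * (\<Sum>u\<in>W. ee n X 0 0 u * tr3 w u v))"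
    by (subst sum3_swap12, subst sum3_swap23) (simp only: sum_distrib_left mult.commute mult.left_commute mult.assoc)
  also have "\<dots> = (\<Sum>v\<in>W. 2^n * (ee n X 1 1 v * ee n X 0 3 v) * (\<Sum>w\<in>W. sg n v w * (ee n X 2 2 w * ee n X 3 0 w)))"
    unfolding sum_middle[OF X pauli_carrier pauli_carrier]
    by (simp only: ee_def sum_distrib_left mult.commute mult.left_commute mult.assoc)
  also have "\<dots> = 4^n * pp n X 3 1 0 2"
    unfolding sum_sg_ee[OF X] pp_def four_pow sum_distrib_left
    by (simp only: mult.commute mult.left_commute mult.assoc)
  finally show ?thesis .
qed

lemma phi_orders:
  "eps u v w * tr3 w v u = phi n X u v w"
  "eps u v w * tr3 w u v = sg n u v * phi n X u v w"
  "eps u v w * tr3 v w u = sg n v w * phi n X u v w"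
  "eps u v w * tr3 u w v = sg n u w * (sg n u v * phi n X u v w)"
  "eps u v w * tr3 v u w = sg n u w * (sg n v w * phi n X u v w)"
  "eps u v w * tr3 u v w = sg n u v * (sg n u w * (sg n v w * phi n X u v w))"
proof -
  note f = mtrace_swap_inner[OF x33, of u v w] mtrace_swap_outer[OF x33, of v w u]
    mtrace_swap_outer[OF x33, of u w v] mtrace_swap_inner[OF x33, of u w v] mtrace_swap_outer[OF x33, of u v w]
  have c: "a * (s * t) = s * (a * t)" for a s t :: complex by simp
  show 0: "eps u v w * tr3 w v u = phi n X u v w" by (simp add: phi_def)
  show 1: "eps u v w * tr3 w u v = sg n u v * phi n X u v w"
    unfolding f(1)[symmetric] 0[symmetric] by (rule c)
  show 2: "eps u v w * tr3 v w u = sg n v w * phi n X u v w"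
    unfolding f(2)[symmetric] 0[symmetric] by (rule c)
  show 3: "eps u v w * tr3 u w v = sg n u w * (sg n u v * phi n X u v w)"
    unfolding f(3)[symmetric] 1[symmetric] by (rule c)
  show 4: "eps u v w * tr3 v u w = sg n u w * (sg n v w * phi n X u v w)"
    unfolding f(4)[symmetric] 2[symmetric] by (rule c)
  show 5: "eps u v w * tr3 u v w = sg n u v * (sg n u w * (sg n v w * phi n X u v w))"
    unfolding f(5)[symmetric] 4[symmetric] by (rule c)
qed

text \<open>The product of the three projections has eight sign terms. Six are the orders of the
  Pauli operators in the last factor and give the 4-cycles; the other two, sg(u,w) and sg(u,v)
  sg(v,w), give invariants \<open>pp\<close>.\<close>

lemma sum3_plus:
  "(\<Sum>u\<in>W. \<Sum>v\<in>W. \<Sum>w\<in>W. (1 + sg n u v) / 2 * ((1 + sg n u w) / 2 * ((1 + sg n v w) / 2 * phi n X u v w))) =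
   (cyc n X 0 1 2 + cyc n X 1 0 2 + cyc n X 0 2 1 + cyc n X 1 2 0 + cyc n X 2 0 1 + cyc n X 2 1 0
     + 4^n * pp n X 0 3 1 2 + 4^n * pp n X 3 1 0 2) / 8"
proof -
  have e: "(1 + sg n u v) / 2 * ((1 + sg n u w) / 2 * ((1 + sg n v w) / 2 * phi n X u v w)) =
     (eps u v w * tr3 w v u + eps u v w * tr3 w u v + eps u v w * tr3 v w u + eps u v w * tr3 u w v
      + eps u v w * tr3 v u w + eps u v w * tr3 u v w + sg n u w * (eps u v w * tr3 w v u)
      + sg n v w * (eps u v w * tr3 w u v)) / 8" for u v w
    unfolding phi_orders by (simp add: field_simps)
  show ?thesis
    unfolding e unfolding sum_divide_distrib[symmetric] sum.distrib six_orders sum3_s13 sum3_s12_s23 ..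
qed

lemma sum3_minus:
  "(\<Sum>u\<in>W. \<Sum>v\<in>W. \<Sum>w\<in>W. (1 + sg n u v) / 2 * ((1 - sg n u w) / 2 * ((1 - sg n v w) / 2 * phi n X u v w))) =
   (cyc n X 0 1 2 + cyc n X 1 0 2 - cyc n X 0 2 1 - cyc n X 1 2 0 + cyc n X 2 0 1 + cyc n X 2 1 0
     - 4^n * pp n X 0 3 1 2 - 4^n * pp n X 3 1 0 2) / 8"
proof -
  have e: "(1 + sg n u v) / 2 * ((1 - sg n u w) / 2 * ((1 - sg n v w) / 2 * phi n X u v w)) =
     (eps u v w * tr3 w v u + eps u v w * tr3 w u v - eps u v w * tr3 v w u - eps u v w * tr3 u w v
      + eps u v w * tr3 v u w + eps u v w * tr3 u v w - sg n u w * (eps u v w * tr3 w v u)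
      - sg n v w * (eps u v w * tr3 w u v)) / 8" for u v w
    unfolding phi_orders by (simp add: field_simps)
  show ?thesis
    unfolding e unfolding sum_divide_distrib[symmetric] sum.distrib sum_subtractf six_orders sum3_s13 sum3_s12_s23 ..
qed

end

subsection \<open>Values of the Clifford averages on the orbits of words\<close>

lemma cjf_gg: "rank1 n X \<Longrightarrow> C \<in> clifford_group n \<Longrightarrow> gg (cjf C X) i j = gg X i j"
  unfolding cjf_def
  by (rule mtrace_cj[OF clifford_carrier rank1_carrier clifford_unitary])

lemma cjf_rank1: "rank1 n X \<Longrightarrow> C \<in> clifford_group n \<Longrightarrow> rank1 n (cjf C X)"
  by (rule rank1_cjf[OF _ clifford_carrier clifford_unitary])

text \<open>A Clifford unitary permutes the words, and the sign attached to each word enters to the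
  fourth power.\<close>

lemma cjf_pp:
  assumes X: "rank1 n X" and C: "C \<in> clifford_group n"
  shows "pp n (cjf C X) a b c e = pp n X a b c e"
proof -
  obtain \<pi> where \<pi>: "acts n C \<pi>" using clifford_acts[OF C] by blast
  have "ee n (cjf C X) 0 a u * ee n (cjf C X) 1 b u * ee n (cjf C X) 2 c u * ee n (cjf C X) 3 e u =
    ee n X 0 a (\<pi> u) * ee n X 1 b (\<pi> u) * ee n X 2 c (\<pi> u) * ee n X 3 e (\<pi> u)" if u: "u \<in> words n" for u
  proof -
    obtain s where s: "pm s" "\<And>Y. Y \<in> carrier_mat (2^n) (2^n) \<Longrightarrow> mtrace (cj C Y * pauli n u) = s * mtrace (Y * pauli n (\<pi> u))"
      using mtrace_acts[OF \<pi> u rank1_carrier[OF X]] by blast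
    then show ?thesis unfolding ee_def cjf_def s(2)[OF rank1_carrier[OF X]] by (auto simp: pm_def)
  qed
  then have "pp n (cjf C X) a b c e = (\<Sum>u\<in>words n. (\<lambda>v. ee n X 0 a v * ee n X 1 b v * ee n X 2 c v * ee n X 3 e v) (\<pi> u))"
    unfolding pp_def by (intro sum.cong refl) simp
  also have "\<dots> = (\<Sum>u\<in>words n. (\<lambda>v. ee n X 0 a v * ee n X 1 b v * ee n X 2 c v * ee n X 3 e v) u)"
    by (rule acts_sum[OF \<pi>])
  finally show ?thesis by (simp only: pp_def)
qed

lemma cjf_t3c: "rank1 n X \<Longrightarrow> C \<in> clifford_group n \<Longrightarrow> t3c n (cjf C X) i j k = t3c n X i j k"
  by (simp add: t3c_def cjf_gg)

lemma cjf_cyc: "rank1 n X \<Longrightarrow> C \<in> clifford_group n \<Longrightarrow> cyc n (cjf C X) i j k = cyc n X i j k"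
  by (simp add: cyc_def cjf_gg)

lemmas cjf_inv = cjf_gg cjf_pp cjf_t3c cjf_cyc

text \<open>Traces of permutations of the tensor factors: \<open>t0\<close> belongs to the identity,
  \<open>pr\<close> to a transposition and \<open>dt\<close> to a double transposition, with one
  power of 2^n for each sum over words.\<close>

definition t0 :: "fam \<Rightarrow> complex" where
  "t0 X = gg X 0 0 * gg X 1 1 * gg X 2 2 * gg X 3 3"

definition pr :: "nat \<Rightarrow> fam \<Rightarrow> nat \<Rightarrow> nat \<Rightarrow> nat \<Rightarrow> nat \<Rightarrow> complex" where
  "pr n X i j k l = 2^n * (gg X i j * gg X j i) * (gg X k k * gg X l l)"

definition dt :: "nat \<Rightarrow> fam \<Rightarrow> complex" where
  "dt n X = 4^n * (gg X 0 1 * gg X 1 0 * (gg X 2 3 * gg X 3 2))"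

lemma FF_000: "rank1 n X \<Longrightarrow> FF n X 0 0 0 = t0 X"
  unfolding FF_def by (rule avg_eq_const) (simp add: phi_uuv cjf_rank1 cjf_gg t0_def)

lemma sum_FF_single:
  assumes X: "rank1 n X"
  shows "(\<Sum>u\<in>words n. FF n X u u u) = pp n X 0 1 2 3"
    "(\<Sum>u\<in>words n. FF n X u u 0) = pr n X 0 1 2 3"
    "(\<Sum>u\<in>words n. FF n X 0 0 u) = pr n X 2 3 0 1"
    "(\<Sum>u\<in>words n. FF n X u 0 u) = pr n X 0 2 1 3"
    "(\<Sum>u\<in>words n. FF n X 0 u 0) = pr n X 1 3 0 2"
    "(\<Sum>u\<in>words n. FF n X 0 u u) = pr n X 1 2 0 3"
    "(\<Sum>u\<in>words n. FF n X u 0 0) = pr n X 0 3 1 2"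
proof -
  have S: "(\<Sum>u\<in>words n. phi n Y u u u) = pp n Y 0 1 2 3"
    "(\<Sum>u\<in>words n. phi n Y u u 0) = pr n Y 0 1 2 3"
    "(\<Sum>u\<in>words n. phi n Y 0 0 u) = pr n Y 2 3 0 1"
    "(\<Sum>u\<in>words n. phi n Y u 0 u) = pr n Y 0 2 1 3"
    "(\<Sum>u\<in>words n. phi n Y 0 u 0) = pr n Y 1 3 0 2"
    "(\<Sum>u\<in>words n. phi n Y 0 u u) = pr n Y 1 2 0 3"
    "(\<Sum>u\<in>words n. phi n Y u 0 0) = pr n Y 0 3 1 2" if Y: "rank1 n Y" for Y
    by (simp add: phi_uuv pp_def mult.assoc,
        simp_all add: phi_uuv phi_uvv phi_uvu[OF Y] ee_0[OF Y] pr_def sum_ee_ee[OF Y]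
        sum_distrib_left[symmetric] sum_distrib_right[symmetric])
  show "(\<Sum>u\<in>words n. FF n X u u u) = pp n X 0 1 2 3"
    "(\<Sum>u\<in>words n. FF n X u u 0) = pr n X 0 1 2 3"
    "(\<Sum>u\<in>words n. FF n X 0 0 u) = pr n X 2 3 0 1"
    "(\<Sum>u\<in>words n. FF n X u 0 u) = pr n X 0 2 1 3"
    "(\<Sum>u\<in>words n. FF n X 0 u 0) = pr n X 1 3 0 2"
    "(\<Sum>u\<in>words n. FF n X 0 u u) = pr n X 1 2 0 3"
    "(\<Sum>u\<in>words n. FF n X u 0 0) = pr n X 0 3 1 2"
    unfolding FF_def avg_sum[symmetric]
    by (rule avg_eq_const, simp only: S[OF cjf_rank1[OF X]] pr_def cjf_inv[OF X])+
qed

lemma sum_FF_pair: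
  assumes X: "rank1 n X"
  shows "(\<Sum>u\<in>words n. \<Sum>v\<in>words n. (1 + sg n u v) / 2 * FF n X u u v) = (dt n X + 2^n * pp n X 0 1 3 2) / 2"
    "(\<Sum>u\<in>words n. \<Sum>v\<in>words n. (1 - sg n u v) / 2 * FF n X u u v) = (dt n X - 2^n * pp n X 0 1 3 2) / 2"
proof -
  have e: "(1 + s) / 2 * p = (p + s * p) / 2" "(1 - s) / 2 * p = (p - s * p) / 2" for s p :: complex
    by (simp_all add: field_simps)
  have S: "(\<Sum>u\<in>words n. \<Sum>v\<in>words n. (1 + sg n u v) / 2 * phi n Y u u v) = (dt n Y + 2^n * pp n Y 0 1 3 2) / 2"
    "(\<Sum>u\<in>words n. \<Sum>v\<in>words n. (1 - sg n u v) / 2 * phi n Y u u v) = (dt n Y - 2^n * pp n Y 0 1 3 2) / 2"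
    if Y: "rank1 n Y" for Y
    unfolding e sum_divide_distrib[symmetric] sum.distrib sum_subtractf sum2_uv[OF Y] sum2_sg[OF Y] dt_def by simp_all
  show "(\<Sum>u\<in>words n. \<Sum>v\<in>words n. (1 + sg n u v) / 2 * FF n X u u v) = (dt n X + 2^n * pp n X 0 1 3 2) / 2"
    "(\<Sum>u\<in>words n. \<Sum>v\<in>words n. (1 - sg n u v) / 2 * FF n X u u v) = (dt n X - 2^n * pp n X 0 1 3 2) / 2"
    unfolding FF_def avg_cmult[symmetric] avg_sum[symmetric]
    by (rule avg_eq_const, simp only: S[OF cjf_rank1[OF X]] dt_def cjf_inv[OF X])+
qed

lemma pauli_0_mult: "pauli n 0 * (pauli n u * pauli n v) = pauli n u * pauli n v"
  unfolding pauli_0 by (rule left_mult_one_mat[OF mult_carrier_mat[OF pauli_carrier pauli_carrier]])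

lemma sum_FF_three:
  assumes X: "rank1 n X"
  shows "(\<Sum>u\<in>words n. \<Sum>v\<in>words n. (1 + sg n u v) / 2 * FF n X u v 0) = t3c n X 0 1 3 * gg X 2 2"
    "(\<Sum>u\<in>words n. \<Sum>v\<in>words n. (1 + sg n u v) / 2 * FF n X u 0 v) = t3c n X 0 2 3 * gg X 1 1"
    "(\<Sum>u\<in>words n. \<Sum>v\<in>words n. (1 + sg n u v) / 2 * FF n X 0 u v) = t3c n X 1 2 3 * gg X 0 0"
    "(\<Sum>u\<in>words n. \<Sum>v\<in>words n. (1 + sg n u v) / 2 * FF n X u v (u + v)) = t3c n X 0 1 2 * gg X 3 3"
proof -
  have S: "(\<Sum>u\<in>words n. \<Sum>v\<in>words n. (1 + sg n u v) / 2 * phi n Y u v 0) = t3c n Y 0 1 3 * gg Y 2 2"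
    "(\<Sum>u\<in>words n. \<Sum>v\<in>words n. (1 + sg n u v) / 2 * phi n Y u 0 v) = t3c n Y 0 2 3 * gg Y 1 1"
    "(\<Sum>u\<in>words n. \<Sum>v\<in>words n. (1 + sg n u v) / 2 * phi n Y 0 u v) = t3c n Y 1 2 3 * gg Y 0 0"
    "(\<Sum>u\<in>words n. \<Sum>v\<in>words n. (1 + sg n u v) / 2 * phi n Y u v (u + v)) = t3c n Y 0 1 2 * gg Y 3 3"
    if Y: "rank1 n Y" for Y
    unfolding sum2_three_comm[OF Y, symmetric] sum_distrib_right phi_sum_pauli[OF Y]
    by (simp_all add: phi_def ee_0[OF Y] pauli_0_mult mult_ac)
  show "(\<Sum>u\<in>words n. \<Sum>v\<in>words n. (1 + sg n u v) / 2 * FF n X u v 0) = t3c n X 0 1 3 * gg X 2 2"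
    "(\<Sum>u\<in>words n. \<Sum>v\<in>words n. (1 + sg n u v) / 2 * FF n X u 0 v) = t3c n X 0 2 3 * gg X 1 1"
    "(\<Sum>u\<in>words n. \<Sum>v\<in>words n. (1 + sg n u v) / 2 * FF n X 0 u v) = t3c n X 1 2 3 * gg X 0 0"
    "(\<Sum>u\<in>words n. \<Sum>v\<in>words n. (1 + sg n u v) / 2 * FF n X u v (u + v)) = t3c n X 0 1 2 * gg X 3 3"
    unfolding FF_def avg_cmult[symmetric] avg_sum[symmetric]
    by (rule avg_eq_const, simp only: S[OF cjf_rank1[OF X]] cjf_inv[OF X])+
qed

definition plus3 :: "nat \<Rightarrow> fam \<Rightarrow> complex" where
  "plus3 n X = (cyc n X 0 1 2 + cyc n X 1 0 2 + cyc n X 0 2 1 + cyc n X 1 2 0 + cyc n X 2 0 1 + cyc n X 2 1 0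
     + 4^n * pp n X 0 3 1 2 + 4^n * pp n X 3 1 0 2) / 8"

definition minus3 :: "nat \<Rightarrow> fam \<Rightarrow> complex" where
  "minus3 n X = (cyc n X 0 1 2 + cyc n X 1 0 2 - cyc n X 0 2 1 - cyc n X 1 2 0 + cyc n X 2 0 1 + cyc n X 2 1 0
     - 4^n * pp n X 0 3 1 2 - 4^n * pp n X 3 1 0 2) / 8"

lemma sum_FF_triple:
  assumes X: "rank1 n X"
  shows "(\<Sum>u\<in>words n. \<Sum>v\<in>words n. \<Sum>w\<in>words n. (1 + sg n u v) / 2 * ((1 + sg n u w) / 2 * ((1 + sg n v w) / 2 * FF n X u v w))) = plus3 n X"
    "(\<Sum>u\<in>words n. \<Sum>v\<in>words n. \<Sum>w\<in>words n. (1 + sg n u v) / 2 * ((1 - sg n u w) / 2 * ((1 - sg n v w) / 2 * FF n X u v w))) = minus3 n X"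
  unfolding FF_def avg_cmult[symmetric] avg_sum[symmetric]
  by (rule avg_eq_const, simp only: sum3_plus[OF cjf_rank1[OF X]] sum3_minus[OF cjf_rank1[OF X]]
      plus3_def minus3_def cjf_inv[OF X])+

text \<open>\<open>NC\<close> counts the ordered pairs of distinct nonzero commuting words,
  \<open>NA\<close> the ordered anticommuting pairs.\<close>

definition NC :: "nat \<Rightarrow> complex" where "NC n = (4^n - 1) * (4^n / 2 - 2)"
definition NA :: "nat \<Rightarrow> complex" where "NA n = (4^n - 1) * (4^n / 2)"

lemma value_equal:
  assumes X: "rank1 n X" and u: "u \<in> words n" "u \<noteq> 0"
  shows "(4^n - 1) * FF n X u u u = pp n X 0 1 2 3 - t0 X"
  using single_value[of n "\<lambda>u. FF n X u u u", OF _ u] FF_isoms[OF _ X] sum_FF_single(1)[OF X] FF_000[OF X] by simp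

definition cval :: "nat \<Rightarrow> fam \<Rightarrow> complex" where
  "cval n X = (dt n X + 2^n * pp n X 0 1 3 2) / 2 - pr n X 0 1 2 3 - pr n X 2 3 0 1 - pp n X 0 1 2 3 + 2 * t0 X"

definition aval :: "nat \<Rightarrow> fam \<Rightarrow> complex" where
  "aval n X = (dt n X - 2^n * pp n X 0 1 3 2) / 2"

lemma value_comm:
  assumes X: "rank1 n X" and u: "u \<in> words n" "v \<in> words n" "u \<noteq> 0" "v \<noteq> 0" "u \<noteq> v" "sg n u v = 1"
  shows "NC n * FF n X u u v = cval n X"
proof -
  have "FF n X (h u) (h u) (h v) = FF n X u u v" if "h \<in> isoms n" "u \<in> words n" "v \<in> words n" for h u v
    using FF_isoms[OF that(1) X that(2,2,3)] .
  from pair_value_comm[of n "\<lambda>u v. FF n X u u v", OF this u] show ?thesis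
    unfolding NC_def cval_def sum_FF_pair[OF X] sum_FF_single[OF X] FF_000[OF X] .
qed

lemma value_anti:
  assumes X: "rank1 n X" and u: "u \<in> words n" "v \<in> words n" "sg n u v = -1"
  shows "NA n * FF n X u u v = aval n X"
proof -
  have "FF n X (h u) (h u) (h v) = FF n X u u v" if "h \<in> isoms n" "u \<in> words n" "v \<in> words n" for h u v
    using FF_isoms[OF that(1) X that(2,2,3)] .
  from pair_value_anti[of n "\<lambda>u v. FF n X u u v", OF this u] show ?thesis
    unfolding NA_def aval_def sum_FF_pair[OF X] .
qed

lemma value_I3:
  assumes X: "rank1 n X" and u: "u \<in> words n" "v \<in> words n" "u \<noteq> 0" "v \<noteq> 0" "u \<noteq> v" "sg n u v = 1"
  shows "NC n * FF n X u v 0 = t3c n X 0 1 3 * gg X 2 2 - pr n X 0 3 1 2 - pr n X 1 3 0 2 - pr n X 0 1 2 3 + 2 * t0 X"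
proof -
  have "FF n X (h u) (h v) 0 = FF n X u v 0" if "h \<in> isoms n" "u \<in> words n" "v \<in> words n" for h u v
    using FF_isoms[OF that(1) X that(2,3) words_0] isoms_eq_0[OF that(1), of 0] by simp
  from pair_value_comm[of n "\<lambda>u v. FF n X u v 0", OF this u] show ?thesis
    unfolding NC_def sum_FF_three[OF X] sum_FF_single[OF X] FF_000[OF X] .
qed

lemma value_I4:
  assumes X: "rank1 n X" and u: "u \<in> words n" "v \<in> words n" "u \<noteq> 0" "v \<noteq> 0" "u \<noteq> v" "sg n u v = 1"
  shows "NC n * FF n X u v (u + v) = t3c n X 0 1 2 * gg X 3 3 - pr n X 0 2 1 3 - pr n X 1 2 0 3 - pr n X 0 1 2 3 + 2 * t0 X"
proof -
  have "FF n X (h u) (h v) (h u + h v) = FF n X u v (u + v)" if "h \<in> isoms n" "u \<in> words n" "v \<in> words n" for h u v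
    using FF_isoms[OF that(1) X that(2,3) words_add[OF that(2,3)]] isoms_add[OF that(1)] by simp
  from pair_value_comm[of n "\<lambda>u v. FF n X u v (u + v)", OF this u] show ?thesis
    unfolding NC_def sum_FF_three[OF X] add_0_left add_0_right word_double sum_FF_single[OF X] FF_000[OF X] .
qed

text \<open>H sums over the third word and is an invariant function of a commuting pair, to which
  \<open>pair_value_comm\<close> applies. The sum inside H then splits into the degenerate words 0,
  u, v, u + v and the generic ones.\<close>

lemma value_plus:
  assumes X: "rank1 n X" and u: "u \<in> words n" "v \<in> words n" "w \<in> words n" "u \<noteq> 0" "v \<noteq> 0" "u \<noteq> v"
    and s: "sg n u v = 1" "sg n u w = 1" "sg n v w = 1" and w: "w \<notin> {0, u, v, u + v}"
  shows "NC n * (4^n / 4 - 4) * FF n X u v w = plus3 n X - t3c n X 0 2 3 * gg X 1 1 - t3c n X 1 2 3 * gg X 0 0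
    - (dt n X + 2^n * pp n X 0 1 3 2) / 2 + 2 * pr n X 2 3 0 1
    - NC n * (FF n X u v 0 + FF n X u v u + FF n X u v v + FF n X u v (u + v))"
proof -
  define H where "H u v = (\<Sum>w\<in>words n. (1 + sg n u w) / 2 * ((1 + sg n v w) / 2 * FF n X u v w))" for u v
  have inv: "H (h u) (h v) = H u v" if h: "h \<in> isoms n" and uv: "u \<in> words n" "v \<in> words n" for h u v
  proof -
    have "H (h u) (h v) = (\<Sum>w\<in>words n. (1 + sg n (h u) (h w)) / 2 * ((1 + sg n (h v) (h w)) / 2 * FF n X (h u) (h v) (h w)))"
      unfolding H_def by (rule sum_isoms[OF h, symmetric])
    also have "\<dots> = H u v"
      unfolding H_def by (intro sum.cong refl) (simp add: isoms_sg[OF h] FF_isoms[OF h X] uv)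
    finally show ?thesis .
  qed
  \<comment> \<open>A projection (1 + s)/2 is idempotent, which collapses the doubled factor on the
    diagonal u = v.\<close>
  have s1: "(1 + s) / 2 * ((1 + s) / 2 * p) = (1 + s) / 2 * p" if "s = sg n a b" for s p :: complex and a b
    using sg_cases[of n a b] that by auto
  have "NC n * H u v = (\<Sum>u\<in>words n. \<Sum>v\<in>words n. (1 + sg n u v) / 2 * H u v) - (\<Sum>u\<in>words n. H u 0) - (\<Sum>v\<in>words n. H 0 v)
    - (\<Sum>u\<in>words n. H u u) + 2 * H 0 0"
    unfolding NC_def by (rule pair_value_comm[OF inv]) (use u s in auto)
  also have "(\<Sum>u\<in>words n. \<Sum>v\<in>words n. (1 + sg n u v) / 2 * H u v) = plus3 n X"
    unfolding sum_FF_triple(1)[OF X, symmetric] H_def sum_distrib_left ..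
  also have "(\<Sum>u\<in>words n. H u 0) = t3c n X 0 2 3 * gg X 1 1"
    unfolding sum_FF_three(2)[OF X, symmetric] H_def by simp
  also have "(\<Sum>v\<in>words n. H 0 v) = t3c n X 1 2 3 * gg X 0 0"
    unfolding sum_FF_three(3)[OF X, symmetric] H_def by simp
  also have "(\<Sum>u\<in>words n. H u u) = (dt n X + 2^n * pp n X 0 1 3 2) / 2"
    unfolding sum_FF_pair(1)[OF X, symmetric] H_def s1[OF refl] ..
  also have "H 0 0 = pr n X 2 3 0 1"
    unfolding sum_FF_single(3)[OF X, symmetric] H_def by simp
  finally have NH: "NC n * H u v = plus3 n X - t3c n X 0 2 3 * gg X 1 1 - t3c n X 1 2 3 * gg X 0 0
    - (dt n X + 2^n * pp n X 0 1 3 2) / 2 + 2 * pr n X 2 3 0 1" .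
  have "H u v = (\<Sum>w\<in>{w \<in> words n. sg n u w = 1 \<and> sg n v w = 1}. FF n X u v w)"
  proof -
    have "H u v = (\<Sum>w\<in>words n. if sg n u w = 1 \<and> sg n v w = 1 then FF n X u v w else 0)"
      unfolding H_def
    proof (intro sum.cong refl)
      fix w show "(1 + sg n u w) / 2 * ((1 + sg n v w) / 2 * FF n X u v w) = (if sg n u w = 1 \<and> sg n v w = 1 then FF n X u v w else 0)"
        using sg_cases[of n u w] sg_cases[of n v w] by auto
    qed
    then show ?thesis by (simp add: sum.inter_filter)
  qed
  also have "\<dots> = FF n X u v 0 + FF n X u v u + FF n X u v v + FF n X u v (u + v) + (4^n / 4 - 4) * FF n X u v w"
  proof (rule sum_given_2)
    fix w' assume w': "w' \<in> words n" "w' \<notin> {0, u, v, u + v}" "sg n u w' = 1" "sg n v w' = 1"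
    then obtain h where "h \<in> isoms n" "h u = u" "h v = v" "h w = w'"
      using witt_3[of u n v w u v w'] u w s by auto
    then show "FF n X u v w' = FF n X u v w" using FF_isoms[OF _ X, of h u v w] u by simp
  qed (use u s in auto)
  finally have Hv: "H u v = FF n X u v 0 + FF n X u v u + FF n X u v v + FF n X u v (u + v) + (4^n / 4 - 4) * FF n X u v w" .
  show ?thesis unfolding NH[symmetric] Hv by (simp add: algebra_simps)
qed

text \<open>No degenerate third word occurs, because 0, u, v and u + v commute with u and v. In the
  pair sum only the diagonal has to be removed, since H vanishes when one argument is 0.\<close>

lemma value_minus:
  assumes X: "rank1 n X" and u: "u \<in> words n" "v \<in> words n" "w \<in> words n" "u \<noteq> v"
    and s: "sg n u v = 1" "sg n u w = -1" "sg n v w = -1"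
  shows "NC n * (4^n / 4) * FF n X u v w = minus3 n X - aval n X"
proof -
  have ne: "u \<noteq> 0" "v \<noteq> 0" using s by auto
  define H where "H u v = (\<Sum>w\<in>words n. (1 - sg n u w) / 2 * ((1 - sg n v w) / 2 * FF n X u v w))" for u v
  have inv: "H (h u) (h v) = H u v" if h: "h \<in> isoms n" and uv: "u \<in> words n" "v \<in> words n" for h u v
  proof -
    have "H (h u) (h v) = (\<Sum>w\<in>words n. (1 - sg n (h u) (h w)) / 2 * ((1 - sg n (h v) (h w)) / 2 * FF n X (h u) (h v) (h w)))"
      unfolding H_def by (rule sum_isoms[OF h, symmetric])
    also have "\<dots> = H u v"
      unfolding H_def by (intro sum.cong refl) (simp add: isoms_sg[OF h] FF_isoms[OF h X] uv)
    finally show ?thesis .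
  qed
  have s1: "(1 - s) / 2 * ((1 - s) / 2 * p) = (1 - s) / 2 * p" if "s = sg n a b" for s p :: complex and a b
    using sg_cases[of n a b] that by auto
  have z: "H u 0 = 0" "H 0 u = 0" for u by (simp_all add: H_def)
  have "NC n * H u v = (\<Sum>u\<in>words n. \<Sum>v\<in>words n. (1 + sg n u v) / 2 * H u v) - (\<Sum>u\<in>words n. H u 0) - (\<Sum>v\<in>words n. H 0 v)
    - (\<Sum>u\<in>words n. H u u) + 2 * H 0 0"
    unfolding NC_def by (rule pair_value_comm[OF inv]) (use u s ne in auto)
  also have "(\<Sum>u\<in>words n. \<Sum>v\<in>words n. (1 + sg n u v) / 2 * H u v) = minus3 n X"
    unfolding sum_FF_triple(2)[OF X, symmetric] H_def sum_distrib_left ..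
  also have "(\<Sum>u\<in>words n. H u u) = aval n X"
    unfolding aval_def sum_FF_pair(2)[OF X, symmetric] H_def s1[OF refl] ..
  finally have NH: "NC n * H u v = minus3 n X - aval n X" by (simp add: z)
  let ?M = "{w \<in> words n. sg n u w = -1 \<and> sg n v w = -1}"
  have "H u v = (\<Sum>w\<in>words n. if sg n u w = -1 \<and> sg n v w = -1 then FF n X u v w else 0)"
    unfolding H_def
  proof (intro sum.cong refl)
    fix w show "(1 - sg n u w) / 2 * ((1 - sg n v w) / 2 * FF n X u v w) = (if sg n u w = -1 \<and> sg n v w = -1 then FF n X u v w else 0)"
      using sg_cases[of n u w] sg_cases[of n v w] by auto
  qed
  also have "\<dots> = (\<Sum>w\<in>?M. FF n X u v w)" by (simp add: sum.inter_filter)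
  also have "\<dots> = (\<Sum>w'\<in>?M. FF n X u v w)"
  proof (intro sum.cong refl)
    fix w' assume w': "w' \<in> ?M"
    have "w' \<notin> {0, u, v, u + v}" "w \<notin> {0, u, v, u + v}" using w' s by (auto simp: sg_add_right sg_sym[of n v u])
    then obtain h where "h \<in> isoms n" "h u = u" "h v = v" "h w = w'"
      using witt_3[of u n v w u v w'] u w' s ne by auto
    then show "FF n X u v w' = FF n X u v w" using FF_isoms[OF _ X, of h u v w] u by simp
  qed
  also have "\<dots> = (4^n / 4) * FF n X u v w"
    using card_sg2[OF u(1,2) ne u(4), of "-1" "-1"] by simp
  finally show ?thesis unfolding NH[symmetric] by simp
qed

text \<open>Named by the two tensor factors, counted from 1, that are brought into the first two
  positions.\<close>

definition r13 :: "nat \<Rightarrow> nat" where "r13 i = (if i = 1 then 2 else if i = 2 then 1 else i)"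
definition r14 :: "nat \<Rightarrow> nat" where "r14 i = (if i = 1 then 3 else if i = 2 then 1 else if i = 3 then 2 else i)"
definition r23 :: "nat \<Rightarrow> nat" where "r23 i = (if i = 0 then 1 else if i = 1 then 2 else if i = 2 then 0 else i)"

lemma cjf_reidx: "cjf C (reidx \<sigma> X) = reidx \<sigma> (cjf C X)"
  by (simp add: cjf_def reidx_def)

lemma ee_reidx: "ee n (reidx \<sigma> X) i j = ee n X (\<sigma> i) (\<sigma> j)"
  by (simp add: ee_def reidx_def fun_eq_iff)

lemma FF_uvu: "rank1 n X \<Longrightarrow> FF n X u v u = sg n u v * FF n (reidx r13 X) u u v"
  unfolding FF_def avg_cmult[symmetric]
  by (rule avg_cong) (simp add: phi_uvu cjf_rank1 cjf_reidx phi_uuv ee_reidx r13_def)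

lemma FF_uvv: "rank1 n X \<Longrightarrow> FF n X u v v = FF n (reidx r14 X) u u v"
  unfolding FF_def
  by (rule avg_cong) (simp add: phi_uvv cjf_rank1 cjf_reidx phi_uuv ee_reidx r14_def)

text \<open>Brings a commuting pair u, w into the first two arguments, where the orbit values are
  known; the sign is the cost of reordering the product of the three Pauli operators.\<close>

lemma FF_r13:
  assumes "rank1 n X"
  shows "FF n X u v w = sg n v w * FF n (reidx r13 X) u w v"
  unfolding FF_def avg_cmult[symmetric]
proof (rule avg_cong)
  fix C assume "C \<in> clifford_group n"
  then have Y: "rank1 n (cjf C X)" using assms by (rule cjf_rank1[rotated])
  let ?Y = "cjf C X"
  have "phi n (reidx r13 ?Y) u w v = sg n v w * phi n ?Y u v w"
    unfolding phi_orders(3)[OF Y, symmetric]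
    by (simp add: phi_def ee_reidx r13_def) (simp add: reidx_def r13_def)
  then have "sg n v w * phi n (reidx r13 ?Y) u w v = (sg n v w * sg n v w) * phi n ?Y u v w" by simp
  then show "phi n ?Y u v w = sg n v w * phi n (cjf C (reidx r13 X)) u w v" by (simp add: cjf_reidx)
qed

lemma FF_r23:
  assumes "rank1 n X"
  shows "FF n X u v w = sg n u v * (sg n u w * FF n (reidx r23 X) v w u)"
  unfolding FF_def avg_cmult[symmetric]
proof (rule avg_cong)
  fix C assume "C \<in> clifford_group n"
  then have Y: "rank1 n (cjf C X)" using assms by (rule cjf_rank1[rotated])
  let ?Y = "cjf C X"
  have "phi n (reidx r23 ?Y) v w u = sg n u w * (sg n u v * phi n ?Y u v w)"
    unfolding phi_orders(4)[OF Y, symmetric]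
    by (simp add: phi_def ee_reidx r23_def) (simp add: reidx_def r23_def)
  then have "sg n u v * (sg n u w * phi n (reidx r23 ?Y) v w u) = (sg n u v * sg n u v) * ((sg n u w * sg n u w) * phi n ?Y u v w)"
    by (simp only: mult_ac)
  then show "phi n ?Y u v w = sg n u v * (sg n u w * phi n (cjf C (reidx r23 X)) v w u)" by (simp add: cjf_reidx)
qed

subsection \<open>The layer of T gates\<close>

definition tf :: "nat \<Rightarrow> nat \<Rightarrow> nat \<Rightarrow> complex mat" where
  "tf n k q = (if q < n - k then I2 else Tgate)"

lemma Tgate_carrier [simp]: "Tgate \<in> carrier_mat 2 2"
  by (simp add: Tgate_def)

lemma tf_carrier [simp]: "tf n k q \<in> carrier_mat 2 2"
  by (simp add: tf_def)

lemma That_ten: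
  assumes "k \<le> n"
  shows "That n k = ten n (tf n k)"
proof -
  have "replicate (n - k) I2 @ replicate k Tgate = map (tf n k) [0..<n]"
    by (rule nth_equalityI) (use assms in \<open>auto simp: nth_append tf_def\<close>)
  then show ?thesis by (simp add: That_def ten_def)
qed

lemma cis_pi_4: "cis (pi / 4) = rt * (1 + \<i>)"
  by (simp add: complex_eq_iff cos_45 sin_45 rt_def real_div_sqrt)

lemma Tgate_entries: "Tgate $$ (0,0) = 1" "Tgate $$ (0,Suc 0) = 0" "Tgate $$ (Suc 0,0) = 0" "Tgate $$ (Suc 0,Suc 0) = rt * (1 + \<i>)"
  by (simp_all add: Tgate_def cis_pi_4)

lemma Tgate_unitary: "adj Tgate * Tgate = I2"
proof (rule mat2_eqI)
  show "adj Tgate * Tgate \<in> carrier_mat 2 2" by (rule mult_carrier_mat[OF adj_carrier[OF Tgate_carrier] Tgate_carrier])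
  note i = mat2_mult_index[OF adj_carrier[OF Tgate_carrier] Tgate_carrier] adj_index[OF Tgate_carrier]
  show "(adj Tgate * Tgate) $$ (0,0) = I2 $$ (0,0)" "(adj Tgate * Tgate) $$ (0,1) = I2 $$ (0,1)"
    "(adj Tgate * Tgate) $$ (1,0) = I2 $$ (1,0)" "(adj Tgate * Tgate) $$ (1,1) = I2 $$ (1,1)"
    by (simp_all add: i[unfolded One_nat_def] Tgate_entries I2_def algebra_simps del: index_mult_mat(1))
qed simp

lemma tf_unitary: "adj (tf n k q) * tf n k q = I2"
proof -
  have "adj I2 * I2 = I2" by (simp add: I2_def)
  then show ?thesis by (simp add: tf_def Tgate_unitary)
qed

lemma That_carrier: "k \<le> n \<Longrightarrow> That n k \<in> carrier_mat (2^n) (2^n)"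
  by (simp add: That_ten)

lemma That_unitary: "k \<le> n \<Longrightarrow> adj (That n k) * That n k = 1\<^sub>m (2^n)"
proof -
  assume k: "k \<le> n"
  have "adj (That n k) * That n k = ten n (\<lambda>q. I2)"
    unfolding That_ten[OF k] by (subst adj_ten, simp, subst ten_mult) (auto simp: tf_unitary)
  also have "\<dots> = on_qubit n n I2" by (simp add: on_qubit_ten)
  finally show ?thesis by (simp add: on_qubit_one)
qed

text \<open>The Pauli transfer matrix of T: entry (a, b) is the coefficient of b in the conjugate of
  a. The letters I and Z are fixed, and the X-Y plane is rotated by pi/4.\<close>

definition cT :: "letter \<Rightarrow> letter \<Rightarrow> complex" where
  "cT a b = (if a = b \<and> (a = LI \<or> a = LZ) then 1
     else if a \<in> {LX,LY} \<and> b \<in> {LX,LY} then (if a = LX \<and> b = LY then - rt else rt) else 0)"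

definition cc :: "nat \<Rightarrow> nat \<Rightarrow> nat \<Rightarrow> letter \<Rightarrow> letter \<Rightarrow> complex" where
  "cc n k q a b = (if q < n - k then (if a = b then 1 else 0) else cT a b)"

lemma mtrace2: "A \<in> carrier_mat 2 2 \<Longrightarrow> mtrace A = A $$ (0,0) + A $$ (1,1)"
  by (simp add: mtrace_def numeral_2_eq_2)

lemma trace_Tgate: "mtrace (adj Tgate * sigma a * Tgate * sigma b) = 2 * cT a b"
proof -
  have c1: "adj Tgate \<in> carrier_mat 2 2" by simp
  note c2 = mult_carrier_mat[OF c1 sigma_carrier[of a]]
  note c3 = mult_carrier_mat[OF c2 Tgate_carrier]
  note c4 = mult_carrier_mat[OF c3 sigma_carrier[of b]]
  show ?thesis
    unfolding mtrace2[OF c4]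
    by (simp add: mat2_mult_index[OF c3 sigma_carrier, unfolded One_nat_def] mat2_mult_index[OF c2 Tgate_carrier, unfolded One_nat_def]
        mat2_mult_index[OF c1 sigma_carrier, unfolded One_nat_def] adj_index[OF Tgate_carrier] Tgate_entries del: index_mult_mat(1) assoc_mult_mat)
      (cases a; cases b; simp add: sigma_entries cT_def algebra_simps)
qed

lemma trace_tf: "mtrace (adj (tf n k q) * sigma a * tf n k q * sigma b) = 2 * cc n k q a b"
proof (cases "q < n - k")
  case True
  have "adj I2 * sigma a * I2 * sigma b = sigma a * sigma b"
  proof -
    have "adj I2 = I2" by (simp add: I2_def)
    then show ?thesis using left_mult_one_mat[OF sigma_carrier[of a]] right_mult_one_mat[OF sigma_carrier[of a]]
      by (simp add: I2_def)
  qed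
  then have "mtrace (adj (tf n k q) * sigma a * tf n k q * sigma b) = pl a b * mtrace (sigma (a + b))"
    using True by (simp add: tf_def sigma_mult mtrace_smult[OF sigma_carrier])
  then show ?thesis using True
    by (cases a; cases b) (simp_all add: cc_def mtrace_sigma pl_def plus_letter_def zero_letter_def)
next
  case False
  then show ?thesis by (simp add: tf_def cc_def trace_Tgate)
qed

definition cw :: "nat \<Rightarrow> nat \<Rightarrow> word \<Rightarrow> word \<Rightarrow> complex" where
  "cw n k u v = (\<Prod>q<n. cc n k q (u q) (v q))"

lemma trace_That:
  assumes "k \<le> n"
  shows "mtrace (adj (That n k) * pauli n u * That n k * pauli n v) = 2^n * cw n k u v"
proof -
  have c: "adj (tf n k q) \<in> carrier_mat 2 2" "adj (tf n k q) * sigma a \<in> carrier_mat 2 2"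
    "adj (tf n k q) * sigma a * tf n k q \<in> carrier_mat 2 2" for q a
    by (auto intro!: mult_carrier_mat[of _ 2 2 _ 2])
  have c4: "adj (tf n k q) * sigma a * tf n k q * sigma b \<in> carrier_mat 2 2" for q a b
    by (rule mult_carrier_mat[OF c(3) sigma_carrier])
  have "adj (That n k) * pauli n u * That n k * pauli n v =
     ten n (\<lambda>q. adj (tf n k q) * sigma (u q) * tf n k q * sigma (v q))"
    unfolding That_ten[OF assms] pauli_def
    by (simp only: adj_ten[OF tf_carrier] ten_mult[OF c(1) sigma_carrier] ten_mult[OF c(2) tf_carrier] ten_mult[OF c(3) sigma_carrier])
  then have "mtrace (adj (That n k) * pauli n u * That n k * pauli n v) = (\<Prod>q<n. 2 * cc n k q (u q) (v q))"
    by (simp only: mtrace_ten[OF c4] trace_tf)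
  then show ?thesis by (simp add: cw_def prod.distrib)
qed

lemma trace_That_expand:
  assumes k: "k \<le> n" and Y: "Y \<in> carrier_mat (2^n) (2^n)"
  shows "mtrace (cj (That n k) Y * pauli n u) = (\<Sum>v\<in>words n. cw n k u v * mtrace (Y * pauli n v))"
proof -
  note T = That_carrier[OF k]
  have A: "adj (That n k) * pauli n u * That n k \<in> carrier_mat (2^n) (2^n)"
    by (rule mult_carrier_mat[OF mult_carrier_mat[OF adj_carrier[OF T] pauli_carrier] T])
  have "2^n * mtrace (Y * (adj (That n k) * pauli n u * That n k)) = (\<Sum>v\<in>words n. mtrace (Y * pauli n v) * (2^n * cw n k u v))"
    unfolding sum_pauli_trace[OF Y A, symmetric] trace_That[OF k] ..
  also have "\<dots> = 2^n * (\<Sum>v\<in>words n. cw n k u v * mtrace (Y * pauli n v))"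
    by (simp add: sum_distrib_left mult_ac)
  finally show ?thesis unfolding mtrace_cj_mult[OF T Y pauli_carrier] by simp
qed

section \<open>Pauli twirling and the average after a T layer\<close>

lemma pauli_in_clifford:
  assumes "w \<in> words n" "w \<noteq> 0"
  obtains e where "cnj e * e = 1" "e \<cdot>\<^sub>m pauli n w \<in> clifford_group n"
proof -
  obtain c where c: "cnj c * c = 1" "c \<cdot>\<^sub>m tgate n w \<in> clifford_group n"
    using tset_all[OF assms] by (auto simp: tset_def)
  have t: "tgate n w \<in> carrier_mat (2^n) (2^n)" by (simp add: tgate_def)
  have "(c \<cdot>\<^sub>m tgate n w) * (c \<cdot>\<^sub>m tgate n w) = (c * c) \<cdot>\<^sub>m (tgate n w * tgate n w)"
    by (rule smult_mult_smult[OF t t])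
  also have "tgate n w * tgate n w = (- \<i>) \<cdot>\<^sub>m pauli n w"
    unfolding tgate_def lin_mult lin_pauli[symmetric] by (rule arg_cong2[where f="lin n w"]) (simp_all add: algebra_simps)
  finally have "(c * c * (- \<i>)) \<cdot>\<^sub>m pauli n w \<in> clifford_group n"
    using clifford_mult[OF c(2) c(2)] by (simp add: smult_smult_mat)
  moreover
  have "cnj (c * c * (- \<i>)) * (c * c * (- \<i>)) = (cnj c * c) * (cnj c * c) * (\<i> * (- \<i>))"
    by (simp only: complex_cnj_mult complex_cnj_minus complex_cnj_i minus_minus mult_ac)
  then have "cnj (c * c * (- \<i>)) * (c * c * (- \<i>)) = 1" unfolding c(1) by simp
  ultimately show ?thesis using that by blast
qed

text \<open>Conjugation by a Pauli operator multiplies each Pauli coefficient by a commutation sign;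
  the unit phase in front of the operator cancels.\<close>

lemma pauli_twirl:
  assumes w: "w \<in> words n"
  obtains g where "g \<in> clifford_group n"
    "\<And>C Z u. C \<in> clifford_group n \<Longrightarrow> Z \<in> carrier_mat (2^n) (2^n) \<Longrightarrow>
      mtrace (cj (g * C) Z * pauli n u) = sg n u w * mtrace (cj C Z * pauli n u)"
proof (cases "w = 0")
  case True
  have "1\<^sub>m (2^n) \<in> clifford_group n" by (rule clifford_group.one)
  then show ?thesis by (rule that) (simp add: True left_mult_one_mat[OF clifford_carrier])
next
  case False
  obtain e where e: "cnj e * e = 1" "e \<cdot>\<^sub>m pauli n w \<in> clifford_group n" using pauli_in_clifford[OF w False] .
  let ?g = "e \<cdot>\<^sub>m pauli n w"
  note gc = clifford_carrier[OF e(2)]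
  have conj: "adj ?g * pauli n u * ?g = sg n u w \<cdot>\<^sub>m pauli n u" for u
  proof -
    have PP: "pauli n w * pauli n u \<in> carrier_mat (2^n) (2^n)" by (rule mult_carrier_mat[OF pauli_carrier pauli_carrier])
    have "adj ?g * pauli n u * ?g = (cnj e \<cdot>\<^sub>m (pauli n w * pauli n u)) * ?g"
      unfolding adj_smult adj_pauli mult_smult_assoc_mat[OF pauli_carrier pauli_carrier] ..
    also have "\<dots> = (cnj e * e) \<cdot>\<^sub>m (pauli n w * pauli n u * pauli n w)"
      by (rule smult_mult_smult[OF PP pauli_carrier])
    also have "pauli n w * pauli n u * pauli n w = pauli n w * (pauli n u * pauli n w)"
      by (rule assoc_mult_mat[OF pauli_carrier pauli_carrier pauli_carrier])
    also have "\<dots> = sg n u w \<cdot>\<^sub>m (pauli n w * (pauli n w * pauli n u))"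
      unfolding pauli_commute[of n u w] by (rule mult_smult_distrib[OF pauli_carrier PP])
    finally show ?thesis by (simp add: e smult_smult_mat)
  qed
  show ?thesis
  proof (rule that[OF e(2)])
    fix C Z :: "complex mat" and u assume C: "C \<in> clifford_group n" and Z: "Z \<in> carrier_mat (2^n) (2^n)"
    note Cc = clifford_carrier[OF C]
    have cX: "cj C Z \<in> carrier_mat (2^n) (2^n)" by (rule cj_carrier[OF Cc Z])
    show "mtrace (cj (?g * C) Z * pauli n u) = sg n u w * mtrace (cj C Z * pauli n u)"
      unfolding cj_mult[OF gc Cc Z] mtrace_cj_mult[OF gc cX pauli_carrier] conj
      using mult_smult_distrib[OF cX pauli_carrier] mtrace_smult[OF mult_carrier_mat[OF cX pauli_carrier]] by simp
  qed
qed

text \<open>If the four words do not add up to 0, twirling with a Pauli operator that anticommutes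
  with their sum reverses the sign of the average.\<close>

lemma avg_pauli_zero:
  assumes X: "rank1 n X" and v: "v1 \<in> words n" "v2 \<in> words n" "v3 \<in> words n" "v4 \<in> words n"
    and ne: "v4 \<noteq> v3 + (v2 + v1)"
  shows "avg n (\<lambda>C. ee n (cjf C X) 0 0 v1 * ee n (cjf C X) 1 1 v2 * ee n (cjf C X) 2 2 v3 * ee n (cjf C X) 3 3 v4) = 0"
proof -
  let ?f = "\<lambda>C. ee n (cjf C X) 0 0 v1 * ee n (cjf C X) 1 1 v2 * ee n (cjf C X) 2 2 v3 * ee n (cjf C X) 3 3 v4"
  let ?s = "v4 + (v3 + (v2 + v1))"
  have s: "?s \<in> words n" "?s \<noteq> 0" using v ne by auto
  obtain w where w: "w \<in> words n" "sg n ?s w = -1" using exists_anticommuting[OF s] .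
  obtain g where g: "g \<in> clifford_group n" "\<And>C Z u. C \<in> clifford_group n \<Longrightarrow> Z \<in> carrier_mat (2^n) (2^n) \<Longrightarrow>
      mtrace (cj (g * C) Z * pauli n u) = sg n u w * mtrace (cj C Z * pauli n u)"
    using pauli_twirl[OF w(1)] by metis
  have ee: "ee n (cjf (g * C) X) i j u = sg n u w * ee n (cjf C X) i j u" if "C \<in> clifford_group n" for C i j u
    unfolding ee_def cjf_def using g(2)[OF that rank1_carrier[OF X]] .
  have "avg n ?f = avg n (\<lambda>C. ?f (g * C))" by (rule avg_shift[OF g(1), symmetric])
  also have "\<dots> = avg n (\<lambda>C. sg n ?s w * ?f C)"
    by (rule avg_cong) (simp add: ee sg_add_left mult_ac)
  also have "\<dots> = - avg n ?f" unfolding avg_cmult w(2) by simp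
  finally show ?thesis by simp
qed

text \<open>The fourth letter is the sum of the other three. The division by phases accounts for
  \<open>FF\<close> containing the product of Pauli operators instead of the Pauli operator of the
  summed word.\<close>

definition wf :: "nat \<Rightarrow> nat \<Rightarrow> nat \<Rightarrow> letter \<Rightarrow> letter \<Rightarrow> letter \<Rightarrow> complex" where
  "wf n k q a b c = (\<Sum>l\<in>UNIV. cc n k q l a * cc n k q l b * cc n k q l c * cc n k q l (c + (b + a))) / (pl b a * pl c (b + a))"

definition wt :: "nat \<Rightarrow> nat \<Rightarrow> word \<Rightarrow> word \<Rightarrow> word \<Rightarrow> complex" where
  "wt n k u v w = (\<Prod>q<n. wf n k q (u q) (v q) (w q))"

lemma pl_nonzero: "pl a b \<noteq> 0"
  by (simp add: pl_def)

text \<open>Expanding the four coefficients through the transfer matrix gives a sum over four words.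
  Twirling leaves only the fourth word determined by the other three, which is the form of
  \<open>FF\<close>.\<close>

lemma avg_That:
  assumes X: "rank1 n X" and k: "k \<le> n"
  shows "avg n (\<lambda>C. pp n (cjf (That n k * C) X) 0 1 2 3) =
    (\<Sum>u\<in>words n. \<Sum>v\<in>words n. \<Sum>w\<in>words n. wt n k u v w * FF n X u v w)"
proof -
  let ?W = "words n"
  let ?c = "\<lambda>v1 v2 v3 v4. \<Sum>u\<in>?W. cw n k u v1 * cw n k u v2 * cw n k u v3 * cw n k u v4"
  let ?e = "\<lambda>C v1 v2 v3 v4. ee n (cjf C X) 0 0 v1 * ee n (cjf C X) 1 1 v2 * ee n (cjf C X) 2 2 v3 * ee n (cjf C X) 3 3 v4"
  have expand: "pp n (cjf (That n k * C) X) 0 1 2 3 = (\<Sum>v1\<in>?W. \<Sum>v2\<in>?W. \<Sum>v3\<in>?W. \<Sum>v4\<in>?W. ?c v1 v2 v3 v4 * ?e C v1 v2 v3 v4)"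
    if C: "C \<in> clifford_group n" for C
  proof -
    note Cc = clifford_carrier[OF C]
    have E: "ee n (cjf (That n k * C) X) i j u = (\<Sum>v\<in>?W. cw n k u v * ee n (cjf C X) i j v)" for i j u
      unfolding ee_def cjf_def cj_mult[OF That_carrier[OF k] Cc rank1_carrier[OF X]]
      by (rule trace_That_expand[OF k cj_carrier[OF Cc rank1_carrier[OF X]]])
    have "pp n (cjf (That n k * C) X) 0 1 2 3 = (\<Sum>u\<in>?W. \<Sum>v1\<in>?W. \<Sum>v2\<in>?W. \<Sum>v3\<in>?W. \<Sum>v4\<in>?W.
       cw n k u v1 * cw n k u v2 * cw n k u v3 * cw n k u v4 * ?e C v1 v2 v3 v4)"
    proof -
      have p4: "(\<Sum>a\<in>?W. f1 a) * (\<Sum>b\<in>?W. f2 b) * (\<Sum>c\<in>?W. f3 c) * (\<Sum>e\<in>?W. f4 e) =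
        (\<Sum>a\<in>?W. \<Sum>b\<in>?W. \<Sum>c\<in>?W. \<Sum>e\<in>?W. f1 a * (f2 b * (f3 c * f4 e)))" for f1 f2 f3 f4 :: "word \<Rightarrow> complex"
        unfolding mult.assoc sum_product[of f3 _ f4]
        unfolding sum_product[of f2 _ "\<lambda>c. \<Sum>e\<in>_. f3 c * f4 e"]
        unfolding sum_product[of f1 _ "\<lambda>b. \<Sum>c\<in>_. f2 b * (\<Sum>e\<in>_. f3 c * f4 e)"]
        by (simp only: sum_distrib_left)
      then show ?thesis unfolding pp_def E p4 by (simp only: mult_ac)
    qed
    also have "\<dots> = (\<Sum>v1\<in>?W. \<Sum>v2\<in>?W. \<Sum>v3\<in>?W. \<Sum>v4\<in>?W. \<Sum>u\<in>?W.
       cw n k u v1 * cw n k u v2 * cw n k u v3 * cw n k u v4 * ?e C v1 v2 v3 v4)"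
      by (subst sum.swap, rule sum.cong[OF refl], subst sum.swap, rule sum.cong[OF refl],
          subst sum.swap, rule sum.cong[OF refl], subst sum.swap, rule refl)
    finally show ?thesis by (simp only: sum_distrib_right)
  qed
  have "avg n (\<lambda>C. pp n (cjf (That n k * C) X) 0 1 2 3) =
     avg n (\<lambda>C. \<Sum>v1\<in>?W. \<Sum>v2\<in>?W. \<Sum>v3\<in>?W. \<Sum>v4\<in>?W. ?c v1 v2 v3 v4 * ?e C v1 v2 v3 v4)"
    by (rule avg_cong) (rule expand)
  also have "\<dots> = (\<Sum>v1\<in>?W. \<Sum>v2\<in>?W. \<Sum>v3\<in>?W. \<Sum>v4\<in>?W. ?c v1 v2 v3 v4 * avg n (\<lambda>C. ?e C v1 v2 v3 v4))"
    unfolding avg_sum avg_cmult ..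
  also have "\<dots> = (\<Sum>v1\<in>?W. \<Sum>v2\<in>?W. \<Sum>v3\<in>?W. wt n k v1 v2 v3 * FF n X v1 v2 v3)"
  proof (intro sum.cong refl)
    fix v1 v2 v3 assume v: "v1 \<in> ?W" "v2 \<in> ?W" "v3 \<in> ?W"
    let ?v4 = "v3 + (v2 + v1)"
    let ?ph = "phase n v2 v1 * phase n v3 (v2 + v1)"
    have ph: "?ph \<noteq> 0" by (simp add: phase_def pl_def)
    have "(\<Sum>v4\<in>?W. ?c v1 v2 v3 v4 * avg n (\<lambda>C. ?e C v1 v2 v3 v4)) =
      ?c v1 v2 v3 ?v4 * avg n (\<lambda>C. ?e C v1 v2 v3 ?v4) + (\<Sum>v4\<in>?W - {?v4}. ?c v1 v2 v3 v4 * avg n (\<lambda>C. ?e C v1 v2 v3 v4))"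
      by (rule sum.remove) (use v in auto)
    also have "(\<Sum>v4\<in>?W - {?v4}. ?c v1 v2 v3 v4 * avg n (\<lambda>C. ?e C v1 v2 v3 v4)) = 0"
      by (rule sum.neutral) (use avg_pauli_zero[OF X v] in auto)
    finally have 1: "(\<Sum>v4\<in>?W. ?c v1 v2 v3 v4 * avg n (\<lambda>C. ?e C v1 v2 v3 v4)) = ?c v1 v2 v3 ?v4 * avg n (\<lambda>C. ?e C v1 v2 v3 ?v4)"
      by simp
    have 2: "FF n X v1 v2 v3 = ?ph * avg n (\<lambda>C. ?e C v1 v2 v3 ?v4)"
      unfolding FF_def avg_cmult[symmetric]
    proof (rule avg_cong)
      fix C assume C: "C \<in> clifford_group n"
      have Y: "cjf C X 3 3 \<in> carrier_mat (2^n) (2^n)" by (rule rank1_carrier[OF cjf_rank1[OF X C]])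
      have "pauli n v3 * (pauli n v2 * pauli n v1) = ?ph \<cdot>\<^sub>m pauli n ?v4"
        unfolding pauli_mult[of n v2 v1] mult_smult_distrib[OF pauli_carrier pauli_carrier] pauli_mult smult_smult_mat ..
      then have "mtrace (cjf C X 3 3 * (pauli n v3 * (pauli n v2 * pauli n v1))) = ?ph * ee n (cjf C X) 3 3 ?v4"
        unfolding ee_def using mult_smult_distrib[OF Y pauli_carrier] mtrace_smult[OF mult_carrier_mat[OF Y pauli_carrier]] by simp
      then show "phi n (cjf C X) v1 v2 v3 = ?ph * ?e C v1 v2 v3 ?v4" by (simp add: phi_def mult_ac)
    qed
    have 3: "?c v1 v2 v3 ?v4 = wt n k v1 v2 v3 * ?ph"
    proof -
      have "?c v1 v2 v3 ?v4 = (\<Prod>q<n. \<Sum>l\<in>UNIV. cc n k q l (v1 q) * cc n k q l (v2 q) * cc n k q l (v3 q) * cc n k q l (?v4 q))"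
        unfolding cw_def prod.distrib[symmetric] by (rule sum_words_prod)
      also have "\<dots> = (\<Prod>q<n. wf n k q (v1 q) (v2 q) (v3 q) * (pl (v2 q) (v1 q) * pl (v3 q) ((v2 + v1) q)))"
        by (intro prod.cong refl) (simp add: wf_def plus_fun_apply pl_nonzero)
      finally show ?thesis unfolding wt_def phase_def prod.distrib .
    qed
    show "(\<Sum>v4\<in>?W. ?c v1 v2 v3 v4 * avg n (\<lambda>C. ?e C v1 v2 v3 v4)) = wt n k v1 v2 v3 * FF n X v1 v2 v3"
      unfolding 1 2 3 by simp
  qed
  finally show ?thesis .
qed

lemma wf_I: "q < n - k \<Longrightarrow> wf n k q a b c = (if a = b \<and> b = c then 1 else 0)"
  by (cases a; cases b; cases c; simp add: wf_def cc_def sum_letter pl_def plus_letter_def zero_letter_def)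

text \<open>The negative value comes from the phase in XYX = -Y and YXY = -X.\<close>

definition wT :: "letter \<Rightarrow> letter \<Rightarrow> letter \<Rightarrow> complex" where
  "wT a b c = (if a = b \<and> b = c \<and> (a = LI \<or> a = LZ) then 1
     else if a \<in> {LX,LY} \<and> b \<in> {LX,LY} \<and> c \<in> {LX,LY} then (if a = c \<and> b \<noteq> a then -1/2 else 1/2) else 0)"

lemma wf_T: "\<not> q < n - k \<Longrightarrow> wf n k q a b c = wT a b c"
  by (cases a; cases b; cases c; simp add: wf_def cc_def cT_def wT_def sum_letter pl_def plus_letter_def zero_letter_def field_simps)

section \<open>Support and sums of the weights of a T layer\<close>

lemma wf_support:
  assumes "wf n k q a b c \<noteq> 0"
  shows "sl a b * sl a c = sl b c" "a = 0 \<longleftrightarrow> b = 0" "a = 0 \<longleftrightarrow> c = 0" "c + (b + a) = 0 \<longleftrightarrow> a = 0"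
  using assms by (cases "q < n - k"; cases a; cases b; cases c; simp add: wf_I wf_T wT_def sl_def zero_letter_def plus_letter_def)+

text \<open>The one-qubit rules survive the product over positions. Hence either all three words
  commute or exactly one pair does, and degenerate triples with a zero word or w = u + v reduce to
  the triple of zeros.\<close>

lemma wt_support:
  assumes ne: "wt n k u v w \<noteq> 0" and u: "u \<in> words n" "v \<in> words n" "w \<in> words n"
  shows "sg n v w = sg n u v * sg n u w" "u = 0 \<longleftrightarrow> v = 0" "u = 0 \<longleftrightarrow> w = 0" "w = u + v \<longleftrightarrow> u = 0"
proof -
  have q: "wf n k q (u q) (v q) (w q) \<noteq> 0" if "q < n" for q using ne that by (auto simp: wt_def)
  show "sg n v w = sg n u v * sg n u w"
    unfolding sg_def prod.distrib[symmetric] by (intro prod.cong refl) (use wf_support(1)[OF q] in auto)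
  have z: "x = 0 \<longleftrightarrow> (\<forall>q<n. x q = 0)" if "x \<in> words n" for x
    using that by (auto simp: words_def fun_eq_iff zero_fun_apply) (metis not_le)
  show "u = 0 \<longleftrightarrow> v = 0" unfolding z[OF u(1)] z[OF u(2)] using wf_support(2)[OF q] by blast
  show "u = 0 \<longleftrightarrow> w = 0" unfolding z[OF u(1)] z[OF u(3)] using wf_support(3)[OF q] by blast
  have "w = u + v \<longleftrightarrow> w + (v + u) = 0" by (simp add: add.commute)
  also have "\<dots> \<longleftrightarrow> u = 0"
    unfolding z[OF u(1)] z[OF words_add[OF u(3) words_add[OF u(2,1)]]] plus_fun_apply
    using wf_support(4)[OF q] by blast
  finally show "w = u + v \<longleftrightarrow> u = 0" .
qed

lemma sum_words_prod2:
  "(\<Sum>u\<in>words n. \<Sum>v\<in>words n. \<Prod>q<n. g q (u q) (v q)) = (\<Prod>q<n. \<Sum>a\<in>UNIV. \<Sum>b\<in>UNIV. (g q a b :: complex))"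
proof -
  have "(\<Sum>v\<in>words n. \<Prod>q<n. g q (u q) (v q)) = (\<Prod>q<n. \<Sum>b\<in>UNIV. g q (u q) b)" for u
    by (rule sum_words_prod)
  then show ?thesis by (simp add: sum_words_prod[of "\<lambda>q a. \<Sum>b\<in>UNIV. g q a b" n])
qed

lemma sum_words_prod3:
  "(\<Sum>u\<in>words n. \<Sum>v\<in>words n. \<Sum>w\<in>words n. \<Prod>q<n. g q (u q) (v q) (w q)) =
    (\<Prod>q<n. \<Sum>a\<in>UNIV. \<Sum>b\<in>UNIV. \<Sum>c\<in>UNIV. (g q a b c :: complex))"
proof -
  have "(\<Sum>w\<in>words n. \<Prod>q<n. g q (u q) (v q) (w q)) = (\<Prod>q<n. \<Sum>c\<in>UNIV. g q (u q) (v q) c)" for u v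
    by (rule sum_words_prod)
  then show ?thesis by (simp add: sum_words_prod2[of "\<lambda>q a b. \<Sum>c\<in>UNIV. g q a b c"])
qed

lemma prod_layers:
  assumes "k \<le> n" and "\<And>q. q < n - k \<Longrightarrow> f q = 4" and "\<And>q. \<not> q < n - k \<Longrightarrow> f q = (4 * m :: complex)"
  shows "(\<Prod>q<n. f q) = 4^n * m^k"
proof -
  have "{..<n} = {..<n - k} \<union> {n - k..<n}" using assms(1) by auto
  then have "(\<Prod>q<n. f q) = (\<Prod>q<n - k. f q) * (\<Prod>q\<in>{n - k..<n}. f q)"
    by (metis (no_types) finite_lessThan finite_atLeastLessThan ivl_disj_int_one(2) lessThan_atLeast0 prod.union_disjoint)
  also have "(\<Prod>q<n - k. f q) = 4^(n - k)" using assms(2) by simp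
  also have "(\<Prod>q\<in>{n - k..<n}. f q) = (4 * m)^k" using assms(1,3) by simp
  also have "4^(n - k) * (4 * m)^k = 4^n * m^k"
    using assms(1) by (simp add: power_mult_distrib power_add[symmetric])
  finally show ?thesis .
qed

context
  fixes n k :: nat
  assumes k: "k \<le> n"
begin

text \<open>Each sum factors over positions: an untouched qubit contributes 4, a qubit carrying T
  contributes 4m. On the full diagonal m = 3/4; for the sign of u and w it is 0, so that sum
  vanishes once k >= 1.\<close>

lemma wt_sums:
  "(\<Sum>u\<in>words n. wt n k u u u) = 4^n * (3/4)^k"
  "(\<Sum>u\<in>words n. \<Sum>v\<in>words n. wt n k u u v) = 4^n"
  "(\<Sum>u\<in>words n. \<Sum>v\<in>words n. sg n u v * wt n k u u v) = 4^n * (1/2)^k"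
  "(\<Sum>u\<in>words n. \<Sum>v\<in>words n. wt n k u v u) = 4^n * (1/2)^k"
  "(\<Sum>u\<in>words n. \<Sum>v\<in>words n. sg n u v * wt n k u v u) = 4^n"
  "(\<Sum>u\<in>words n. \<Sum>v\<in>words n. wt n k u v v) = 4^n"
  "(\<Sum>u\<in>words n. \<Sum>v\<in>words n. sg n u v * wt n k u v v) = 4^n * (1/2)^k"
  "(\<Sum>u\<in>words n. \<Sum>v\<in>words n. \<Sum>w\<in>words n. wt n k u v w) = 4^n"
  "(\<Sum>u\<in>words n. \<Sum>v\<in>words n. \<Sum>w\<in>words n. sg n u v * wt n k u v w) = 4^n"
  "(\<Sum>u\<in>words n. \<Sum>v\<in>words n. \<Sum>w\<in>words n. sg n u w * wt n k u v w) = 4^n * 0^k"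
  "(\<Sum>u\<in>words n. \<Sum>v\<in>words n. \<Sum>w\<in>words n. sg n v w * wt n k u v w) = 4^n"
proof -
  note d = wt_def sg_def prod.distrib[symmetric]
  have "card (UNIV :: letter set) = 4" by (simp add: UNIV_letter)
  note e = sum_letter wT_def sl_def this
  show "(\<Sum>u\<in>words n. wt n k u u u) = 4^n * (3/4)^k"
    unfolding d sum_words_prod[of "\<lambda>q a. wf n k q a a a" n] by (rule prod_layers[OF k]) (simp_all add: wf_I wf_T e)
  show "(\<Sum>u\<in>words n. \<Sum>v\<in>words n. wt n k u u v) = 4^n"
    unfolding d sum_words_prod2[of "\<lambda>q a b. wf n k q a a b"] by (subst prod_layers[OF k, where m=1]) (simp_all add: wf_I wf_T e)
  show "(\<Sum>u\<in>words n. \<Sum>v\<in>words n. sg n u v * wt n k u u v) = 4^n * (1/2)^k"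
    unfolding d sum_words_prod2[of "\<lambda>q a b. sl a b * wf n k q a a b"] by (rule prod_layers[OF k]) (simp_all add: wf_I wf_T e)
  show "(\<Sum>u\<in>words n. \<Sum>v\<in>words n. wt n k u v u) = 4^n * (1/2)^k"
    unfolding d sum_words_prod2[of "\<lambda>q a b. wf n k q a b a"] by (rule prod_layers[OF k]) (simp_all add: wf_I wf_T e)
  show "(\<Sum>u\<in>words n. \<Sum>v\<in>words n. sg n u v * wt n k u v u) = 4^n"
    unfolding d sum_words_prod2[of "\<lambda>q a b. sl a b * wf n k q a b a"] by (subst prod_layers[OF k, where m=1]) (simp_all add: wf_I wf_T e)
  show "(\<Sum>u\<in>words n. \<Sum>v\<in>words n. wt n k u v v) = 4^n"
    unfolding d sum_words_prod2[of "\<lambda>q a b. wf n k q a b b"] by (subst prod_layers[OF k, where m=1]) (simp_all add: wf_I wf_T e)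
  show "(\<Sum>u\<in>words n. \<Sum>v\<in>words n. sg n u v * wt n k u v v) = 4^n * (1/2)^k"
    unfolding d sum_words_prod2[of "\<lambda>q a b. sl a b * wf n k q a b b"] by (rule prod_layers[OF k]) (simp_all add: wf_I wf_T e)
  show "(\<Sum>u\<in>words n. \<Sum>v\<in>words n. \<Sum>w\<in>words n. wt n k u v w) = 4^n"
    unfolding d sum_words_prod3[of "\<lambda>q a b c. wf n k q a b c"] by (subst prod_layers[OF k, where m=1]) (simp_all add: wf_I wf_T e)
  show "(\<Sum>u\<in>words n. \<Sum>v\<in>words n. \<Sum>w\<in>words n. sg n u v * wt n k u v w) = 4^n"
    unfolding d sum_words_prod3[of "\<lambda>q a b c. sl a b * wf n k q a b c"] by (subst prod_layers[OF k, where m=1]) (simp_all add: wf_I wf_T e)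
  show "(\<Sum>u\<in>words n. \<Sum>v\<in>words n. \<Sum>w\<in>words n. sg n u w * wt n k u v w) = 4^n * 0^k"
    unfolding d sum_words_prod3[of "\<lambda>q a b c. sl a c * wf n k q a b c"] by (rule prod_layers[OF k]) (simp_all add: wf_I wf_T e)
  show "(\<Sum>u\<in>words n. \<Sum>v\<in>words n. \<Sum>w\<in>words n. sg n v w * wt n k u v w) = 4^n"
    unfolding d sum_words_prod3[of "\<lambda>q a b c. sl b c * wf n k q a b c"] by (subst prod_layers[OF k, where m=1]) (simp_all add: wf_I wf_T e)
qed

lemma wt_zero: "wt n k 0 0 0 = 1"
proof -
  have "wf n k q 0 0 0 = 1" for q
    by (cases "q < n - k") (simp_all add: wf_I wf_T wT_def zero_letter_def)
  then show ?thesis by (simp add: wt_def zero_fun_apply)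
qed

end

lemma four_pow_ge: "n \<ge> 3 \<Longrightarrow> (4::nat)^n \<ge> 64"
  using power_increasing[of 3 n "4::nat"] by simp

lemma four_pow_ne:
  assumes "n \<ge> 3" and "m < 64"
  shows "(4::complex)^n \<noteq> of_nat m"
proof
  assume "(4::complex)^n = of_nat m"
  then have "of_nat (4^n) = (of_nat m :: complex)" by simp
  then have "4^n = m" by (simp only: of_nat_eq_iff)
  then show False using four_pow_ge[OF assms(1)] assms(2) by simp
qed

text \<open>NC vanishes for n = 1 and 4^n/4 - 4 for n = 2, reflecting the absence of distinct
  commuting pairs and of independent commuting triples.\<close>

lemma denominators:
  assumes "n \<ge> 3"
  shows "(4::complex)^n - 1 \<noteq> 0" "NC n \<noteq> 0" "NA n \<noteq> 0" "(4::complex)^n / 4 - 4 \<noteq> 0"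
proof -
  have "(4::complex)^n \<noteq> 1" "(4::complex)^n \<noteq> 4" "(4::complex)^n \<noteq> 16"
    using four_pow_ne[OF assms, of 1] four_pow_ne[OF assms, of 4] four_pow_ne[OF assms, of 16] by simp_all
  then have "(4::complex)^n - 1 \<noteq> 0" "(4::complex)^n / 2 - 2 \<noteq> 0" "(4::complex)^n / 4 - 4 \<noteq> 0"
    by simp_all
  then show "(4::complex)^n - 1 \<noteq> 0" "NC n \<noteq> 0" "NA n \<noteq> 0" "(4::complex)^n / 4 - 4 \<noteq> 0"
    unfolding NC_def NA_def mult_eq_0_iff by simp_all
qed

text \<open>Values of \<open>FF\<close> by the type of triple: \<open>fa\<close> for equal nonzero
  words, \<open>fc\<close> and \<open>fac\<close> for (u, u, v) with u and v commuting or
  anticommuting, \<open>fm\<close> when only the pair u, v commutes, \<open>fp\<close> for generic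
  commuting triples.\<close>

definition fa :: "nat \<Rightarrow> fam \<Rightarrow> complex" where "fa n X = (pp n X 0 1 2 3 - t0 X) / (4^n - 1)"
definition fc :: "nat \<Rightarrow> fam \<Rightarrow> complex" where "fc n X = cval n X / NC n"
definition fac :: "nat \<Rightarrow> fam \<Rightarrow> complex" where "fac n X = aval n X / NA n"
definition fm :: "nat \<Rightarrow> fam \<Rightarrow> complex" where "fm n X = (minus3 n X - aval n X) / (NC n * (4^n / 4))"
definition fp :: "nat \<Rightarrow> fam \<Rightarrow> complex" where
  "fp n X = (plus3 n X - t3c n X 0 2 3 * gg X 1 1 - t3c n X 1 2 3 * gg X 0 0
    - (dt n X + 2^n * pp n X 0 1 3 2) / 2 + 2 * pr n X 2 3 0 1
    - ((t3c n X 0 1 3 * gg X 2 2 - pr n X 0 3 1 2 - pr n X 1 3 0 2 - pr n X 0 1 2 3 + 2 * t0 X)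
      + cval n (reidx r13 X) + cval n (reidx r14 X)
      + (t3c n X 0 1 2 * gg X 3 3 - pr n X 0 2 1 3 - pr n X 1 2 0 3 - pr n X 0 1 2 3 + 2 * t0 X)))
    / (NC n * (4^n / 4 - 4))"

context
  fixes n :: nat and X :: fam
  assumes n: "n \<ge> 3" and X: "rank1 n X"
begin

private abbreviation "X2 \<equiv> reidx r13 X"
private abbreviation "X3 \<equiv> reidx r14 X"
private abbreviation "X4 \<equiv> reidx r23 X"

lemma FF_a: "u \<in> words n \<Longrightarrow> u \<noteq> 0 \<Longrightarrow> FF n X u u u = fa n X"
  using value_equal[OF X] denominators[OF n] by (simp add: fa_def field_simps)

lemma FF_c: "rank1 n Y \<Longrightarrow> u \<in> words n \<Longrightarrow> v \<in> words n \<Longrightarrow> u \<noteq> 0 \<Longrightarrow> v \<noteq> 0 \<Longrightarrow> u \<noteq> v \<Longrightarrow> sg n u v = 1 \<Longrightarrow>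
  FF n Y u u v = fc n Y"
  using value_comm[of n Y u v] denominators[OF n] by (simp add: fc_def field_simps)

lemma FF_ac: "rank1 n Y \<Longrightarrow> u \<in> words n \<Longrightarrow> v \<in> words n \<Longrightarrow> sg n u v = -1 \<Longrightarrow> FF n Y u u v = fac n Y"
  using value_anti[of n Y u v] denominators[OF n] by (simp add: fac_def field_simps)

lemma FF_m: "rank1 n Y \<Longrightarrow> u \<in> words n \<Longrightarrow> v \<in> words n \<Longrightarrow> w \<in> words n \<Longrightarrow> u \<noteq> v \<Longrightarrow> sg n u v = 1 \<Longrightarrow>
  sg n u w = -1 \<Longrightarrow> sg n v w = -1 \<Longrightarrow> FF n Y u v w = fm n Y"
  using value_minus[of n Y u v w] denominators[OF n] by (simp add: fm_def field_simps)

lemma FF_p: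
  assumes u: "u \<in> words n" "v \<in> words n" "w \<in> words n" "u \<noteq> 0" "v \<noteq> 0" "u \<noteq> v"
    and s: "sg n u v = 1" "sg n u w = 1" "sg n v w = 1" and w: "w \<notin> {0, u, v, u + v}"
  shows "FF n X u v w = fp n X"
proof -
  have c: "NC n * FF n X u v u = cval n X2" "NC n * FF n X u v v = cval n X3"
    unfolding FF_uvu[OF X] FF_uvv[OF X] s(1)
    using value_comm[OF rank1_reidx[OF X] u(1,2,4,5,6) s(1)] by simp_all
  have "NC n * (4^n / 4 - 4) * FF n X u v w = fp n X * (NC n * (4^n / 4 - 4))"
    unfolding value_plus[OF X u s w] distrib_left c value_I3[OF X u(1,2,4,5,6) s(1)] value_I4[OF X u(1,2,4,5,6) s(1)]
    using denominators[OF n] by (simp add: fp_def)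
  then show ?thesis using denominators[OF n] by simp
qed

text \<open>On the support of the weights the generic value depends on two signs only and is a
  combination of sign projections. The further terms correct it where two words coincide, where all
  three do, and at the triple of zeros.\<close>

lemma FF_support:
  assumes u: "u \<in> words n" "v \<in> words n" "w \<in> words n" and ne: "wt n k u v w \<noteq> 0"
  defines "a \<equiv> sg n u v" and "b \<equiv> sg n u w"
  shows "FF n X u v w =
      (1 + a) / 2 * ((1 + b) / 2) * fp n X + (1 + a) / 2 * ((1 - b) / 2) * fm n X
      - (1 - a) / 2 * ((1 + b) / 2) * fm n X2 + (1 - a) / 2 * ((1 - b) / 2) * fm n X4
    + (if v = u then (1 + b) / 2 * (fc n X - fp n X) + (1 - b) / 2 * (fac n X - fm n X) else 0)
    + (if w = u then (1 + a) / 2 * (fc n X2 - fp n X) - (1 - a) / 2 * (fac n X2 - fm n X2) else 0)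
    + (if w = v then (1 + a) / 2 * (fc n X3 - fp n X) + (1 - a) / 2 * (fac n X3 - fm n X4) else 0)
    + (if v = u \<and> w = u then fa n X + 2 * fp n X - fc n X - fc n X2 - fc n X3 else 0)
    + (if u = 0 \<and> v = 0 \<and> w = 0 then t0 X - fa n X else 0)"
proof -
  note sup = wt_support[OF ne u]
  note Y = rank1_reidx[OF X]
  have ab: "a = 1 \<or> a = -1" "b = 1 \<or> b = -1" unfolding a_def b_def using sg_cases by auto
  have vw: "sg n v w = a * b" using sup(1) by (simp add: a_def b_def)
  show ?thesis
  proof (cases "u = 0")
    case True
    then have "v = 0" "w = 0" using sup by auto
    then show ?thesis using True FF_000[OF X] by (simp add: a_def b_def)
  next
    case False
    then have nz: "u \<noteq> 0" "v \<noteq> 0" "w \<noteq> 0" "w \<noteq> u + v" using sup by auto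
    consider "v = u" "w = u" | "v = u" "w \<noteq> u" | "v \<noteq> u" "w = u" | "v \<noteq> u" "w = v" | "v \<noteq> u" "w \<noteq> u" "w \<noteq> v"
      by blast
    then show ?thesis
    proof cases
      case 1
      then show ?thesis using FF_a[OF u(1) nz(1)] nz by (simp add: a_def b_def)
    next
      case 2
      then have "FF n X u v w = (if b = 1 then fc n X else fac n X)"
        using FF_c[OF X u(1,3) nz(1,3)] FF_ac[OF X u(1,3)] ab(2) by (auto simp: b_def)
      then show ?thesis using 2 nz ab by (auto simp: a_def field_simps)
    next
      case 3
      have "FF n X u v w = a * FF n X2 u u v" using FF_uvu[OF X, of u v] 3 by (simp add: a_def)
      also have "FF n X2 u u v = (if a = 1 then fc n X2 else fac n X2)"
        using FF_c[OF Y u(1,2) nz(1,2)] FF_ac[OF Y u(1,2)] ab(1) 3 by (auto simp: a_def)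
      finally show ?thesis using 3 nz ab by (auto simp: b_def field_simps)
    next
      case 4
      have "FF n X u v w = FF n X3 u u v" using FF_uvv[OF X, of u v] 4 by simp
      also have "\<dots> = (if a = 1 then fc n X3 else fac n X3)"
        using FF_c[OF Y u(1,2) nz(1,2)] FF_ac[OF Y u(1,2)] ab(1) 4 by (auto simp: a_def)
      finally show ?thesis using 4 nz ab by (auto simp: a_def b_def field_simps)
    next
      case 5
      have w: "w \<notin> {0, u, v, u + v}" using 5 nz by auto
      from ab consider "a = 1" "b = 1" | "a = 1" "b = -1" | "a = -1" "b = 1" | "a = -1" "b = -1" by blast
      then show ?thesis
      proof cases
        case 1
        then have "FF n X u v w = fp n X" using FF_p[OF u nz(1,2) _ _ _ _ w] 5 vw by (simp add: a_def b_def)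
        then show ?thesis using 1 5 nz by simp
      next
        case 2
        then have "FF n X u v w = fm n X" using FF_m[OF X u] 5 vw by (simp add: a_def b_def)
        then show ?thesis using 2 5 nz by simp
      next
        case 3
        have "FF n X u v w = sg n v w * FF n X2 u w v" by (rule FF_r13[OF X])
        also have "FF n X2 u w v = fm n X2"
          using FF_m[OF Y u(1,3,2)] 5 3 vw by (simp add: a_def b_def sg_sym)
        finally show ?thesis using 3 5 nz vw by simp
      next
        case 4
        have "FF n X u v w = sg n u v * (sg n u w * FF n X4 v w u)" by (rule FF_r23[OF X])
        also have "FF n X4 v w u = fm n X4"
          using FF_m[OF Y u(2,3,1)] 5 4 vw by (simp add: a_def b_def sg_sym)
        finally show ?thesis using 4 5 nz by (simp add: a_def b_def)
      qed
    qed
  qed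
qed

lemma sum_if_const: "(\<Sum>w\<in>W. if P then f w else (0::complex)) = (if P then sum f W else 0)"
  by simp

lemma wt_FF_sum:
  assumes k: "1 \<le> k" "k \<le> n"
  defines "x \<equiv> (1/2)^k" and "y \<equiv> (3/4)^k"
  shows "(\<Sum>u\<in>words n. \<Sum>v\<in>words n. \<Sum>w\<in>words n. wt n k u v w * FF n X u v w) =
     4^n * ((3 * fp n X + fm n X + fm n X2 + fm n X4) / 4
      + (1 + x) / 2 * (fc n X + fc n X2 + fc n X3 - 3 * fp n X)
      + (1 - x) / 2 * (fac n X + fac n X2 + fac n X3 - fm n X - fm n X2 - fm n X4)
      + y * (fa n X + 2 * fp n X - fc n X - fc n X2 - fc n X3)) + t0 X - fa n X"
proof -
  let ?W = "words n"
  define e0 where "e0 = (fp n X + fm n X - fm n X2 + fm n X4) / 4"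
  define e1 where "e1 = (fp n X + fm n X + fm n X2 - fm n X4) / 4"
  define e2 where "e2 = (fp n X - fm n X - fm n X2 - fm n X4) / 4"
  define e3 where "e3 = (fp n X - fm n X + fm n X2 + fm n X4) / 4"
  define c10 where "c10 = ((fc n X - fp n X) + (fac n X - fm n X)) / 2"
  define c11 where "c11 = ((fc n X - fp n X) - (fac n X - fm n X)) / 2"
  define c20 where "c20 = ((fc n X2 - fp n X) - (fac n X2 - fm n X2)) / 2"
  define c21 where "c21 = ((fc n X2 - fp n X) + (fac n X2 - fm n X2)) / 2"
  define c30 where "c30 = ((fc n X3 - fp n X) + (fac n X3 - fm n X4)) / 2"
  define c31 where "c31 = ((fc n X3 - fp n X) - (fac n X3 - fm n X4)) / 2"
  define ca where "ca = fa n X + 2 * fp n X - fc n X - fc n X2 - fc n X3"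
  define cz where "cz = t0 X - fa n X"
  have pt: "wt n k u v w * FF n X u v w = e0 * wt n k u v w + e1 * (sg n u v * wt n k u v w)
      + e2 * (sg n u w * wt n k u v w) + e3 * (sg n v w * wt n k u v w)
    + (if v = u then c10 * wt n k u u w + c11 * (sg n u w * wt n k u u w) else 0)
    + (if w = u then c20 * wt n k u v u + c21 * (sg n u v * wt n k u v u) else 0)
    + (if w = v then c30 * wt n k u v v + c31 * (sg n u v * wt n k u v v) else 0)
    + (if v = u then (if w = u then ca * wt n k u u u else 0) else 0)
    + (if u = 0 then (if v = 0 then (if w = 0 then cz * wt n k 0 0 0 else 0) else 0) else 0)"
    if u: "u \<in> ?W" "v \<in> ?W" "w \<in> ?W" for u v w
  proof (cases "wt n k u v w = 0")
    case True
    then show ?thesis by auto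
  next
    case False
    have vw: "sg n v w = sg n u v * sg n u w" by (rule wt_support(1)[OF False u])
    show ?thesis
      unfolding FF_support[OF u False] vw e0_def e1_def e2_def e3_def c10_def c11_def c20_def c21_def c30_def c31_def ca_def cz_def
      by (auto simp: field_simps)
  qed
  have S: "(\<Sum>u\<in>?W. \<Sum>v\<in>?W. \<Sum>w\<in>?W. wt n k u v w * FF n X u v w) =
    (\<Sum>u\<in>?W. \<Sum>v\<in>?W. \<Sum>w\<in>?W. e0 * wt n k u v w) + (\<Sum>u\<in>?W. \<Sum>v\<in>?W. \<Sum>w\<in>?W. e1 * (sg n u v * wt n k u v w))
    + (\<Sum>u\<in>?W. \<Sum>v\<in>?W. \<Sum>w\<in>?W. e2 * (sg n u w * wt n k u v w)) + (\<Sum>u\<in>?W. \<Sum>v\<in>?W. \<Sum>w\<in>?W. e3 * (sg n v w * wt n k u v w))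
    + (\<Sum>u\<in>?W. \<Sum>v\<in>?W. \<Sum>w\<in>?W. if v = u then c10 * wt n k u u w + c11 * (sg n u w * wt n k u u w) else 0)
    + (\<Sum>u\<in>?W. \<Sum>v\<in>?W. \<Sum>w\<in>?W. if w = u then c20 * wt n k u v u + c21 * (sg n u v * wt n k u v u) else 0)
    + (\<Sum>u\<in>?W. \<Sum>v\<in>?W. \<Sum>w\<in>?W. if w = v then c30 * wt n k u v v + c31 * (sg n u v * wt n k u v v) else 0)
    + (\<Sum>u\<in>?W. \<Sum>v\<in>?W. \<Sum>w\<in>?W. if v = u then (if w = u then ca * wt n k u u u else 0) else 0)
    + (\<Sum>u\<in>?W. \<Sum>v\<in>?W. \<Sum>w\<in>?W. if u = 0 then (if v = 0 then (if w = 0 then cz * wt n k 0 0 0 else 0) else 0) else 0)"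
    unfolding sum.distrib[symmetric] by (intro sum.cong refl pt)
  note ws = wt_sums[OF k(2)]
  \<comment> \<open>This is where k >= 1 enters: the weight sum with sg n u w is 4^n * 0^k. For k =
    0 the layer is the identity, a case settled in \<open>ens_qT\<close> and
    \<open>ens_qS\<close>.\<close>
  have z: "(0::complex)^k = 0" using k by simp
  have 1: "(\<Sum>u\<in>?W. \<Sum>v\<in>?W. \<Sum>w\<in>?W. e0 * wt n k u v w) = e0 * 4^n"
    "(\<Sum>u\<in>?W. \<Sum>v\<in>?W. \<Sum>w\<in>?W. e1 * (sg n u v * wt n k u v w)) = e1 * 4^n"
    "(\<Sum>u\<in>?W. \<Sum>v\<in>?W. \<Sum>w\<in>?W. e2 * (sg n u w * wt n k u v w)) = 0"
    "(\<Sum>u\<in>?W. \<Sum>v\<in>?W. \<Sum>w\<in>?W. e3 * (sg n v w * wt n k u v w)) = e3 * 4^n"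
  proof -
    have "(\<Sum>u\<in>?W. \<Sum>v\<in>?W. \<Sum>w\<in>?W. c * f u v w) = c * (\<Sum>u\<in>?W. \<Sum>v\<in>?W. \<Sum>w\<in>?W. f u v w)"
      for c :: complex and f by (simp only: sum_distrib_left)
    note m = this
    show "(\<Sum>u\<in>?W. \<Sum>v\<in>?W. \<Sum>w\<in>?W. e0 * wt n k u v w) = e0 * 4^n"
      "(\<Sum>u\<in>?W. \<Sum>v\<in>?W. \<Sum>w\<in>?W. e1 * (sg n u v * wt n k u v w)) = e1 * 4^n"
      "(\<Sum>u\<in>?W. \<Sum>v\<in>?W. \<Sum>w\<in>?W. e2 * (sg n u w * wt n k u v w)) = 0"
      "(\<Sum>u\<in>?W. \<Sum>v\<in>?W. \<Sum>w\<in>?W. e3 * (sg n v w * wt n k u v w)) = e3 * 4^n"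
      unfolding m ws z by simp_all
  qed
  have 2: "(\<Sum>u\<in>?W. \<Sum>v\<in>?W. \<Sum>w\<in>?W. if v = u then c10 * wt n k u u w + c11 * (sg n u w * wt n k u u w) else 0) = c10 * 4^n + c11 * (4^n * x)"
  proof -
    have "(\<Sum>u\<in>?W. \<Sum>v\<in>?W. \<Sum>w\<in>?W. if v = u then c10 * wt n k u u w + c11 * (sg n u w * wt n k u u w) else 0)
      = (\<Sum>u\<in>?W. \<Sum>w\<in>?W. c10 * wt n k u u w + c11 * (sg n u w * wt n k u u w))"
      unfolding sum_if_const by (rule sum.cong[OF refl]) (simp only: sum.delta finite_words if_True)
    then show ?thesis unfolding sum.distrib sum_distrib_left[symmetric] ws x_def .
  qed
  have 3: "(\<Sum>u\<in>?W. \<Sum>v\<in>?W. \<Sum>w\<in>?W. if w = u then c20 * wt n k u v u + c21 * (sg n u v * wt n k u v u) else 0) = c20 * (4^n * x) + c21 * 4^n"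
  proof -
    have "(\<Sum>u\<in>?W. \<Sum>v\<in>?W. \<Sum>w\<in>?W. if w = u then c20 * wt n k u v u + c21 * (sg n u v * wt n k u v u) else 0)
      = (\<Sum>u\<in>?W. \<Sum>v\<in>?W. c20 * wt n k u v u + c21 * (sg n u v * wt n k u v u))"
      by (intro sum.cong refl) (simp only: sum.delta finite_words if_True)
    then show ?thesis unfolding sum.distrib sum_distrib_left[symmetric] ws x_def .
  qed
  have 4: "(\<Sum>u\<in>?W. \<Sum>v\<in>?W. \<Sum>w\<in>?W. if w = v then c30 * wt n k u v v + c31 * (sg n u v * wt n k u v v) else 0) = c30 * 4^n + c31 * (4^n * x)"
  proof -
    have "(\<Sum>u\<in>?W. \<Sum>v\<in>?W. \<Sum>w\<in>?W. if w = v then c30 * wt n k u v v + c31 * (sg n u v * wt n k u v v) else 0)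
      = (\<Sum>u\<in>?W. \<Sum>v\<in>?W. c30 * wt n k u v v + c31 * (sg n u v * wt n k u v v))"
      by (intro sum.cong refl) (simp only: sum.delta finite_words if_True)
    then show ?thesis unfolding sum.distrib sum_distrib_left[symmetric] ws x_def .
  qed
  have 5: "(\<Sum>u\<in>?W. \<Sum>v\<in>?W. \<Sum>w\<in>?W. if v = u then (if w = u then ca * wt n k u u u else 0) else 0) = ca * (4^n * y)"
  proof -
    have "(\<Sum>u\<in>?W. \<Sum>v\<in>?W. \<Sum>w\<in>?W. if v = u then (if w = u then ca * wt n k u u u else 0) else 0) = (\<Sum>u\<in>?W. ca * wt n k u u u)"
      unfolding sum_if_const by (rule sum.cong[OF refl]) (simp only: sum.delta finite_words if_True)
    then show ?thesis unfolding sum_distrib_left[symmetric] ws y_def .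
  qed
  have 6: "(\<Sum>u\<in>?W. \<Sum>v\<in>?W. \<Sum>w\<in>?W. if u = 0 then (if v = 0 then (if w = 0 then cz * wt n k 0 0 0 else 0) else 0) else 0) = cz"
    unfolding sum_if_const wt_zero[OF k(2)] by (simp only: sum.delta finite_words if_True words_0 mult_1_right)
  show ?thesis unfolding S 1 2 3 4 5 6 unfolding e0_def e1_def e3_def c10_def c11_def c20_def c21_def c30_def c31_def ca_def cz_def
    by (simp add: field_simps)
qed

end

subsection \<open>Pairs of pure states\<close>

text \<open>The inner product, conjugate-linear in the first argument. It is written as a trace so
  that unitary invariance follows from that of \<open>mtrace\<close>.\<close>

definition ip :: "complex vec \<Rightarrow> complex vec \<Rightarrow> complex" where
  "ip a b = mtrace (outer b a)"

definition vfam :: "(nat \<Rightarrow> complex vec) \<Rightarrow> (nat \<Rightarrow> complex vec) \<Rightarrow> fam" where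
  "vfam a b = (\<lambda>i j. outer (b j) (a i))"

lemma outer_carrier [simp]: "b \<in> carrier_vec d \<Longrightarrow> a \<in> carrier_vec d \<Longrightarrow> outer b a \<in> carrier_mat d d"
  by (auto simp: outer_def)

lemma outer_index: "b \<in> carrier_vec d \<Longrightarrow> a \<in> carrier_vec d \<Longrightarrow> i < d \<Longrightarrow> j < d \<Longrightarrow> outer b a $$ (i,j) = b $ i * cnj (a $ j)"
  by (auto simp: outer_def)

lemma mult_index: "A \<in> carrier_mat d d \<Longrightarrow> B \<in> carrier_mat d d \<Longrightarrow> i < d \<Longrightarrow> j < d \<Longrightarrow>
    (A * B) $$ (i,j) = (\<Sum>k<d. A $$ (i,k) * B $$ (k,j))"
  by (simp add: scalar_prod_def lessThan_atLeast0)

lemma outer_collapse: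
  assumes v: "a \<in> carrier_vec d" "b \<in> carrier_vec d" "a' \<in> carrier_vec d" "b' \<in> carrier_vec d" and A: "A \<in> carrier_mat d d"
  shows "outer b a * A * outer b' a' = mtrace (outer b' a * A) \<cdot>\<^sub>m outer b a'"
proof (rule eq_matI)
  note o = outer_carrier[OF v(2,1)] outer_carrier[OF v(4,3)] outer_carrier[OF v(4,1)] outer_carrier[OF v(2,3)]
  have oA: "outer b a * A \<in> carrier_mat d d" by (rule mult_carrier_mat[OF o(1) A])
  have oAo: "outer b a * A * outer b' a' \<in> carrier_mat d d" by (rule mult_carrier_mat[OF oA o(2)])
  fix i j assume "i < dim_row (mtrace (outer b' a * A) \<cdot>\<^sub>m outer b a')" "j < dim_col (mtrace (outer b' a * A) \<cdot>\<^sub>m outer b a')"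
  then have ij: "i < d" "j < d" using o(4) by auto
  have "(outer b a * A * outer b' a') $$ (i,j) = (\<Sum>k<d. (\<Sum>l<d. b $ i * cnj (a $ l) * A $$ (l,k)) * (b' $ k * cnj (a' $ j)))"
    by (simp add: mult_index[OF oA o(2) ij] mult_index[OF o(1) A ij(1)] outer_index[OF v(4,3) _ ij(2)] outer_index[OF v(2,1) ij(1)])
  also have "\<dots> = (\<Sum>k<d. \<Sum>l<d. b' $ k * cnj (a $ l) * A $$ (l,k)) * (b $ i * cnj (a' $ j))"
    by (simp add: sum_distrib_left sum_distrib_right mult_ac)
  also have "(\<Sum>k<d. \<Sum>l<d. b' $ k * cnj (a $ l) * A $$ (l,k)) = mtrace (outer b' a * A)"
    by (simp add: mtrace_mult[OF o(3) A] outer_index[OF v(4,1)])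
  finally show "(outer b a * A * outer b' a') $$ (i,j) = (mtrace (outer b' a * A) \<cdot>\<^sub>m outer b a') $$ (i,j)"
    using ij o(4) by (simp add: outer_index[OF v(2,3)])
qed (use v in \<open>auto simp: outer_def\<close>)

lemma rank1_vfam:
  assumes "\<And>i. a i \<in> carrier_vec (2^n)" "\<And>i. b i \<in> carrier_vec (2^n)"
  shows "rank1 n (vfam a b)"
  unfolding rank1_def vfam_def
  by (intro conjI allI ballI outer_carrier assms, rule outer_collapse[where d="2^n"]) (simp_all add: assms)

lemma mult_mat_vec_index: "A \<in> carrier_mat d d \<Longrightarrow> v \<in> carrier_vec d \<Longrightarrow> i < d \<Longrightarrow> (A *\<^sub>v v) $ i = (\<Sum>k<d. A $$ (i,k) * v $ k)"
  by (simp add: scalar_prod_def lessThan_atLeast0)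

lemma cj_outer:
  assumes C: "C \<in> carrier_mat d d" and v: "a \<in> carrier_vec d" "b \<in> carrier_vec d"
  shows "cj C (outer b a) = outer (C *\<^sub>v b) (C *\<^sub>v a)"
proof (rule eq_matI)
  have Cv: "C *\<^sub>v a \<in> carrier_vec d" "C *\<^sub>v b \<in> carrier_vec d" using C v by auto
  have c1: "C * outer b a \<in> carrier_mat d d" by (rule mult_carrier_mat[OF C outer_carrier[OF v(2,1)]])
  show "dim_row (cj C (outer b a)) = dim_row (outer (C *\<^sub>v b) (C *\<^sub>v a))"
    "dim_col (cj C (outer b a)) = dim_col (outer (C *\<^sub>v b) (C *\<^sub>v a))"
    using C by (auto simp: cj_def outer_def)
  fix i j assume "i < dim_row (outer (C *\<^sub>v b) (C *\<^sub>v a))" "j < dim_col (outer (C *\<^sub>v b) (C *\<^sub>v a))"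
  then have ij: "i < d" "j < d" using C by (auto simp: outer_def)
  have "cj C (outer b a) $$ (i,j) = (\<Sum>k<d. (\<Sum>l<d. C $$ (i,l) * (b $ l * cnj (a $ k))) * cnj (C $$ (j,k)))"
    unfolding cj_def
    by (simp add: mult_index[OF c1 adj_carrier[OF C] ij] mult_index[OF C outer_carrier[OF v(2,1)] ij(1)] outer_index[OF v(2,1)] adj_index[OF C _ ij(2)])
  also have "\<dots> = (\<Sum>l<d. C $$ (i,l) * b $ l) * cnj (\<Sum>k<d. C $$ (j,k) * a $ k)"
    by (simp add: sum_distrib_left sum_distrib_right mult_ac)
  also have "\<dots> = outer (C *\<^sub>v b) (C *\<^sub>v a) $$ (i,j)"
    by (simp add: outer_index[OF Cv(2,1) ij] mult_mat_vec_index[OF C v(1) ij(2)] mult_mat_vec_index[OF C v(2) ij(1)])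
  finally show "cj C (outer b a) $$ (i,j) = outer (C *\<^sub>v b) (C *\<^sub>v a) $$ (i,j)" .
qed

definition famA :: "complex vec \<Rightarrow> complex vec \<Rightarrow> fam" where
  "famA \<psi> \<phi> = vfam (\<lambda>i. if i = 0 \<or> i = 1 then \<psi> else \<phi>) (\<lambda>i. if i = 0 \<or> i = 1 then \<psi> else \<phi>)"

text \<open>Bras psi, phi, psi, phi against kets psi, phi, phi, psi, so that the diagonal invariant
  \<open>pp\<close> of this family is \<open>qB\<close>, as it is \<open>qA\<close> for
  \<open>famA\<close>.\<close>

definition famB :: "complex vec \<Rightarrow> complex vec \<Rightarrow> fam" where
  "famB \<psi> \<phi> = vfam (\<lambda>i. if i = 0 \<or> i = 2 then \<psi> else \<phi>) (\<lambda>i. if i = 0 \<or> i = 3 then \<psi> else \<phi>)"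

definition bra :: "nat \<Rightarrow> complex vec \<Rightarrow> complex vec \<Rightarrow> word \<Rightarrow> complex" where
  "bra n a b u = mtrace (outer b a * pauli n u)"

definition qA :: "nat \<Rightarrow> complex vec \<Rightarrow> complex vec \<Rightarrow> complex" where
  "qA n \<psi> \<phi> = (\<Sum>u\<in>words n. bra n \<psi> \<psi> u * bra n \<psi> \<psi> u * bra n \<phi> \<phi> u * bra n \<phi> \<phi> u)"

definition qB :: "nat \<Rightarrow> complex vec \<Rightarrow> complex vec \<Rightarrow> complex" where
  "qB n \<psi> \<phi> = (\<Sum>u\<in>words n. bra n \<psi> \<psi> u * bra n \<phi> \<phi> u * bra n \<psi> \<phi> u * bra n \<phi> \<psi> u)"

lemma rank1_famA: "\<psi> \<in> carrier_vec (2^n) \<Longrightarrow> \<phi> \<in> carrier_vec (2^n) \<Longrightarrow> rank1 n (famA \<psi> \<phi>)"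
  unfolding famA_def by (rule rank1_vfam) auto

lemma rank1_famB: "\<psi> \<in> carrier_vec (2^n) \<Longrightarrow> \<phi> \<in> carrier_vec (2^n) \<Longrightarrow> rank1 n (famB \<psi> \<phi>)"
  unfolding famB_def by (rule rank1_vfam) auto

lemma cjf_famA:
  assumes "C \<in> carrier_mat (2^n) (2^n)" "\<psi> \<in> carrier_vec (2^n)" "\<phi> \<in> carrier_vec (2^n)"
  shows "cjf C (famA \<psi> \<phi>) = famA (C *\<^sub>v \<psi>) (C *\<^sub>v \<phi>)"
  unfolding cjf_def famA_def vfam_def by (intro ext) (simp add: cj_outer[OF assms(1)] assms)

lemma cjf_famB:
  assumes "C \<in> carrier_mat (2^n) (2^n)" "\<psi> \<in> carrier_vec (2^n)" "\<phi> \<in> carrier_vec (2^n)"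
  shows "cjf C (famB \<psi> \<phi>) = famB (C *\<^sub>v \<psi>) (C *\<^sub>v \<phi>)"
  unfolding cjf_def famB_def vfam_def by (intro ext) (simp add: cj_outer[OF assms(1)] assms)

lemma pp_famA: "pp n (famA \<psi> \<phi>) 0 1 2 3 = qA n \<psi> \<phi>"
  by (simp add: pp_def qA_def famA_def vfam_def ee_def bra_def)

lemma pp_famB: "pp n (famB \<psi> \<phi>) 0 1 2 3 = qB n \<psi> \<phi>"
  by (simp add: pp_def qB_def famB_def vfam_def ee_def bra_def mult_ac)

lemma eight_pow: "(8::complex)^n = 2^n * 2^n * 2^n"
  by (simp add: power_mult_distrib[symmetric])

text \<open>After normalisation the inner products enter only through f, and every \<open>pp\<close>
  that occurs is A or B up to the order of its factors. Each orbit value thus becomes a rational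
  function of d, f, A and B.\<close>

lemma famA_values:
  fixes \<psi> \<phi> n
  defines "X \<equiv> famA \<psi> \<phi>" and "d \<equiv> (2::complex)^n" and "A \<equiv> qA n \<psi> \<phi>" and "B \<equiv> qB n \<psi> \<phi>"
  assumes u: "ip \<psi> \<psi> = 1" "ip \<phi> \<phi> = 1" and f: "ip \<psi> \<phi> * ip \<phi> \<psi> = f"
  shows "t0 X = 1" "fa n X = (A - 1) / (d^2 - 1)"
    "fc n X = ((d^2 + d * A) / 2 - 2 * d - A + 2) / NC n"
    "fc n (reidx r13 X) = ((d^2 * f^2 + d * B) / 2 - 2 * d * f - A + 2) / NC n"
    "fc n (reidx r14 X) = ((d^2 * f^2 + d * B) / 2 - 2 * d * f - A + 2) / NC n"
    "fac n X = (d^2 - d * A) / 2 / NA n"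
    "fac n (reidx r13 X) = (d^2 * f^2 - d * B) / 2 / NA n"
    "fac n (reidx r14 X) = (d^2 * f^2 - d * B) / 2 / NA n"
    "fm n X = ((4 * d^3 * f - 2 * d^3 * f^2 - 2 * d^2 * B) / 8 - (d^2 - d * A) / 2) / (NC n * (d^2 / 4))"
    "fm n (reidx r13 X) = ((2 * d^3 * f^2 - 2 * d^2 * B) / 8 - (d^2 * f^2 - d * B) / 2) / (NC n * (d^2 / 4))"
    "fm n (reidx r23 X) = ((2 * d^3 * f^2 - 2 * d^2 * B) / 8 - (d^2 * f^2 - d * B) / 2) / (NC n * (d^2 / 4))"
    "fp n X = ((4 * d^3 * f + 2 * d^3 * f^2 + 2 * d^2 * B) / 8 - 4 * d^2 * f - (d^2 + d * A + 2 * (d^2 * f^2 + d * B)) / 2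
       + 2 * (2 * d + 4 * d * f) + 2 * A - 8) / (NC n * (d^2 / 4 - 4))"
proof -
  have f': "ip \<phi> \<psi> * ip \<psi> \<phi> = f" using f by (simp add: mult.commute)
  have ff: "ip \<psi> \<phi> * (ip \<phi> \<psi> * z) = f * z" "ip \<phi> \<psi> * (ip \<psi> \<phi> * z) = f * z" for z
    using f f' by (simp_all add: mult.assoc[symmetric])
  have g: "gg X i j = ip (if i = 0 \<or> i = 1 then \<psi> else \<phi>) (if j = 0 \<or> j = 1 then \<psi> else \<phi>)" for i j
    by (simp add: X_def famA_def vfam_def ip_def)
  have e: "ee n X i j = bra n (if i = 0 \<or> i = 1 then \<psi> else \<phi>) (if j = 0 \<or> j = 1 then \<psi> else \<phi>)" for i j
    by (simp add: X_def famA_def vfam_def ee_def bra_def fun_eq_iff)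
  have r: "gg (reidx s X) i j = gg X (s i) (s j)" for s i j by (simp add: reidx_def)
  note v = g r e ee_reidx r13_def r14_def r23_def u f f' ff four_pow eight_pow
  note P = pp_def qA_def qB_def A_def B_def
  have A1: "A = pp n X 0 1 2 3" "A = pp n X 0 1 3 2" "A = pp n (reidx r13 X) 0 1 2 3" "A = pp n (reidx r14 X) 0 1 2 3"
    by (simp_all add: P v mult_ac)
  have B1: "B = pp n (reidx r13 X) 0 1 3 2" "B = pp n (reidx r14 X) 0 1 3 2" "B = pp n (reidx r23 X) 0 1 3 2"
    "B = pp n X 0 3 1 2" "B = pp n X 3 1 0 2" "B = pp n (reidx r13 X) 0 3 1 2" "B = pp n (reidx r13 X) 3 1 0 2"
    "B = pp n (reidx r23 X) 0 3 1 2" "B = pp n (reidx r23 X) 3 1 0 2"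
    by (simp_all add: P v mult_ac)
  note w = A1[symmetric, unfolded One_nat_def] A1[symmetric] B1[symmetric, unfolded One_nat_def] B1[symmetric] v d_def[symmetric] power2_eq_square power3_eq_cube
  show "t0 X = 1" by (simp add: t0_def v)
  show "fa n X = (A - 1) / (d^2 - 1)" unfolding fa_def A1(1)[symmetric] by (simp add: t0_def w)
  show "fc n X = ((d^2 + d * A) / 2 - 2 * d - A + 2) / NC n"
    by (simp add: fc_def cval_def dt_def pr_def t0_def w)
  show "fc n (reidx r13 X) = ((d^2 * f^2 + d * B) / 2 - 2 * d * f - A + 2) / NC n"
    by (simp add: fc_def cval_def dt_def pr_def t0_def w algebra_simps)
  show "fc n (reidx r14 X) = ((d^2 * f^2 + d * B) / 2 - 2 * d * f - A + 2) / NC n"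
    by (simp add: fc_def cval_def dt_def pr_def t0_def w algebra_simps)
  show "fac n X = (d^2 - d * A) / 2 / NA n"
    "fac n (reidx r13 X) = (d^2 * f^2 - d * B) / 2 / NA n"
    "fac n (reidx r14 X) = (d^2 * f^2 - d * B) / 2 / NA n"
    by (simp_all add: fac_def aval_def dt_def w algebra_simps)
  show "fm n X = ((4 * d^3 * f - 2 * d^3 * f^2 - 2 * d^2 * B) / 8 - (d^2 - d * A) / 2) / (NC n * (d^2 / 4))"
    "fm n (reidx r13 X) = ((2 * d^3 * f^2 - 2 * d^2 * B) / 8 - (d^2 * f^2 - d * B) / 2) / (NC n * (d^2 / 4))"
    "fm n (reidx r23 X) = ((2 * d^3 * f^2 - 2 * d^2 * B) / 8 - (d^2 * f^2 - d * B) / 2) / (NC n * (d^2 / 4))"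
    by (simp_all add: fm_def minus3_def aval_def dt_def cyc_def w algebra_simps)
  show "fp n X = ((4 * d^3 * f + 2 * d^3 * f^2 + 2 * d^2 * B) / 8 - 4 * d^2 * f - (d^2 + d * A + 2 * (d^2 * f^2 + d * B)) / 2
       + 2 * (2 * d + 4 * d * f) + 2 * A - 8) / (NC n * (d^2 / 4 - 4))"
    unfolding fp_def
    by (rule arg_cong2[where f="(/)"])
      (simp_all add: plus3_def cval_def t3c_def dt_def pr_def t0_def cyc_def w field_simps)
qed

text \<open>One double sum with the sign sg n u v is evaluated in the two possible orders. This is
  the invariance under double transpositions that reduces S_4 to its quotient by V_4.\<close>

lemma ee_double_transposition:
  assumes X: "rank1 n X"
  shows "(\<Sum>u\<in>words n. ee n X i a u * ee n X j b u * (ee n X k e u * ee n X l c u)) =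
    (\<Sum>u\<in>words n. ee n X i b u * ee n X j a u * (ee n X k c u * ee n X l e u))"
proof -
  have "2^n * (\<Sum>u\<in>words n. ee n X i a u * ee n X j b u * (ee n X k e u * ee n X l c u)) =
    (\<Sum>u\<in>words n. \<Sum>v\<in>words n. sg n u v * (ee n X i a u * ee n X j b u * (ee n X k c v * ee n X l e v)))"
  proof -
    have "(\<Sum>u\<in>words n. \<Sum>v\<in>words n. sg n u v * (ee n X i a u * ee n X j b u * (ee n X k c v * ee n X l e v))) =
      (\<Sum>u\<in>words n. (ee n X i a u * ee n X j b u) * (\<Sum>v\<in>words n. sg n u v * (ee n X k c v * ee n X l e v)))"
      by (simp add: sum_distrib_left mult_ac)
    then show ?thesis unfolding sum_sg_ee[OF X] by (simp add: sum_distrib_left mult_ac)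
  qed
  also have "\<dots> = (\<Sum>v\<in>words n. \<Sum>u\<in>words n. sg n v u * (ee n X i a u * ee n X j b u * (ee n X k c v * ee n X l e v)))"
    by (subst sum.swap) (simp add: sg_sym)
  also have "\<dots> = (\<Sum>v\<in>words n. (ee n X k c v * ee n X l e v) * (\<Sum>u\<in>words n. sg n v u * (ee n X i a u * ee n X j b u)))"
    by (simp add: sum_distrib_left mult_ac)
  also have "\<dots> = 2^n * (\<Sum>u\<in>words n. ee n X i b u * ee n X j a u * (ee n X k c u * ee n X l e u))"
    unfolding sum_sg_ee[OF X] by (simp add: sum_distrib_left mult_ac)
  finally show ?thesis by simp
qed

lemma qA_swap:
  assumes "\<psi> \<in> carrier_vec (2^n)" "\<phi> \<in> carrier_vec (2^n)"
  shows "(\<Sum>u\<in>words n. bra n \<phi> \<psi> u * bra n \<psi> \<phi> u * (bra n \<phi> \<psi> u * bra n \<psi> \<phi> u)) = qA n \<psi> \<phi>"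
  using ee_double_transposition[OF rank1_famA[OF assms], of 2 0 0 2 2 0 0 2]
  by (simp add: ee_def famA_def vfam_def bra_def qA_def mult_ac)

lemma famB_values:
  fixes \<psi> \<phi> n
  defines "X \<equiv> famB \<psi> \<phi>" and "d \<equiv> (2::complex)^n" and "A \<equiv> qA n \<psi> \<phi>" and "B \<equiv> qB n \<psi> \<phi>"
  assumes c: "\<psi> \<in> carrier_vec (2^n)" "\<phi> \<in> carrier_vec (2^n)" and u: "ip \<psi> \<psi> = 1" "ip \<phi> \<phi> = 1" and f: "ip \<psi> \<phi> * ip \<phi> \<psi> = f"
  shows "t0 X = f" "fa n X = (B - f) / (d^2 - 1)"
    "fc n X = ((d^2 * f + d * A) / 2 - d * f^2 - d - B + 2 * f) / NC n"
    "fc n (reidx r13 X) = ((d^2 * f + d * B) / 2 - 2 * d * f - B + 2 * f) / NC n"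
    "fc n (reidx r14 X) = ((d^2 * f + d * B) / 2 - 2 * d * f - B + 2 * f) / NC n"
    "fac n X = (d^2 * f - d * A) / 2 / NA n"
    "fac n (reidx r13 X) = (d^2 * f - d * B) / 2 / NA n"
    "fac n (reidx r14 X) = (d^2 * f - d * B) / 2 / NA n"
    "fm n X = ((d^3 * (4 * f - 1 - f^2) - d^2 * (A + B)) / 8 - (d^2 * f - d * A) / 2) / (NC n * (d^2 / 4))"
    "fm n (reidx r13 X) = ((d^3 * (1 + f^2) - d^2 * (A + B)) / 8 - (d^2 * f - d * B) / 2) / (NC n * (d^2 / 4))"
    "fm n (reidx r23 X) = ((d^3 * (1 + f^2) - d^2 * (A + B)) / 8 - (d^2 * f - d * B) / 2) / (NC n * (d^2 / 4))"
    "fp n X = ((d^3 * (1 + 4 * f + f^2) + d^2 * (A + B)) / 8 - d^2 * (1 + 2 * f + f^2) - (3 * d^2 * f + d * A + 2 * d * B) / 2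
       + d * (2 + 8 * f + 2 * f^2) + 2 * B - 8 * f) / (NC n * (d^2 / 4 - 4))"
proof -
  have f': "ip \<phi> \<psi> * ip \<psi> \<phi> = f" using f by (simp add: mult.commute)
  have ff: "ip \<psi> \<phi> * (ip \<phi> \<psi> * z) = f * z" "ip \<phi> \<psi> * (ip \<psi> \<phi> * z) = f * z" for z
    using f f' by (simp_all add: mult.assoc[symmetric])
  have g: "gg X i j = ip (if i = 0 \<or> i = 2 then \<psi> else \<phi>) (if j = 0 \<or> j = 3 then \<psi> else \<phi>)" for i j
    by (simp add: X_def famB_def vfam_def ip_def)
  have e: "ee n X i j = bra n (if i = 0 \<or> i = 2 then \<psi> else \<phi>) (if j = 0 \<or> j = 3 then \<psi> else \<phi>)" for i j
    by (simp add: X_def famB_def vfam_def ee_def bra_def fun_eq_iff)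
  have r: "gg (reidx s X) i j = gg X (s i) (s j)" for s i j by (simp add: reidx_def)
  note v = g r e ee_reidx r13_def r14_def r23_def u f f' ff four_pow eight_pow
  note P = pp_def qA_def qB_def A_def B_def
  have A1: "A = pp n X 0 1 3 2" "A = pp n X 3 1 0 2" "A = pp n (reidx r13 X) 0 3 1 2"
    by (simp_all add: P v mult_ac)
  have B1: "B = pp n X 0 1 2 3" "B = pp n (reidx r13 X) 0 1 2 3" "B = pp n (reidx r14 X) 0 1 2 3"
    "B = pp n (reidx r13 X) 0 1 3 2" "B = pp n (reidx r14 X) 0 1 3 2" "B = pp n (reidx r23 X) 0 1 3 2"
    "B = pp n X 0 3 1 2" "B = pp n (reidx r13 X) 3 1 0 2"
    by (simp_all add: P v mult_ac)
  \<comment> \<open>The first summand is B directly. The second is the sum of squares in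
    \<open>qA_swap\<close>, which equals A only by a double transposition. Only the sum of the two
    enters below.\<close>
  have AB: "pp n (reidx r23 X) 0 3 1 2 + pp n (reidx r23 X) 3 1 0 2 = A + B"
    using qA_swap[OF c] by (simp add: P v mult_ac)
  then have AB': "pp n (reidx r23 X) 0 3 1 2 = A + B - pp n (reidx r23 X) 3 1 0 2" by (simp add: algebra_simps)
  note w = A1[symmetric, unfolded One_nat_def] A1[symmetric] B1[symmetric, unfolded One_nat_def] B1[symmetric] v d_def[symmetric] power2_eq_square power3_eq_cube
  show "t0 X = f" by (simp add: t0_def v)
  show "fa n X = (B - f) / (d^2 - 1)" unfolding fa_def B1(1)[symmetric] by (simp add: t0_def w)
  show "fc n X = ((d^2 * f + d * A) / 2 - d * f^2 - d - B + 2 * f) / NC n"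
    by (simp add: fc_def cval_def dt_def pr_def t0_def w algebra_simps)
  show "fc n (reidx r13 X) = ((d^2 * f + d * B) / 2 - 2 * d * f - B + 2 * f) / NC n"
    by (simp add: fc_def cval_def dt_def pr_def t0_def w algebra_simps)
  show "fc n (reidx r14 X) = ((d^2 * f + d * B) / 2 - 2 * d * f - B + 2 * f) / NC n"
    by (simp add: fc_def cval_def dt_def pr_def t0_def w algebra_simps)
  show "fac n X = (d^2 * f - d * A) / 2 / NA n"
    "fac n (reidx r13 X) = (d^2 * f - d * B) / 2 / NA n"
    "fac n (reidx r14 X) = (d^2 * f - d * B) / 2 / NA n"
    by (simp_all add: fac_def aval_def dt_def w algebra_simps)
  show "fm n X = ((d^3 * (4 * f - 1 - f^2) - d^2 * (A + B)) / 8 - (d^2 * f - d * A) / 2) / (NC n * (d^2 / 4))"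
    "fm n (reidx r13 X) = ((d^3 * (1 + f^2) - d^2 * (A + B)) / 8 - (d^2 * f - d * B) / 2) / (NC n * (d^2 / 4))"
    by (simp_all add: fm_def minus3_def aval_def dt_def cyc_def w algebra_simps)
  show "fm n (reidx r23 X) = ((d^3 * (1 + f^2) - d^2 * (A + B)) / 8 - (d^2 * f - d * B) / 2) / (NC n * (d^2 / 4))"
    unfolding fm_def minus3_def AB' by (simp add: aval_def dt_def cyc_def w algebra_simps)
  show "fp n X = ((d^3 * (1 + 4 * f + f^2) + d^2 * (A + B)) / 8 - d^2 * (1 + 2 * f + f^2) - (3 * d^2 * f + d * A + 2 * d * B) / 2
       + d * (2 + 8 * f + 2 * f^2) + 2 * B - 8 * f) / (NC n * (d^2 / 4 - 4))"
    unfolding fp_def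
    by (rule arg_cong2[where f="(/)"])
      (simp_all add: plus3_def cval_def t3c_def dt_def pr_def t0_def cyc_def w field_simps)
qed

text \<open>One layer of T gates acts on the two invariants \<open>qA\<close>, \<open>qB\<close> diagonally in the combinations
  \<open>qA + 2 qB\<close> and \<open>qA - qB\<close>, which belong to the trivial and to the two-dimensional
  representation of the group \<open>S\<^sub>4/V\<^sub>4\<close> permuting the tensor factors.\<close>

definition alT :: "nat \<Rightarrow> nat \<Rightarrow> real" where
  "alT n k = (if k = 0 then 1 else (((2^n)^2 * (3/4)^k + 3 * 2^n * (1/2)^k) * (2^n * (2^n + 3)) - 4 * ((2^n + 1) * (2^n + 2)))
     / ((2^n + 1) * (2^n + 2) * ((2^n - 1) * (2^n + 4))))"

definition alS :: "nat \<Rightarrow> nat \<Rightarrow> real" where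
  "alS n k = (if k = 0 then 1 else ((2^n)^4 * (3/4)^k - 4 * ((2^n)^2 - 1)) / (((2^n)^2 - 1) * ((2^n)^2 - 4)))"

text \<open>Positivity rests on d^2 (3/4)^k >= 3^n >= 27, which uses both k <= n and n >= 3. The
  upper bounds compare (1/2)^k with (3/4)^k and, for \<open>alS\<close>, use (3/4)^k <= 3/4 for k >=
  1.\<close>

lemma al_bounds:
  assumes n: "n \<ge> 3" and k: "k \<le> n"
  shows "0 \<le> alT n k" "alT n k \<le> (3/4)^k" "0 \<le> alS n k" "alS n k \<le> (3/4)^k"
proof -
  define d where "d = (2::real)^n"
  define x where "x = (1/2::real)^k"
  define y where "y = (3/4::real)^k"
  have d: "d \<ge> 8" using power_increasing[of 3 n "2::real"] n by (simp add: d_def)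
  have y0: "y > 0" "x > 0" "y \<le> 1" unfolding x_def y_def by (simp_all add: power_le_one)
  have xy: "x \<le> y" unfolding x_def y_def by (rule power_mono) auto
  have dy: "d^2 * y \<ge> 27"
  proof -
    have "(27::real) \<le> 3^n" using power_increasing[of 3 n "3::real"] n by simp
    also have "\<dots> = (4 * (3/4))^n" by simp
    also have "\<dots> = d^2 * (3/4)^n" unfolding power_mult_distrib d_def power2_eq_square by (simp flip: power_mult_distrib)
    also have "\<dots> \<le> d^2 * y" unfolding y_def using k by (intro mult_left_mono power_decreasing) auto
    finally show ?thesis .
  qed
  define s where "s = d * (d + 3)"
  have s: "s \<ge> 88" unfolding s_def using mult_mono[of 8 d 11 "d+3"] d by simp
  have dens: "(d + 1) * (d + 2) = s + 2" "(d - 1) * (d + 4) = s - 4" by (simp_all add: s_def algebra_simps)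
  have "0 \<le> alT n k \<and> alT n k \<le> y \<and> 0 \<le> alS n k \<and> alS n k \<le> y"
  proof (cases "k = 0")
    case False
    have T: "alT n k = ((d^2 * y + 3 * d * x) * s - 4 * (s + 2)) / ((s + 2) * (s - 4))"
      unfolding alT_def using False by (simp add: d_def[symmetric] x_def[symmetric] y_def[symmetric] dens s_def[symmetric])
    have S: "alS n k = (d^4 * y - 4 * (d^2 - 1)) / ((d^2 - 1) * (d^2 - 4))"
      unfolding alS_def using False by (simp add: d_def y_def)
    have y34: "y \<le> 3/4" unfolding y_def using False power_decreasing[of 1 k "3/4::real"] by simp
    have "(d^2 * y + 3 * d * x) * s \<ge> 27 * s" using dy y0 d s by (intro mult_right_mono) (auto intro!: add_increasing2)
    then have "27 * s - 4 * (s + 2) \<le> (d^2 * y + 3 * d * x) * s - 4 * (s + 2)" by simp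
    moreover have "0 \<le> 27 * s - 4 * (s + 2)" using s by simp
    ultimately have T0: "(d^2 * y + 3 * d * x) * s - 4 * (s + 2) \<ge> 0" by (rule order_trans[rotated])
    have "3 * d * x \<le> 3 * d * y" using xy d by simp
    then have "(d^2 * y + 3 * d * x) * s \<le> (d^2 * y + 3 * d * y) * s" using s by (intro mult_right_mono) auto
    also have "\<dots> = y * s^2" unfolding s_def power2_eq_square by (simp add: algebra_simps)
    finally have "(d^2 * y + 3 * d * x) * s - 4 * (s + 2) \<le> y * s^2 - 4 * (s + 2)" by simp
    also have "\<dots> \<le> y * ((s + 2) * (s - 4))"
      using mult_right_mono[OF y0(3), of "2 * s + 8"] s by (simp add: algebra_simps power2_eq_square)
    finally have T1: "(d^2 * y + 3 * d * x) * s - 4 * (s + 2) \<le> y * ((s + 2) * (s - 4))" .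
    have sp: "(s + 2) * (s - 4) > 0" using s by simp
    have d2: "d^2 \<ge> 64" using power_mono[OF d, of 2] by simp
    have sp2: "(d^2 - 1) * (d^2 - 4) > 0" using d2 by simp
    have d4: "d^4 = d^2 * d^2" by (simp add: power2_eq_square power4_eq_xxxx)
    have "d^2 * 27 \<le> d^2 * (d^2 * y)" using dy by (intro mult_left_mono) auto
    then have S0: "d^4 * y - 4 * (d^2 - 1) \<ge> 0" unfolding d4 using d2 by (simp add: mult.assoc)
    have "y * (5 * d^2 - 4) \<le> 3/4 * (5 * d^2 - 4)" using y34 d2 by (intro mult_right_mono) auto
    also have "\<dots> \<le> 4 * (d^2 - 1)" using d2 by simp
    finally have S1: "d^4 * y - 4 * (d^2 - 1) \<le> y * ((d^2 - 1) * (d^2 - 4))"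
      unfolding d4 by (simp add: algebra_simps)
    show ?thesis unfolding T S
      using T0 T1 S0 S1 sp sp2 by (simp add: divide_le_eq zero_le_divide_iff)
  qed (simp add: alT_def alS_def y_def)
  then show "0 \<le> alT n k" "alT n k \<le> (3/4)^k" "0 \<le> alS n k" "alS n k \<le> (3/4)^k" unfolding y_def by auto
qed

section \<open>Exact recursion for one layer of T gates\<close>

context
  fixes n k :: nat and \<psi> \<phi> :: "complex vec" and f :: complex
  assumes n: "n \<ge> 3" and k: "1 \<le> k" "k \<le> n"
    and c: "\<psi> \<in> carrier_vec (2^n)" "\<phi> \<in> carrier_vec (2^n)"
    and u: "ip \<psi> \<psi> = 1" "ip \<phi> \<phi> = 1" and f: "ip \<psi> \<phi> * ip \<phi> \<psi> = f"
begin

private definition "RA = avg n (\<lambda>C. qA n ((That n k * C) *\<^sub>v \<psi>) ((That n k * C) *\<^sub>v \<phi>))"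
private definition "RB = avg n (\<lambda>C. qB n ((That n k * C) *\<^sub>v \<psi>) ((That n k * C) *\<^sub>v \<phi>))"

private lemma TC: "C \<in> clifford_group n \<Longrightarrow> That n k * C \<in> carrier_mat (2^n) (2^n)"
  by (rule mult_carrier_mat[OF That_carrier[OF k(2)] clifford_carrier])

private lemma RA_sum: "RA = (\<Sum>u\<in>words n. \<Sum>v\<in>words n. \<Sum>w\<in>words n. wt n k u v w * FF n (famA \<psi> \<phi>) u v w)"
  unfolding avg_That[OF rank1_famA[OF c] k(2), symmetric] RA_def
  by (rule avg_cong) (simp only: cjf_famA[OF TC c] pp_famA)

private lemma RB_sum: "RB = (\<Sum>u\<in>words n. \<Sum>v\<in>words n. \<Sum>w\<in>words n. wt n k u v w * FF n (famB \<psi> \<phi>) u v w)"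
  unfolding avg_That[OF rank1_famB[OF c] k(2), symmetric] RB_def
  by (rule avg_cong) (simp only: cjf_famB[OF TC c] pp_famB)

private lemma dne:
  "(2::complex)^n - 1 \<noteq> 0" "(2::complex)^n + 1 \<noteq> 0" "(2::complex)^n - 2 \<noteq> 0" "(2::complex)^n + 2 \<noteq> 0"
  "(2::complex)^n - 4 \<noteq> 0" "(2::complex)^n + 4 \<noteq> 0" "(2::complex)^n + 3 \<noteq> 0" "(2::complex)^n \<noteq> 0"
proof -
  have ge: "(2::real)^n \<ge> 8" using power_increasing[of 3 n "2::real"] n by simp
  have e: "(2::complex)^n + of_real a = of_real (2^n + a)" for a by simp
  have "(2::complex)^n + of_real a \<noteq> 0" if "a > -8" for a
    unfolding e of_real_eq_0_iff using ge that by simp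
  from this[of "-1"] this[of 1] this[of "-2"] this[of 2] this[of "-4"] this[of 4] this[of 3]
  show "(2::complex)^n - 1 \<noteq> 0" "(2::complex)^n + 1 \<noteq> 0" "(2::complex)^n - 2 \<noteq> 0" "(2::complex)^n + 2 \<noteq> 0"
    "(2::complex)^n - 4 \<noteq> 0" "(2::complex)^n + 4 \<noteq> 0" "(2::complex)^n + 3 \<noteq> 0" "(2::complex)^n \<noteq> 0"
    by simp_all
qed

private abbreviation "dd \<equiv> (2::complex)^n"
private abbreviation "K \<equiv> (dd^2 - 1) * ((dd^2 - 4) * (dd^2 - 16))"

text \<open>Clears the denominators once for symbolic numerators, with D in place of d^2, so that
  both families are afterwards handled by polynomial identities.\<close>

private lemma fields:
  fixes D x y na nc nac nm np t :: complex
  assumes ne: "D - 1 \<noteq> 0" "D - 4 \<noteq> 0" "D - 16 \<noteq> 0" "D \<noteq> 0"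
  defines "N \<equiv> (D - 1) * (D - 4) / 2" and "M \<equiv> (D - 1) * D / 2"
  shows "(D * ((3 * (np / (N * (D / 4 - 4))) + nm / (N * (D / 4))) / 4
      + (1 + x) / 2 * (nc / N - 3 * (np / (N * (D / 4 - 4))))
      + (1 - x) / 2 * (nac / M - nm / (N * (D / 4)))
      + y * (na / (D - 1) + 2 * (np / (N * (D / 4 - 4))) - nc / N)) + t - na / (D - 1)) * ((D - 1) * ((D - 4) * (D - 16)))
    = 6 * D * np + 2 * nm * (D - 16) + D * (1 + x) * (nc * (D - 16) - 12 * np)
      + (1 - x) * (nac * ((D - 4) * (D - 16)) - 4 * nm * (D - 16))
      + D * y * (na * ((D - 4) * (D - 16)) + 16 * np - 2 * nc * (D - 16))
      + (t * (D - 1) - na) * ((D - 4) * (D - 16))"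
proof -
  define p where "p = np / ((D - 1) * ((D - 4) * (D - 16)))"
  define m where "m = nm / ((D - 1) * (D - 4))"
  define q where "q = nc / ((D - 1) * (D - 4))"
  define r where "r = nac / (D - 1)"
  define a where "a = na / (D - 1)"
  have np: "np = p * ((D - 1) * ((D - 4) * (D - 16)))" and nm: "nm = m * ((D - 1) * (D - 4))"
    and nc: "nc = q * ((D - 1) * (D - 4))" and nac: "nac = r * (D - 1)" and na: "na = a * (D - 1)"
    using ne by (simp_all add: p_def m_def q_def r_def a_def)
  have N: "N \<noteq> 0" "M \<noteq> 0" "D / 4 - 4 \<noteq> 0" "D / 4 \<noteq> 0" using ne by (auto simp: N_def M_def)
  have N1: "N * (D / 4 - 4) = ((D - 1) * ((D - 4) * (D - 16))) / 8" by (simp add: N_def field_simps)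
  have P: "np / (N * (D / 4 - 4)) = 8 * p" unfolding N1 by (simp add: p_def)
  have Mm: "nm / (N * (D / 4)) = 8 * m / D" unfolding N_def using ne by (simp add: m_def field_simps)
  have Q: "nc / N = 2 * q" unfolding N_def by (simp add: q_def)
  have R: "nac / M = 2 * r / D" unfolding M_def using ne by (simp add: r_def field_simps)
  have "D * ((3 * (8 * p) + 8 * m / D) / 4 + (1 + x) / 2 * (2 * q - 3 * (8 * p)) + (1 - x) / 2 * (2 * r / D - 8 * m / D)
     + y * (a + 2 * (8 * p) - 2 * q)) = 6 * D * p + 2 * m + D * (1 + x) * (q - 12 * p) + (1 - x) * (r - 4 * m) + D * y * (a + 16 * p - 2 * q)"
    using ne(4) by (simp add: field_simps)
  note e = this
  show ?thesis unfolding P Mm Q R a_def[symmetric] e unfolding np nm nc nac na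
    by (simp add: algebra_simps)
qed

private lemma d_ne: "dd^2 - 1 \<noteq> 0" "dd^2 - 4 \<noteq> 0" "dd^2 - 16 \<noteq> 0" "dd^2 \<noteq> 0"
proof -
  have "dd^2 - 1 = (dd - 1) * (dd + 1)" "dd^2 - 4 = (dd - 2) * (dd + 2)" "dd^2 - 16 = (dd - 4) * (dd + 4)"
    by (simp_all add: field_simps power2_eq_square)
  then show "dd^2 - 1 \<noteq> 0" "dd^2 - 4 \<noteq> 0" "dd^2 - 16 \<noteq> 0" "dd^2 \<noteq> 0" using dne by simp_all
qed

private lemma NCd: "NC n = (dd^2 - 1) * (dd^2 - 4) / 2"
  unfolding NC_def four_pow by (simp add: field_simps power2_eq_square)

private lemma NAd: "NA n = (dd^2 - 1) * dd^2 / 2"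
  unfolding NA_def four_pow by (simp add: field_simps power2_eq_square)

private abbreviation "xx \<equiv> (1/2 :: complex)^k"
private abbreviation "yy \<equiv> (3/4 :: complex)^k"

private definition "rk na nc nac nm np t = 6 * dd^2 * np + 2 * nm * (dd^2 - 16) + dd^2 * (1 + xx) * (nc * (dd^2 - 16) - 12 * np)
      + (1 - xx) * (nac * ((dd^2 - 4) * (dd^2 - 16)) - 4 * nm * (dd^2 - 16))
      + dd^2 * yy * (na * ((dd^2 - 4) * (dd^2 - 16)) + 16 * np - 2 * nc * (dd^2 - 16))
      + (t * (dd^2 - 1) - na) * ((dd^2 - 4) * (dd^2 - 16))"

private lemma R_general:
  assumes X: "rank1 n X" and "t0 X = t" "fa n X = na / (dd^2 - 1)"
    "fc n X = c1 / NC n" "fc n (reidx r13 X) = c2 / NC n" "fc n (reidx r14 X) = c3 / NC n"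
    "fac n X = a1 / NA n" "fac n (reidx r13 X) = a2 / NA n" "fac n (reidx r14 X) = a3 / NA n"
    "fm n X = m1 / (NC n * (dd^2 / 4))" "fm n (reidx r13 X) = m2 / (NC n * (dd^2 / 4))" "fm n (reidx r23 X) = m3 / (NC n * (dd^2 / 4))"
    "fp n X = np / (NC n * (dd^2 / 4 - 4))"
  shows "(\<Sum>u\<in>words n. \<Sum>v\<in>words n. \<Sum>w\<in>words n. wt n k u v w * FF n X u v w) * K =
    rk na (c1 + c2 + c3) (a1 + a2 + a3) (m1 + m2 + m3) np t"
proof -
  have D: "(4::complex)^n = dd^2" by (simp add: four_pow power2_eq_square)
  have s: "c1 / NC n + c2 / NC n + c3 / NC n = (c1 + c2 + c3) / NC n" "a1 / NA n + a2 / NA n + a3 / NA n = (a1 + a2 + a3) / NA n"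
    "3 * q + m1 / (NC n * (dd^2 / 4)) + m2 / (NC n * (dd^2 / 4)) + m3 / (NC n * (dd^2 / 4)) = 3 * q + (m1 + m2 + m3) / (NC n * (dd^2 / 4))"
    "q - m1 / (NC n * (dd^2 / 4)) - m2 / (NC n * (dd^2 / 4)) - m3 / (NC n * (dd^2 / 4)) = q - (m1 + m2 + m3) / (NC n * (dd^2 / 4))"
    "q - c1 / NC n - c2 / NC n - c3 / NC n = q - (c1 + c2 + c3) / NC n" for q
    by (simp_all add: add_divide_distrib)
  show ?thesis
    unfolding wt_FF_sum[OF n X k] assms(2-) D s unfolding rk_def NCd NAd
    by (rule fields[OF d_ne])
qed

private definition "npA A B = (4 * dd^3 * f + 2 * dd^3 * f^2 + 2 * dd^2 * B) / 8 - 4 * dd^2 * f - (dd^2 + dd * A + 2 * (dd^2 * f^2 + dd * B)) / 2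
       + 2 * (2 * dd + 4 * dd * f) + 2 * A - 8"
private definition "npB A B = (dd^3 * (1 + 4 * f + f^2) + dd^2 * (A + B)) / 8 - dd^2 * (1 + 2 * f + f^2) - (3 * dd^2 * f + dd * A + 2 * dd * B) / 2
       + dd * (2 + 8 * f + 2 * f^2) + 2 * B - 8 * f"

private lemma RA_K: "RA * K = (let A = qA n \<psi> \<phi>; B = qB n \<psi> \<phi> in
  rk (A - 1) (((dd^2 + dd * A) / 2 - 2 * dd - A + 2) + ((dd^2 * f^2 + dd * B) / 2 - 2 * dd * f - A + 2) + ((dd^2 * f^2 + dd * B) / 2 - 2 * dd * f - A + 2))
    ((dd^2 - dd * A) / 2 + (dd^2 * f^2 - dd * B) / 2 + (dd^2 * f^2 - dd * B) / 2)
    (((4 * dd^3 * f - 2 * dd^3 * f^2 - 2 * dd^2 * B) / 8 - (dd^2 - dd * A) / 2) + ((2 * dd^3 * f^2 - 2 * dd^2 * B) / 8 - (dd^2 * f^2 - dd * B) / 2)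
     + ((2 * dd^3 * f^2 - 2 * dd^2 * B) / 8 - (dd^2 * f^2 - dd * B) / 2)) (npA A B) 1)"
  unfolding RA_sum Let_def npA_def
  by (rule R_general[OF rank1_famA[OF c]]) (rule famA_values[OF u f])+

private lemma RB_K: "RB * K = (let A = qA n \<psi> \<phi>; B = qB n \<psi> \<phi> in
  rk (B - f) (((dd^2 * f + dd * A) / 2 - dd * f^2 - dd - B + 2 * f) + ((dd^2 * f + dd * B) / 2 - 2 * dd * f - B + 2 * f) + ((dd^2 * f + dd * B) / 2 - 2 * dd * f - B + 2 * f))
    ((dd^2 * f - dd * A) / 2 + (dd^2 * f - dd * B) / 2 + (dd^2 * f - dd * B) / 2)
    (((dd^3 * (4 * f - 1 - f^2) - dd^2 * (A + B)) / 8 - (dd^2 * f - dd * A) / 2) + ((dd^3 * (1 + f^2) - dd^2 * (A + B)) / 8 - (dd^2 * f - dd * B) / 2)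
     + ((dd^3 * (1 + f^2) - dd^2 * (A + B)) / 8 - (dd^2 * f - dd * B) / 2)) (npB A B) f)"
  unfolding RB_sum Let_def npB_def
  by (rule R_general[OF rank1_famB[OF c]]) (rule famB_values[OF c u f])+

private definition "aT = (dd^2 * yy + 3 * dd * xx) * (dd * (dd + 3)) - 4 * ((dd + 1) * (dd + 2))"
private definition "bT = 2 * dd^2 * ((dd + 1) * (dd + 2) - dd^2 * yy - 3 * dd * xx)"

text \<open>In this combination the factors d - 2 and d - 4 of K cancel, in \<open>RH_K\<close> the
  factor d^2 - 16 does. What remains is an affine map whose linear coefficient defines
  \<open>alT\<close>.\<close>

private lemma RG_K: "(RA + 2 * RB) * K = (aT * (qA n \<psi> \<phi> + 2 * qB n \<psi> \<phi>) + bT * (1 + 4 * f + f^2)) * ((dd - 2) * (dd - 4))"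
proof -
  define A where "A = qA n \<psi> \<phi>"
  define B where "B = qB n \<psi> \<phi>"
  define d where "d = dd"
  define x where "x = xx"
  define y where "y = yy"
  have *: "(RA + 2 * RB) * K = RA * K + 2 * (RB * K)" by (simp add: algebra_simps)
  show ?thesis
    unfolding * RA_K RB_K Let_def A_def[symmetric] B_def[symmetric] rk_def npA_def npB_def aT_def bT_def
    unfolding d_def[symmetric] x_def[symmetric] y_def[symmetric]
    by (simp add: field_simps power2_eq_square power3_eq_cube power4_eq_xxxx)
qed

private lemma RH_K: "(RA - RB) * K = ((dd^4 * yy - 4 * (dd^2 - 1)) * (qA n \<psi> \<phi> - qB n \<psi> \<phi>)
    + 2 * dd^2 * (dd^2 - 1 - dd^2 * yy) * (1 - f)^2) * (dd^2 - 16)"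
proof -
  define A where "A = qA n \<psi> \<phi>"
  define B where "B = qB n \<psi> \<phi>"
  define d where "d = dd"
  define x where "x = xx"
  define y where "y = yy"
  have *: "(RA - RB) * K = RA * K - RB * K" by (simp add: algebra_simps)
  show ?thesis
    unfolding * RA_K RB_K Let_def A_def[symmetric] B_def[symmetric] rk_def npA_def npB_def
    unfolding d_def[symmetric] x_def[symmetric] y_def[symmetric]
    by (simp add: field_simps power2_eq_square power3_eq_cube power4_eq_xxxx)
qed

text \<open>The fixed point is necessarily the Haar average of the invariant: averaging the identity
  over states rotated by a common Haar unitary reproduces that average on both sides, and the factor
  \<open>alT n k\<close> is below 1 for k >= 1.\<close>

lemma avg_qT:
  "avg n (\<lambda>C. qA n ((That n k * C) *\<^sub>v \<psi>) ((That n k * C) *\<^sub>v \<phi>) + 2 * qB n ((That n k * C) *\<^sub>v \<psi>) ((That n k * C) *\<^sub>v \<phi>))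
   = of_real (alT n k) * (qA n \<psi> \<phi> + 2 * qB n \<psi> \<phi>) + (1 - of_real (alT n k)) * (2 * 2^n / (2^n + 3) * (1 + 4 * f + f^2))"
proof -
  define G where "G = qA n \<psi> \<phi> + 2 * qB n \<psi> \<phi>"
  define g where "g = 1 + 4 * f + f^2"
  define d where "d = dd"
  define x where "x = xx"
  define y where "y = yy"
  have al: "of_real (alT n k) = ((d^2 * y + 3 * d * x) * (d * (d + 3)) - 4 * ((d + 1) * (d + 2))) / ((d + 1) * (d + 2) * ((d - 1) * (d + 4)))"
    unfolding alT_def d_def x_def y_def using k by simp
  define m where "m = (d + 1) * (d + 2) * ((d - 1) * (d + 4))"
  define r where "r = (d - 2) * (d - 4)"
  note ne = dne[folded d_def]
  have m0: "m \<noteq> 0" "r \<noteq> 0" "d + 3 \<noteq> 0" using ne by (simp_all add: m_def r_def)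
  have K: "K = m * r" unfolding m_def r_def d_def[symmetric] by (simp add: algebra_simps power2_eq_square)
  define a where "a = (d^2 * y + 3 * d * x) * (d * (d + 3)) - 4 * ((d + 1) * (d + 2))"
  define b where "b = 2 * d^2 * ((d + 1) * (d + 2) - d^2 * y - 3 * d * x)"
  \<comment> \<open>Turns the inhomogeneous coefficient b / m into (1 - a / m) * (2 * d / (d + 3)),
    which exhibits the fixed point.\<close>
  have ab: "b * (d + 3) = (m - a) * (2 * d)" unfolding a_def b_def m_def by (simp add: algebra_simps power2_eq_square)
  have "(RA + 2 * RB) * m * r = (a * G + b * g) * r"
    using RG_K unfolding K unfolding aT_def bT_def d_def[symmetric] x_def[symmetric] y_def[symmetric] a_def[symmetric] b_def[symmetric]
      G_def[symmetric] g_def[symmetric] r_def[symmetric] by (simp add: mult.assoc)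
  then have e: "(RA + 2 * RB) * m = a * G + b * g" using m0 by simp
  have "RA + 2 * RB = a / m * G + b / m * g"
    using e m0 by (simp add: field_simps)
  moreover have "b / m = (1 - a / m) * (2 * d / (d + 3))"
  proof -
    have "b = (m - a) * (2 * d) / (d + 3)" using ab m0 by (simp add: eq_divide_eq)
    moreover have "1 - a / m = (m - a) / m" using m0 by (simp add: diff_divide_distrib)
    ultimately show ?thesis by simp
  qed
  ultimately have "RA + 2 * RB = a / m * G + (1 - a / m) * (2 * d / (d + 3) * g)" by (simp add: mult.assoc)
  then show ?thesis
    unfolding al[folded a_def m_def] G_def[symmetric] g_def[symmetric] d_def[symmetric] avg_add avg_cmult RA_def RB_def .
qed

lemma avg_qS:
  "avg n (\<lambda>C. qA n ((That n k * C) *\<^sub>v \<psi>) ((That n k * C) *\<^sub>v \<phi>) - qB n ((That n k * C) *\<^sub>v \<psi>) ((That n k * C) *\<^sub>v \<phi>))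
   = of_real (alS n k) * (qA n \<psi> \<phi> - qB n \<psi> \<phi>) + (1 - of_real (alS n k)) * (2 * (1 - f)^2)"
proof -
  define G where "G = qA n \<psi> \<phi> - qB n \<psi> \<phi>"
  define g where "g = (1 - f)^2"
  define d where "d = dd"
  define y where "y = yy"
  have al: "of_real (alS n k) = (d^4 * y - 4 * (d^2 - 1)) / ((d^2 - 1) * (d^2 - 4))"
    unfolding alS_def d_def y_def using k by simp
  define m where "m = (d^2 - 1) * (d^2 - 4)"
  define r where "r = d^2 - 16"
  note ne = d_ne[folded d_def]
  have m0: "m \<noteq> 0" "r \<noteq> 0" using ne by (simp_all add: m_def r_def)
  have K: "K = m * r" unfolding m_def r_def d_def[symmetric] by (simp add: algebra_simps power2_eq_square)
  define a where "a = d^4 * y - 4 * (d^2 - 1)"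
  define b where "b = 2 * d^2 * (d^2 - 1 - d^2 * y)"
  have ab: "b = (m - a) * 2" unfolding a_def b_def m_def by (simp add: algebra_simps power2_eq_square power4_eq_xxxx)
  have "(RA - RB) * m * r = (a * G + b * g) * r"
    using RH_K unfolding K unfolding d_def[symmetric] y_def[symmetric] a_def[symmetric] b_def[symmetric]
      G_def[symmetric] g_def[symmetric] r_def[symmetric] by (simp add: mult.assoc)
  then have e: "(RA - RB) * m = a * G + b * g" using m0 by simp
  have "RA - RB = a / m * G + (1 - a / m) * (2 * g)"
    using e m0 unfolding ab by (simp add: field_simps)
  then show ?thesis
    unfolding al[folded a_def m_def] G_def[symmetric] g_def[symmetric] d_def[symmetric] avg_diff RA_def RB_def .
qed

end

subsection \<open>The circuit ensemble\<close>

definition unitaries :: "nat \<Rightarrow> complex mat set" where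
  "unitaries n = {U \<in> carrier_mat (2^n) (2^n). adj U * U = 1\<^sub>m (2^n)}"

lemma unitariesD: "U \<in> unitaries n \<Longrightarrow> U \<in> carrier_mat (2^n) (2^n)" "U \<in> unitaries n \<Longrightarrow> adj U * U = 1\<^sub>m (2^n)"
  by (auto simp: unitaries_def)

lemma unitaries_mult: "U \<in> unitaries n \<Longrightarrow> V \<in> unitaries n \<Longrightarrow> U * V \<in> unitaries n"
proof -
  assume U: "U \<in> unitaries n" and V: "V \<in> unitaries n"
  note c = unitariesD(1)[OF U] unitariesD(1)[OF V]
  note a = adj_carrier[OF c(1)] adj_carrier[OF c(2)]
  have "adj (U * V) * (U * V) = adj V * (adj U * (U * V))"
    unfolding adj_mult[OF c] by (rule assoc_mult_mat[OF a(2,1) mult_carrier_mat[OF c]])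
  also have "adj U * (U * V) = V"
    unfolding assoc_mult_mat[OF a(1) c, symmetric] unitariesD(2)[OF U] by (rule left_mult_one_mat[OF c(2)])
  finally show ?thesis using mult_carrier_mat[OF c] unitariesD(2)[OF V] by (simp add: unitaries_def)
qed

lemma clifford_unitaries: "C \<in> clifford_group n \<Longrightarrow> C \<in> unitaries n"
  using clifford_carrier clifford_unitary by (simp add: unitaries_def)

lemma That_unitaries: "k \<le> n \<Longrightarrow> That n k \<in> unitaries n"
  using That_carrier That_unitary by (simp add: unitaries_def)

lemma one_unitaries: "1\<^sub>m (2^n) \<in> unitaries n"
  by (simp add: unitaries_def)

lemma That_0: "That n 0 = 1\<^sub>m (2^n)"
  by (subst That_ten) (auto simp: pauli_0[symmetric] pauli_def tf_def sigma_def zero_fun_apply zero_letter_def intro!: ten_cong)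

lemma ckword_unitaries:
  "k \<le> n \<Longrightarrow> (\<And>i. i \<le> m \<Longrightarrow> c i \<in> clifford_group n) \<Longrightarrow> ckword n k c m \<in> unitaries n"
proof (induction m)
  case (Suc m)
  have "ckword n k c m \<in> unitaries n" using Suc by simp
  then show ?case
    using unitaries_mult[OF unitaries_mult[OF clifford_unitaries[OF Suc.prems(2)[OF order_refl]] That_unitaries[OF Suc.prems(1)]]] by simp
qed (simp add: clifford_unitaries)

lemma ckword_cong: "(\<And>i. i \<le> m \<Longrightarrow> c i = c' i) \<Longrightarrow> ckword n k c m = ckword n k c' m"
  by (induction m) auto

lemma ens_cong:
  assumes "k \<le> n" "\<And>U. U \<in> unitaries n \<Longrightarrow> f U = g U"
  shows "ens_expect n k l f = ens_expect n k l g"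
  unfolding ens_expect_def Let_def
  by (intro arg_cong2[where f=scaleR] sum.cong refl assms(2) ckword_unitaries assms(1)) auto

lemma ens_card: "card (Pi\<^sub>E {0..l::nat} (\<lambda>_. clifford_group n)) > 0"
  by (subst card_PiE) (auto intro!: prod_pos card_clifford_pos simp del: card_gt_0_iff)

lemma ens_const [simp]: "ens_expect n k l (\<lambda>_. c) = c"
  using ens_card[of l n] by (simp add: ens_expect_def Let_def sum_constant_scaleR)

lemma ens_add: "ens_expect n k l (\<lambda>U. f U + g U) = ens_expect n k l f + ens_expect n k l g"
  by (simp add: ens_expect_def Let_def sum.distrib scaleR_add_right)

lemma ens_diff: "ens_expect n k l (\<lambda>U. f U - g U) = ens_expect n k l f - ens_expect n k l g"
  by (simp add: ens_expect_def Let_def sum_subtractf scaleR_diff_right)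

lemma ens_linear:
  assumes "linear T"
  shows "ens_expect n k l (\<lambda>U. T (f U)) = T (ens_expect n k l f)"
  by (simp add: ens_expect_def Let_def linear_scale[OF assms] linear_sum[OF assms])

lemma ens_cmult: "ens_expect n k l (\<lambda>U. (c::'a::real_algebra) * f U) = c * ens_expect n k l f"
  by (simp add: ens_expect_def Let_def sum_distrib_left)

lemma ens_mono:
  assumes "k \<le> n" "\<And>U. U \<in> unitaries n \<Longrightarrow> f U \<le> g U"
  shows "ens_expect n k l f \<le> (ens_expect n k l g :: real)"
  unfolding ens_expect_def Let_def real_scaleR_def
  by (intro mult_left_mono sum_mono assms(2) ckword_unitaries assms(1)) auto

lemma ens_sum: "ens_expect n k l (\<lambda>U. \<Sum>i\<in>I. f i U) = (\<Sum>i\<in>I. ens_expect n k l (f i))"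
  unfolding ens_expect_def Let_def by (subst sum.swap) (simp add: scaleR_sum_right)

section \<open>Splitting the outermost layer off the circuit\<close>

lemma ens_0: "ens_expect n k 0 f = avg n f"
proof -
  have P: "Pi\<^sub>E {0..0::nat} (\<lambda>_. clifford_group n) = (\<lambda>C. (\<lambda>_. undefined)(0 := C)) ` clifford_group n"
    by (simp add: PiE_insert_eq PiE_empty_domain image_def fun_upd_def)
  have "inj_on (\<lambda>C. (\<lambda>_. undefined)(0::nat := C)) (clifford_group n)"
    by (rule inj_onI) (metis fun_upd_same)
  then show ?thesis
    unfolding ens_expect_def Let_def P avg_def by (simp add: card_image sum.reindex)
qed

lemma ens_Suc: "ens_expect n k (Suc l) f = ens_expect n k l (\<lambda>U. avg n (\<lambda>C. f (C * That n k * U)))"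
proof -
  let ?G = "clifford_group n" and ?P = "Pi\<^sub>E {0..l} (\<lambda>_. clifford_group n)"
  let ?h = "\<lambda>(y, g). g(Suc l := y)"
  have P: "Pi\<^sub>E {0..Suc l} (\<lambda>_. ?G) = ?h ` (?G \<times> ?P)"
    unfolding atLeast0_atMost_Suc PiE_insert_eq by simp
  have inj: "inj_on ?h (?G \<times> ?P)"
    by (rule inj_combinator) simp
  have w: "ckword n k (g(Suc l := y)) (Suc l) = y * That n k * ckword n k g l" for g y
    using ckword_cong[of l "g(Suc l := y)" g] by simp
  have "(\<Sum>c\<in>Pi\<^sub>E {0..Suc l} (\<lambda>_. ?G). f (ckword n k c (Suc l))) = (\<Sum>y\<in>?G. \<Sum>g\<in>?P. f (y * That n k * ckword n k g l))"
    unfolding P sum.reindex[OF inj] sum.cartesian_product by (rule sum.cong) (auto simp: w simp del: ckword.simps)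
  also have "\<dots> = (\<Sum>g\<in>?P. \<Sum>y\<in>?G. f (y * That n k * ckword n k g l))" by (rule sum.swap)
  finally show ?thesis
    unfolding ens_expect_def Let_def avg_def
    by (simp add: card_PiE scaleR_sum_right mult.commute)
qed

text \<open>The outermost gate of the circuit is already a uniform Clifford element, so another one
  multiplied from the left does not change the distribution.\<close>

lemma ens_twirl:
  assumes k: "k \<le> n"
  shows "ens_expect n k l f = ens_expect n k l (\<lambda>U. avg n (\<lambda>C. f (C * U)))"
proof (cases l)
  case 0
  have "avg n (\<lambda>U. avg n (\<lambda>C. f (C * U))) = avg n (\<lambda>C. avg n (\<lambda>U. f (C * U)))"
    unfolding avg_def by (simp add: scaleR_sum_right) (rule sum.swap)
  also have "\<dots> = avg n f" by (rule avg_eq_const) (rule avg_shift)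
  finally show ?thesis using 0 by (simp add: ens_0)
next
  case (Suc m)
  have "avg n (\<lambda>C. f (C * That n k * U)) = avg n (\<lambda>D. avg n (\<lambda>C. f (C * (D * That n k * U))))" if U: "U \<in> unitaries n" for U
  proof -
    note cc = That_carrier[OF k] unitariesD(1)[OF U]
    have "avg n (\<lambda>D. avg n (\<lambda>C. f (C * (D * That n k * U)))) = avg n (\<lambda>D. avg n (\<lambda>C. f (C * D * That n k * U)))"
    proof (intro avg_cong arg_cong[where f=f])
      fix C D assume "C \<in> clifford_group n" "D \<in> clifford_group n"
      note c = this[THEN clifford_carrier]
      show "D * (C * That n k * U) = D * C * That n k * U"
        using c cc by (simp add: assoc_mult_mat[where ?n\<^sub>1="2^n" and ?n\<^sub>2="2^n" and ?n\<^sub>3="2^n" and ?n\<^sub>4="2^n"])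
    qed
    also have "\<dots> = avg n (\<lambda>C. avg n (\<lambda>D. f (C * D * That n k * U)))"
      unfolding avg_def by (simp add: scaleR_sum_right) (rule sum.swap)
    also have "\<dots> = avg n (\<lambda>C. f (C * That n k * U))"
      by (rule avg_eq_const) (rule avg_shift[where f="\<lambda>C. f (C * That n k * U)"])
    finally show ?thesis by simp
  qed
  then show ?thesis unfolding Suc ens_Suc by (rule ens_cong[OF k])
qed

text \<open>Invariance of Q removes the outermost Clifford gate. Twirling the inner circuit then
  puts a fresh independent gate directly below the T layer, where the one-layer averages
  apply.\<close>

lemma ens_step:
  assumes k: "k \<le> n" and inv: "\<And>C U. C \<in> clifford_group n \<Longrightarrow> U \<in> unitaries n \<Longrightarrow> Q (C * U) = Q U"
  shows "ens_expect n k (Suc l) Q = ens_expect n k l (\<lambda>U. avg n (\<lambda>C. Q (That n k * C * U)))"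
proof -
  have "ens_expect n k (Suc l) Q = ens_expect n k l (\<lambda>U. Q (That n k * U))"
    unfolding ens_Suc
  proof (rule ens_cong[OF k], rule avg_eq_const)
    fix U C assume U: "U \<in> unitaries n" and C: "C \<in> clifford_group n"
    have "C * That n k * U = C * (That n k * U)"
      by (rule assoc_mult_mat[OF clifford_carrier[OF C] That_carrier[OF k] unitariesD(1)[OF U]])
    then show "Q (C * That n k * U) = Q (That n k * U)"
      using inv[OF C unitaries_mult[OF That_unitaries[OF k] U]] by simp
  qed
  also have "\<dots> = ens_expect n k l (\<lambda>U. avg n (\<lambda>C. Q (That n k * C * U)))"
    unfolding ens_twirl[OF k, of l "\<lambda>U. Q (That n k * U)"]
    by (rule ens_cong[OF k], rule avg_cong)
      (simp add: assoc_mult_mat[OF That_carrier[OF k] clifford_carrier unitariesD(1)])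
  finally show ?thesis .
qed

text \<open>An affine recursion with fixed point b. At depth 0 the circuit is a single Clifford
  element, on which Q is constant.\<close>

lemma ens_recursion:
  fixes Q :: "complex mat \<Rightarrow> 'a::{real_algebra_1,comm_ring_1}"
  assumes k: "k \<le> n" and inv: "\<And>C U. C \<in> clifford_group n \<Longrightarrow> U \<in> unitaries n \<Longrightarrow> Q (C * U) = Q U"
    and step: "\<And>U. U \<in> unitaries n \<Longrightarrow> avg n (\<lambda>C. Q (That n k * C * U)) = a * Q U + (1 - a) * b"
  shows "ens_expect n k l Q = b + a ^ l * (Q (1\<^sub>m (2^n)) - b)"
proof (induction l)
  case 0
  have "Q C = Q (1\<^sub>m (2^n))" if "C \<in> clifford_group n" for C
    using inv[OF that one_unitaries] right_mult_one_mat[OF clifford_carrier[OF that]] by simp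
  then show ?case by (simp add: ens_0 avg_eq_const)
next
  case (Suc l)
  have "ens_expect n k (Suc l) Q = ens_expect n k l (\<lambda>U. a * Q U + (1 - a) * b)"
    by (rule trans[OF ens_step[of k n Q, OF k inv] ens_cong[OF k step]])
  also have "\<dots> = a * ens_expect n k l Q + (1 - a) * b" by (simp add: ens_add ens_cmult)
  finally show ?case by (simp add: Suc algebra_simps)
qed

lemma ens_growth:
  fixes Q :: "complex mat \<Rightarrow> real"
  assumes k: "k \<le> n" and inv: "\<And>C U. C \<in> clifford_group n \<Longrightarrow> U \<in> unitaries n \<Longrightarrow> Q (C * U) = Q U"
    and step: "\<And>U. U \<in> unitaries n \<Longrightarrow> avg n (\<lambda>C. Q (That n k * C * U)) \<ge> a * Q U" and a: "a \<ge> 0"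
  shows "ens_expect n k l Q \<ge> a ^ l * Q (1\<^sub>m (2^n))"
proof (induction l)
  case 0
  have "Q C = Q (1\<^sub>m (2^n))" if "C \<in> clifford_group n" for C
    using inv[OF that one_unitaries] right_mult_one_mat[OF clifford_carrier[OF that]] by simp
  then show ?case by (simp add: ens_0 avg_eq_const)
next
  case (Suc l)
  have "a ^ Suc l * Q (1\<^sub>m (2^n)) \<le> a * ens_expect n k l Q" using mult_left_mono[OF Suc a] by (simp add: mult.assoc)
  also have "\<dots> = ens_expect n k l (\<lambda>U. a * Q U)" by (simp add: ens_cmult)
  also have "\<dots> \<le> ens_expect n k l (\<lambda>U. avg n (\<lambda>C. Q (That n k * C * U)))" by (rule ens_mono[OF k step])
  also have "\<dots> = ens_expect n k (Suc l) Q" using ens_step[of k n Q, OF k inv] by simp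
  finally show ?case .
qed

subsection \<open>Moments of computational basis measurements\<close>

text \<open>The overlap of two diagonals. For X and Y conjugated by U it is the bilinear expression
  from which both the measurement channel and the estimator are built.\<close>

definition dg :: "nat \<Rightarrow> complex mat \<Rightarrow> complex mat \<Rightarrow> complex" where
  "dg n X Y = (\<Sum>b<2^n. X $$ (b,b) * Y $$ (b,b))"

definition zwords :: "nat \<Rightarrow> word set" where
  "zwords n = {u \<in> words n. \<forall>q<n. u q = LI \<or> u q = LZ}"

lemma zwords_words: "u \<in> zwords n \<Longrightarrow> u \<in> words n"
  by (simp add: zwords_def)

lemma finite_zwords [simp]: "finite (zwords n)"
  by (simp add: zwords_def)

lemma zero_zwords: "0 \<in> zwords n"
  by (simp add: zwords_def zero_fun_apply zero_letter_def)

lemma card_zwords: "card (zwords n) = 2^n"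
proof -
  have "(\<Sum>u\<in>words n. \<Prod>q<n. if u q = LI \<or> u q = LZ then 1 else 0) = (\<Prod>q<n. \<Sum>l\<in>UNIV. if l = LI \<or> l = LZ then 1 else (0::nat))"
    by (rule sum_words_prod)
  also have "\<dots> = 2^n" by (simp add: UNIV_letter numeral_eq_Suc)
  also have "(\<Sum>u\<in>words n. \<Prod>q<n. if u q = LI \<or> u q = LZ then 1 else 0) = (\<Sum>u\<in>words n. if u \<in> zwords n then 1 else (0::nat))"
    by (rule sum.cong) (auto simp: zwords_def intro!: prod_zero)
  also have "\<dots> = card (zwords n)"
    by (simp add: sum.If_cases Int_absorb1[of "zwords n" "words n"] zwords_def Int_def)
  finally show ?thesis by simp
qed

lemma sg_zwords: "u \<in> zwords n \<Longrightarrow> v \<in> zwords n \<Longrightarrow> sg n u v = 1"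
proof -
  assume uv: "u \<in> zwords n" "v \<in> zwords n"
  have "sl (u q) (v q) = 1" if "q < n" for q
  proof -
    have "u q = LI \<or> u q = LZ" "v q = LI \<or> v q = LZ" using uv that by (auto simp: zwords_def)
    then show ?thesis by (auto simp: sl_def zero_letter_def)
  qed
  then show ?thesis unfolding sg_def by (intro prod.neutral) auto
qed

lemma pauli_index: "i < 2^n \<Longrightarrow> j < 2^n \<Longrightarrow> pauli n u $$ (i,j) = (\<Prod>q<n. sigma (u q) $$ (qbit n q i, qbit n q j))"
  unfolding pauli_def by (rule ten_index) simp_all

lemma qbit_cases: "qbit n q i = 0 \<or> qbit n q i = Suc 0"
  unfolding qbit_def by linarith

lemma pauli_offdiag:
  assumes u: "u \<in> zwords n" and ij: "i < 2^n" "j < 2^n" "i \<noteq> j"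
  shows "pauli n u $$ (i,j) = 0"
proof -
  obtain q where q: "q < n" "qbit n q i \<noteq> qbit n q j" using qbit_eqI[OF ij(1,2)] ij(3) by auto
  have "u q = LI \<or> u q = LZ" using u q by (simp add: zwords_def)
  then have "sigma (u q) $$ (qbit n q i, qbit n q j) = 0"
    using q(2) qbit_cases[of n q i] qbit_cases[of n q j] by (elim disjE) (simp_all add: sigma_entries)
  then show ?thesis unfolding pauli_index[OF ij(1,2)] using q(1) by (intro prod_zero) auto
qed

lemma pauli_diag:
  assumes u: "u \<in> words n - zwords n" and i: "i < 2^n"
  shows "pauli n u $$ (i,i) = 0"
proof -
  obtain q where q: "q < n" "u q \<noteq> LI" "u q \<noteq> LZ" using u by (auto simp: zwords_def)
  then have "sigma (u q) $$ (qbit n q i, qbit n q i) = 0"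
    using qbit_cases[of n q i] by (cases "u q") (auto simp: sigma_entries)
  then show ?thesis unfolding pauli_index[OF i i] using q(1) by (intro prod_zero) auto
qed

text \<open>Completeness applied to the diagonal parts D of X and Y: strings of I and Z are diagonal
  matrices, and all other strings have zero diagonal.\<close>

lemma dg_pauli:
  assumes X: "X \<in> carrier_mat (2^n) (2^n)" and Y: "Y \<in> carrier_mat (2^n) (2^n)"
  shows "2^n * dg n X Y = (\<Sum>u\<in>zwords n. mtrace (X * pauli n u) * mtrace (Y * pauli n u))"
proof -
  define D where "D Z = mat (2^n) (2^n) (\<lambda>(i,j). if i = j then Z $$ (i,i) else (0::complex))" for Z :: "complex mat"
  have Dc: "D Z \<in> carrier_mat (2^n) (2^n)" for Z by (simp add: D_def)
  have Dp: "mtrace (D Z * pauli n u) = (\<Sum>i<2^n. Z $$ (i,i) * pauli n u $$ (i,i))" for Z u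
    unfolding mtrace_mult[OF Dc pauli_carrier]
  proof (rule sum.cong)
    fix i assume "i \<in> {..<(2::nat)^n}"
    then have i: "i < 2^n" by simp
    have "(\<Sum>j<2^n. D Z $$ (i,j) * pauli n u $$ (j,i)) = (\<Sum>j<2^n. if j = i then Z $$ (i,i) * pauli n u $$ (i,i) else 0)"
      by (rule sum.cong) (auto simp: D_def i)
    then show "(\<Sum>j<2^n. D Z $$ (i,j) * pauli n u $$ (j,i)) = Z $$ (i,i) * pauli n u $$ (i,i)" using i by simp
  qed simp
  have z: "mtrace (D Z * pauli n u) = mtrace (Z * pauli n u)" if Z: "Z \<in> carrier_mat (2^n) (2^n)" and u: "u \<in> zwords n" for Z u
    unfolding Dp mtrace_mult[OF Z pauli_carrier]
  proof (rule sum.cong)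
    fix i assume "i \<in> {..<(2::nat)^n}"
    then have i: "i < 2^n" by simp
    have "(\<Sum>j<2^n. Z $$ (i,j) * pauli n u $$ (j,i)) = (\<Sum>j<2^n. if j = i then Z $$ (i,i) * pauli n u $$ (i,i) else 0)"
      using pauli_offdiag[OF u _ i] by (intro sum.cong) auto
    then show "Z $$ (i,i) * pauli n u $$ (i,i) = (\<Sum>j<2^n. Z $$ (i,j) * pauli n u $$ (j,i))" using i by simp
  qed simp
  have nz: "mtrace (D Z * pauli n u) = 0" if "u \<in> words n - zwords n" for Z u
    unfolding Dp using pauli_diag[OF that] by (intro sum.neutral) auto
  have "mtrace (D X * D Y) = dg n X Y"
    unfolding mtrace_mult[OF Dc Dc] dg_def
  proof (rule sum.cong)
    fix i assume "i \<in> {..<(2::nat)^n}"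
    then have i: "i < 2^n" by simp
    have "(\<Sum>j<2^n. D X $$ (i,j) * D Y $$ (j,i)) = (\<Sum>j<2^n. if j = i then X $$ (i,i) * Y $$ (i,i) else 0)"
      by (rule sum.cong) (auto simp: D_def i)
    then show "(\<Sum>j<2^n. D X $$ (i,j) * D Y $$ (j,i)) = X $$ (i,i) * Y $$ (i,i)" using i by simp
  qed simp
  then have "2^n * dg n X Y = (\<Sum>u\<in>words n. mtrace (D X * pauli n u) * mtrace (D Y * pauli n u))"
    using sum_pauli_trace[OF Dc[of X] Dc[of Y]] by simp
  also have "\<dots> = (\<Sum>u\<in>zwords n. mtrace (D X * pauli n u) * mtrace (D Y * pauli n u))"
    by (rule sum.mono_neutral_right) (auto simp: nz zwords_def)
  also have "\<dots> = (\<Sum>u\<in>zwords n. mtrace (X * pauli n u) * mtrace (Y * pauli n u))"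
    by (rule sum.cong) (simp_all add: z X Y)
  finally show ?thesis .
qed

lemma mtrace_cj_prod:
  assumes C: "C \<in> carrier_mat d d" "adj C * C = 1\<^sub>m d" and X: "X \<in> carrier_mat d d" "Y \<in> carrier_mat d d"
  shows "mtrace (cj C X * cj C Y) = mtrace (X * Y)"
proof -
  note a = adj_carrier[OF C(1)]
  have "adj C * cj C Y * C = adj C * (C * (Y * adj C)) * C" unfolding cj_def assoc_mult_mat[OF C(1) X(2) a] ..
  also have "adj C * (C * (Y * adj C)) = Y * adj C"
    unfolding assoc_mult_mat[OF a C(1) mult_carrier_mat[OF X(2) a], symmetric] C(2)
    by (rule left_mult_one_mat[OF mult_carrier_mat[OF X(2) a]])
  also have "Y * adj C * C = Y" unfolding assoc_mult_mat[OF X(2) a C(1)] C(2) by (rule right_mult_one_mat[OF X(2)])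
  finally show ?thesis unfolding mtrace_cj_mult[OF C(1) X(1) cj_carrier[OF C(1) X(2)]] by simp
qed

text \<open>Second-moment version of the orbit argument: signs square to 1 and all nonzero words are
  equivalent, so the total over all words determines the common value.\<close>

lemma avg_single:
  assumes X: "X \<in> carrier_mat (2^n) (2^n)" and Y: "Y \<in> carrier_mat (2^n) (2^n)" and u: "u \<in> words n" "u \<noteq> 0"
  shows "(4^n - 1) * avg n (\<lambda>C. mtrace (cj C X * pauli n u) * mtrace (cj C Y * pauli n u))
    = 2^n * mtrace (X * Y) - mtrace X * mtrace Y"
proof -
  define G where "G u = avg n (\<lambda>C. mtrace (cj C X * pauli n u) * mtrace (cj C Y * pauli n u))" for u
  have tv: "G (tv n w v) = G v" if w: "w \<in> words n" "w \<noteq> 0" and v: "v \<in> words n" for w v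
  proof -
    obtain g where g: "g \<in> clifford_group n" "acts n g (tv n w)" using clifford_transvection[OF w] .
    obtain e where e: "pm e" "\<And>Z. Z \<in> carrier_mat (2^n) (2^n) \<Longrightarrow> mtrace (cj g Z * pauli n v) = e * mtrace (Z * pauli n (tv n w v))"
      using mtrace_acts[OF g(2) v X] by auto
    have "G v = avg n (\<lambda>C. mtrace (cj (g * C) X * pauli n v) * mtrace (cj (g * C) Y * pauli n v))"
      unfolding G_def by (rule avg_shift[OF g(1), symmetric])
    also have "\<dots> = G (tv n w v)" unfolding G_def
    proof (rule avg_cong)
      fix C assume C: "C \<in> clifford_group n"
      note c = clifford_carrier[OF g(1)] clifford_carrier[OF C]
      show "mtrace (cj (g * C) X * pauli n v) * mtrace (cj (g * C) Y * pauli n v)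
        = mtrace (cj C X * pauli n (tv n w v)) * mtrace (cj C Y * pauli n (tv n w v))"
        unfolding cj_mult[OF c X] cj_mult[OF c Y] e(2)[OF cj_carrier[OF c(2) X]] e(2)[OF cj_carrier[OF c(2) Y]]
        using e(1) by (auto simp: pm_def)
    qed
    finally show ?thesis ..
  qed
  have iso: "G (h v) = G v" if "h \<in> isoms n" "v \<in> words n" for h v
    using that
  proof (induction rule: isoms.induct)
    case (isoms_step h w)
    then show ?case using tv[OF isoms_step(2,3) isoms_words[OF isoms_step(1)]] by simp
  qed simp
  have G0: "G 0 = mtrace X * mtrace Y"
    unfolding G_def
  proof (rule avg_eq_const)
    fix C assume C: "C \<in> clifford_group n"
    note c = clifford_carrier[OF C] clifford_unitary[OF C]
    show "mtrace (cj C X * pauli n 0) * mtrace (cj C Y * pauli n 0) = mtrace X * mtrace Y"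
      unfolding pauli_0 right_mult_one_mat[OF cj_carrier[OF c(1) X]] right_mult_one_mat[OF cj_carrier[OF c(1) Y]]
        mtrace_cj[OF c(1) X c(2)] mtrace_cj[OF c(1) Y c(2)] ..
  qed
  have "(\<Sum>u\<in>words n. G u) = 2^n * mtrace (X * Y)"
    unfolding G_def avg_sum[symmetric]
  proof (rule avg_eq_const)
    fix C assume C: "C \<in> clifford_group n"
    note c = clifford_carrier[OF C] clifford_unitary[OF C]
    show "(\<Sum>u\<in>words n. mtrace (cj C X * pauli n u) * mtrace (cj C Y * pauli n u)) = 2^n * mtrace (X * Y)"
      unfolding sum_pauli_trace[OF cj_carrier[OF c(1) X] cj_carrier[OF c(1) Y]] mtrace_cj_prod[OF c X Y] ..
  qed
  then show ?thesis using single_value[where n=n and G=G and ?u0.0=u] iso u G0 by (simp add: G_def)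
qed

lemma pow2_ne: "n \<ge> 1 \<Longrightarrow> (2::complex)^n - 1 \<noteq> 0" "(2::complex)^n + 1 \<noteq> 0" "(2::complex)^n + 2 \<noteq> 0"
proof -
  have g: "(2::real)^n \<ge> 1" by simp
  have e: "(2::complex)^n + of_real a = of_real (2^n + a)" for a by simp
  have "(2::complex)^n + of_real a \<noteq> 0" if "a > -1" for a unfolding e of_real_eq_0_iff using g that by linarith
  from this[of 1] this[of 2] show "(2::complex)^n + 1 \<noteq> 0" "(2::complex)^n + 2 \<noteq> 0" by simp_all
  assume "n \<ge> 1"
  then have "(2::real)^n \<ge> 2" using power_increasing[of 1 n "2::real"] by simp
  then have "(2::complex)^n + of_real (-1) \<noteq> 0" unfolding e of_real_eq_0_iff by simp
  then show "(2::complex)^n - 1 \<noteq> 0" by simp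
qed

lemma avg_dg:
  assumes n: "n \<ge> 1" and X: "X \<in> carrier_mat (2^n) (2^n)" and Y: "Y \<in> carrier_mat (2^n) (2^n)"
  shows "avg n (\<lambda>C. dg n (cj C X) (cj C Y)) = (mtrace X * mtrace Y + mtrace (X * Y)) / (2^n + 1)"
proof -
  let ?g = "\<lambda>u C. mtrace (cj C X * pauli n u) * mtrace (cj C Y * pauli n u)"
  define s where "s = (2^n * mtrace (X * Y) - mtrace X * mtrace Y) / (4^n - 1)"
  define d where "d = (2::complex)^n"
  have d: "d \<noteq> 0" "d - 1 \<noteq> 0" "d + 1 \<noteq> 0" using pow2_ne[of n] n by (simp_all add: d_def)
  have D: "(4::complex)^n - 1 = (d - 1) * (d + 1)" unfolding four_pow d_def[symmetric] by (simp add: algebra_simps)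
  have "2^n * avg n (\<lambda>C. dg n (cj C X) (cj C Y)) = avg n (\<lambda>C. \<Sum>u\<in>zwords n. ?g u C)"
    unfolding avg_cmult[symmetric] by (rule avg_cong) (rule dg_pauli[OF cj_carrier[OF clifford_carrier X] cj_carrier[OF clifford_carrier Y]])
  also have "\<dots> = (\<Sum>u\<in>zwords n. avg n (?g u))" by (rule avg_sum)
  also have "\<dots> = avg n (?g 0) + (\<Sum>u\<in>zwords n - {0}. avg n (?g u))"
    by (rule sum.remove) (simp_all add: zero_zwords)
  also have "avg n (?g 0) = mtrace X * mtrace Y"
  proof (rule avg_eq_const)
    fix C assume C: "C \<in> clifford_group n"
    note c = clifford_carrier[OF C] clifford_unitary[OF C]
    show "?g 0 C = mtrace X * mtrace Y"
      unfolding pauli_0 right_mult_one_mat[OF cj_carrier[OF c(1) X]] right_mult_one_mat[OF cj_carrier[OF c(1) Y]]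
        mtrace_cj[OF c(1) X c(2)] mtrace_cj[OF c(1) Y c(2)] ..
  qed
  also have "(\<Sum>u\<in>zwords n - {0}. avg n (?g u)) = (\<Sum>u\<in>zwords n - {0}. s)"
  proof (rule sum.cong)
    fix u assume "u \<in> zwords n - {0}"
    then have "u \<in> words n" "u \<noteq> 0" by (auto simp: zwords_words)
    from avg_single[OF X Y this] show "avg n (?g u) = s"
      unfolding s_def using d D by (simp add: eq_divide_eq mult.commute)
  qed simp
  also have "\<dots> = (d - 1) * s" by (simp add: zero_zwords card_zwords of_nat_diff d_def)
  also have "\<dots> = (d * mtrace (X * Y) - mtrace X * mtrace Y) / (d + 1)"
    unfolding s_def D d_def[symmetric] using d by simp
  finally have "d * avg n (\<lambda>C. dg n (cj C X) (cj C Y)) = d * ((mtrace X * mtrace Y + mtrace (X * Y)) / (d + 1))"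
    unfolding d_def[symmetric] using d by (simp add: field_simps)
  then show ?thesis using d(1) unfolding mult_cancel_left d_def by blast
qed

text \<open>The traces of X, Y and X * Y are unitarily invariant, so one Clifford twirl already
  gives the same value at every depth l.\<close>

lemma ens_dg:
  assumes n: "n \<ge> 1" and k: "k \<le> n" and X: "X \<in> carrier_mat (2^n) (2^n)" and Y: "Y \<in> carrier_mat (2^n) (2^n)"
  shows "ens_expect n k l (\<lambda>U. dg n (cj U X) (cj U Y)) = (mtrace X * mtrace Y + mtrace (X * Y)) / (2^n + 1)"
proof -
  have "ens_expect n k l (\<lambda>U. dg n (cj U X) (cj U Y)) =
     ens_expect n k l (\<lambda>U. avg n (\<lambda>C. dg n (cj (C * U) X) (cj (C * U) Y)))" by (rule ens_twirl[OF k])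
  also have "\<dots> = ens_expect n k l (\<lambda>_. (mtrace X * mtrace Y + mtrace (X * Y)) / (2^n + 1))"
  proof (rule ens_cong[OF k])
    fix U assume U: "U \<in> unitaries n"
    note c = unitariesD[OF U]
    have "avg n (\<lambda>C. dg n (cj (C * U) X) (cj (C * U) Y)) = avg n (\<lambda>C. dg n (cj C (cj U X)) (cj C (cj U Y)))"
      by (rule avg_cong) (simp add: cj_mult[OF clifford_carrier c(1)] X Y)
    then show "avg n (\<lambda>C. dg n (cj (C * U) X) (cj (C * U) Y)) = (mtrace X * mtrace Y + mtrace (X * Y)) / (2^n + 1)"
      unfolding avg_dg[OF n cj_carrier[OF c(1) X] cj_carrier[OF c(1) Y]]
        mtrace_cj[OF c(1) X c(2)] mtrace_cj[OF c(1) Y c(2)] mtrace_cj_prod[OF c X Y] by simp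
  qed
  finally show ?thesis by simp
qed

lemma meas_channel_eq:
  assumes n: "n \<ge> 1" and k: "k \<le> n" and X: "X \<in> carrier_mat (2^n) (2^n)"
  shows "meas_channel n k l X = (1 / (2^n + 1)) \<cdot>\<^sub>m (X + mtrace X \<cdot>\<^sub>m 1\<^sub>m (2^n))"
proof (rule eq_matI)
  fix i j assume "i < dim_row ((1 / (2^n + 1)) \<cdot>\<^sub>m (X + mtrace X \<cdot>\<^sub>m 1\<^sub>m (2^n)))" "j < dim_col ((1 / (2^n + 1)) \<cdot>\<^sub>m (X + mtrace X \<cdot>\<^sub>m 1\<^sub>m (2^n)))"
  then have ij: "i < 2^n" "j < 2^n" using X by auto
  \<comment> \<open>The matrix unit dual to position (i, j). Pairing with it turns an entry of the
    channel into the second moment \<open>ens_dg\<close>.\<close>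
  define E where "E = outer (unit_vec (2^n) j) (unit_vec (2^n) i)"
  have E: "E \<in> carrier_mat (2^n) (2^n)" unfolding E_def by (intro outer_carrier unit_vec_carrier)
  have Ei: "E $$ (a,b) = (if a = j \<and> b = i then 1 else 0)" if "a < 2^n" "b < 2^n" for a b
    using that ij by (simp add: E_def outer_index[OF unit_vec_carrier unit_vec_carrier])
  have tE: "mtrace (Z * E) = Z $$ (i,j)" if Z: "Z \<in> carrier_mat (2^n) (2^n)" for Z
  proof -
    have "mtrace (Z * E) = (\<Sum>a<2^n. \<Sum>b<2^n. if a = i then (if b = j then Z $$ (i,j) else 0) else 0)"
      unfolding mtrace_mult[OF Z E] by (intro sum.cong refl) (simp add: Ei)
    also have "\<dots> = (\<Sum>a<2^n. if a = i then (\<Sum>b<2^n. if b = j then Z $$ (i,j) else 0) else 0)"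
      by (rule sum.cong) auto
    also have "\<dots> = Z $$ (i,j)" using ij by simp
    finally show ?thesis .
  qed
  have t1: "mtrace E = (if i = j then 1 else 0)"
    using tE[OF one_carrier_mat] left_mult_one_mat[OF E] ij by simp
  have "(\<Sum>b<2^n. (U * X * adj U) $$ (b,b) * (adj U * basis_proj (2^n) b * U) $$ (i,j)) = dg n (cj U X) (cj U E)"
    (is "?f U = _") if U: "U \<in> unitaries n" for U
    unfolding dg_def cj_def[symmetric, of U X]
  proof (intro sum.cong arg_cong2[where f="(*)"] refl)
    fix b assume "b \<in> {..<(2::nat)^n}"
    then have b: "b < 2^n" by simp
    note c = unitariesD(1)[OF U]
    have B: "basis_proj (2^n) b \<in> carrier_mat (2^n) (2^n)" by (simp add: basis_proj_def)
    have "(adj U * basis_proj (2^n) b * U) $$ (i,j) = mtrace ((adj U * basis_proj (2^n) b * U) * E)"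
      by (rule tE[symmetric]) (intro mult_carrier_mat[of _ _ "2^n"] adj_carrier c B)
    also have "\<dots> = mtrace (E * (adj U * basis_proj (2^n) b * U))"
      by (rule mtrace_comm[OF _ E]) (intro mult_carrier_mat[of _ _ "2^n"] adj_carrier c B)
    also have "\<dots> = mtrace (cj U E * basis_proj (2^n) b)" by (rule mtrace_cj_mult[OF c E B, symmetric])
    also have "\<dots> = (\<Sum>x<2^n. \<Sum>y<2^n. if x = b then (if y = b then cj U E $$ (b,b) else 0) else 0)"
      unfolding mtrace_mult[OF cj_carrier[OF c E] B] by (intro sum.cong refl) (simp add: basis_proj_def)
    also have "\<dots> = (\<Sum>x<2^n. if x = b then (\<Sum>y<2^n. if y = b then cj U E $$ (b,b) else 0) else 0)"
      by (rule sum.cong) auto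
    also have "\<dots> = cj U E $$ (b,b)" using b by simp
    finally show "(adj U * basis_proj (2^n) b * U) $$ (i,j) = cj U E $$ (b,b)" .
  qed
  then have "ens_expect n k l ?f = ens_expect n k l (\<lambda>U. dg n (cj U X) (cj U E))" by (rule ens_cong[OF k])
  moreover have "meas_channel n k l X $$ (i,j) = ens_expect n k l ?f"
    unfolding meas_channel_def by (rule index_mat(1)[OF ij])
  ultimately have "meas_channel n k l X $$ (i,j) = ens_expect n k l (\<lambda>U. dg n (cj U X) (cj U E))" by simp
  also have "\<dots> = ((1 / (2^n + 1)) \<cdot>\<^sub>m (X + mtrace X \<cdot>\<^sub>m 1\<^sub>m (2^n))) $$ (i,j)"
    unfolding ens_dg[OF n k X E] tE[OF X] t1 using X ij by (simp add: add.commute)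
  finally show "meas_channel n k l X $$ (i,j) = ((1 / (2^n + 1)) \<cdot>\<^sub>m (X + mtrace X \<cdot>\<^sub>m 1\<^sub>m (2^n))) $$ (i,j)" .
qed (use X in \<open>simp_all add: meas_channel_def\<close>)

text \<open>The channel preserves traces, so a preimage of a traceless matrix is traceless, and
  there the channel is division by d + 1. This gives the uniqueness that the definite description
  demands.\<close>

lemma meas_channel_inv_traceless:
  assumes n: "n \<ge> 1" and k: "k \<le> n" and X: "X \<in> carrier_mat (2^n) (2^n)" "mtrace X = 0"
  shows "meas_channel_inv n k l X = (2^n + 1) \<cdot>\<^sub>m X"
  unfolding meas_channel_inv_def
proof (rule the_equality)
  note ne = pow2_ne(2)[of n]
  have "(2^n + 1) \<cdot>\<^sub>m X \<in> carrier_mat (2^n) (2^n)" using X by simp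
  moreover have "meas_channel n k l ((2^n + 1) \<cdot>\<^sub>m X) = X"
    unfolding meas_channel_eq[OF n k calculation] mtrace_smult[OF X(1)] X(2)
    by (rule eq_matI) (use X ne in auto)
  ultimately show "(2^n + 1) \<cdot>\<^sub>m X \<in> carrier_mat (2^n) (2^n) \<and> meas_channel n k l ((2^n + 1) \<cdot>\<^sub>m X) = X" ..
  fix Z assume "Z \<in> carrier_mat (2^n) (2^n) \<and> meas_channel n k l Z = X"
  then have Z: "Z \<in> carrier_mat (2^n) (2^n)" and e: "X = (1 / (2^n + 1)) \<cdot>\<^sub>m (Z + mtrace Z \<cdot>\<^sub>m 1\<^sub>m (2^n))"
    using meas_channel_eq[OF n k] by auto
  have c: "mtrace Z \<cdot>\<^sub>m 1\<^sub>m (2^n) \<in> carrier_mat (2^n) (2^n)" by simp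
  have "mtrace X = (1 / (2^n + 1)) * (mtrace Z + mtrace Z * 2^n)"
    unfolding e mtrace_smult[OF add_carrier_mat[OF c, of Z]] mtrace_add[OF Z c] mtrace_smult[OF one_carrier_mat] by simp
  also have "\<dots> = mtrace Z" using ne by (simp add: field_simps)
  finally have "mtrace Z = 0" using X by simp
  then show "Z = (2^n + 1) \<cdot>\<^sub>m X"
    unfolding e by (intro eq_matI) (use Z ne in auto)
qed

text \<open>A single qubit has only one nontrivial string of I and Z, so the generic pairs in
  \<open>avg_dg_sq\<close> do not occur for n = 1.\<close>

lemma zwords_pair: "u \<in> zwords 1 \<Longrightarrow> u \<noteq> 0 \<Longrightarrow> v \<in> zwords 1 \<Longrightarrow> v \<noteq> 0 \<Longrightarrow> u = v"
proof -
  have "w = (\<lambda>q. if q = 0 then LZ else LI)" if w: "w \<in> zwords 1" "w \<noteq> 0" for w :: word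
  proof -
    have o: "w q = LI" if "q \<noteq> 0" for q using w(1) that by (simp add: zwords_def words_def zero_letter_def)
    have "w 0 \<noteq> LI"
    proof
      assume "w 0 = LI"
      then have "w = 0" using o by (intro ext) (metis zero_fun_apply zero_letter_def)
      then show False using w(2) by simp
    qed
    then have "w 0 = LZ" using w(1) by (simp add: zwords_def)
    then show ?thesis using o by auto
  qed
  then show "u \<in> zwords 1 \<Longrightarrow> u \<noteq> 0 \<Longrightarrow> v \<in> zwords 1 \<Longrightarrow> v \<noteq> 0 \<Longrightarrow> u = v" by metis
qed

text \<open>All strings of I and Z commute, so expanding the square needs \<open>FF\<close> only on
  commuting triples (v, v, w). The order psi, phi, psi, phi of the factors of Y puts one overlap on
  v and the other on w.\<close>

lemma avg_dg_sq:
  assumes n: "n \<ge> 1" and c: "\<psi> \<in> carrier_vec (2^n)" "\<phi> \<in> carrier_vec (2^n)"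
    and u: "ip \<psi> \<psi> = 1" "ip \<phi> \<phi> = 1" and f: "ip \<psi> \<phi> * ip \<phi> \<psi> = f"
  defines "d \<equiv> (2::complex)^n" and "A \<equiv> qA n \<psi> \<phi>" and "B \<equiv> qB n \<psi> \<phi>"
  shows "d^2 * avg n (\<lambda>C. (dg n (cj C (outer \<psi> \<psi>)) (cj C (outer \<phi> \<phi>)))^2) =
    1 + 2 * (d * f - 1) / (d + 1) + (A - 1) / (d + 1)
      + (if n = 1 then 0 else (d^2 * f^2 + d * B - 4 * d * f - 2 * A + 4) / ((d + 1) * (d + 2)))"
proof -
  define Y where "Y = reidx r13 (famA \<psi> \<phi>)"
  have Y: "rank1 n Y" unfolding Y_def by (rule rank1_reidx[OF rank1_famA[OF c]])
  have d: "d \<noteq> 0" "d - 1 \<noteq> 0" "d + 1 \<noteq> 0" "d + 2 \<noteq> 0" using pow2_ne[of n] n by (simp_all add: d_def)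
  have D: "(4::complex)^n - 1 = (d - 1) * (d + 1)" unfolding four_pow d_def[symmetric] by (simp add: algebra_simps)
  have f': "ip \<phi> \<psi> * ip \<psi> \<phi> = f" using f by (simp add: mult.commute)
  have g: "gg Y i j = ip (if i = 0 \<or> i = 2 then \<psi> else \<phi>) (if j = 0 \<or> j = 2 then \<psi> else \<phi>)"
    if "i < 4" "j < 4" for i j
    using that by (auto simp: Y_def reidx_def r13_def famA_def vfam_def ip_def)
  have t0: "t0 Y = 1" by (simp add: t0_def g u)
  define s where "s = (d * f - 1) / ((d - 1) * (d + 1))"
  define a where "a = (A - 1) / ((d - 1) * (d + 1))"
  define r where "r = (if n = 1 then 0 else (d^2 * f^2 + d * B - 4 * d * f - 2 * A + 4) / (((d - 1) * (d + 1)) * ((d - 2) * (d + 2))))"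
  have iso0: "h 0 = 0" if "h \<in> isoms n" for h using isoms_eq_0[OF that, of 0] by simp
  have s1: "FF n Y 0 0 w = s" if w: "w \<in> words n" "w \<noteq> 0" for w
  proof -
    have "(4^n - 1) * FF n Y 0 0 w = pr n Y 2 3 0 1 - t0 Y"
      using single_value[where n=n and G="\<lambda>v. FF n Y 0 0 v" and ?u0.0=w] w
        FF_isoms[OF _ Y words_0 words_0] iso0 sum_FF_single(3)[OF Y] FF_000[OF Y] by simp
    then show ?thesis unfolding s_def t0 D pr_def d_def[symmetric] using d by (simp add: g u f f' eq_divide_eq mult_ac)
  qed
  have s2: "FF n Y w w 0 = s" if w: "w \<in> words n" "w \<noteq> 0" for w
  proof -
    have "(4^n - 1) * FF n Y w w 0 = pr n Y 0 1 2 3 - t0 Y"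
      using single_value[where n=n and G="\<lambda>v. FF n Y v v 0" and ?u0.0=w] w
        FF_isoms[OF _ Y _ _ words_0] iso0 sum_FF_single(2)[OF Y] FF_000[OF Y] by simp
    then show ?thesis unfolding s_def t0 D pr_def d_def[symmetric] using d by (simp add: g u f f' eq_divide_eq mult_ac)
  qed
  have "pp n Y 0 1 2 3 = A"
    unfolding pp_def A_def qA_def by (simp add: Y_def ee_def reidx_def r13_def famA_def vfam_def bra_def mult_ac)
  then have a1: "FF n Y w w w = a" if w: "w \<in> words n" "w \<noteq> 0" for w
    using value_equal[OF Y w] d unfolding D t0 a_def by (simp add: eq_divide_eq mult_ac)
  have r1: "FF n Y v v w = r" if w: "v \<in> zwords n" "w \<in> zwords n" "v \<noteq> 0" "w \<noteq> 0" "v \<noteq> w" for v w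
  proof -
    have n2: "n \<ge> 2" using zwords_pair[of v w] w n by (cases "n = 1") auto
    have "(2::real)^n \<ge> 4" using power_increasing[OF n2, of "2::real"] by simp
    then have "of_real (2^n - 2) \<noteq> (0::complex)" unfolding of_real_eq_0_iff by simp
    then have d2: "d - 2 \<noteq> 0" by (simp add: d_def)
    have NC: "NC n = ((d - 1) * (d + 1)) * ((d - 2) * (d + 2)) / 2"
      unfolding NC_def four_pow d_def[symmetric] by (simp add: field_simps)
    have NC0: "NC n \<noteq> 0" unfolding NC using d d2 by simp
    have "cval n Y = (d^2 * f^2 + d * B) / 2 - 2 * d * f - A + 2"
      using famA_values(4)[OF u f, of n] NC0 unfolding fc_def Y_def A_def B_def d_def by simp
    then have "NC n * FF n Y v v w = (d^2 * f^2 + d * B) / 2 - 2 * d * f - A + 2"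
      using value_comm[OF Y zwords_words[OF w(1)] zwords_words[OF w(2)] w(3-5) sg_zwords[OF w(1,2)]] by simp
    then have "FF n Y v v w = ((d^2 * f^2 + d * B) / 2 - 2 * d * f - A + 2) / NC n"
      using NC0 by (simp add: eq_divide_eq mult_ac)
    also have "\<dots> = (2 * ((d^2 * f^2 + d * B) / 2 - 2 * d * f - A + 2)) / (2 * NC n)"
      by (rule mult_divide_mult_cancel_left[symmetric]) simp
    also have "2 * ((d^2 * f^2 + d * B) / 2 - 2 * d * f - A + 2) = d^2 * f^2 + d * B - 4 * d * f - 2 * A + 4"
      by (simp add: field_simps)
    also have "2 * NC n = ((d - 1) * (d + 1)) * ((d - 2) * (d + 2))" by (simp add: NC)
    also have "(d^2 * f^2 + d * B - 4 * d * f - 2 * A + 4) / (((d - 1) * (d + 1)) * ((d - 2) * (d + 2))) = r"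
      using n2 by (simp add: r_def)
    finally show ?thesis .
  qed
  \<comment> \<open>The generic value r is corrected where v = w, v = 0 or w = 0; the last term
    repairs (0, 0), where all three corrections apply at once and the value is 1.\<close>
  have F: "FF n Y v v w = r + (if w = v then a - r else 0) + (if v = 0 then s - r else 0) + (if w = 0 then s - r else 0)
      + (if w = 0 then if v = 0 then 1 - a - 2 * s + 2 * r else 0 else 0)" if "v \<in> zwords n" "w \<in> zwords n" for v w
    using that s1[OF zwords_words[OF that(2)]] s2[OF zwords_words[OF that(1)]] a1[OF zwords_words[OF that(2)]] r1[OF that] FF_000[OF Y] t0
    by (cases "v = 0"; cases "w = 0"; cases "v = w") auto
  have "d^2 * avg n (\<lambda>C. (dg n (cj C (outer \<psi> \<psi>)) (cj C (outer \<phi> \<phi>)))^2)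
     = avg n (\<lambda>C. \<Sum>v\<in>zwords n. \<Sum>w\<in>zwords n. phi n (cjf C Y) v v w)"
    unfolding avg_cmult[symmetric]
  proof (rule avg_cong)
    fix C assume "C \<in> clifford_group n"
    note C = clifford_carrier[OF this]
    have "d^2 * (dg n (cj C (outer \<psi> \<psi>)) (cj C (outer \<phi> \<phi>)))^2 = (d * dg n (cj C (outer \<psi> \<psi>)) (cj C (outer \<phi> \<phi>)))^2"
      by (simp add: power_mult_distrib)
    also have "\<dots> = (\<Sum>v\<in>zwords n. \<Sum>w\<in>zwords n. phi n (cjf C Y) v v w)"
      unfolding d_def dg_pauli[OF cj_carrier[OF C outer_carrier[OF c(1) c(1)]] cj_carrier[OF C outer_carrier[OF c(2) c(2)]]]
        power2_eq_square sum_product phi_uuv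
      by (simp add: ee_def cjf_def Y_def reidx_def r13_def famA_def vfam_def)
    finally show "d^2 * (dg n (cj C (outer \<psi> \<psi>)) (cj C (outer \<phi> \<phi>)))^2 = (\<Sum>v\<in>zwords n. \<Sum>w\<in>zwords n. phi n (cjf C Y) v v w)" .
  qed
  also have "\<dots> = (\<Sum>v\<in>zwords n. \<Sum>w\<in>zwords n. FF n Y v v w)" unfolding avg_sum FF_def ..
  also have "\<dots> = (\<Sum>v\<in>zwords n. \<Sum>w\<in>zwords n. r + (if w = v then a - r else 0) + (if v = 0 then s - r else 0) + (if w = 0 then s - r else 0)
      + (if w = 0 then if v = 0 then 1 - a - 2 * s + 2 * r else 0 else 0))"
    by (intro sum.cong refl F)
  also have "\<dots> = (\<Sum>v\<in>zwords n. d * r + (a - r) + d * (if v = 0 then s - r else 0) + (s - r) + (if v = 0 then 1 - a - 2 * s + 2 * r else 0))"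
    by (rule sum.cong) (simp_all add: sum.distrib zero_zwords card_zwords d_def)
  also have "\<dots> = d * (d * r) + d * (a - r) + d * (s - r) + d * (s - r) + (1 - a - 2 * s + 2 * r)"
    unfolding sum.distrib sum_distrib_left[symmetric] by (simp add: zero_zwords card_zwords d_def[symmetric])
  also have "\<dots> = 1 + 2 * ((d - 1) * s) + (d - 1) * a + (d - 1) * (d - 2) * r" by (simp add: algebra_simps)
  also have "(d - 1) * s = (d * f - 1) / (d + 1)" unfolding s_def using d by simp
  also have "(d - 1) * a = (A - 1) / (d + 1)" unfolding a_def using d by simp
  also have "(d - 1) * (d - 2) * r = (if n = 1 then 0 else (d^2 * f^2 + d * B - 4 * d * f - 2 * A + 4) / ((d + 1) * (d + 2)))"
  proof (cases "n = 1")
    case False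
    then have n2: "n \<ge> 2" using n by simp
    have "(2::real)^n \<ge> 4" using power_increasing[OF n2, of "2::real"] by simp
    then have "of_real (2^n - 2) \<noteq> (0::complex)" unfolding of_real_eq_0_iff by simp
    then have d2: "d - 2 \<noteq> 0" by (simp add: d_def)
    have "(d - 1) * (d - 2) * (x / (((d - 1) * (d + 1)) * ((d - 2) * (d + 2)))) = x / ((d + 1) * (d + 2))" for x
    proof -
      have e: "((d - 1) * (d + 1)) * ((d - 2) * (d + 2)) = ((d - 1) * (d - 2)) * ((d + 1) * (d + 2))" by (simp add: mult_ac)
      show ?thesis unfolding e using d d2 by simp
    qed
    then show ?thesis unfolding r_def using False by (simp only: if_False)
  qed (simp add: r_def)
  finally show ?thesis by simp
qed

subsection \<open>Real Pauli coefficients\<close>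

lemma mtrace_adj: "A \<in> carrier_mat d d \<Longrightarrow> mtrace (adj A) = cnj (mtrace A)"
  by (auto simp: mtrace_def adj_def)

lemma adj_outer: "adj (outer b a) = outer a b"
  by (rule eq_matI) (auto simp: adj_def outer_def)

lemma bra_cnj:
  assumes "a \<in> carrier_vec (2^n)" "b \<in> carrier_vec (2^n)"
  shows "cnj (bra n a b u) = bra n b a u"
proof -
  note o = outer_carrier[OF assms(2,1)] outer_carrier[OF assms]
  have "cnj (bra n a b u) = mtrace (adj (outer b a * pauli n u))"
    unfolding bra_def by (rule mtrace_adj[OF mult_carrier_mat[OF o(1) pauli_carrier], symmetric])
  also have "\<dots> = mtrace (pauli n u * outer a b)" unfolding adj_mult[OF o(1) pauli_carrier] adj_outer adj_pauli ..
  also have "\<dots> = bra n b a u" unfolding bra_def by (rule mtrace_comm[OF pauli_carrier o(2)])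
  finally show ?thesis .
qed

definition rx :: "nat \<Rightarrow> complex vec \<Rightarrow> word \<Rightarrow> real" where
  "rx n \<psi> u = Re (bra n \<psi> \<psi> u)"

definition ra :: "nat \<Rightarrow> complex vec \<Rightarrow> complex vec \<Rightarrow> real" where
  "ra n \<psi> \<phi> = (\<Sum>u\<in>words n. (rx n \<psi> u)^2 * (rx n \<phi> u)^2)"

definition rb :: "nat \<Rightarrow> complex vec \<Rightarrow> complex vec \<Rightarrow> real" where
  "rb n \<psi> \<phi> = (\<Sum>u\<in>words n. rx n \<psi> u * rx n \<phi> u * (cmod (bra n \<psi> \<phi> u))^2)"

lemma bra_rx: "\<psi> \<in> carrier_vec (2^n) \<Longrightarrow> bra n \<psi> \<psi> u = of_real (rx n \<psi> u)"
  using bra_cnj[of \<psi> n \<psi> u] by (simp add: rx_def complex_eq_iff)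

lemma bra_bra: "\<psi> \<in> carrier_vec (2^n) \<Longrightarrow> \<phi> \<in> carrier_vec (2^n) \<Longrightarrow> bra n \<psi> \<phi> u * bra n \<phi> \<psi> u = of_real ((cmod (bra n \<psi> \<phi> u))^2)"
  unfolding bra_cnj[of \<psi> n \<phi> u, symmetric] by (rule complex_norm_square[symmetric])

lemma qA_ra: "\<psi> \<in> carrier_vec (2^n) \<Longrightarrow> \<phi> \<in> carrier_vec (2^n) \<Longrightarrow> qA n \<psi> \<phi> = of_real (ra n \<psi> \<phi>)"
  by (simp add: qA_def ra_def bra_rx power2_eq_square mult_ac)

lemma qB_rb: "\<psi> \<in> carrier_vec (2^n) \<Longrightarrow> \<phi> \<in> carrier_vec (2^n) \<Longrightarrow> qB n \<psi> \<phi> = of_real (rb n \<psi> \<phi>)"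
proof -
  assume c: "\<psi> \<in> carrier_vec (2^n)" "\<phi> \<in> carrier_vec (2^n)"
  have "bra n \<psi> \<psi> u * bra n \<phi> \<phi> u * bra n \<psi> \<phi> u * bra n \<phi> \<psi> u = of_real (rx n \<psi> u * rx n \<phi> u * (cmod (bra n \<psi> \<phi> u))^2)" for u
    unfolding mult.assoc bra_bra[OF c] unfolding bra_rx[OF c(1)] bra_rx[OF c(2)] by simp
  then show ?thesis by (simp add: qB_def rb_def)
qed

lemma rb_self: "\<psi> \<in> carrier_vec (2^n) \<Longrightarrow> rb n \<psi> \<psi> = ra n \<psi> \<psi>"
  unfolding rb_def ra_def by (rule sum.cong) (simp_all add: bra_rx power2_eq_square)

lemma sum_rx_sq:
  assumes c: "\<psi> \<in> carrier_vec (2^n)" and u: "ip \<psi> \<psi> = 1"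
  shows "(\<Sum>u\<in>words n. (rx n \<psi> u)^2) = 2^n"
proof -
  have "complex_of_real (\<Sum>u\<in>words n. (rx n \<psi> u)^2) = (\<Sum>u\<in>words n. ee n (famA \<psi> \<psi>) 0 0 u * ee n (famA \<psi> \<psi>) 0 0 u)"
    by (simp add: famA_def vfam_def ee_def bra_def[symmetric] bra_rx[OF c] power2_eq_square)
  also have "\<dots> = of_real (2^n)"
    unfolding sum_ee_ee[OF rank1_famA[OF c c]] using u by (simp add: famA_def vfam_def ip_def)
  finally show ?thesis by (simp only: of_real_eq_iff)
qed

text \<open>By \<open>sum_sg_ee\<close>, 2^n times the squared coefficient is a signed sum of all
  squared coefficients, whose unsigned sum is 2^n.\<close>

lemma rx_le: 
  assumes c: "\<psi> \<in> carrier_vec (2^n)" and u: "ip \<psi> \<psi> = 1"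
  shows "(rx n \<psi> w)^2 \<le> 1"
proof -
  have "complex_of_real (2^n * (rx n \<psi> w)^2) = 2^n * (ee n (famA \<psi> \<psi>) 0 0 w * ee n (famA \<psi> \<psi>) 0 0 w)"
    by (simp add: famA_def vfam_def ee_def bra_def[symmetric] bra_rx[OF c] power2_eq_square)
  also have "\<dots> = (\<Sum>v\<in>words n. sg n w v * (ee n (famA \<psi> \<psi>) 0 0 v * ee n (famA \<psi> \<psi>) 0 0 v))"
    by (rule sum_sg_ee[OF rank1_famA[OF c c], symmetric])
  also have "\<dots> = (\<Sum>v\<in>words n. of_real (Re (sg n w v) * (rx n \<psi> v)^2))"
  proof (rule sum.cong)
    fix v
    have "sg n w v = of_real (Re (sg n w v))" using sg_cases[of n w v] by auto
    then show "sg n w v * (ee n (famA \<psi> \<psi>) 0 0 v * ee n (famA \<psi> \<psi>) 0 0 v) = of_real (Re (sg n w v) * (rx n \<psi> v)^2)"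
      by (simp add: famA_def vfam_def ee_def bra_def[symmetric] bra_rx[OF c] power2_eq_square)
  qed simp
  finally have "2^n * (rx n \<psi> w)^2 = (\<Sum>v\<in>words n. Re (sg n w v) * (rx n \<psi> v)^2)"
    unfolding of_real_sum[symmetric] by (simp only: of_real_eq_iff)
  also have "\<dots> \<le> (\<Sum>v\<in>words n. 1 * (rx n \<psi> v)^2)"
  proof (intro sum_mono mult_right_mono)
    show "Re (sg n w v) \<le> 1" for v using sg_cases[of n w v] by auto
  qed simp
  also have "\<dots> = 2^n" by (simp add: sum_rx_sq[OF assms])
  finally show ?thesis by simp
qed

lemma rx_0: "ip \<psi> \<psi> = 1 \<Longrightarrow> \<psi> \<in> carrier_vec (2^n) \<Longrightarrow> rx n \<psi> 0 = 1"
  unfolding rx_def bra_def pauli_0 ip_def by (subst right_mult_one_mat[of _ "2^n" "2^n"]) simp_all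

text \<open>The bounds on \<open>rb\<close> are 2|xy| <= x^2 + y^2, since a double transposition
  shows that the fourth powers of |<psi|P|phi>| also sum to \<open>ra\<close>. The last bound is
  Cauchy-Schwarz.\<close>

lemma ra_bounds:
  assumes c: "\<psi> \<in> carrier_vec (2^n)" "\<phi> \<in> carrier_vec (2^n)" and u: "ip \<psi> \<psi> = 1" "ip \<phi> \<phi> = 1"
  shows "1 \<le> ra n \<psi> \<phi>" "ra n \<psi> \<phi> \<le> 2^n" "rb n \<psi> \<phi> \<le> ra n \<psi> \<phi>" "- ra n \<psi> \<phi> \<le> rb n \<psi> \<phi>"
    "ra n \<psi> \<phi> \<le> sqrt (2^n * ra n \<phi> \<phi>)"
proof -
  have "(rx n \<psi> 0)^2 * (rx n \<phi> 0)^2 \<le> ra n \<psi> \<phi>"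
    unfolding ra_def by (rule member_le_sum) auto
  then show 1: "1 \<le> ra n \<psi> \<phi>" using rx_0[OF u(1) c(1)] rx_0[OF u(2) c(2)] by simp
  have "ra n \<psi> \<phi> \<le> (\<Sum>w\<in>words n. 1 * (rx n \<phi> w)^2)"
    unfolding ra_def by (intro sum_mono mult_right_mono rx_le[OF c(1) u(1)]) auto
  then show "ra n \<psi> \<phi> \<le> 2^n" by (simp add: sum_rx_sq[OF c(2) u(2)])
  let ?m = "\<lambda>w. (cmod (bra n \<psi> \<phi> w))^2"
  have "complex_of_real (ra n \<psi> \<phi>) = (\<Sum>w\<in>words n. ee n (famA \<psi> \<phi>) 0 0 w * ee n (famA \<psi> \<phi>) 2 2 w * (ee n (famA \<psi> \<phi>) 0 0 w * ee n (famA \<psi> \<phi>) 2 2 w))"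
    unfolding ra_def by (simp add: famA_def vfam_def ee_def bra_def[symmetric] bra_rx[OF c(1)] bra_rx[OF c(2)] power2_eq_square mult_ac)
  also have "\<dots> = (\<Sum>w\<in>words n. ee n (famA \<psi> \<phi>) 0 2 w * ee n (famA \<psi> \<phi>) 2 0 w * (ee n (famA \<psi> \<phi>) 0 2 w * ee n (famA \<psi> \<phi>) 2 0 w))"
    by (rule ee_double_transposition[OF rank1_famA[OF c]])
  also have "\<dots> = of_real (\<Sum>w\<in>words n. (?m w)^2)"
    by (simp add: famA_def vfam_def ee_def bra_def[symmetric] bra_bra[OF c] power2_eq_square)
  finally have m: "ra n \<psi> \<phi> = (\<Sum>w\<in>words n. (?m w)^2)" by (simp only: of_real_eq_iff)
  have "2 * ra n \<psi> \<phi> = (\<Sum>w\<in>words n. (rx n \<psi> w * rx n \<phi> w)^2 + (?m w)^2)"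
    using m by (simp add: sum.distrib ra_def power_mult_distrib)
  moreover have "2 * rb n \<psi> \<phi> = (\<Sum>w\<in>words n. 2 * (rx n \<psi> w * rx n \<phi> w) * ?m w)"
    by (simp add: rb_def sum_distrib_left mult_ac)
  moreover have "(\<Sum>w\<in>words n. 2 * (rx n \<psi> w * rx n \<phi> w) * ?m w) \<le> (\<Sum>w\<in>words n. (rx n \<psi> w * rx n \<phi> w)^2 + (?m w)^2)"
    by (intro sum_mono sum_squares_bound)
  moreover have "(\<Sum>w\<in>words n. - (2 * (rx n \<psi> w * rx n \<phi> w) * ?m w)) \<le> (\<Sum>w\<in>words n. (rx n \<psi> w * rx n \<phi> w)^2 + (?m w)^2)"
    using sum_squares_bound[of "- (rx n \<psi> w * rx n \<phi> w)" "?m w" for w] by (intro sum_mono) simp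
  ultimately show "rb n \<psi> \<phi> \<le> ra n \<psi> \<phi>" "- ra n \<psi> \<phi> \<le> rb n \<psi> \<phi>" by (simp_all add: sum_negf)
  define Z where "Z = ra n \<phi> \<phi>"
  define s where "s = sqrt (2^n * Z)"
  \<comment> \<open>The weight that balances the two terms in 2xy <= x^2 + y^2: both are then
    bounded by Z, which turns the estimate into Cauchy-Schwarz.\<close>
  define t where "t = s / 2^n"
  have "(rx n \<phi> 0)^2 * (rx n \<phi> 0)^2 \<le> Z"
    unfolding Z_def ra_def by (rule member_le_sum) auto
  then have Z: "1 \<le> Z" using rx_0[OF u(2) c(2)] by simp
  have s: "s > 0" "s * s = 2^n * Z" using Z by (simp_all add: s_def)
  have "t * (2 * ra n \<psi> \<phi>) = (\<Sum>w\<in>words n. 2 * (t * (rx n \<psi> w)^2) * (rx n \<phi> w)^2)"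
    by (simp add: ra_def sum_distrib_left mult_ac)
  also have "\<dots> \<le> (\<Sum>w\<in>words n. (t * (rx n \<psi> w)^2)^2 + ((rx n \<phi> w)^2)^2)"
    by (intro sum_mono sum_squares_bound)
  also have "\<dots> = t^2 * (\<Sum>w\<in>words n. ((rx n \<psi> w)^2)^2) + Z"
    by (simp add: Z_def ra_def sum.distrib sum_distrib_left power_mult_distrib power2_eq_square mult_ac)
  also have "\<dots> \<le> t^2 * 2^n + Z"
  proof -
    have "(\<Sum>w\<in>words n. ((rx n \<psi> w)^2)^2) \<le> (\<Sum>w\<in>words n. (rx n \<psi> w)^2)"
    proof (rule sum_mono)
      fix w show "((rx n \<psi> w)^2)^2 \<le> (rx n \<psi> w)^2"
        using mult_right_mono[OF rx_le[OF c(1) u(1), of w], of "(rx n \<psi> w)^2"] by (simp add: power2_eq_square)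
    qed
    then have "t^2 * (\<Sum>w\<in>words n. ((rx n \<psi> w)^2)^2) \<le> t^2 * 2^n"
      unfolding sum_rx_sq[OF c(1) u(1)] by (intro mult_left_mono) auto
    then show ?thesis by simp
  qed
  also have "t^2 * 2^n = Z" unfolding t_def power2_eq_square using s(2) by (simp add: field_simps)
  finally have "t * ra n \<psi> \<phi> \<le> Z" by simp
  then have "s * ra n \<psi> \<phi> \<le> s * s" unfolding s(2) t_def by (simp add: field_simps)
  then show "ra n \<psi> \<phi> \<le> sqrt (2^n * ra n \<phi> \<phi>)"
    using s(1) unfolding Z_def[symmetric] s_def[symmetric] by simp
qed

subsection \<open>Evolution along the circuit\<close>

lemma ip_unitary:
  assumes U: "U \<in> unitaries n" and c: "\<psi> \<in> carrier_vec (2^n)" "\<phi> \<in> carrier_vec (2^n)"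
  shows "ip (U *\<^sub>v \<psi>) (U *\<^sub>v \<phi>) = ip \<psi> \<phi>"
  unfolding ip_def cj_outer[OF unitariesD(1)[OF U] c, symmetric]
  by (rule mtrace_cj[OF unitariesD(1)[OF U] outer_carrier[OF c(2,1)] unitariesD(2)[OF U]])

lemma q_clifford:
  assumes C: "C \<in> clifford_group n" and c: "\<psi> \<in> carrier_vec (2^n)" "\<phi> \<in> carrier_vec (2^n)"
  shows "qA n (C *\<^sub>v \<psi>) (C *\<^sub>v \<phi>) = qA n \<psi> \<phi>" "qB n (C *\<^sub>v \<psi>) (C *\<^sub>v \<phi>) = qB n \<psi> \<phi>"
  unfolding pp_famA[symmetric] pp_famB[symmetric] cjf_famA[OF clifford_carrier[OF C] c, symmetric]
    cjf_famB[OF clifford_carrier[OF C] c, symmetric]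
    cjf_pp[OF rank1_famA[OF c] C] cjf_pp[OF rank1_famB[OF c] C] by simp_all

context
  fixes n k :: nat and \<psi> \<phi> :: "complex vec" and f :: complex
  assumes n: "n \<ge> 3" and k: "k \<le> n"
    and c: "\<psi> \<in> carrier_vec (2^n)" "\<phi> \<in> carrier_vec (2^n)"
    and u: "ip \<psi> \<psi> = 1" "ip \<phi> \<phi> = 1" and f: "ip \<psi> \<phi> * ip \<phi> \<psi> = f"
begin

private lemma U:
  assumes "U \<in> unitaries n"
  shows "U *\<^sub>v \<psi> \<in> carrier_vec (2^n)" "U *\<^sub>v \<phi> \<in> carrier_vec (2^n)"
    "ip (U *\<^sub>v \<psi>) (U *\<^sub>v \<psi>) = 1" "ip (U *\<^sub>v \<phi>) (U *\<^sub>v \<phi>) = 1" "ip (U *\<^sub>v \<psi>) (U *\<^sub>v \<phi>) * ip (U *\<^sub>v \<phi>) (U *\<^sub>v \<psi>) = f"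
  using mult_mat_vec_carrier[OF unitariesD(1)[OF assms] c(1)] mult_mat_vec_carrier[OF unitariesD(1)[OF assms] c(2)]
    ip_unitary[OF assms] c u f by simp_all

private lemma TCU:
  assumes "U \<in> unitaries n" "C \<in> clifford_group n" "\<chi> \<in> carrier_vec (2^n)"
  shows "(That n k * C * U) *\<^sub>v \<chi> = (That n k * C) *\<^sub>v (U *\<^sub>v \<chi>)"
  by (rule assoc_mult_mat_vec[OF mult_carrier_mat[OF That_carrier[OF k] clifford_carrier[OF assms(2)]] unitariesD(1)[OF assms(1)] assms(3)])

private lemma CU:
  assumes "U \<in> unitaries n" "C \<in> clifford_group n" "\<chi> \<in> carrier_vec (2^n)"
  shows "(C * U) *\<^sub>v \<chi> = C *\<^sub>v (U *\<^sub>v \<chi>)"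
  by (rule assoc_mult_mat_vec[OF clifford_carrier[OF assms(2)] unitariesD(1)[OF assms(1)] assms(3)])

private lemma T0: "C \<in> clifford_group n \<Longrightarrow> That n 0 * C = C"
  unfolding That_0 by (rule left_mult_one_mat[OF clifford_carrier])

lemma ens_qT:
  "ens_expect n k l (\<lambda>U. qA n (U *\<^sub>v \<psi>) (U *\<^sub>v \<phi>) + 2 * qB n (U *\<^sub>v \<psi>) (U *\<^sub>v \<phi>)) =
    2 * 2^n / (2^n + 3) * (1 + 4 * f + f^2) + of_real (alT n k) ^ l * (qA n \<psi> \<phi> + 2 * qB n \<psi> \<phi> - 2 * 2^n / (2^n + 3) * (1 + 4 * f + f^2))"
proof -
  let ?Q = "\<lambda>U. qA n (U *\<^sub>v \<psi>) (U *\<^sub>v \<phi>) + 2 * qB n (U *\<^sub>v \<psi>) (U *\<^sub>v \<phi>)"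
  have "ens_expect n k l ?Q = 2 * 2^n / (2^n + 3) * (1 + 4 * f + f^2) + of_real (alT n k) ^ l * (?Q (1\<^sub>m (2^n)) - 2 * 2^n / (2^n + 3) * (1 + 4 * f + f^2))"
  proof (rule ens_recursion[OF k])
    fix C V assume C: "C \<in> clifford_group n" and V: "V \<in> unitaries n"
    show "?Q (C * V) = ?Q V"
      unfolding CU[OF V C c(1)] CU[OF V C c(2)] q_clifford[OF C U(1,2)[OF V]] ..
  next
    fix V assume V: "V \<in> unitaries n"
    have "avg n (\<lambda>C. ?Q (That n k * C * V)) = avg n (\<lambda>C. qA n ((That n k * C) *\<^sub>v (V *\<^sub>v \<psi>)) ((That n k * C) *\<^sub>v (V *\<^sub>v \<phi>))
        + 2 * qB n ((That n k * C) *\<^sub>v (V *\<^sub>v \<psi>)) ((That n k * C) *\<^sub>v (V *\<^sub>v \<phi>)))"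
      by (rule avg_cong) (simp only: TCU[OF V _ c(1)] TCU[OF V _ c(2)])
    also have "\<dots> = of_real (alT n k) * ?Q V + (1 - of_real (alT n k)) * (2 * 2^n / (2^n + 3) * (1 + 4 * f + f^2))"
    proof (cases "k = 0")
      case True
      have "alT n 0 = 1" by (simp add: alT_def)
      then show ?thesis unfolding True
        by (intro trans[OF avg_eq_const]) (simp_all only: T0 q_clifford[OF _ U(1,2)[OF V]], simp)
    next
      case False
      then have "1 \<le> k" by simp
      from avg_qT[OF n this k U[OF V]] show ?thesis .
    qed
    finally show "avg n (\<lambda>C. ?Q (That n k * C * V)) = of_real (alT n k) * ?Q V + (1 - of_real (alT n k)) * (2 * 2^n / (2^n + 3) * (1 + 4 * f + f^2))" .
  qed
  then show ?thesis unfolding one_mult_mat_vec[OF c(1)] one_mult_mat_vec[OF c(2)] .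
qed

lemma ens_qS:
  "ens_expect n k l (\<lambda>U. qA n (U *\<^sub>v \<psi>) (U *\<^sub>v \<phi>) - qB n (U *\<^sub>v \<psi>) (U *\<^sub>v \<phi>)) =
    2 * (1 - f)^2 + of_real (alS n k) ^ l * (qA n \<psi> \<phi> - qB n \<psi> \<phi> - 2 * (1 - f)^2)"
proof -
  let ?Q = "\<lambda>U. qA n (U *\<^sub>v \<psi>) (U *\<^sub>v \<phi>) - qB n (U *\<^sub>v \<psi>) (U *\<^sub>v \<phi>)"
  have "ens_expect n k l ?Q = 2 * (1 - f)^2 + of_real (alS n k) ^ l * (?Q (1\<^sub>m (2^n)) - 2 * (1 - f)^2)"
  proof (rule ens_recursion[OF k])
    fix C V assume C: "C \<in> clifford_group n" and V: "V \<in> unitaries n"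
    show "?Q (C * V) = ?Q V"
      unfolding CU[OF V C c(1)] CU[OF V C c(2)] q_clifford[OF C U(1,2)[OF V]] ..
  next
    fix V assume V: "V \<in> unitaries n"
    have "avg n (\<lambda>C. ?Q (That n k * C * V)) = avg n (\<lambda>C. qA n ((That n k * C) *\<^sub>v (V *\<^sub>v \<psi>)) ((That n k * C) *\<^sub>v (V *\<^sub>v \<phi>))
        - qB n ((That n k * C) *\<^sub>v (V *\<^sub>v \<psi>)) ((That n k * C) *\<^sub>v (V *\<^sub>v \<phi>)))"
      by (rule avg_cong) (simp only: TCU[OF V _ c(1)] TCU[OF V _ c(2)])
    also have "\<dots> = of_real (alS n k) * ?Q V + (1 - of_real (alS n k)) * (2 * (1 - f)^2)"
    proof (cases "k = 0")
      case True
      have "alS n 0 = 1" by (simp add: alS_def)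
      then show ?thesis unfolding True
        by (intro trans[OF avg_eq_const]) (simp_all only: T0 q_clifford[OF _ U(1,2)[OF V]], simp)
    next
      case False
      then have "1 \<le> k" by simp
      from avg_qS[OF n this k U[OF V]] show ?thesis .
    qed
    finally show "avg n (\<lambda>C. ?Q (That n k * C * V)) = of_real (alS n k) * ?Q V + (1 - of_real (alS n k)) * (2 * (1 - f)^2)" .
  qed
  then show ?thesis unfolding one_mult_mat_vec[OF c(1)] one_mult_mat_vec[OF c(2)] .
qed

end

section \<open>Growth of the fourth moment from below\<close>

lemma mean_square:
  fixes f :: "'a \<Rightarrow> real"
  assumes "finite I" "I \<noteq> {}"
  shows "(sum f I)^2 \<le> real (card I) * (\<Sum>i\<in>I. (f i)^2)"
proof -
  define N where "N = real (card I)"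
  define m where "m = sum f I / N"
  have N: "N > 0" using assms by (simp add: N_def card_gt_0_iff)
  have "(\<Sum>i\<in>I. 2 * m * f i) \<le> (\<Sum>i\<in>I. m^2 + (f i)^2)" by (intro sum_mono sum_squares_bound)
  then have "2 * m * sum f I \<le> N * m^2 + (\<Sum>i\<in>I. (f i)^2)"
    by (simp add: sum_distrib_left sum.distrib N_def)
  then have "N * (2 * m * sum f I) \<le> N * (N * m^2 + (\<Sum>i\<in>I. (f i)^2))" using N by (intro mult_left_mono) auto
  moreover have "N * (2 * m * sum f I) = 2 * (sum f I)^2" "N * (N * m^2) = (sum f I)^2"
    using N by (simp_all add: m_def power2_eq_square)
  ultimately show ?thesis unfolding N_def[symmetric] by (simp add: distrib_left)
qed

lemma sum_sq_le_sq_sum: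
  fixes f :: "'a \<Rightarrow> real"
  assumes "finite I" "\<And>i. i \<in> I \<Longrightarrow> f i \<ge> 0"
  shows "(\<Sum>i\<in>I. (f i)^2) \<le> (sum f I)^2"
proof -
  have "(\<Sum>i\<in>I. f i * f i) \<le> (\<Sum>i\<in>I. f i * sum f I)"
    by (intro sum_mono mult_left_mono member_le_sum assms) auto
  then show ?thesis by (simp add: power2_eq_square sum_distrib_right)
qed

definition rs :: "nat \<Rightarrow> word \<Rightarrow> word \<Rightarrow> real" where "rs n u v = Re (sg n u v)"

lemma sg_rs: "sg n u v = of_real (rs n u v)"
  using sg_cases[of n u v] by (auto simp: rs_def)

text \<open>Conditionally on the orbit under the Pauli group, the fourth moment of a Pauli coefficient
  after the T gates dominates the square of its second moment, in which the cross terms vanish.\<close>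

lemma pauli_fourth_moment:
  fixes a :: "word \<Rightarrow> real"
  shows "(\<Sum>v\<in>words n. (a v)^4) * 4^n \<le> (\<Sum>w\<in>words n. (\<Sum>v\<in>words n. rs n v w * a v)^4)"
proof -
  have orth: "(\<Sum>w\<in>words n. rs n v w * rs n v' w) = (if v = v' then 4^n else 0)" if "v \<in> words n" "v' \<in> words n" for v v'
  proof -
    have "complex_of_real (\<Sum>w\<in>words n. rs n v w * rs n v' w) = (\<Sum>w\<in>words n. sg n (v + v') w)"
      unfolding sg_add_left unfolding sg_rs by simp
    also have "\<dots> = of_real (if v = v' then 4^n else 0)"
      using sum_sg[OF words_add[OF that]] by (simp add: word_add_eq_0_iff)
    finally show ?thesis by (simp only: of_real_eq_iff)
  qed
  define Y where "Y w = (\<Sum>v\<in>words n. rs n v w * a v)" for w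
  have "(\<Sum>w\<in>words n. (Y w)^2) = (\<Sum>w\<in>words n. \<Sum>v\<in>words n. \<Sum>v'\<in>words n. (rs n v w * a v) * (rs n v' w * a v'))"
    unfolding Y_def power2_eq_square sum_product ..
  also have "\<dots> = (\<Sum>v\<in>words n. \<Sum>w\<in>words n. \<Sum>v'\<in>words n. (rs n v w * a v) * (rs n v' w * a v'))"
    by (rule sum.swap)
  also have "\<dots> = (\<Sum>v\<in>words n. \<Sum>v'\<in>words n. \<Sum>w\<in>words n. (rs n v w * a v) * (rs n v' w * a v'))"
    by (rule sum.cong[OF refl]) (rule sum.swap)
  also have "\<dots> = (\<Sum>v\<in>words n. \<Sum>v'\<in>words n. a v * a v' * (\<Sum>w\<in>words n. rs n v w * rs n v' w))"
    by (simp add: sum_distrib_left mult_ac)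
  also have "\<dots> = (\<Sum>v\<in>words n. \<Sum>v'\<in>words n. if v' = v then 4^n * (a v)^2 else 0)"
    by (intro sum.cong refl) (auto simp: orth power2_eq_square)
  also have "\<dots> = 4^n * (\<Sum>v\<in>words n. (a v)^2)" by (simp add: sum_distrib_left)
  finally have Y2: "(\<Sum>w\<in>words n. (Y w)^2) = 4^n * (\<Sum>v\<in>words n. (a v)^2)" .
  \<comment> \<open>The additional factor 4^n anticipates the cardinality of the words in
    \<open>mean_square\<close> and is cancelled at the end.\<close>
  have "4^n * ((\<Sum>v\<in>words n. (a v)^4) * 4^n) = (4^n)^2 * (\<Sum>v\<in>words n. ((a v)^2)^2)"
    by (simp add: power2_eq_square power4_eq_xxxx mult_ac)
  also have "\<dots> \<le> (4^n)^2 * (\<Sum>v\<in>words n. (a v)^2)^2"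
    by (intro mult_left_mono sum_sq_le_sq_sum) auto
  also have "\<dots> = (\<Sum>w\<in>words n. (Y w)^2)^2" unfolding Y2 by (simp add: power_mult_distrib)
  also have "\<dots> \<le> real (card (words n)) * (\<Sum>w\<in>words n. ((Y w)^2)^2)"
    using words_0[of n] by (intro mean_square) (simp, blast)
  also have "\<dots> = 4^n * (\<Sum>w\<in>words n. (Y w)^4)"
    by (simp add: card_words power2_eq_square power4_eq_xxxx mult_ac)
  finally have "(\<Sum>v\<in>words n. (a v)^4) * 4^n \<le> (\<Sum>w\<in>words n. (Y w)^4)" by simp
  then show ?thesis unfolding Y_def .
qed

lemma cc_real: "cc n k q a b \<in> \<real>"
  by (auto simp: cc_def cT_def rt_def)

definition rw :: "nat \<Rightarrow> nat \<Rightarrow> word \<Rightarrow> word \<Rightarrow> real" where "rw n k u v = Re (cw n k u v)"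

lemma cw_rw: "cw n k u v = of_real (rw n k u v)"
proof -
  have "cw n k u v \<in> \<real>" unfolding cw_def by (intro prod_in_Reals cc_real)
  then show ?thesis by (simp add: rw_def)
qed

text \<open>For three equal words the phases in the weight are 1, so the weight is the sum of fourth
  powers in a column of the transfer matrix.\<close>

lemma sum_rw: "k \<le> n \<Longrightarrow> (\<Sum>v\<in>words n. \<Sum>u\<in>words n. (rw n k u v)^4) = 4^n * (3/4)^k"
  "k \<le> n \<Longrightarrow> (\<Sum>u\<in>words n. (rw n k u 0)^4) = 1"
proof -
  assume k: "k \<le> n"
  have e: "complex_of_real (\<Sum>u\<in>words n. (rw n k u v)^4) = wt n k v v v" for v
  proof -
    have "complex_of_real (\<Sum>u\<in>words n. (rw n k u v)^4) = (\<Sum>u\<in>words n. cw n k u v * cw n k u v * cw n k u v * cw n k u v)"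
      by (simp add: cw_rw power4_eq_xxxx)
    also have "\<dots> = (\<Sum>u\<in>words n. \<Prod>q<n. cc n k q (u q) (v q) * cc n k q (u q) (v q) * cc n k q (u q) (v q) * cc n k q (u q) (v q))"
      by (simp add: cw_def prod.distrib)
    also have "\<dots> = (\<Prod>q<n. \<Sum>l\<in>UNIV. cc n k q l (v q) * cc n k q l (v q) * cc n k q l (v q) * cc n k q l (v q))"
      by (rule sum_words_prod)
    also have "\<dots> = wt n k v v v"
      unfolding wt_def wf_def by (simp add: pl_def zero_letter_def[symmetric])
    finally show ?thesis .
  qed
  have "complex_of_real (\<Sum>v\<in>words n. \<Sum>u\<in>words n. (rw n k u v)^4) = of_real (4^n * (3/4)^k)"
    unfolding of_real_sum[of _ "words n"] using e wt_sums(1)[OF k] by simp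
  then show "(\<Sum>v\<in>words n. \<Sum>u\<in>words n. (rw n k u v)^4) = 4^n * (3/4)^k" by (simp only: of_real_eq_iff)
  have "complex_of_real (\<Sum>u\<in>words n. (rw n k u 0)^4) = of_real 1"
    unfolding e wt_zero[OF k] by simp
  then show "(\<Sum>u\<in>words n. (rw n k u 0)^4) = 1" by (simp only: of_real_eq_iff)
qed

lemma avg_of_real: "avg n (\<lambda>C. complex_of_real (f C)) = of_real (avg n f)"
  by (simp add: avg_def scaleR_conv_of_real)

lemma avg_mono: "(\<And>C. C \<in> clifford_group n \<Longrightarrow> f C \<le> g C) \<Longrightarrow> avg n f \<le> (avg n g :: real)"
  unfolding avg_def real_scaleR_def by (intro mult_left_mono sum_mono) auto

lemma bra_cj:
  assumes "U \<in> carrier_mat (2^n) (2^n)" "\<psi> \<in> carrier_vec (2^n)" "\<phi> \<in> carrier_vec (2^n)"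
  shows "bra n (U *\<^sub>v \<psi>) (U *\<^sub>v \<phi>) u = mtrace (cj U (outer \<phi> \<psi>) * pauli n u)"
  unfolding bra_def cj_outer[OF assms] ..

text \<open>Averaging first over the Pauli orbit of each Clifford element makes
  \<open>pauli_fourth_moment\<close> applicable to every output word. What remains needs only the
  orbit value of a single word, so all n >= 1 are covered.\<close>

lemma avg_ra_growth:
  assumes n: "n \<ge> 1" and k: "k \<le> n" and c: "\<psi> \<in> carrier_vec (2^n)" and u: "ip \<psi> \<psi> = 1"
  shows "(3/4)^k * ra n \<psi> \<psi> \<le> avg n (\<lambda>C. ra n ((That n k * C) *\<^sub>v \<psi>) ((That n k * C) *\<^sub>v \<psi>))"
proof -
  define y where "y = (3/4::real)^k"
  define h where "h C = ra n ((That n k * C) *\<^sub>v \<psi>) ((That n k * C) *\<^sub>v \<psi>)" for C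
  define x where "x C v = rx n (C *\<^sub>v \<psi>) v" for C v
  have Tc: "That n k * C \<in> carrier_mat (2^n) (2^n)" if "C \<in> clifford_group n" for C
    by (rule mult_carrier_mat[OF That_carrier[OF k] clifford_carrier[OF that]])
  have xe: "x C v = Re (mtrace (cj C (outer \<psi> \<psi>) * pauli n v))" if "C \<in> carrier_mat (2^n) (2^n)" for C v
    unfolding x_def rx_def bra_cj[OF that c c] ..
  have h: "h C = (\<Sum>u\<in>words n. (\<Sum>v\<in>words n. rw n k u v * x C v)^4)" if C: "C \<in> clifford_group n" for C
  proof -
    have "x (That n k * C) u = (\<Sum>v\<in>words n. rw n k u v * x C v)" for u
      unfolding xe[OF Tc[OF C]] xe[OF clifford_carrier[OF C]] cj_mult[OF That_carrier[OF k] clifford_carrier[OF C] outer_carrier[OF c c]]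
        trace_That_expand[OF k cj_carrier[OF clifford_carrier[OF C] outer_carrier[OF c c]]]
      by (simp add: cw_rw)
    then show ?thesis unfolding h_def ra_def x_def[symmetric] by (simp add: power2_eq_square power4_eq_xxxx mult_ac)
  qed
  have g: "\<exists>g. g \<in> clifford_group n \<and> (\<forall>C v. C \<in> clifford_group n \<longrightarrow> x (g * C) v = rs n v w * x C v)" if w: "w \<in> words n" for w
  proof -
    obtain g where g: "g \<in> clifford_group n" "\<And>C Z u. C \<in> clifford_group n \<Longrightarrow> Z \<in> carrier_mat (2^n) (2^n) \<Longrightarrow>
      mtrace (cj (g * C) Z * pauli n u) = sg n u w * mtrace (cj C Z * pauli n u)"
      using pauli_twirl[OF w] by metis
    have "x (g * C) v = rs n v w * x C v" if C: "C \<in> clifford_group n" for C v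
      unfolding xe[OF clifford_carrier[OF C]] xe[OF clifford_carrier[OF clifford_mult[OF g(1) C]]] g(2)[OF C outer_carrier[OF c c]]
      by (simp add: sg_rs)
    then show ?thesis using g(1) by blast
  qed
  then obtain G where G: "\<And>w. w \<in> words n \<Longrightarrow> G w \<in> clifford_group n"
    "\<And>w C v. w \<in> words n \<Longrightarrow> C \<in> clifford_group n \<Longrightarrow> x (G w * C) v = rs n v w * x C v" by metis
  have "4^n * avg n h = (\<Sum>w\<in>words n. avg n (\<lambda>C. h (G w * C)))"
    using avg_shift[OF G(1), of _ h] by (simp add: card_words)
  also have "\<dots> = avg n (\<lambda>C. \<Sum>w\<in>words n. h (G w * C))" by (rule avg_sum[symmetric])
  also have "\<dots> \<ge> avg n (\<lambda>C. 4^n * (\<Sum>v\<in>words n. (\<Sum>u\<in>words n. (rw n k u v)^4) * (x C v)^4))"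
  proof (rule avg_mono)
    fix C assume C: "C \<in> clifford_group n"
    have "4^n * (\<Sum>v\<in>words n. (\<Sum>u\<in>words n. (rw n k u v)^4) * (x C v)^4) = (\<Sum>v\<in>words n. \<Sum>u\<in>words n. (rw n k u v * x C v)^4 * 4^n)"
      by (simp add: sum_distrib_left sum_distrib_right power_mult_distrib mult_ac)
    also have "\<dots> = (\<Sum>u\<in>words n. (\<Sum>v\<in>words n. (rw n k u v * x C v)^4) * 4^n)"
      unfolding sum_distrib_right by (rule sum.swap)
    also have "\<dots> \<le> (\<Sum>u\<in>words n. \<Sum>w\<in>words n. (\<Sum>v\<in>words n. rs n v w * (rw n k u v * x C v))^4)"
      by (intro sum_mono pauli_fourth_moment)
    also have "\<dots> = (\<Sum>w\<in>words n. \<Sum>u\<in>words n. (\<Sum>v\<in>words n. rs n v w * (rw n k u v * x C v))^4)"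
      by (rule sum.swap)
    also have "\<dots> = (\<Sum>w\<in>words n. h (G w * C))"
      by (intro sum.cong refl) (simp add: h[OF clifford_mult[OF G(1) C]] G(2)[OF _ C] mult_ac)
    finally show "4^n * (\<Sum>v\<in>words n. (\<Sum>u\<in>words n. (rw n k u v)^4) * (x C v)^4) \<le> (\<Sum>w\<in>words n. h (G w * C))" .
  qed
  finally have "4^n * avg n (\<lambda>C. \<Sum>v\<in>words n. (\<Sum>u\<in>words n. (rw n k u v)^4) * (x C v)^4) \<le> 4^n * avg n h"
    unfolding avg_cmult .
  then have le: "avg n (\<lambda>C. \<Sum>v\<in>words n. (\<Sum>u\<in>words n. (rw n k u v)^4) * (x C v)^4) \<le> avg n h" by simp
  define D where "D = (4::real)^n"
  define A where "A = ra n \<psi> \<psi>"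
  have D: "D > 1" unfolding D_def using n by simp
  define m where "m = (A - 1) / (D - 1)"
  have m: "avg n (\<lambda>C. (x C v)^4) = (if v = 0 then 1 else m)" if v: "v \<in> words n" for v
  proof -
    let ?X = "famA \<psi> \<psi>"
    note X = rank1_famA[OF c c]
    have "complex_of_real (avg n (\<lambda>C. (x C v)^4)) = FF n ?X v v v"
      unfolding FF_def avg_of_real[symmetric]
    proof (rule avg_cong)
      fix C assume "C \<in> clifford_group n"
      note C = clifford_carrier[OF this]
      have "complex_of_real (x C v) = mtrace (cj C (outer \<psi> \<psi>) * pauli n v)"
        unfolding x_def bra_rx[OF mult_mat_vec_carrier[OF C c], symmetric] bra_cj[OF C c c] ..
      then show "complex_of_real ((x C v)^4) = phi n (cjf C ?X) v v v"
        by (simp add: phi_uuv ee_def cjf_def famA_def vfam_def power4_eq_xxxx)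
    qed
    also have "\<dots> = of_real (if v = 0 then 1 else m)"
    proof (cases "v = 0")
      case True
      have "t0 ?X = 1" using u by (simp add: t0_def famA_def vfam_def ip_def)
      then show ?thesis using True FF_000[OF X] by simp
    next
      case False
      have "t0 ?X = 1" using u by (simp add: t0_def famA_def vfam_def ip_def)
      then have "(4^n - 1) * FF n ?X v v v = of_real (A - 1)"
        using value_equal[OF X v False] by (simp add: pp_famA[unfolded One_nat_def] pp_famA qA_ra[OF c c] A_def)
      moreover have "(4^n - 1 :: complex) = of_real (D - 1)" by (simp add: D_def)
      ultimately have "of_real (D - 1) * FF n ?X v v v = of_real (A - 1)" by simp
      then have "FF n ?X v v v = of_real (A - 1) / of_real (D - 1)" using D by (simp add: eq_divide_eq mult.commute del: of_real_diff)
      then show ?thesis using False by (simp add: m_def)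
    qed
    finally show ?thesis by (simp only: of_real_eq_iff)
  qed
  have "avg n (\<lambda>C. \<Sum>v\<in>words n. (\<Sum>u\<in>words n. (rw n k u v)^4) * (x C v)^4) = (\<Sum>v\<in>words n. (\<Sum>u\<in>words n. (rw n k u v)^4) * (if v = 0 then 1 else m))"
    unfolding avg_sum avg_cmult by (intro sum.cong refl) (simp add: m)
  also have "\<dots> = (\<Sum>v\<in>words n. m * (\<Sum>u\<in>words n. (rw n k u v)^4) + (if v = 0 then 1 - m else 0))"
    by (intro sum.cong refl) (simp add: sum_rw(2)[OF k])
  also have "\<dots> = m * (D * y) + (1 - m)"
    by (simp add: sum.distrib sum_distrib_left[symmetric] sum_rw(1)[OF k] D_def y_def)
  finally have "m * (D * y) + (1 - m) \<le> avg n h" using le by simp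
  moreover have "y * A \<le> m * (D * y) + (1 - m)"
  proof -
    have y: "y \<le> 1" by (simp add: y_def power_le_one)
    have "A \<le> 2^n" unfolding A_def by (rule ra_bounds(2)[OF c c u u])
    also have "(2::real)^n \<le> D" unfolding D_def by (intro power_mono) auto
    \<comment> \<open>Multiplied by D - 1, the gap between the two sides is exactly (D - A) (1 - y),
      nonnegative because A <= 2^n <= 4^n.\<close>
    finally have "0 \<le> (D - A) * (1 - y)" using y by simp
    moreover have "(D - 1) * m = A - 1" using D by (simp add: m_def)
    then have "(D - 1) * (m * (D * y) + (1 - m)) = (A - 1) * (D * y - 1) + (D - 1)"
      by (metis (no_types, opaque_lifting) add_diff_eq diff_add_eq distrib_left mult.assoc mult.right_neutral right_diff_distrib')
    then have "(D - 1) * (m * (D * y) + (1 - m)) - (D - 1) * (y * A) = (D - A) * (1 - y)" by (simp add: algebra_simps)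
    ultimately have "(D - 1) * (y * A) \<le> (D - 1) * (m * (D * y) + (1 - m))" by simp
    then show ?thesis using D by simp
  qed
  ultimately show ?thesis unfolding h_def A_def y_def by simp
qed

lemma ens_ra_growth:
  assumes n: "n \<ge> 1" and k: "k \<le> n" and c: "\<psi> \<in> carrier_vec (2^n)" and u: "ip \<psi> \<psi> = 1"
  shows "((3/4)^k)^l * ra n \<psi> \<psi> \<le> ens_expect n k l (\<lambda>U. ra n (U *\<^sub>v \<psi>) (U *\<^sub>v \<psi>))"
proof -
  let ?Q = "\<lambda>U. ra n (U *\<^sub>v \<psi>) (U *\<^sub>v \<psi>)"
  have "((3/4)^k)^l * ?Q (1\<^sub>m (2^n)) \<le> ens_expect n k l ?Q"
  proof (rule ens_growth[OF k])
    fix C V assume C: "C \<in> clifford_group n" and V: "V \<in> unitaries n"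
    note Vc = mult_mat_vec_carrier[OF unitariesD(1)[OF V] c]
    have "complex_of_real (?Q (C * V)) = of_real (?Q V)"
      unfolding assoc_mult_mat_vec[OF clifford_carrier[OF C] unitariesD(1)[OF V] c]
        qA_ra[OF mult_mat_vec_carrier[OF clifford_carrier[OF C] Vc] mult_mat_vec_carrier[OF clifford_carrier[OF C] Vc], symmetric]
        q_clifford[OF C Vc Vc] qA_ra[OF Vc Vc] ..
    then show "?Q (C * V) = ?Q V" by (simp only: of_real_eq_iff)
  next
    fix V assume V: "V \<in> unitaries n"
    note Vc = mult_mat_vec_carrier[OF unitariesD(1)[OF V] c]
    have "ip (V *\<^sub>v \<psi>) (V *\<^sub>v \<psi>) = 1" using ip_unitary[OF V c c] u by simp
    from avg_ra_growth[OF n k Vc this]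
    have "(3/4)^k * ?Q V \<le> avg n (\<lambda>C. ra n ((That n k * C) *\<^sub>v (V *\<^sub>v \<psi>)) ((That n k * C) *\<^sub>v (V *\<^sub>v \<psi>)))" .
    also have "\<dots> = avg n (\<lambda>C. ?Q (That n k * C * V))"
      by (rule avg_cong) (simp only: assoc_mult_mat_vec[OF mult_carrier_mat[OF That_carrier[OF k] clifford_carrier] unitariesD(1)[OF V] c])
    finally show "(3/4)^k * ?Q V \<le> avg n (\<lambda>C. ?Q (That n k * C * V))" .
  qed simp
  then show ?thesis unfolding one_mult_mat_vec[OF c] .
qed

subsection \<open>The variance of pure states\<close>

lemma ens_of_real: "ens_expect n k l (\<lambda>U. complex_of_real (f U)) = of_real (ens_expect n k l f)"
  by (rule ens_linear) (rule bounded_linear.linear[OF bounded_linear_of_real])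

lemma ens_Re: "ens_expect n k l (\<lambda>U. Re (f U)) = Re (ens_expect n k l f)"
  by (rule ens_linear) (rule bounded_linear.linear[OF bounded_linear_Re])

lemma dg_outer_real:
  assumes c: "a \<in> carrier_vec (2^n)" "b \<in> carrier_vec (2^n)"
  shows "dg n (outer a a) (outer b b) = of_real (Re (dg n (outer a a) (outer b b)))"
proof -
  have "dg n (outer a a) (outer b b) \<in> \<real>"
    unfolding dg_def
  proof (rule sum_in_Reals)
    fix i assume "i \<in> {..<(2::nat)^n}"
    then have i: "i < 2^n" by simp
    have "outer v v $$ (i,i) \<in> \<real>" if "v \<in> carrier_vec (2^n)" for v
      unfolding outer_index[OF that that i i] complex_mult_cnj by simp
    then show "outer a a $$ (i,i) * outer b b $$ (i,i) \<in> \<real>" using c by simp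
  qed
  then show ?thesis by simp
qed

definition eA :: "nat \<Rightarrow> nat \<Rightarrow> nat \<Rightarrow> complex vec \<Rightarrow> complex vec \<Rightarrow> real" where
  "eA n k l \<psi> \<phi> = ens_expect n k l (\<lambda>U. ra n (U *\<^sub>v \<psi>) (U *\<^sub>v \<phi>))"

definition eB :: "nat \<Rightarrow> nat \<Rightarrow> nat \<Rightarrow> complex vec \<Rightarrow> complex vec \<Rightarrow> real" where
  "eB n k l \<psi> \<phi> = ens_expect n k l (\<lambda>U. rb n (U *\<^sub>v \<psi>) (U *\<^sub>v \<phi>))"

lemma ens_q:
  assumes k: "k \<le> n" and c: "\<psi> \<in> carrier_vec (2^n)" "\<phi> \<in> carrier_vec (2^n)"
  shows "ens_expect n k l (\<lambda>U. qA n (U *\<^sub>v \<psi>) (U *\<^sub>v \<phi>)) = of_real (eA n k l \<psi> \<phi>)"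
    "ens_expect n k l (\<lambda>U. qB n (U *\<^sub>v \<psi>) (U *\<^sub>v \<phi>)) = of_real (eB n k l \<psi> \<phi>)"
  unfolding eA_def eB_def ens_of_real[symmetric]
  by (intro ens_cong[OF k] qA_ra qB_rb mult_mat_vec_carrier[OF unitariesD(1) c(1)] mult_mat_vec_carrier[OF unitariesD(1) c(2)]; assumption)+

lemma ip_ip:
  assumes c: "\<psi> \<in> carrier_vec (2^n)" "\<phi> \<in> carrier_vec (2^n)"
  shows "ip \<psi> \<phi> * ip \<phi> \<psi> = of_real ((cmod (ip \<psi> \<phi>))^2)"
proof -
  have "ip \<phi> \<psi> = cnj (ip \<psi> \<phi>)"
    unfolding ip_def mtrace_adj[OF outer_carrier[OF c(2,1)], symmetric] adj_outer ..
  then show ?thesis by (simp only: complex_norm_square)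
qed

text \<open>The Clifford average of the square is affine in \<open>qA\<close> and \<open>qB\<close>,
  with coefficients in d and the unitarily invariant f, so the outer expectation replaces
  \<open>qA\<close> and \<open>qB\<close> by A and B.\<close>

lemma ens_dg_sq:
  fixes n k l \<psi> \<phi>
  assumes n: "n \<ge> 1" and k: "k \<le> n" and c: "\<psi> \<in> carrier_vec (2^n)" "\<phi> \<in> carrier_vec (2^n)"
    and u: "ip \<psi> \<psi> = 1" "ip \<phi> \<phi> = 1"
  defines "d \<equiv> (2::real)^n" and "A \<equiv> eA n k l \<psi> \<phi>" and "B \<equiv> eB n k l \<psi> \<phi>" and "f \<equiv> (cmod (ip \<psi> \<phi>))^2"
  shows "d^2 * ens_expect n k l (\<lambda>U. (Re (dg n (cj U (outer \<psi> \<psi>)) (cj U (outer \<phi> \<phi>))))^2) =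
    1 + 2 * (d * f - 1) / (d + 1) + (A - 1) / (d + 1)
      + (if n = 1 then 0 else (d^2 * f^2 + d * B - 4 * d * f - 2 * A + 4) / ((d + 1) * (d + 2)))"
proof -
  let ?g = "\<lambda>U. dg n (cj U (outer \<psi> \<psi>)) (cj U (outer \<phi> \<phi>))"
  let ?d = "(2::complex)^n" and ?f = "complex_of_real f"
  define a where "a = (if n = 1 then 1 / (?d + 1) else 1 / (?d + 1) - 2 / ((?d + 1) * (?d + 2)))"
  define b where "b = (if n = 1 then 0 else ?d / ((?d + 1) * (?d + 2)))"
  define e where "e = 1 + 2 * (?d * ?f - 1) / (?d + 1) - 1 / (?d + 1)
     + (if n = 1 then 0 else (?d^2 * ?f^2 - 4 * ?d * ?f + 4) / ((?d + 1) * (?d + 2)))"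
  have split: "1 + 2 * (?d * ?f - 1) / (?d + 1) + (x - 1) / (?d + 1)
      + (if n = 1 then 0 else (?d^2 * ?f^2 + ?d * y - 4 * ?d * ?f - 2 * x + 4) / ((?d + 1) * (?d + 2))) = e + (a * x + b * y)" for x y
    unfolding a_def b_def e_def
    by (simp add: diff_divide_distrib add_divide_distrib algebra_simps)
  have "?d^2 * ens_expect n k l (\<lambda>U. (?g U)^2) = ens_expect n k l (\<lambda>U. ?d^2 * avg n (\<lambda>C. (?g (C * U))^2))"
    unfolding ens_cmult by (subst ens_twirl[OF k]) (rule refl)
  also have "\<dots> = ens_expect n k l (\<lambda>U. e + (a * qA n (U *\<^sub>v \<psi>) (U *\<^sub>v \<phi>) + b * qB n (U *\<^sub>v \<psi>) (U *\<^sub>v \<phi>)))"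
  proof (rule ens_cong[OF k])
    fix U assume U: "U \<in> unitaries n"
    note Uc = unitariesD(1)[OF U]
    note v = mult_mat_vec_carrier[OF Uc c(1)] mult_mat_vec_carrier[OF Uc c(2)]
    have "avg n (\<lambda>C. (?g (C * U))^2) = avg n (\<lambda>C. (dg n (cj C (outer (U *\<^sub>v \<psi>) (U *\<^sub>v \<psi>))) (cj C (outer (U *\<^sub>v \<phi>) (U *\<^sub>v \<phi>))))^2)"
      by (rule avg_cong) (simp add: cj_mult[OF clifford_carrier Uc] c cj_outer[OF Uc])
    moreover have "ip (U *\<^sub>v \<psi>) (U *\<^sub>v \<phi>) * ip (U *\<^sub>v \<phi>) (U *\<^sub>v \<psi>) = ?f"
      unfolding ip_unitary[OF U c] ip_unitary[OF U c(2,1)] f_def by (rule ip_ip[OF c])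
    ultimately show "?d^2 * avg n (\<lambda>C. (?g (C * U))^2) = e + (a * qA n (U *\<^sub>v \<psi>) (U *\<^sub>v \<phi>) + b * qB n (U *\<^sub>v \<psi>) (U *\<^sub>v \<phi>))"
      using avg_dg_sq[OF n v] ip_unitary[OF U c(1) c(1)] ip_unitary[OF U c(2) c(2)] u
      by (simp only: split)
  qed
  also have "\<dots> = e + (a * of_real A + b * of_real B)"
    unfolding ens_add ens_cmult ens_const ens_q[OF k c] A_def B_def ..
  also have "\<dots> = of_real (1 + 2 * (d * f - 1) / (d + 1) + (A - 1) / (d + 1)
      + (if n = 1 then 0 else (d^2 * f^2 + d * B - 4 * d * f - 2 * A + 4) / ((d + 1) * (d + 2))))"
    unfolding split[symmetric] d_def by simp
  finally have "?d^2 * ens_expect n k l (\<lambda>U. (?g U)^2) = \<dots>" .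
  moreover have "ens_expect n k l (\<lambda>U. (?g U)^2) = of_real (ens_expect n k l (\<lambda>U. (Re (?g U))^2))"
    unfolding ens_of_real[symmetric]
  proof (rule ens_cong[OF k])
    fix U assume U: "U \<in> unitaries n"
    note Uc = unitariesD(1)[OF U]
    have "?g U = of_real (Re (?g U))"
      unfolding cj_outer[OF Uc c(1) c(1)] cj_outer[OF Uc c(2) c(2)]
      by (rule dg_outer_real[OF mult_mat_vec_carrier[OF Uc c(1)] mult_mat_vec_carrier[OF Uc c(2)]])
    then show "(?g U)^2 = of_real ((Re (?g U))^2)" by (metis of_real_power)
  qed
  moreover have "?d = of_real d" by (simp add: d_def)
  ultimately show ?thesis by (metis (no_types, lifting) of_real_eq_iff of_real_mult of_real_power)
qed

text \<open>The mean of the single-shot estimator for given U, linear in the state X. The subtracted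
  trace comes from the identity part of the observable.\<close>

definition est :: "nat \<Rightarrow> complex vec \<Rightarrow> complex mat \<Rightarrow> complex mat \<Rightarrow> complex" where
  "est n \<phi> U X = (2^n + 1) * (dg n (cj U X) (cj U (outer \<phi> \<phi>)) - mtrace X / 2^n)"

context
  fixes n k l :: nat and \<phi> :: "complex vec" and Ob :: "complex mat"
  assumes n: "n \<ge> 1" and k: "k \<le> n" and \<phi>: "\<phi> \<in> carrier_vec (2^n)" "ip \<phi> \<phi> = 1"
  defines Ob: "Ob \<equiv> outer \<phi> \<phi> - (1 / 2 ^ n) \<cdot>\<^sub>m 1\<^sub>m (2 ^ n)"
begin

lemma Ob_carrier: "Ob \<in> carrier_mat (2^n) (2^n)"
  unfolding Ob by (rule minus_carrier_mat[OF smult_carrier_mat[OF one_carrier_mat]])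

lemma Ob_trace: "mtrace Ob = 0"
proof -
  have "mtrace (outer \<phi> \<phi>) = 1" using \<phi>(2) unfolding ip_def .
  then show ?thesis unfolding Ob
    by (subst mtrace_minus[of _ "2^n"]) (simp_all add: \<phi> mtrace_smult[OF one_carrier_mat])
qed

lemma Ob_mult_trace:
  assumes X: "X \<in> carrier_mat (2^n) (2^n)"
  shows "mtrace (Ob * X) = mtrace (outer \<phi> \<phi> * X) - mtrace X / 2^n"
proof -
  have "Ob * X = outer \<phi> \<phi> * X - (1 / 2 ^ n) \<cdot>\<^sub>m X"
    unfolding Ob by (subst minus_mult_distrib_mat[of _ "2^n" "2^n"]) (use X \<phi> in auto)
  then show ?thesis
    by (simp add: mtrace_minus[OF mult_carrier_mat[OF outer_carrier[OF \<phi>(1) \<phi>(1)] X] smult_carrier_mat[OF X]] mtrace_smult[OF X])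
qed

lemma est_eq:
  assumes U: "U \<in> unitaries n" and X: "X \<in> carrier_mat (2^n) (2^n)"
  shows "(\<Sum>b<2^n. (U * X * adj U) $$ (b,b) * (U * meas_channel_inv n k l Ob * adj U) $$ (b,b)) = est n \<phi> U X"
proof -
  note Uc = unitariesD(1)[OF U]
  have UU: "U * adj U = 1\<^sub>m (2^n)"
    using mat_mult_left_right_inverse[OF adj_carrier[OF Uc] Uc unitariesD(2)[OF U]] .
  have e: "cj U ((2^n + 1) \<cdot>\<^sub>m Ob) = (2^n + 1) \<cdot>\<^sub>m (cj U (outer \<phi> \<phi>) - (1 / 2^n) \<cdot>\<^sub>m 1\<^sub>m (2^n))"
  proof -
    have P: "outer \<phi> \<phi> \<in> carrier_mat (2^n) (2^n)" using \<phi> by simp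
    note a = adj_carrier[OF Uc]
    have "cj U ((2^n + 1) \<cdot>\<^sub>m Ob) = (2^n + 1) \<cdot>\<^sub>m (U * Ob * adj U)"
      unfolding cj_def mult_smult_distrib[OF Uc Ob_carrier] by (rule mult_smult_assoc_mat[OF mult_carrier_mat[OF Uc Ob_carrier] a])
    also have "U * Ob = U * outer \<phi> \<phi> - (1 / 2^n) \<cdot>\<^sub>m U"
      unfolding Ob by (subst mult_minus_distrib_mat[OF Uc P]) (simp_all add: mult_smult_distrib[OF Uc one_carrier_mat] right_mult_one_mat[OF Uc])
    also have "(U * outer \<phi> \<phi> - (1 / 2^n) \<cdot>\<^sub>m U) * adj U = cj U (outer \<phi> \<phi>) - (1 / 2^n) \<cdot>\<^sub>m 1\<^sub>m (2^n)"
      unfolding cj_def by (subst minus_mult_distrib_mat[OF mult_carrier_mat[OF Uc P] smult_carrier_mat[OF Uc] a])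
        (simp add: mult_smult_assoc_mat[OF Uc a] UU)
    finally show ?thesis .
  qed
  have "(U * X * adj U) $$ (b,b) * (cj U ((2^n + 1) \<cdot>\<^sub>m Ob)) $$ (b,b) =
      (2^n + 1) * (cj U X $$ (b,b) * cj U (outer \<phi> \<phi>) $$ (b,b) - cj U X $$ (b,b) / 2^n)" if b: "b < 2^n" for b
    unfolding e using b carrier_matD[OF cj_carrier[OF Uc outer_carrier[OF \<phi>(1) \<phi>(1)]]] by (simp add: cj_def[of U X] algebra_simps)
  then have "(\<Sum>b<2^n. (U * X * adj U) $$ (b,b) * (cj U ((2^n + 1) \<cdot>\<^sub>m Ob)) $$ (b,b)) =
     (\<Sum>b<2^n. (2^n + 1) * (cj U X $$ (b,b) * cj U (outer \<phi> \<phi>) $$ (b,b) - cj U X $$ (b,b) / 2^n))"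
    by (intro sum.cong) auto
  also have "\<dots> = (2^n + 1) * (dg n (cj U X) (cj U (outer \<phi> \<phi>)) - mtrace (cj U X) / 2^n)"
    using carrier_matD(1)[OF cj_carrier[OF Uc X]] unfolding dg_def mtrace_def
    by (simp add: sum_distrib_left sum_subtractf sum_divide_distrib right_diff_distrib)
  finally show ?thesis
    unfolding est_def mtrace_cj[OF Uc X unitariesD(2)[OF U]] meas_channel_inv_traceless[OF n k Ob_carrier Ob_trace] cj_def[symmetric, of U "(2^n + 1) \<cdot>\<^sub>m Ob"] .
qed

lemma Vstar_est:
  assumes X: "X \<in> carrier_mat (2^n) (2^n)"
  shows "Vstar n k l Ob X = ens_expect n k l (\<lambda>U. (Re (est n \<phi> U X))^2) - (Re (mtrace (Ob * X)))^2"
  unfolding Vstar_def by (intro arg_cong2[where f="(-)"] refl ens_cong[OF k]) (simp add: est_eq X)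

text \<open>Unbiasedness of the estimator; it turns the variance into the second moment of a centred
  quantity.\<close>

lemma ens_est:
  assumes X: "X \<in> carrier_mat (2^n) (2^n)"
  shows "ens_expect n k l (\<lambda>U. est n \<phi> U X) = mtrace (Ob * X)"
proof -
  have P: "outer \<phi> \<phi> \<in> carrier_mat (2^n) (2^n)" using \<phi> by simp
  have t: "mtrace (outer \<phi> \<phi>) = 1" using \<phi>(2) unfolding ip_def .
  have e: "(D + 1) * ((t * 1 + p) / (D + 1) - t / D) = p - t / D" if "D \<noteq> 0" "D + 1 \<noteq> 0" for D t p :: complex
    using that by (simp add: right_diff_distrib) (simp add: field_simps)
  show ?thesis
    unfolding est_def ens_cmult ens_diff ens_const ens_dg[OF n k X P] Ob_mult_trace[OF X] t mtrace_comm[OF X P]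
    by (rule e) (use pow2_ne(2)[of n] in simp_all)
qed

text \<open>The two cases differ because the generic-pair term of the second moment is absent for a
  single qubit.\<close>

lemma Vstar_pure:
  assumes c: "\<psi> \<in> carrier_vec (2^n)" "ip \<psi> \<psi> = 1"
  defines "d \<equiv> (2::real)^n" and "A \<equiv> eA n k l \<psi> \<phi>" and "B \<equiv> eB n k l \<psi> \<phi>" and "f \<equiv> (cmod (ip \<psi> \<phi>))^2"
  shows "n = 1 \<Longrightarrow> Vstar n k l Ob (outer \<psi> \<psi>) = 3 / 4 * A - 1 + f - f^2"
    "n \<noteq> 1 \<Longrightarrow> Vstar n k l Ob (outer \<psi> \<psi>) = ((d + 1) / d * (A + B) - (1 + f)^2) / (d + 2)"
proof -
  note X = outer_carrier[OF c(1) c(1)] outer_carrier[OF \<phi>(1) \<phi>(1)]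
  have t1: "mtrace (outer \<psi> \<psi>) = 1" "mtrace (outer \<phi> \<phi>) = 1" using c(2) \<phi>(2) unfolding ip_def .
  let ?g = "\<lambda>U. dg n (cj U (outer \<psi> \<psi>)) (cj U (outer \<phi> \<phi>))"
  have tf: "mtrace (outer \<phi> \<phi> * outer \<psi> \<psi>) = of_real f"
  proof -
    have "outer \<phi> \<phi> * outer \<psi> \<psi> = mtrace (outer \<psi> \<phi>) \<cdot>\<^sub>m outer \<phi> \<psi>"
      using outer_collapse[OF \<phi>(1) \<phi>(1) c(1) c(1) one_carrier_mat] by (simp add: right_mult_one_mat[OF X(2)] right_mult_one_mat[OF outer_carrier[OF c(1) \<phi>(1)]])
    then have "mtrace (outer \<phi> \<phi> * outer \<psi> \<psi>) = ip \<phi> \<psi> * ip \<psi> \<phi>"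
      by (simp add: mtrace_smult[OF outer_carrier[OF \<phi>(1) c(1)]] ip_def)
    then show ?thesis unfolding f_def using ip_ip[OF c(1) \<phi>(1)] by (simp only: mult.commute)
  qed
  have d0: "d > 0" by (simp add: d_def)
  define g2 where "g2 = ens_expect n k l (\<lambda>U. (Re (?g U))^2)"
  have g1: "ens_expect n k l (\<lambda>U. Re (?g U)) = (1 + f) / (d + 1)"
  proof -
    have "ens_expect n k l ?g = of_real ((1 + f) / (d + 1))"
      unfolding ens_dg[OF n k X] t1 mtrace_comm[OF X] tf by (simp add: d_def)
    then show ?thesis unfolding ens_Re by simp
  qed
  have "Re (est n \<phi> U (outer \<psi> \<psi>)) = (d + 1) * (Re (?g U) - 1 / d)" for U
  proof -
    have "(2::complex)^n + 1 = of_real (d + 1)" "(1::complex) / 2^n = of_real (1 / d)" by (simp_all add: d_def)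
    then have "est n \<phi> U (outer \<psi> \<psi>) = of_real (d + 1) * (?g U - of_real (1 / d))" unfolding est_def t1 by simp
    then show ?thesis by simp
  qed
  moreover have "((d + 1) * (r - 1 / d))^2 = (d + 1)^2 * (r^2 - 2 / d * r + 1 / d^2)" for r
    by (simp add: power_mult_distrib power2_diff power_divide mult.commute)
  ultimately have "ens_expect n k l (\<lambda>U. (Re (est n \<phi> U (outer \<psi> \<psi>)))^2) =
      ens_expect n k l (\<lambda>U. (d + 1)^2 * ((Re (?g U))^2 - 2 / d * Re (?g U) + 1 / d^2))"
    by (simp only:)
  also have "\<dots> = (d + 1)^2 * (g2 - 2 / d * ((1 + f) / (d + 1)) + 1 / d^2)"
    unfolding ens_cmult ens_add ens_diff ens_const g1 g2_def ..
  finally have V: "Vstar n k l Ob (outer \<psi> \<psi>) = (d + 1)^2 * (g2 - 2 / d * ((1 + f) / (d + 1)) + 1 / d^2) - (f - 1 / d)^2"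
    unfolding Vstar_est[OF X(1)] Ob_mult_trace[OF X(1)] tf t1 by (simp add: d_def Re_divide_of_nat flip: of_real_power)
  have g2: "d^2 * g2 = 1 + 2 * (d * f - 1) / (d + 1) + (A - 1) / (d + 1)
      + (if n = 1 then 0 else (d^2 * f^2 + d * B - 4 * d * f - 2 * A + 4) / ((d + 1) * (d + 2)))"
    unfolding g2_def d_def f_def A_def B_def by (rule ens_dg_sq[OF n k c(1) \<phi>(1) c(2) \<phi>(2)])
  {
    assume "n = 1"
    then have "d = 2" by (simp add: d_def)
    with g2 \<open>n = 1\<close> have "4 * g2 = 1 + 2 * (2 * f - 1) / 3 + (A - 1) / 3" by simp
    then have "g2 = (1 + 2 * (2 * f - 1) / 3 + (A - 1) / 3) / 4" by simp
    then show "Vstar n k l Ob (outer \<psi> \<psi>) = 3 / 4 * A - 1 + f - f^2"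
      unfolding V \<open>d = 2\<close> by (simp add: power2_eq_square field_simps)
  next
    assume "n \<noteq> 1"
    with g2 have "d^2 * g2 = 1 + 2 * (d * f - 1) / (d + 1) + (A - 1) / (d + 1)
      + (d^2 * f^2 + d * B - 4 * d * f - 2 * A + 4) / ((d + 1) * (d + 2))" by simp
    then have "(d + 1) * (d + 2) * (d^2 * g2) = (d + 1) * (d + 2) + 2 * (d * f - 1) * (d + 2) + (A - 1) * (d + 2)
      + (d^2 * f^2 + d * B - 4 * d * f - 2 * A + 4)" using d0 by (simp add: divide_simps) (simp add: algebra_simps)
    also have "\<dots> = d * (d * (1 + f)^2 + (A + B))" by (simp add: power2_eq_square algebra_simps)
    finally have "d * ((d + 1) * (d + 2) * (d * g2)) = d * (d * (1 + f)^2 + (A + B))" by (simp add: power2_eq_square mult_ac)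
    then have "(d + 1) * (d + 2) * (d * g2) = d * (1 + f)^2 + (A + B)" using d0 by simp
    then have "(d + 1) * g2 = (d * (1 + f)^2 + (A + B)) / (d * (d + 2))" using d0 by (simp add: eq_divide_eq mult_ac)
    then have g2': "(d + 1)^2 * g2 = (d + 1) * ((d * (1 + f)^2 + (A + B)) / (d * (d + 2)))" by (simp only: power2_eq_square mult.assoc)
    \<comment> \<open>With 1/d and (1 + f)/(d + 1) as symbols, only the relations q d = 1 and h (d +
      1) = 1 + f are needed, and the subtracted terms combine to (1 + f)^2.\<close>
    define q where "q = 1 / d"
    define h where "h = (1 + f) / (d + 1)"
    have qh: "q * d = 1" "h * (d + 1) = 1 + f" using d0 by (simp_all add: q_def h_def)
    have "(d + 1)^2 * (g2 - 2 * q * h + q^2) - (f - q)^2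
        = (d + 1)^2 * g2 - 2 * (q * d + q) * (h * (d + 1)) + (q * d + q)^2 - (f - q)^2"
      by (simp add: power2_eq_square algebra_simps)
    also have "\<dots> = (d + 1)^2 * g2 - (1 + f)^2" unfolding qh by (simp add: power2_eq_square algebra_simps)
    finally have "Vstar n k l Ob (outer \<psi> \<psi>) = (d + 1)^2 * g2 - (1 + f)^2"
      unfolding V by (simp add: q_def h_def power_divide)
    also have "\<dots> = ((d + 1) / d * (A + B) - (1 + f)^2) / (d + 2)"
      unfolding g2' using d0 by (simp add: divide_simps) (simp add: algebra_simps)
    finally show "Vstar n k l Ob (outer \<psi> \<psi>) = ((d + 1) / d * (A + B) - (1 + f)^2) / (d + 2)" .
  }
qed

end

lemma ens_pure_bounds:
  assumes k: "k \<le> n" and c: "\<psi> \<in> carrier_vec (2^n)" "\<phi> \<in> carrier_vec (2^n)"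
    and u: "ip \<psi> \<psi> = 1" "ip \<phi> \<phi> = 1"
  shows "1 \<le> eA n k l \<psi> \<phi>" "eA n k l \<psi> \<phi> \<le> 2^n" "eB n k l \<psi> \<phi> \<le> eA n k l \<psi> \<phi>"
proof -
  have b: "1 \<le> ra n (U *\<^sub>v \<psi>) (U *\<^sub>v \<phi>)" "ra n (U *\<^sub>v \<psi>) (U *\<^sub>v \<phi>) \<le> 2^n"
    "rb n (U *\<^sub>v \<psi>) (U *\<^sub>v \<phi>) \<le> ra n (U *\<^sub>v \<psi>) (U *\<^sub>v \<phi>)" if U: "U \<in> unitaries n" for U
    by (intro ra_bounds mult_mat_vec_carrier[OF unitariesD(1)[OF U]] c; simp only: ip_unitary[OF U] c u)+
  show "1 \<le> eA n k l \<psi> \<phi>" "eA n k l \<psi> \<phi> \<le> 2^n" "eB n k l \<psi> \<phi> \<le> eA n k l \<psi> \<phi>"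
    using ens_mono[OF k, of "\<lambda>_. 1" _ l] ens_mono[OF k, of _ "\<lambda>_. 2^n" l] ens_mono[OF k, of _ _ l] b
    unfolding eA_def eB_def by auto
qed

lemma ens_pure_recursion:
  fixes n k l :: nat and \<psi> \<phi> :: "complex vec"
  assumes n: "n \<ge> 3" and k: "k \<le> n" and c: "\<psi> \<in> carrier_vec (2^n)" "\<phi> \<in> carrier_vec (2^n)"
    and u: "ip \<psi> \<psi> = 1" "ip \<phi> \<phi> = 1"
  defines "A \<equiv> eA n k l \<psi> \<phi>" and "B \<equiv> eB n k l \<psi> \<phi>" and "f \<equiv> (cmod (ip \<psi> \<phi>))^2"
    and "h \<equiv> 2 * (2::real)^n / (2^n + 3)"
  shows "A + 2 * B = h * (1 + 4 * f + f^2) + alT n k ^ l * (ra n \<psi> \<phi> + 2 * rb n \<psi> \<phi> - h * (1 + 4 * f + f^2))"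
    "A - B = 2 * (1 - f)^2 + alS n k ^ l * (ra n \<psi> \<phi> - rb n \<psi> \<phi> - 2 * (1 - f)^2)"
proof -
  note f = ip_ip[OF c, folded f_def]
  have "complex_of_real (A + 2 * B) = of_real (h * (1 + 4 * f + f^2) + alT n k ^ l * (ra n \<psi> \<phi> + 2 * rb n \<psi> \<phi> - h * (1 + 4 * f + f^2)))"
    using ens_qT[OF n k c u f, of l]
    unfolding ens_add ens_cmult ens_q[OF k c] qA_ra[OF c] qB_rb[OF c] A_def B_def h_def by simp
  then show "A + 2 * B = h * (1 + 4 * f + f^2) + alT n k ^ l * (ra n \<psi> \<phi> + 2 * rb n \<psi> \<phi> - h * (1 + 4 * f + f^2))"
    by (simp only: of_real_eq_iff)
  have "complex_of_real (A - B) = of_real (2 * (1 - f)^2 + alS n k ^ l * (ra n \<psi> \<phi> - rb n \<psi> \<phi> - 2 * (1 - f)^2))"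
    using ens_qS[OF n k c u f, of l]
    unfolding ens_diff ens_q[OF k c] qA_ra[OF c] qB_rb[OF c] A_def B_def by simp
  then show "A - B = 2 * (1 - f)^2 + alS n k ^ l * (ra n \<psi> \<phi> - rb n \<psi> \<phi> - 2 * (1 - f)^2)"
    by (simp only: of_real_eq_iff)
qed

text \<open>Cauchy-Schwarz through Pauli coefficients: 2^n times the squared overlap is the inner
  product of two coefficient vectors of squared length 2^n.\<close>

lemma cmod_ip_le:
  assumes n: "n \<ge> 1" and c: "\<psi> \<in> carrier_vec (2^n)" "\<phi> \<in> carrier_vec (2^n)"
    and u: "ip \<psi> \<psi> = 1" "ip \<phi> \<phi> = 1"
  shows "(cmod (ip \<psi> \<phi>))^2 \<le> 1"
proof -
  have e: "2^n * ip \<psi> \<phi> * ip \<phi> \<psi> = complex_of_real (\<Sum>u\<in>words n. rx n \<psi> u * rx n \<phi> u)"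
  proof -
    have "2^n * mtrace (outer \<psi> \<psi> * outer \<phi> \<phi>) = (\<Sum>u\<in>words n. bra n \<psi> \<psi> u * bra n \<phi> \<phi> u)"
      using sum_pauli_trace[OF outer_carrier[OF c(1) c(1)] outer_carrier[OF c(2) c(2)]] unfolding bra_def by simp
    also have "outer \<psi> \<psi> * outer \<phi> \<phi> = ip \<psi> \<phi> \<cdot>\<^sub>m outer \<psi> \<phi>"
      using outer_collapse[OF c(1) c(1) c(2) c(2) one_carrier_mat]
      by (simp add: right_mult_one_mat[OF outer_carrier[OF c(1) c(1)]] right_mult_one_mat[OF outer_carrier[OF c(2) c(1)]] ip_def)
    finally show ?thesis unfolding bra_rx[OF c(1)] bra_rx[OF c(2)] mtrace_smult[OF outer_carrier[OF c]]
      by (simp add: ip_def mult.assoc)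
  qed
  have "2 * (\<Sum>u\<in>words n. rx n \<psi> u * rx n \<phi> u) \<le> (\<Sum>u\<in>words n. (rx n \<psi> u)^2 + (rx n \<phi> u)^2)"
    unfolding sum_distrib_left by (intro sum_mono) (simp add: sum_squares_bound mult.assoc[symmetric])
  also have "\<dots> = 2 * 2^n" unfolding sum.distrib sum_rx_sq[OF c(1) u(1)] sum_rx_sq[OF c(2) u(2)] by simp
  finally have le: "(\<Sum>u\<in>words n. rx n \<psi> u * rx n \<phi> u) \<le> 2^n" by simp
  have "complex_of_real (2^n * (cmod (ip \<psi> \<phi>))^2) = of_real (\<Sum>u\<in>words n. rx n \<psi> u * rx n \<phi> u)"
    unfolding e[symmetric] mult.assoc ip_ip[OF c] by simp
  then have "2^n * (cmod (ip \<psi> \<phi>))^2 = (\<Sum>u\<in>words n. rx n \<psi> u * rx n \<phi> u)" by (simp only: of_real_eq_iff)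
  with le have "2^n * (cmod (ip \<psi> \<phi>))^2 \<le> 2^n * 1" by simp
  then show ?thesis by (rule mult_left_le_imp_le) simp
qed

text \<open>The term -b a^l is dropped and q replaced by its positive part, after which a may be
  increased to y.\<close>

lemma relaxation_le:
  fixes a :: real
  assumes "0 \<le> a" "a \<le> y" "0 \<le> b"
  shows "b + a ^ l * (q - b) \<le> b + y ^ l * max q 0"
proof -
  have "a ^ l * (q - b) \<le> a ^ l * max q 0" using assms by (intro mult_left_mono) auto
  also have "\<dots> \<le> y ^ l * max q 0" using assms by (intro mult_right_mono power_mono) auto
  finally show ?thesis by simp
qed

context
  fixes n k l :: nat and \<phi> :: "complex vec" and Ob :: "complex mat" and y s d :: real
  assumes n: "n \<ge> 1" and k: "k \<le> n" and \<phi>: "\<phi> \<in> carrier_vec (2^n)" "ip \<phi> \<phi> = 1"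
  defines Ob: "Ob \<equiv> outer \<phi> \<phi> - (1 / 2 ^ n) \<cdot>\<^sub>m 1\<^sub>m (2 ^ n)"
    and y: "y \<equiv> ((3 / 4)^k)^l" and s: "s \<equiv> ra n \<phi> \<phi> / 2^n" and d: "d \<equiv> 2^n"
begin

lemma y_bounds: "0 < y" "y \<le> 1"
  unfolding y by (simp_all add: power_le_one)

lemma s_bounds: "0 < s" "s \<le> 1"
  unfolding s using ra_bounds(1,2)[OF \<phi>(1) \<phi>(1) \<phi>(2) \<phi>(2)] by simp_all

text \<open>For n <= 2 the crude bounds B <= A <= d, together with 0 <= f <= 1, already give at most
  6/d. For n >= 3, three times A + B is 2 (A + 2B) + (A - B), a combination of the two quantities
  with known recursions.\<close>

lemma Vstar_pure_le:
  assumes c: "\<psi> \<in> carrier_vec (2^n)" "ip \<psi> \<psi> = 1"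
  shows "Vstar n k l Ob (outer \<psi> \<psi>) \<le> 2 * sqrt s * y + 6 / d"
proof -
  define A where "A = eA n k l \<psi> \<phi>"
  define B where "B = eB n k l \<psi> \<phi>"
  define f where "f = (cmod (ip \<psi> \<phi>))^2"
  have f: "0 \<le> f" "f \<le> 1" unfolding f_def using cmod_ip_le[OF n c(1) \<phi>(1) c(2) \<phi>(2)] by simp_all
  note V = Vstar_pure[OF n k \<phi> c, of l, folded Ob A_def B_def f_def d]
  note AB = ens_pure_bounds[OF k c(1) \<phi>(1) c(2) \<phi>(2), of l, folded A_def B_def d]
  have sy: "0 \<le> 2 * sqrt s * y" using s_bounds y_bounds by simp
  consider "n = 1" | "n = 2" | "n \<ge> 3" using n by linarith
  then show ?thesis
  proof cases
    case 1
    then have "d = 2" by (simp add: d)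
    have "f - f^2 \<le> 1" using f zero_le_power2[of f] by linarith
    moreover have "A \<le> 2" "6 / d = 3" using AB(2) \<open>d = 2\<close> by simp_all
    ultimately show ?thesis using V(1)[OF 1] sy by linarith
  next
    case 2
    then have d4: "d = 4" by (simp add: d)
    have "1 \<le> (1 + f)^2" using f by (simp add: one_le_power)
    moreover have "A + B \<le> 8" using AB d4 by simp
    ultimately have "(5 / 4 * (A + B) - (1 + f)^2) / 6 \<le> (5 / 4 * 8 - 1) / 6"
      by (intro divide_right_mono diff_mono mult_left_mono) simp_all
    moreover have "Vstar n k l Ob (outer \<psi> \<psi>) = (5 / 4 * (A + B) - (1 + f)^2) / 6"
      using V(2) 2 d4 by simp
    ultimately have "Vstar n k l Ob (outer \<psi> \<psi>) \<le> (5 / 4 * 8 - 1) / 6" by (simp only:)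
    then show ?thesis by (rule order_trans) (use sy in \<open>simp add: d4\<close>)
  next
    case 3
    have "(2::real)^3 \<le> 2^n" using 3 by (intro power_increasing) auto
    then have d8: "d \<ge> 8" by (simp add: d)
    define h where "h = 2 * d / (d + 3)"
    have h: "0 \<le> h" "h \<le> 2" using d8 by (simp_all add: h_def divide_le_eq)
    define a0 where "a0 = ra n \<psi> \<phi>"
    define b0 where "b0 = rb n \<psi> \<phi>"
    define c1 where "c1 = h * (1 + 4 * f + f^2)"
    define c2 where "c2 = 2 * (1 - f)^2"
    have c12: "0 \<le> c1" "0 \<le> c2" using f h by (simp_all add: c1_def c2_def)
    note r = ens_pure_recursion[OF 3 k c(1) \<phi>(1) c(2) \<phi>(2), of l, folded A_def B_def f_def d, folded h_def a0_def b0_def, folded c1_def c2_def]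
    note al = al_bounds[OF 3 k]
    have G: "A + 2 * B \<le> c1 + y * max (a0 + 2 * b0) 0"
      unfolding r(1) y using al(1,2) c12(1) by (rule relaxation_le)
    have H: "A - B \<le> c2 + y * max (a0 - b0) 0"
      unfolding r(2) y using al(3,4) c12(2) by (rule relaxation_le)
    note ab0 = ra_bounds[OF c(1) \<phi>(1) c(2) \<phi>(2), folded a0_def b0_def]
    \<comment> \<open>The extreme case of |b0| <= a0 is b0 = a0. After division by 3 the constant 6
      becomes the factor 2 of the bound.\<close>
    have "2 * max (a0 + 2 * b0) 0 + max (a0 - b0) 0 \<le> 6 * a0" using ab0(1,3,4) by (auto simp: max_def)
    then have "y * (2 * max (a0 + 2 * b0) 0 + max (a0 - b0) 0) \<le> y * (6 * a0)"
      using y_bounds by (intro mult_left_mono) auto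
    with G H have AB1: "3 * (A + B) \<le> 2 * c1 + c2 + 6 * (y * a0)" by (simp add: algebra_simps)
    have "h * (1 + 4 * f + f^2) \<le> 2 * (1 + 4 * f + f^2)" using h f by (intro mult_right_mono) auto
    \<comment> \<open>With h <= 2 the fixed points combine to 6 (1 + f)^2. Half of the resulting
      term 2 (1 + f)^2 is removed by the subtraction in the variance formula, and what is left is of
      order 1/d.\<close>
    then have "2 * c1 + c2 \<le> 6 * (1 + f)^2" unfolding c1_def c2_def by (simp add: power2_eq_square algebra_simps)
    with AB1 have AB2: "A + B \<le> 2 * (1 + f)^2 + 2 * (y * a0)" by simp
    have "a0 \<le> sqrt (d * (d * s))" using ab0(5) unfolding d s by simp
    also have "\<dots> = d * sqrt s" using d8 by (simp add: mult.assoc[symmetric] real_sqrt_mult)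
    finally have "y * a0 \<le> y * (d * sqrt s)" using y_bounds by (intro mult_left_mono) auto
    with AB2 have "A + B \<le> 2 * (1 + f)^2 + d * (2 * sqrt s * y)" by (simp add: mult_ac)
    then have "(d + 1) / d * (A + B) \<le> (d + 1) / d * (2 * (1 + f)^2 + d * (2 * sqrt s * y))"
      using d8 by (intro mult_left_mono) auto
    also have "\<dots> = 2 * (1 + f)^2 + 2 * (1 + f)^2 / d + (d + 1) * (2 * sqrt s * y)"
      using d8 by (simp add: field_simps)
    finally have "(d + 1) / d * (A + B) - (1 + f)^2 \<le> (1 + f)^2 + 2 * (1 + f)^2 / d + (d + 2) * (2 * sqrt s * y)"
      using sy by (simp add: algebra_simps)
    also have "\<dots> = (d + 2) * ((1 + f)^2 / d + 2 * sqrt s * y)" using d8 by (simp add: field_simps)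
    finally have "Vstar n k l Ob (outer \<psi> \<psi>) \<le> (1 + f)^2 / d + 2 * sqrt s * y"
      using V(2) 3 d8 by (simp add: divide_le_eq mult.commute)
    moreover have "(1 + f)^2 \<le> 2^2" using f by (intro power_mono) auto
    then have "(1 + f)^2 / d \<le> 6 / d" using d8 by (intro divide_right_mono) auto
    ultimately show ?thesis by simp
  qed
qed

text \<open>For psi = phi the overlap is 1 and A = B, so A alone determines the variance. For n >= 2
  the lower bound comes from \<open>ens_ra_growth\<close>; the upper one comes from the recursion
  for n >= 3 and from A <= d for n = 2. The trivial bounds on A settle n = 1.\<close>

lemma Vstar_self_bounds:
  shows "- 6 / d < Vstar n k l Ob (outer \<phi> \<phi>) - 2 * s * y" "Vstar n k l Ob (outer \<phi> \<phi>) - 2 * s * y < 4 / d"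
proof -
  define A where "A = eA n k l \<phi> \<phi>"
  define V where "V = Vstar n k l Ob (outer \<phi> \<phi>)"
  have B: "eB n k l \<phi> \<phi> = A"
    unfolding A_def eA_def eB_def
    by (rule ens_cong[OF k]) (rule rb_self[OF mult_mat_vec_carrier[OF unitariesD(1) \<phi>(1)]])
  note V = Vstar_pure[OF n k \<phi> \<phi>, of l, folded Ob d, unfolded B A_def[symmetric] \<phi>(2), folded V_def]
  note A = ens_pure_bounds[OF k \<phi>(1) \<phi>(1) \<phi>(2) \<phi>(2), of l, folded A_def d]
  have sy: "0 < s * y" "s * y \<le> 1" using s_bounds y_bounds by (simp_all add: mult_le_one)
  have "- 6 / d < V - 2 * s * y \<and> V - 2 * s * y < 4 / d"
  proof (cases "n = 1")
    case True
    then have "d = 2" by (simp add: d)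
    then show ?thesis using V(1)[OF True] A sy by simp
  next
    case False
    then have n2: "n \<ge> 2" using n by simp
    have "(2::real)^2 \<le> 2^n" using n2 by (intro power_increasing) auto
    then have d4: "d \<ge> 4" by (simp add: d)
    have V2: "(d + 2) * V = 2 * (A + A / d) - 4"
    proof -
      have "(d + 1) / d * (A + A) = 2 * (A + A / d)" using d4 by (simp add: field_simps)
      then have "V = (2 * (A + A / d) - 4) / (d + 2)" using V(2)[OF False] by simp
      then show ?thesis using d4 by simp
    qed
    have "d * (s * y) \<le> A"
      using ens_ra_growth[OF n k \<phi>, of l] unfolding A_def eA_def d s y by (simp add: mult_ac)
    then have "d * (s * y) / d \<le> A / d" using d4 by (intro divide_right_mono) auto
    then have "s * y \<le> A / d" using d4 by simp
    with V2 \<open>d * (s * y) \<le> A\<close> have "2 * (d * (s * y)) + 2 * (s * y) - 4 \<le> (d + 2) * V" by simp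
    then have "(d + 2) * (2 * s * y) - 6 \<le> (d + 2) * V" using sy by (simp add: algebra_simps)
    then have "- 6 \<le> (d + 2) * (V - 2 * s * y)" by (simp add: algebra_simps)
    then have "- 6 / (d + 2) \<le> V - 2 * s * y" using d4 by (intro mult_imp_div_pos_le) (simp_all add: mult.commute)
    moreover have "- 6 / d < - 6 / (d + 2)" using d4 by (simp add: frac_less2)
    ultimately have lower: "- 6 / d < V - 2 * s * y" by linarith
    have "V - 2 * s * y < 4 / d"
    proof (cases "n = 2")
      case True
      then have "d = 4" by (simp add: d)
      then show ?thesis using V2 A sy by simp
    next
      case False
      then have n3: "n \<ge> 3" using n2 by simp
      define h where "h = 2 * d / (d + 3)"
      have h: "0 \<le> h" using d4 by (simp add: h_def)
      \<comment> \<open>Since A = B, the recursion for A + 2B is one for 3A; the overlap 1 gives 1 +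
        4f + f^2 = 6.\<close>
      have "A + 2 * A = h * 6 + alT n k ^ l * (ra n \<phi> \<phi> + 2 * rb n \<phi> \<phi> - h * 6)"
        using ens_pure_recursion(1)[OF n3 k \<phi>(1) \<phi>(1) \<phi>(2) \<phi>(2), of l, folded A_def d, folded h_def, unfolded B \<phi>(2)] by simp
      then have "3 * A = h * 6 + alT n k ^ l * (3 * (d * s) - h * 6)"
        using d4 by (simp add: rb_self[OF \<phi>(1)] s d)
      also have "\<dots> \<le> h * 6 + y * max (3 * (d * s)) 0"
        unfolding y using al_bounds(1,2)[OF n3 k] h by (intro relaxation_le) auto
      also have "max (3 * (d * s)) 0 = 3 * (d * s)" using d4 s_bounds by simp
      finally have "A \<le> 2 * h + d * (s * y)" by (simp add: mult_ac)
      moreover from this have "A / d \<le> (2 * h + d * (s * y)) / d" using d4 by (intro divide_right_mono) auto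
      then have "A / d \<le> 2 * h / d + s * y" using d4 by (simp add: add_divide_distrib)
      ultimately have "(d + 2) * V \<le> 2 * ((2 * h + d * (s * y)) + (2 * h / d + s * y)) - 4" using V2 by simp
      also have "\<dots> = 4 * h + 4 * h / d - 4 + 2 * ((d + 1) * (s * y))" by (simp add: algebra_simps)
      also have "2 * ((d + 1) * (s * y)) \<le> (d + 2) * (2 * s * y)" using sy by (simp add: algebra_simps)
      finally have "(d + 2) * V \<le> 4 * h + 4 * h / d - 4 + (d + 2) * (2 * s * y)" by simp
      also have "4 * h + 4 * h / d - 4 = 4 * (d - 1) / (d + 3)"
      proof -
        have "4 * h / d = 8 / (d + 3)" using d4 by (simp add: h_def)
        then show ?thesis using d4 by (simp add: h_def field_simps)
      qed
      finally have "(d + 2) * (V - 2 * s * y) \<le> 4 * (d - 1) / (d + 3)" by (simp add: algebra_simps)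
      also have "\<dots> < 4" using d4 by (simp add: divide_less_eq)
      finally have "V - 2 * s * y < 4 / (d + 2)" using d4 by (simp add: less_divide_eq mult.commute)
      also have "\<dots> < 4 / d" using d4 by (simp add: frac_less2)
      finally show ?thesis .
    qed
    with lower show ?thesis ..
  qed
  then show "- 6 / d < Vstar n k l Ob (outer \<phi> \<phi>) - 2 * s * y" "Vstar n k l Ob (outer \<phi> \<phi>) - 2 * s * y < 4 / d"
    unfolding V_def by auto
qed

end

subsection \<open>Mixed states\<close>

definition psd :: "nat \<Rightarrow> (nat \<Rightarrow> nat \<Rightarrow> complex) \<Rightarrow> bool" where
  "psd d R \<longleftrightarrow> (\<forall>i<d. \<forall>j<d. R j i = cnj (R i j)) \<and>
     (\<forall>x. 0 \<le> Re (\<Sum>i<d. \<Sum>j<d. cnj (x i) * R i j * x j))"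

text \<open>One step of the Cholesky decomposition; the positivity of the Schur complement is seen at the
  vector obtained from x by cancelling its coupling to the pivot m.\<close>
lemma psd_step:
  assumes R: "psd d R" and m: "m < d" and z: "\<And>i j. i < d \<Longrightarrow> j < d \<Longrightarrow> i < m \<or> j < m \<Longrightarrow> R i j = 0"
  shows "\<exists>v R'. psd d R' \<and> (\<forall>i<d. \<forall>j<d. R i j = v i * cnj (v j) + R' i j) \<and>
    (\<forall>i<d. \<forall>j<d. i < Suc m \<or> j < Suc m \<longrightarrow> R' i j = 0)"
proof -
  define Q where "Q x = (\<Sum>i<d. \<Sum>j<d. cnj (x i) * R i j * x j)" for x
  define r where "r x = (\<Sum>j<d. R m j * x j)" for x
  have herm: "R j i = cnj (R i j)" if "i < d" "j < d" for i j using R that unfolding psd_def by blast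
  have pos: "0 \<le> Re (Q x)" for x using R unfolding psd_def Q_def by blast
  define a where "a = Re (R m m)"
  have Rmm: "R m m = of_real a"
  proof -
    have "Im (R m m) = 0" using arg_cong[OF herm[OF m m], of Im] by simp
    then show ?thesis by (simp add: a_def complex_eq_iff)
  qed
  have shift: "Re (Q (\<lambda>i. x i + (if i = m then t else 0))) = Re (Q x) + 2 * Re (cnj t * r x) + a * (cmod t)^2" for x t
  proof -
    have "Q (\<lambda>i. x i + (if i = m then t else 0)) = (\<Sum>i<d. \<Sum>j<d. cnj (x i) * R i j * x j
       + (if j = m then cnj (x i) * R i m * t else 0) + (if i = m then cnj t * R m j * x j else 0)
       + (if i = m then (if j = m then cnj t * R m m * t else 0) else 0))"
      unfolding Q_def by (intro sum.cong refl) (auto simp: algebra_simps)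
    also have "\<dots> = Q x + (\<Sum>i<d. cnj (x i) * R i m * t) + (\<Sum>j<d. cnj t * R m j * x j) + cnj t * R m m * t"
    proof -
      have "(\<Sum>i<d. \<Sum>j<d. if i = m then cnj t * R m j * x j else 0) = (\<Sum>i<d. if i = m then (\<Sum>j<d. cnj t * R m j * x j) else 0)"
        "(\<Sum>i<d. \<Sum>j<d. if i = m then (if j = m then cnj t * R m m * t else 0) else 0) = (\<Sum>i<d. if i = m then (\<Sum>j<d. if j = m then cnj t * R m m * t else 0) else 0)"
        by (intro sum.cong refl; simp)+
      then show ?thesis unfolding sum.distrib using m by (simp add: Q_def)
    qed
    finally have e: "Q (\<lambda>i. x i + (if i = m then t else 0)) = \<dots>" .
    have e1: "(\<Sum>j<d. cnj t * R m j * x j) = cnj t * r x" by (simp add: r_def sum_distrib_left mult.assoc)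
    have e2: "(\<Sum>i<d. cnj (x i) * R i m * t) = cnj (cnj t * r x)"
    proof -
      have "cnj (x i) * R i m * t = cnj (cnj t * (R m i * x i))" if "i < d" for i
        using herm[OF m that] by simp
      then show ?thesis unfolding r_def sum_distrib_left cnj_sum by (intro sum.cong) auto
    qed
    have e3: "cnj t * R m m * t = of_real (a * (cmod t)^2)"
      unfolding Rmm by (simp add: complex_norm_square mult_ac del: of_real_power)
    show ?thesis unfolding e e1 e2 e3 by simp
  qed
  show ?thesis
  proof (cases "a = 0")
    case True
    have r0: "r x = 0" for x
    proof (rule ccontr)
      assume "r x \<noteq> 0"
      then have n: "(cmod (r x))^2 > 0" by simp
      \<comment> \<open>Chosen so that, the pivot being 0, the form at the shifted vector equals -1,
        contradicting positivity.\<close>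
      define s where "s = (Re (Q x) + 1) / (2 * (cmod (r x))^2)"
      have "Re (cnj (- (of_real s * r x)) * r x) = - (s * (cmod (r x))^2)"
        unfolding cmod_power2 by (simp add: power2_eq_square algebra_simps)
      then have "0 \<le> Re (Q x) + 2 * (- (s * (cmod (r x))^2))"
        using pos[of "\<lambda>i. x i + (if i = m then - (of_real s * r x) else 0)"] unfolding shift True by simp
      moreover have "2 * (s * (cmod (r x))^2) = Re (Q x) + 1" using n by (simp add: s_def)
      ultimately show False by simp
    qed
    have row: "R m j = 0" if "j < d" for j
      using r0[of "\<lambda>i. if i = j then 1 else 0"] that by (simp add: r_def if_distrib[of "\<lambda>x. _ * x"] cong: if_cong)
    have "R i j = 0" if ij: "i < d" "j < d" "i < Suc m \<or> j < Suc m" for i j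
    proof -
      consider "i < m" | "j < m" | "i = m" | "j = m" using ij(3) by linarith
      then show ?thesis
      proof cases
        case 4
        then show ?thesis using herm[OF m ij(1)] row[OF ij(1)] by simp
      qed (use ij z row in auto)
    qed
    then show ?thesis using R by (intro exI[of _ "\<lambda>_. 0"] exI[of _ R]) auto
  next
    case False
    have "0 \<le> a"
    proof -
      have "0 \<le> Re (Q (\<lambda>i. 0 + (if i = m then 1 else 0)))" by (rule pos)
      then show ?thesis unfolding shift by (simp add: Q_def r_def)
    qed
    with False have a: "a > 0" by simp
    define v where "v i = R i m / sqrt a" for i
    define R' where "R' i j = R i j - v i * cnj (v j)" for i j
    have ss: "complex_of_real (sqrt a) * of_real (sqrt a) = of_real a"
      using a by (simp flip: of_real_mult)
    have vv: "v i * cnj (v j) = R i m * R m j / of_real a" if "j < d" for i j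
    proof -
      have "v i * cnj (v j) = R i m * R m j / (of_real (sqrt a) * of_real (sqrt a))"
        unfolding v_def by (simp add: herm[OF that m])
      then show ?thesis unfolding ss .
    qed
    have "psd d R'"
      unfolding psd_def
    proof (intro conjI allI impI)
      show "R' j i = cnj (R' i j)" if "i < d" "j < d" for i j
        using herm[OF that] by (simp add: R'_def)
      fix x
      have "(\<Sum>i<d. \<Sum>j<d. cnj (x i) * R' i j * x j) = Q x - (\<Sum>i<d. \<Sum>j<d. (cnj (x i) * R i m) * (R m j * x j) / of_real a)"
        unfolding Q_def sum_subtractf[symmetric]
        by (intro sum.cong refl) (simp add: R'_def vv algebra_simps)
      moreover have "(\<Sum>i<d. \<Sum>j<d. (cnj (x i) * R i m) * (R m j * x j) / of_real a) = (\<Sum>i<d. cnj (x i) * R i m) * r x / of_real a"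
        by (simp add: r_def sum_product sum_divide_distrib)
      moreover have "(\<Sum>i<d. cnj (x i) * R i m) = cnj (r x)"
      proof -
        have "cnj (x i) * R i m = cnj (R m i * x i)" if "i < d" for i
          using herm[OF m that] by simp
        then show ?thesis unfolding r_def cnj_sum by (intro sum.cong) auto
      qed
      moreover have "cnj (r x) * r x / of_real a = of_real ((cmod (r x))^2 / a)"
        by (simp add: complex_norm_square mult_ac del: of_real_power)
      ultimately have e: "Re (\<Sum>i<d. \<Sum>j<d. cnj (x i) * R' i j * x j) = Re (Q x) - (cmod (r x))^2 / a" by simp
      have "0 \<le> Re (Q (\<lambda>i. x i + (if i = m then - (r x / of_real a) else 0)))" by (rule pos)
      also have "\<dots> = Re (Q x) - 2 * ((cmod (r x))^2 / a) + a * ((cmod (r x))^2 / a^2)"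
      proof -
        have "cnj (- (r x / of_real a)) * r x = - of_real ((cmod (r x))^2 / a)"
          by (simp add: complex_norm_square mult_ac del: of_real_power)
        then have "Re (cnj (- (r x / of_real a)) * r x) = - ((cmod (r x))^2 / a)"
          by (simp only: uminus_complex.sel Re_complex_of_real)
        then show ?thesis unfolding shift using a by (simp add: norm_divide power_divide)
      qed
      also have "\<dots> = Re (Q x) - (cmod (r x))^2 / a" using a by (simp add: power2_eq_square)
      finally show "0 \<le> Re (\<Sum>i<d. \<Sum>j<d. cnj (x i) * R' i j * x j)" unfolding e .
    qed
    moreover have "R' i j = 0" if ij: "i < d" "j < d" "i < Suc m \<or> j < Suc m" for i j
    proof -
      have R': "R' i j = R i j - R i m * R m j / of_real a" using vv[OF ij(2)] by (simp add: R'_def)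
      consider "i < m" | "j < m" | "i = m" | "j = m" using ij(3) by linarith
      then show ?thesis unfolding R'
        by cases (use ij z[of i j] z[of i m] z[of m j] m a in \<open>simp_all add: Rmm\<close>)
    qed
    ultimately show ?thesis by (intro exI[of _ v] exI[of _ R']) (simp add: R'_def)
  qed
qed

text \<open>Iterating \<open>psd_step\<close> through all pivots leaves a remainder that vanishes
  everywhere.\<close>

lemma psd_decomposition:
  assumes "psd d R"
  shows "\<exists>v :: nat \<Rightarrow> nat \<Rightarrow> complex. \<forall>i<d. \<forall>j<d. R i j = (\<Sum>m<d. v m i * cnj (v m j))"
proof -
  have "\<exists>v R'. psd d R' \<and> (\<forall>i<d. \<forall>j<d. R i j = (\<Sum>m<e. v m i * cnj (v m j)) + R' i j) \<and>
      (\<forall>i<d. \<forall>j<d. i < e \<or> j < e \<longrightarrow> R' i j = 0)" if "e \<le> d" for e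
    using that
  proof (induction e)
    case 0
    show ?case using assms by (intro exI[of _ "\<lambda>_ _. 0"] exI[of _ R]) simp
  next
    case (Suc e)
    then obtain v R' where IH: "psd d R'" "\<forall>i<d. \<forall>j<d. R i j = (\<Sum>m<e. v m i * cnj (v m j)) + R' i j"
      "\<forall>i<d. \<forall>j<d. i < e \<or> j < e \<longrightarrow> R' i j = 0" using Suc_leD by blast
    note R' = IH(1) IH(2,3)[rule_format]
    obtain w S where S: "psd d S" "\<And>i j. i < d \<Longrightarrow> j < d \<Longrightarrow> R' i j = w i * cnj (w j) + S i j"
      "\<And>i j. i < d \<Longrightarrow> j < d \<Longrightarrow> i < Suc e \<or> j < Suc e \<Longrightarrow> S i j = 0"
      using psd_step[OF R'(1) Suc_le_lessD[OF Suc.prems] R'(3)] by blast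
    have "R i j = (\<Sum>m<Suc e. (v(e := w)) m i * cnj ((v(e := w)) m j)) + S i j" if "i < d" "j < d" for i j
      using R'(2)[OF that] S(2)[OF that] by simp
    then show ?case using S(1,3) by blast
  qed
  from this[of d] show ?thesis by auto
qed

text \<open>Nonnegativity of the variance of x under the weights p.\<close>

lemma weighted_square_le:
  fixes p x :: "'a \<Rightarrow> real"
  assumes "finite I" "\<And>i. i \<in> I \<Longrightarrow> 0 \<le> p i" "sum p I = 1"
  shows "(\<Sum>i\<in>I. p i * x i)^2 \<le> (\<Sum>i\<in>I. p i * (x i)^2)"
proof -
  define s where "s = (\<Sum>i\<in>I. p i * x i)"
  have "0 \<le> (\<Sum>i\<in>I. p i * (x i - s)^2)" using assms by (intro sum_nonneg) auto
  also have "\<dots> = (\<Sum>i\<in>I. p i * (x i)^2 - 2 * s * (p i * x i) + s^2 * p i)"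
    by (intro sum.cong refl) (simp add: power2_diff algebra_simps)
  also have "\<dots> = (\<Sum>i\<in>I. p i * (x i)^2) - 2 * s * (\<Sum>i\<in>I. p i * x i) + s^2 * sum p I"
    unfolding sum.distrib sum_subtractf sum_distrib_left ..
  finally show ?thesis unfolding s_def[symmetric] assms(3) by (simp add: power2_eq_square)
qed

text \<open>By unbiasedness the variance is the second moment of the centred estimator, whose value
  for each U is linear in X. K collects its coefficients; Ob enters with swapped indices because of
  the trace pairing.\<close>

lemma Vstar_quadratic:
  fixes n k l :: nat and \<phi> :: "complex vec"
  assumes n: "n \<ge> 1" and k: "k \<le> n" and \<phi>: "\<phi> \<in> carrier_vec (2^n)" "ip \<phi> \<phi> = 1"
  defines "Ob \<equiv> outer \<phi> \<phi> - (1 / 2 ^ n) \<cdot>\<^sub>m 1\<^sub>m (2 ^ n)"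
  shows "\<exists>K. \<forall>X\<in>carrier_mat (2^n) (2^n). Vstar n k l Ob X =
    ens_expect n k l (\<lambda>U. (Re (\<Sum>i<2^n. \<Sum>j<2^n. X $$ (i,j) * K U i j))^2)"
proof -
  note est = Vstar_est[OF n k \<phi>, folded Ob_def] ens_est[OF n k \<phi>, folded Ob_def]
  have Ob: "Ob \<in> carrier_mat (2^n) (2^n)" unfolding Ob_def by (rule minus_carrier_mat[OF smult_carrier_mat[OF one_carrier_mat]])
  define c where "c U i j = (\<Sum>b<2^n. U $$ (b,i) * cnj (U $$ (b,j)) * cj U (outer \<phi> \<phi>) $$ (b,b))" for U i j
  define K where "K U i j = (2^n + 1) * (c U i j - (if i = j then 1 / 2^n else 0))
     - Ob $$ (j,i)" for U i j
  have "Vstar n k l Ob X = ens_expect n k l (\<lambda>U. (Re (\<Sum>i<2^n. \<Sum>j<2^n. X $$ (i,j) * K U i j))^2)"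
    if X: "X \<in> carrier_mat (2^n) (2^n)" for X
  proof -
    define t where "t = mtrace (Ob * X)"
    have K: "(\<Sum>i<2^n. \<Sum>j<2^n. X $$ (i,j) * K U i j) = est n \<phi> U X - t" if U: "U \<in> unitaries n" for U
    proof -
      note Uc = unitariesD(1)[OF U]
      have g: "dg n (cj U X) (cj U (outer \<phi> \<phi>)) = (\<Sum>i<2^n. \<Sum>j<2^n. X $$ (i,j) * c U i j)"
      proof -
        have "cj U X $$ (b,b) = (\<Sum>i<2^n. \<Sum>j<2^n. X $$ (i,j) * (U $$ (b,i) * cnj (U $$ (b,j))))" if b: "b < 2^n" for b
        proof -
          have "cj U X $$ (b,b) = (\<Sum>j<2^n. (\<Sum>i<2^n. U $$ (b,i) * X $$ (i,j)) * cnj (U $$ (b,j)))"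
            unfolding cj_def mult_index[OF mult_carrier_mat[OF Uc X] adj_carrier[OF Uc] b b]
            by (intro sum.cong refl) (simp add: mult_index[OF Uc X b] adj_index[OF Uc _ b])
          also have "\<dots> = (\<Sum>j<2^n. \<Sum>i<2^n. X $$ (i,j) * (U $$ (b,i) * cnj (U $$ (b,j))))"
            by (simp add: sum_distrib_left sum_distrib_right mult_ac)
          also have "\<dots> = (\<Sum>i<2^n. \<Sum>j<2^n. X $$ (i,j) * (U $$ (b,i) * cnj (U $$ (b,j))))" by (rule sum.swap)
          finally show ?thesis .
        qed
        then have "dg n (cj U X) (cj U (outer \<phi> \<phi>)) = (\<Sum>b<2^n. \<Sum>i<2^n. \<Sum>j<2^n. X $$ (i,j) * (U $$ (b,i) * cnj (U $$ (b,j)) * cj U (outer \<phi> \<phi>) $$ (b,b)))"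
          unfolding dg_def by (intro sum.cong refl) (simp add: sum_distrib_right mult.assoc)
        also have "\<dots> = (\<Sum>i<2^n. \<Sum>b<2^n. \<Sum>j<2^n. X $$ (i,j) * (U $$ (b,i) * cnj (U $$ (b,j)) * cj U (outer \<phi> \<phi>) $$ (b,b)))"
          by (rule sum.swap)
        also have "\<dots> = (\<Sum>i<2^n. \<Sum>j<2^n. \<Sum>b<2^n. X $$ (i,j) * (U $$ (b,i) * cnj (U $$ (b,j)) * cj U (outer \<phi> \<phi>) $$ (b,b)))"
          by (rule sum.cong[OF refl]) (rule sum.swap)
        finally show ?thesis by (simp add: c_def sum_distrib_left)
      qed
      have tr: "mtrace X / 2^n = (\<Sum>i<2^n. \<Sum>j<2^n. X $$ (i,j) * (if i = j then 1 / 2^n else 0))"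
        using X by (simp add: mtrace_def sum_divide_distrib if_distrib[of "\<lambda>x. _ * x"] cong: if_cong)
      have t: "t = (\<Sum>i<2^n. \<Sum>j<2^n. X $$ (i,j) * Ob $$ (j,i))"
        unfolding t_def mtrace_comm[OF Ob X] mtrace_mult[OF X Ob] ..
      show ?thesis
        unfolding est_def g tr t sum_subtractf[symmetric] sum_distrib_left
        by (intro sum.cong refl) (simp add: K_def algebra_simps)
    qed
    have "ens_expect n k l (\<lambda>U. (Re (\<Sum>i<2^n. \<Sum>j<2^n. X $$ (i,j) * K U i j))^2)
        = ens_expect n k l (\<lambda>U. (Re (est n \<phi> U X))^2 - 2 * Re t * Re (est n \<phi> U X) + (Re t)^2)"
      by (rule ens_cong[OF k]) (simp add: K power2_diff)
    also have "\<dots> = ens_expect n k l (\<lambda>U. (Re (est n \<phi> U X))^2) - 2 * Re t * Re t + (Re t)^2"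
      unfolding ens_add ens_diff ens_cmult ens_const ens_Re est(2)[OF X] t_def ..
    finally show ?thesis unfolding est(1)[OF X] t_def[symmetric] by (simp add: power2_eq_square)
  qed
  then show ?thesis by blast
qed

lemma ip_sum:
  assumes "\<psi> \<in> carrier_vec d"
  shows "ip \<psi> \<psi> = of_real (\<Sum>i<d. (cmod (\<psi> $ i))^2)"
  unfolding ip_def mtrace_def using assms carrier_matD(1)[OF outer_carrier[OF assms assms]]
  by (simp add: outer_index complex_norm_square del: of_real_power)

text \<open>Convexity: \<rho> is a mixture of normalised rank-one states with weights w, and for
  every U the squared real part is convex in the state.\<close>

lemma Vstar_le_pure:
  fixes n k l :: nat and \<phi> :: "complex vec"
  assumes n: "n \<ge> 1" and k: "k \<le> n" and \<phi>: "\<phi> \<in> carrier_vec (2^n)" "ip \<phi> \<phi> = 1"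
  defines "Ob \<equiv> outer \<phi> \<phi> - (1 / 2 ^ n) \<cdot>\<^sub>m 1\<^sub>m (2 ^ n)"
  assumes le: "\<And>\<psi>. \<psi> \<in> carrier_vec (2^n) \<Longrightarrow> ip \<psi> \<psi> = 1 \<Longrightarrow> Vstar n k l Ob (outer \<psi> \<psi>) \<le> c"
    and \<rho>: "density_op (2^n) \<rho>"
  shows "Vstar n k l Ob \<rho> \<le> c"
proof -
  let ?d = "(2::nat)^n"
  have \<rho>c: "\<rho> \<in> carrier_mat ?d ?d" and h: "adj \<rho> = \<rho>" and t: "mtrace \<rho> = 1"
    and p: "\<And>v. v \<in> carrier_vec ?d \<Longrightarrow> 0 \<le> Re (conjugate v \<bullet> (\<rho> *\<^sub>v v))"
    using \<rho> by (auto simp: density_op_def)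
  have "psd ?d (\<lambda>i j. \<rho> $$ (i,j))"
    unfolding psd_def
  proof (intro conjI allI impI)
    show "\<rho> $$ (j,i) = cnj (\<rho> $$ (i,j))" if "i < ?d" "j < ?d" for i j
      using adj_index[OF \<rho>c that(2,1)] unfolding h .
    fix x :: "nat \<Rightarrow> complex"
    have "conjugate (vec ?d x) \<bullet> (\<rho> *\<^sub>v vec ?d x) = (\<Sum>i<?d. \<Sum>j<?d. cnj (x i) * \<rho> $$ (i,j) * x j)"
      using \<rho>c unfolding scalar_prod_def
      by (simp add: lessThan_atLeast0[symmetric] mult_mat_vec_index[OF \<rho>c] sum_distrib_left mult.assoc del: index_mult_mat_vec)
    then show "0 \<le> Re (\<Sum>i<?d. \<Sum>j<?d. cnj (x i) * \<rho> $$ (i,j) * x j)"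
      using p[of "vec ?d x"] by simp
  qed
  then obtain v :: "nat \<Rightarrow> nat \<Rightarrow> complex" where v: "\<And>i j. i < ?d \<Longrightarrow> j < ?d \<Longrightarrow> \<rho> $$ (i,j) = (\<Sum>m<?d. v m i * cnj (v m j))"
    using psd_decomposition[OF \<open>psd ?d _\<close>] by blast
  define w where "w m = (\<Sum>i<?d. (cmod (v m i))^2)" for m
  \<comment> \<open>Vectors of weight 0 cannot be normalised and are discarded; they vanish
    identically and contribute nothing to \<rho>.\<close>
  define I where "I = {m. m < ?d \<and> w m \<noteq> 0}"
  define \<psi> where "\<psi> m = vec ?d (\<lambda>i. v m i / sqrt (w m))" for m
  have w0: "0 \<le> w m" for m unfolding w_def by (intro sum_nonneg) simp
  have wI: "0 < w m" if "m \<in> I" for m using that w0[of m] by (simp add: I_def)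
  have fI: "finite I" by (simp add: I_def)
  have \<psi>c: "\<psi> m \<in> carrier_vec ?d" for m by (simp add: \<psi>_def)
  have \<psi>u: "ip (\<psi> m) (\<psi> m) = 1" if "m \<in> I" for m
  proof -
    have "(\<Sum>i<?d. (cmod (\<psi> m $ i))^2) = (\<Sum>i<?d. (cmod (v m i))^2 / w m)"
      using w0[of m] by (intro sum.cong refl) (simp add: \<psi>_def norm_divide power_divide)
    also have "\<dots> = 1" using wI[OF that] by (simp add: sum_divide_distrib[symmetric] w_def[symmetric])
    finally show ?thesis unfolding ip_sum[OF \<psi>c] by simp
  qed
  have v0: "v m i = 0" if "m < ?d" "m \<notin> I" "i < ?d" for m i
  proof -
    have "w m = 0" using that by (simp add: I_def)
    then have "(cmod (v m i))^2 = 0" using that(3) unfolding w_def by (subst (asm) sum_nonneg_eq_0_iff) auto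
    then show ?thesis by simp
  qed
  have vI: "v m i * cnj (v m j) = of_real (w m) * outer (\<psi> m) (\<psi> m) $$ (i,j)" if "m \<in> I" "i < ?d" "j < ?d" for m i j
  proof -
    have ss: "complex_of_real (sqrt (w m)) * of_real (sqrt (w m)) = of_real (w m)"
      using w0[of m] by (simp flip: of_real_mult)
    have "outer (\<psi> m) (\<psi> m) $$ (i,j) = v m i * cnj (v m j) / (of_real (sqrt (w m)) * of_real (sqrt (w m)))"
      unfolding outer_index[OF \<psi>c \<psi>c that(2,3)] using that(2,3) by (simp add: \<psi>_def)
    then show ?thesis unfolding ss using wI[OF that(1)] by simp
  qed
  have sw: "sum w I = 1"
  proof -
    have "1 = (\<Sum>i<?d. \<rho> $$ (i,i))" using t \<rho>c by (simp add: mtrace_def)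
    also have "\<dots> = (\<Sum>i<?d. \<Sum>m<?d. of_real ((cmod (v m i))^2))"
      by (intro sum.cong refl) (simp add: v complex_norm_square del: of_real_power)
    also have "\<dots> = (\<Sum>m<?d. \<Sum>i<?d. of_real ((cmod (v m i))^2))" by (rule sum.swap)
    also have "\<dots> = complex_of_real (\<Sum>m<?d. w m)" by (simp add: w_def)
    also have "(\<Sum>m<?d. w m) = sum w I" by (rule sum.mono_neutral_right) (auto simp: I_def)
    finally show ?thesis by (metis of_real_1 of_real_eq_iff)
  qed
  obtain K where K: "\<And>X. X \<in> carrier_mat ?d ?d \<Longrightarrow> Vstar n k l Ob X =
      ens_expect n k l (\<lambda>U. (Re (\<Sum>i<?d. \<Sum>j<?d. X $$ (i,j) * K U i j))^2)"
    using Vstar_quadratic[OF n k \<phi>, of l, folded Ob_def] by blast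
  define e where "e m U = Re (\<Sum>i<?d. \<Sum>j<?d. outer (\<psi> m) (\<psi> m) $$ (i,j) * K U i j)" for m U
  have mix: "Re (\<Sum>i<?d. \<Sum>j<?d. \<rho> $$ (i,j) * K U i j) = (\<Sum>m\<in>I. w m * e m U)" for U
  proof -
    have "\<rho> $$ (i,j) = (\<Sum>m\<in>I. of_real (w m) * outer (\<psi> m) (\<psi> m) $$ (i,j))" if "i < ?d" "j < ?d" for i j
    proof -
      have "(\<Sum>m<?d. v m i * cnj (v m j)) = (\<Sum>m\<in>I. v m i * cnj (v m j))"
        using v0 that by (intro sum.mono_neutral_right) (auto simp: I_def)
      then show ?thesis unfolding v[OF that] by (simp add: vI that)
    qed
    then have "(\<Sum>i<?d. \<Sum>j<?d. \<rho> $$ (i,j) * K U i j) = (\<Sum>i<?d. \<Sum>j<?d. \<Sum>m\<in>I. of_real (w m) * (outer (\<psi> m) (\<psi> m) $$ (i,j) * K U i j))"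
      by (intro sum.cong refl) (simp add: sum_distrib_right mult.assoc)
    also have "\<dots> = (\<Sum>i<?d. \<Sum>m\<in>I. \<Sum>j<?d. of_real (w m) * (outer (\<psi> m) (\<psi> m) $$ (i,j) * K U i j))"
      by (rule sum.cong[OF refl]) (rule sum.swap)
    also have "\<dots> = (\<Sum>m\<in>I. \<Sum>i<?d. \<Sum>j<?d. of_real (w m) * (outer (\<psi> m) (\<psi> m) $$ (i,j) * K U i j))"
      by (rule sum.swap)
    also have "\<dots> = (\<Sum>m\<in>I. of_real (w m) * (\<Sum>i<?d. \<Sum>j<?d. outer (\<psi> m) (\<psi> m) $$ (i,j) * K U i j))"
      by (simp add: sum_distrib_left)
    finally show ?thesis by (simp add: e_def)
  qed
  have "Vstar n k l Ob \<rho> = ens_expect n k l (\<lambda>U. (\<Sum>m\<in>I. w m * e m U)^2)" unfolding K[OF \<rho>c] mix ..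
  also have "\<dots> \<le> ens_expect n k l (\<lambda>U. \<Sum>m\<in>I. w m * (e m U)^2)"
    by (rule ens_mono[OF k]) (rule weighted_square_le[OF fI w0 sw])
  also have "\<dots> = (\<Sum>m\<in>I. w m * Vstar n k l Ob (outer (\<psi> m) (\<psi> m)))"
    unfolding ens_sum ens_cmult K[OF outer_carrier[OF \<psi>c \<psi>c]] e_def ..
  also have "\<dots> \<le> (\<Sum>m\<in>I. w m * c)"
    by (intro sum_mono mult_left_mono le \<psi>c \<psi>u w0)
  also have "\<dots> = c" unfolding sum_distrib_right[symmetric] sw by simp
  finally show ?thesis .
qed

text \<open>Provides an element of the set of variances in \<open>Vstar_max\<close>, as the supremum
  argument requires.\<close>

lemma density_op_outer:
  assumes "\<phi> \<in> carrier_vec d" "ip \<phi> \<phi> = 1"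
  shows "density_op d (outer \<phi> \<phi>)"
  unfolding density_op_def
proof (intro conjI ballI)
  show "outer \<phi> \<phi> \<in> carrier_mat d d" using assms by simp
  show "adj (outer \<phi> \<phi>) = outer \<phi> \<phi>" by (rule adj_outer)
  show "mtrace (outer \<phi> \<phi>) = 1" using assms(2) by (simp add: ip_def)
  fix v :: "complex vec" assume v: "v \<in> carrier_vec d"
  define z where "z = (\<Sum>i<d. cnj (v $ i) * \<phi> $ i)"
  have "conjugate v \<bullet> (outer \<phi> \<phi> *\<^sub>v v) = (\<Sum>i<d. cnj (v $ i) * (\<Sum>j<d. \<phi> $ i * cnj (\<phi> $ j) * v $ j))"
    using v assms(1) carrier_matD[OF outer_carrier[OF assms(1) assms(1)]] unfolding scalar_prod_def
    by (simp add: lessThan_atLeast0[symmetric] mult_mat_vec_index[OF outer_carrier[OF assms(1) assms(1)] v] outer_index del: index_mult_mat_vec)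
  also have "\<dots> = z * cnj z"
  proof -
    have "(\<Sum>j<d. \<phi> $ i * cnj (\<phi> $ j) * v $ j) = \<phi> $ i * cnj z" for i
      unfolding z_def cnj_sum sum_distrib_left by (intro sum.cong refl) (simp add: mult_ac)
    then show ?thesis by (simp add: z_def sum_distrib_right mult.assoc)
  qed
  also have "\<dots> = of_real ((cmod z)^2)" by (simp add: complex_norm_square del: of_real_power)
  finally show "0 \<le> Re (conjugate v \<bullet> (outer \<phi> \<phi> *\<^sub>v v))" by simp
qed

text \<open>\<open>pauli_strings\<close> is a set of matrices, so replacing a sum over it by a sum
  over words requires that distinct words give distinct matrices.\<close>

lemma pauli_inj: "inj_on (pauli n) (words n)"
proof (rule inj_onI)
  fix u v assume uv: "u \<in> words n" "v \<in> words n" and e: "pauli n u = pauli n v"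
  have "phase n u v \<cdot>\<^sub>m pauli n (u + v) = 1\<^sub>m (2^n)" unfolding pauli_mult[symmetric] e by (rule pauli_square)
  then have "phase n u v * mtrace (pauli n (u + v)) = 2^n"
    using mtrace_smult[OF pauli_carrier, of "phase n u v" n "u + v"] by simp
  then have "mtrace (pauli n (u + v)) \<noteq> 0" by auto
  then show "u = v" using mtrace_pauli[OF words_add[OF uv]] by (auto split: if_splits)
qed

lemma pauli_strings_words: "pauli_strings n = pauli n ` words n"
proof (intro equalityI subsetI)
  fix P assume "P \<in> pauli_strings n"
  then obtain Ps where Ps: "P = tensor_list Ps" "length Ps = n" "set Ps \<subseteq> {I2, PX, PY, PZ}" by (auto simp: pauli_strings_def)
  have "\<exists>l. sigma l = Ps ! q" if "q < n" for q
  proof -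
    have "Ps ! q \<in> {I2, PX, PY, PZ}" using Ps that nth_mem by blast
    also have "{I2, PX, PY, PZ} = sigma ` UNIV" by (simp add: UNIV_letter sigma_def)
    finally show ?thesis by auto
  qed
  then obtain g where g: "\<And>q. q < n \<Longrightarrow> sigma (g q) = Ps ! q" by metis
  define u where "u q = (if q < n then g q else 0)" for q
  have "map (\<lambda>q. sigma (u q)) [0..<n] = Ps" by (rule nth_equalityI) (simp_all add: Ps u_def g)
  then have "pauli n u = P" by (simp add: pauli_def ten_def Ps)
  moreover have "u \<in> words n" by (simp add: words_def u_def)
  ultimately show "P \<in> pauli n ` words n" by blast
next
  fix P assume "P \<in> pauli n ` words n"
  then obtain u where u: "P = tensor_list (map (\<lambda>q. sigma (u q)) [0..<n])" by (auto simp: pauli_def ten_def)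
  have "sigma (u q) \<in> {I2, PX, PY, PZ}" for q by (cases "u q") (simp_all add: sigma_def)
  then show "P \<in> pauli_strings n" unfolding pauli_strings_def u by fastforce
qed

lemma scalar_prod_trace:
  assumes a: "a \<in> carrier_vec d" and A: "A \<in> carrier_mat d d"
  shows "conjugate a \<bullet> (A *\<^sub>v a) = mtrace (outer a a * A)"
proof -
  have "conjugate a \<bullet> (A *\<^sub>v a) = (\<Sum>i<d. \<Sum>j<d. cnj (a $ i) * A $$ (i,j) * a $ j)"
    using a A unfolding scalar_prod_def
    by (simp add: lessThan_atLeast0[symmetric] mult_mat_vec_index[OF A a] sum_distrib_left mult.assoc del: index_mult_mat_vec)
  also have "\<dots> = (\<Sum>i<d. \<Sum>j<d. outer a a $$ (j,i) * A $$ (i,j))"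
    by (intro sum.cong refl) (simp add: outer_index[OF a a] mult_ac)
  also have "\<dots> = mtrace (outer a a * A)"
    unfolding mtrace_mult[OF outer_carrier[OF a a] A] by (rule sum.swap)
  finally show ?thesis .
qed

lemma stab_renyi2_ra:
  assumes \<phi>: "\<phi> \<in> carrier_vec (2^n)"
  shows "stab_renyi2 n \<phi> = - log 2 (ra n \<phi> \<phi> / 2^n)"
proof -
  have "(\<Sum>P\<in>pauli_strings n. (Re (conjugate \<phi> \<bullet> (P *\<^sub>v \<phi>)))^4) = (\<Sum>u\<in>words n. (Re (conjugate \<phi> \<bullet> (pauli n u *\<^sub>v \<phi>)))^4)"
    unfolding pauli_strings_words by (simp add: sum.reindex[OF pauli_inj])
  also have "\<dots> = ra n \<phi> \<phi>"
    unfolding ra_def scalar_prod_trace[OF \<phi> pauli_carrier]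
    by (intro sum.cong refl) (simp add: rx_def bra_def power2_eq_square power4_eq_xxxx mult_ac)
  finally show ?thesis unfolding stab_renyi2_def by simp
qed

theorem theorem6:
  fixes n k l :: nat and \<phi> :: "complex vec"
  assumes "1 \<le> n" and "k \<le> n"
    and "\<phi> \<in> carrier_vec (2 ^ n)" and "conjugate \<phi> \<bullet> \<phi> = 1"
  defines "d \<equiv> (2::real) ^ n"
    and "Ob \<equiv> outer \<phi> \<phi> - (1 / 2 ^ n) \<cdot>\<^sub>m 1\<^sub>m (2 ^ n)"
    and "\<gamma> \<equiv> (3::real) / 4"
  shows "Vstar_max n k l Ob \<le> 2 powr (1 - stab_renyi2 n \<phi> / 2) * \<gamma> ^ (k * l) + 6 / d \<and>
         - 6 / d < Vstar n k l Ob (outer \<phi> \<phi>) - 2 powr (1 - stab_renyi2 n \<phi>) * \<gamma> ^ (k * l) \<and>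
         Vstar n k l Ob (outer \<phi> \<phi>) - 2 powr (1 - stab_renyi2 n \<phi>) * \<gamma> ^ (k * l) < 4 / d"
proof -
  have u: "ip \<phi> \<phi> = 1"
    using scalar_prod_trace[OF assms(3) one_carrier_mat] assms(3,4)
    by (simp add: ip_def right_mult_one_mat[OF outer_carrier[OF assms(3) assms(3)]])
  \<comment> \<open>s is 2^(-M_2(phi)), so its square root accounts for the half in the exponent of
    the first bound.\<close>
  define s where "s = ra n \<phi> \<phi> / 2^n"
  have s: "0 < s" unfolding s_def using ra_bounds(1)[OF assms(3) assms(3) u u] by simp
  have r: "stab_renyi2 n \<phi> = - log 2 s" unfolding s_def by (rule stab_renyi2_ra[OF assms(3)])
  have p1: "2 powr (1 - stab_renyi2 n \<phi>) = 2 * s" using s by (simp add: r powr_add)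
  have p2: "2 powr (1 - stab_renyi2 n \<phi> / 2) = 2 * sqrt s"
  proof -
    have "2 powr (1 - stab_renyi2 n \<phi> / 2) = 2 * (2 powr log 2 s) powr (1 / 2)"
      unfolding r powr_powr by (simp add: powr_add)
    then show ?thesis using s by (simp add: powr_half_sqrt)
  qed
  note b = Vstar_self_bounds[OF assms(1,2,3) u, of l, folded Ob_def s_def d_def \<gamma>_def, folded power_mult]
  have "Vstar_max n k l Ob \<le> 2 * sqrt s * \<gamma> ^ (k * l) + 6 / d"
    unfolding Vstar_max_def
  proof (rule cSup_least)
    show "{Vstar n k l Ob \<rho> |\<rho>. density_op (2^n) \<rho>} \<noteq> {}"
      using density_op_outer[OF assms(3) u] by blast
    fix x assume "x \<in> {Vstar n k l Ob \<rho> |\<rho>. density_op (2^n) \<rho>}"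
    then obtain \<rho> where x: "x = Vstar n k l Ob \<rho>" and \<rho>: "density_op (2^n) \<rho>" by blast
    show "x \<le> 2 * sqrt s * \<gamma> ^ (k * l) + 6 / d"
      unfolding x Ob_def
    proof (rule Vstar_le_pure[OF assms(1,2,3) u _ \<rho>])
      fix \<psi> :: "complex vec" assume \<psi>: "\<psi> \<in> carrier_vec (2^n)" "ip \<psi> \<psi> = 1"
      show "Vstar n k l (outer \<phi> \<phi> - (1 / 2 ^ n) \<cdot>\<^sub>m 1\<^sub>m (2 ^ n)) (outer \<psi> \<psi>) \<le> 2 * sqrt s * \<gamma> ^ (k * l) + 6 / d"
        using Vstar_pure_le[OF assms(1,2,3) u \<psi>, of l, folded s_def d_def \<gamma>_def, folded power_mult] .
    qed
  qed
  then show ?thesis unfolding p1 p2 using b by simp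
qed

end
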